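(* Let $\beta=0$ and $f\equiv0$. There exist $\omega>0$ and an increasing positive function $\mathcal Q$ on $[0,\infty)$, depending only on the structural parameters $\Omega,\alpha,\mu$ of the problem, such that for every initial datum $U_0\in\mathcal H$ the corresponding energy $\mathcal E(t)=\frac12\|S(t)U_0\|_{\mathcal H}^2$ fulfills $$\mathcal E(t)\le\mathcal Q(\mathcal E(0))e^{-\omega t},\qquad\forall\,t\ge0.$$
   Context: Setting. $\Omega\subset\mathbb R^3$ is a bounded domain with smooth boundary and outward normal $n$; $\alpha>0$ is a constant. $\mathbf H=\{u\in[L^2(\Omega)]^3:\ \mathrm{div}\,u=0,\ u\cdot n|_{\partial\Omega}=0\}$ with the $L^2$ inner product $\langle\cdot,\cdot\rangle$ and norm $\|\cdot\|$; $\mathbf V=\{u\in[H^1_0(\Omega)]^3:\ \mathrm{div}\,u=0\}$ with $\langle u,v\rangle_1=\langle\nabla u,\nabla v\rangle$, $\|u\|_1=\|\nabla u\|$. $b(u,v,w)=\int_\Omega (u\cdot\nabla)v\cdot w\,dx$ for $u,v,w\in\mathbf V$. Memory kernel. $g:[0,\infty)\to\mathbb R$ is convex, nonnegative, smooth on $(0,\infty)$, vanishing at infinity, with $\int_0^\infty g(s)\,ds=1$. $\mu=-g'$ is nonnegative, decreasing, absolutely continuous on compact subintervals of $(0,\infty)$ (a singularity at $0$ is allowed), summable with $\kappa=\int_0^\infty\mu(s)\,ds>0$, and there is $\delta>0$ with $\mu'(s)+\delta\mu(s)\le 0$ for a.e. $s>0$. Spaces. $\mathcal M=L^2_\mu(\mathbb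 R^+;\mathbf V)$ with $\langle\eta,\xi\rangle_{\mathcal M}=\int_0^\infty\mu(s)\langle\eta(s),\xi(s)\rangle_1ds$. $\mathcal H=\mathbf V\times\mathcal M$ with $\|(u,\eta)\|_{\mathcal H}^2=\alpha\|u\|_1^2+\|u\|^2+\|\eta\|_{\mathcal M}^2$. Weak solution (case $\beta=0$, $f\equiv0$). Given $U_0=(u_0,\eta_0)\in\mathcal H$, a weak solution with datum $U_0$ is $U=(u,\eta)\in C([0,\infty),\mathcal H)$ with $\partial_tu\in L^2(0,\tau;\mathbf V)$ for all $\tau>0$, $U(0)=U_0$, such that for every $v\in\mathbf V$ and a.e. $t>0$ $$\langle\partial_tu,v\rangle+\alpha\langle\partial_tu,v\rangle_1+\int_0^\infty\mu(s)\langle\eta^t(s),v\rangle_1ds+b(u,u,v)=0,$$ and $\eta^t(s)=\int_0^su(t-\sigma)d\sigma$ for $0<s\le t$, $\eta^t(s)=\eta_0(s-t)+\int_0^tu(t-\sigma)d\sigma$ for $s>t$. For every $U_0\in\mathcal H$ there is a unique weak solution $U(t)$, and $S(t)U_0=U(t)$ defines a strongly continuous semigroup $S(t):\mathcal H\to\mathcal H$, $t\ge 0$. *)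

theory Defs
  imports "HOL-Analysis.Analysis"
begin

section \<open>Smooth functions and smooth domains\<close>

text \<open>Both definitions are meant for open sets.\<close>

primrec Ck_on :: "nat \<Rightarrow> 'a::euclidean_space set \<Rightarrow> ('a \<Rightarrow> real) \<Rightarrow> bool" where
  "Ck_on 0 S f \<longleftrightarrow> continuous_on S f"
| "Ck_on (Suc k) S f \<longleftrightarrow>
     (\<forall>x\<in>S. f differentiable (at x)) \<and>
     (\<forall>b\<in>Basis. Ck_on k S (\<lambda>x. frechet_derivative f (at x) b))"

definition smooth_on :: "'a::euclidean_space set \<Rightarrow> ('a \<Rightarrow> real) \<Rightarrow> bool" where
  "smooth_on S f \<longleftrightarrow> (\<forall>k. Ck_on k S f)"

definition test_fun :: "'a::euclidean_space set \<Rightarrow> ('a \<Rightarrow> real) \<Rightarrow> bool" where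
  "test_fun S \<phi> \<longleftrightarrow> smooth_on UNIV \<phi> \<and>
     compact (closure {x. \<phi> x \<noteq> 0}) \<and> closure {x. \<phi> x \<noteq> 0} \<subseteq> S"

text \<open>Smoothness of the boundary is expressed by local defining functions: near each boundary
  point, the domain is a strict sublevel set of a smooth function without critical points.\<close>

definition smooth_boundary :: "(real^3) set \<Rightarrow> bool" where
  "smooth_boundary \<Omega> \<longleftrightarrow>
     (\<forall>p\<in>frontier \<Omega>. \<exists>W \<rho>. open W \<and> p \<in> W \<and> smooth_on W \<rho> \<and>
        (\<forall>x\<in>W. frechet_derivative \<rho> (at x) \<noteq> (\<lambda>h. 0)) \<and>
        \<Omega> \<inter> W = {x \<in> W. \<rho> x < 0})"

definition smooth_bounded_domain :: "(real^3) set \<Rightarrow> bool" where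
  "smooth_bounded_domain \<Omega> \<longleftrightarrow>
     open \<Omega> \<and> connected \<Omega> \<and> \<Omega> \<noteq> {} \<and> bounded \<Omega> \<and> smooth_boundary \<Omega>"


section \<open>The spaces of the velocity field\<close>

text \<open>Elements of Lebesgue and Sobolev spaces on \<open>\<Omega>\<close> are represented by functions on the whole
  space, of which only the values on \<open>\<Omega>\<close> matter, up to null sets. No quotient is formed:
  the norms below are seminorms on representatives, and equality in a space is expressed
  by the vanishing of the seminorm of the difference.\<close>

type_synonym vfield = "real^3 \<Rightarrow> real^3"

definition L2 :: "(real^3) set \<Rightarrow> (real^3 \<Rightarrow> real) set" where
  "L2 \<Omega> = {f \<in> borel_measurable (lebesgue_on \<Omega>). integrable (lebesgue_on \<Omega>) (\<lambda>x. (f x)\<^sup>2)}"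

definition partial :: "3 \<Rightarrow> (real^3 \<Rightarrow> real) \<Rightarrow> real^3 \<Rightarrow> real" where
  "partial i \<phi> x = frechet_derivative \<phi> (at x) (axis i 1)"

definition has_weak_partial ::
    "(real^3) set \<Rightarrow> 3 \<Rightarrow> (real^3 \<Rightarrow> real) \<Rightarrow> (real^3 \<Rightarrow> real) \<Rightarrow> bool" where
  "has_weak_partial \<Omega> i f g \<longleftrightarrow> g \<in> L2 \<Omega> \<and>
     (\<forall>\<phi>. test_fun \<Omega> \<phi> \<longrightarrow>
        (\<integral>x. f x * partial i \<phi> x \<partial>lebesgue_on \<Omega>) = - (\<integral>x. g x * \<phi> x \<partial>lebesgue_on \<Omega>))"

text \<open>The weak derivative is unique up to null sets; everything below is insensitive
  to the choice of the representative.\<close>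

definition weak_partial :: "(real^3) set \<Rightarrow> 3 \<Rightarrow> (real^3 \<Rightarrow> real) \<Rightarrow> real^3 \<Rightarrow> real" where
  "weak_partial \<Omega> i f = (SOME g. has_weak_partial \<Omega> i f g)"

definition H1 :: "(real^3) set \<Rightarrow> (real^3 \<Rightarrow> real) set" where
  "H1 \<Omega> = {f \<in> L2 \<Omega>. \<forall>i. \<exists>g. has_weak_partial \<Omega> i f g}"

text \<open>The closure of the test functions in the \<open>H1\<close> norm.\<close>

definition H10 :: "(real^3) set \<Rightarrow> (real^3 \<Rightarrow> real) set" where
  "H10 \<Omega> = {f \<in> H1 \<Omega>. \<exists>\<phi>. (\<forall>n::nat. test_fun \<Omega> (\<phi> n)) \<and>
     (\<lambda>n. (\<integral>x. (f x - \<phi> n x)\<^sup>2 \<partial>lebesgue_on \<Omega>) +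
          (\<Sum>i\<in>UNIV. \<integral>x. (weak_partial \<Omega> i f x - partial i (\<phi> n) x)\<^sup>2 \<partial>lebesgue_on \<Omega>))
       \<longlonglongrightarrow> 0}"

text \<open>\<open>grad \<Omega> u x $ i $ j\<close> is the \<open>i\<close>-th partial derivative of the \<open>j\<close>-th component of \<open>u\<close>.\<close>

definition grad :: "(real^3) set \<Rightarrow> vfield \<Rightarrow> real^3 \<Rightarrow> real^3^3" where
  "grad \<Omega> u x = (\<chi> i j. weak_partial \<Omega> i (\<lambda>y. u y $ j) x)"

definition V :: "(real^3) set \<Rightarrow> vfield set" where
  "V \<Omega> = {u. (\<forall>j. (\<lambda>x. u x $ j) \<in> H10 \<Omega>) \<and>
     (AE x in lebesgue_on \<Omega>. (\<Sum>i\<in>UNIV. grad \<Omega> u x $ i $ i) = 0)}"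

definition ip :: "(real^3) set \<Rightarrow> vfield \<Rightarrow> vfield \<Rightarrow> real" where
  "ip \<Omega> u v = (\<integral>x. u x \<bullet> v x \<partial>lebesgue_on \<Omega>)"

definition ip1 :: "(real^3) set \<Rightarrow> vfield \<Rightarrow> vfield \<Rightarrow> real" where
  "ip1 \<Omega> u v = (\<integral>x. grad \<Omega> u x \<bullet> grad \<Omega> v x \<partial>lebesgue_on \<Omega>)"

definition norm0 :: "(real^3) set \<Rightarrow> vfield \<Rightarrow> real" where
  "norm0 \<Omega> u = sqrt (ip \<Omega> u u)"

definition norm1 :: "(real^3) set \<Rightarrow> vfield \<Rightarrow> real" where
  "norm1 \<Omega> u = sqrt (ip1 \<Omega> u u)"

text \<open>The row vector \<open>u x v* grad \<Omega> v x\<close> is the convective term \<open>(u \<cdot> \<nabla>) v\<close> at \<open>x\<close>.\<close>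

definition trilinear :: "(real^3) set \<Rightarrow> vfield \<Rightarrow> vfield \<Rightarrow> vfield \<Rightarrow> real" where
  "trilinear \<Omega> u v w = (\<integral>x. (u x v* grad \<Omega> v x) \<bullet> w x \<partial>lebesgue_on \<Omega>)"


section \<open>Measurability and integration of functions with values in V\<close>

text \<open>Since \<open>V \<Omega>\<close> is a set of representatives and not a type in class \<^class>\<open>banach\<close>, the
  Bochner integral is defined here as in \<^theory>\<open>HOL-Analysis.Bochner_Integration\<close>, with
  \<open>norm1 \<Omega>\<close> in place of the norm.\<close>

definition strongly_measurable ::
    "(real^3) set \<Rightarrow> real measure \<Rightarrow> (real \<Rightarrow> vfield) \<Rightarrow> bool" where
  "strongly_measurable \<Omega> M F \<longleftrightarrow> (\<forall>t\<in>space M. F t \<in> V \<Omega>) \<and>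
     (\<exists>S. (\<forall>n::nat. simple_function M (S n) \<and> (\<forall>t\<in>space M. S n t \<in> V \<Omega>)) \<and>
          (AE t in M. (\<lambda>n. norm1 \<Omega> (S n t - F t)) \<longlonglongrightarrow> 0))"

definition simple_V_integral :: "real measure \<Rightarrow> (real \<Rightarrow> vfield) \<Rightarrow> vfield" where
  "simple_V_integral M S =
     (\<lambda>x. \<Sum>y\<in>S ` space M. measure M {t \<in> space M. S t = y} *\<^sub>R y x)"

definition has_V_integral ::
    "(real^3) set \<Rightarrow> real measure \<Rightarrow> (real \<Rightarrow> vfield) \<Rightarrow> vfield \<Rightarrow> bool" where
  "has_V_integral \<Omega> M F w \<longleftrightarrow> w \<in> V \<Omega> \<and> strongly_measurable \<Omega> M F \<and>
     (\<exists>S. (\<forall>n::nat. simple_function M (S n) \<and> (\<forall>t\<in>space M. S n t \<in> V \<Omega>) \<and>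
              emeasure M {t \<in> space M. S n t \<noteq> (\<lambda>x. 0)} \<noteq> \<infinity>) \<and>
          (\<lambda>n. \<integral>\<^sup>+t. ennreal (norm1 \<Omega> (S n t - F t)) \<partial>M) \<longlonglongrightarrow> 0 \<and>
          (\<lambda>n. norm1 \<Omega> (simple_V_integral M (S n) - w)) \<longlonglongrightarrow> 0)"

definition L2_V :: "(real^3) set \<Rightarrow> real measure \<Rightarrow> (real \<Rightarrow> vfield) set" where
  "L2_V \<Omega> M = {F. strongly_measurable \<Omega> M F \<and> integrable M (\<lambda>t. (norm1 \<Omega> (F t))\<^sup>2)}"

text \<open>The derivative in the sense of \<open>V\<close>-valued distributions on \<open>(0,\<infinity>)\<close>.\<close>

definition has_weak_time_derivative ::
    "(real^3) set \<Rightarrow> (real \<Rightarrow> vfield) \<Rightarrow> (real \<Rightarrow> vfield) \<Rightarrow> bool" where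
  "has_weak_time_derivative \<Omega> u u' \<longleftrightarrow>
     (\<forall>\<psi>. test_fun {0<..} \<psi> \<longrightarrow>
        (\<exists>w. has_V_integral \<Omega> (lebesgue_on {0<..}) (\<lambda>t x. deriv \<psi> t *\<^sub>R u t x) w \<and>
             has_V_integral \<Omega> (lebesgue_on {0<..}) (\<lambda>t x. - (\<psi> t *\<^sub>R u' t x)) w))"


section \<open>The memory kernel\<close>

definition absolutely_continuous_on_interval :: "real \<Rightarrow> real \<Rightarrow> (real \<Rightarrow> real) \<Rightarrow> bool" where
  "absolutely_continuous_on_interval a b f \<longleftrightarrow>
     (\<forall>\<epsilon>>0. \<exists>\<delta>>0. \<forall>(n::nat) x y.
        (\<forall>k<n. a \<le> x k \<and> x k \<le> y k \<and> y k \<le> b) \<and>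
        (\<forall>j<n. \<forall>k<n. j \<noteq> k \<longrightarrow> {x j<..<y j} \<inter> {x k<..<y k} = {}) \<and>
        (\<Sum>k<n. y k - x k) < \<delta>
        \<longrightarrow> (\<Sum>k<n. \<bar>f (y k) - f (x k)\<bar>) < \<epsilon>)"

text \<open>Only the values of \<open>\<mu>\<close> on \<open>(0,\<infinity>)\<close> are relevant.\<close>

definition memory_kernel :: "(real \<Rightarrow> real) \<Rightarrow> (real \<Rightarrow> real) \<Rightarrow> bool" where
  "memory_kernel g \<mu> \<longleftrightarrow>
     convex_on {0..} g \<and> (\<forall>s\<ge>0. 0 \<le> g s) \<and> smooth_on {0<..} g \<and> (g \<longlongrightarrow> 0) at_top \<and>
     has_bochner_integral (lebesgue_on {0..}) g 1 \<and>
     (\<forall>s>0. \<mu> s = - deriv g s) \<and>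
     (\<forall>s>0. 0 \<le> \<mu> s) \<and>
     (\<forall>r s. 0 < r \<and> r \<le> s \<longrightarrow> \<mu> s \<le> \<mu> r) \<and>
     (\<forall>a b. 0 < a \<and> a \<le> b \<longrightarrow> absolutely_continuous_on_interval a b \<mu>) \<and>
     integrable (lebesgue_on {0<..}) \<mu> \<and>
     0 < (\<integral>s. \<mu> s \<partial>lebesgue_on {0<..}) \<and>
     (\<exists>\<delta>>0. AE s in lebesgue_on {0<..}. deriv \<mu> s + \<delta> * \<mu> s \<le> 0)"


section \<open>The extended phase space\<close>

definition memory_space :: "(real^3) set \<Rightarrow> (real \<Rightarrow> real) \<Rightarrow> (real \<Rightarrow> vfield) set" where
  "memory_space \<Omega> \<mu> = {\<eta>. strongly_measurable \<Omega> (lebesgue_on {0<..}) \<eta> \<and>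
     integrable (lebesgue_on {0<..}) (\<lambda>s. \<mu> s * (norm1 \<Omega> (\<eta> s))\<^sup>2)}"

definition ip_memory ::
    "(real^3) set \<Rightarrow> (real \<Rightarrow> real) \<Rightarrow> (real \<Rightarrow> vfield) \<Rightarrow> (real \<Rightarrow> vfield) \<Rightarrow> real" where
  "ip_memory \<Omega> \<mu> \<eta> \<xi> = (\<integral>s. \<mu> s * ip1 \<Omega> (\<eta> s) (\<xi> s) \<partial>lebesgue_on {0<..})"

definition norm_memory :: "(real^3) set \<Rightarrow> (real \<Rightarrow> real) \<Rightarrow> (real \<Rightarrow> vfield) \<Rightarrow> real" where
  "norm_memory \<Omega> \<mu> \<eta> = sqrt (ip_memory \<Omega> \<mu> \<eta> \<eta>)"

type_synonym state = "vfield \<times> (real \<Rightarrow> vfield)"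

definition phase_space :: "(real^3) set \<Rightarrow> (real \<Rightarrow> real) \<Rightarrow> state set" where
  "phase_space \<Omega> \<mu> = V \<Omega> \<times> memory_space \<Omega> \<mu>"

definition norm_phase :: "(real^3) set \<Rightarrow> real \<Rightarrow> (real \<Rightarrow> real) \<Rightarrow> state \<Rightarrow> real" where
  "norm_phase \<Omega> \<alpha> \<mu> U = sqrt (\<alpha> * (norm1 \<Omega> (fst U))\<^sup>2 + (norm0 \<Omega> (fst U))\<^sup>2 +
     (norm_memory \<Omega> \<mu> (snd U))\<^sup>2)"

definition energy :: "(real^3) set \<Rightarrow> real \<Rightarrow> (real \<Rightarrow> real) \<Rightarrow> state \<Rightarrow> real" where
  "energy \<Omega> \<alpha> \<mu> U = 1/2 * (norm_phase \<Omega> \<alpha> \<mu> U)\<^sup>2"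


section \<open>Weak solutions\<close>

text \<open>The representation formula for the history component \<open>\<eta>\<close> is an identity in
  \<^const>\<open>memory_space\<close> for every fixed time, hence is required at almost every \<open>s\<close> with
  \<open>\<mu> s > 0\<close>; by monotonicity of \<open>\<mu>\<close> it only uses the initial history where \<open>\<mu>\<close> is positive.\<close>

definition history_formula ::
    "(real^3) set \<Rightarrow> (real \<Rightarrow> real) \<Rightarrow> (real \<Rightarrow> vfield) \<Rightarrow> (real \<Rightarrow> vfield) \<Rightarrow>
     real \<Rightarrow> (real \<Rightarrow> vfield) \<Rightarrow> bool" where
  "history_formula \<Omega> \<mu> \<eta>\<^sub>0 u t \<eta> \<longleftrightarrow>
     (AE s in lebesgue_on {0<..}. \<mu> s > 0 \<longrightarrow>
        (if s \<le> t
         then has_V_integral \<Omega> (lebesgue_on {0..s}) (\<lambda>\<sigma>. u (t - \<sigma>)) (\<eta> s)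
         else has_V_integral \<Omega> (lebesgue_on {0..t}) (\<lambda>\<sigma>. u (t - \<sigma>)) (\<eta> s - \<eta>\<^sub>0 (s - t))))"

definition weak_solution ::
    "(real^3) set \<Rightarrow> real \<Rightarrow> (real \<Rightarrow> real) \<Rightarrow> state \<Rightarrow> (real \<Rightarrow> state) \<Rightarrow> bool" where
  "weak_solution \<Omega> \<alpha> \<mu> U\<^sub>0 U \<longleftrightarrow>
     (let u = (\<lambda>t. fst (U t)); \<eta> = (\<lambda>t. snd (U t)) in
       (\<forall>t\<ge>0. U t \<in> phase_space \<Omega> \<mu>) \<and>
       (\<forall>t\<ge>0. ((\<lambda>r. norm_phase \<Omega> \<alpha> \<mu> (U r - U t)) \<longlongrightarrow> 0) (at t within {0..})) \<and>
       norm_phase \<Omega> \<alpha> \<mu> (U 0 - U\<^sub>0) = 0 \<and>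
       (\<exists>u'. has_weak_time_derivative \<Omega> u u' \<and>
          (\<forall>\<tau>>0. u' \<in> L2_V \<Omega> (lebesgue_on {0<..<\<tau>})) \<and>
          (\<forall>v\<in>V \<Omega>. AE t in lebesgue_on {0<..}.
             ip \<Omega> (u' t) v + \<alpha> * ip1 \<Omega> (u' t) v
             + (\<integral>s. \<mu> s * ip1 \<Omega> (\<eta> t s) v \<partial>lebesgue_on {0<..})
             + trilinear \<Omega> (u t) (u t) v = 0)) \<and>
       (\<forall>t\<ge>0. history_formula \<Omega> \<mu> (snd U\<^sub>0) u t (\<eta> t)))"

end

(*
  Testing the momentum equation with the solution itself is legitimate because the integrated
  equation makes the velocity Lipschitz in V, so that |u|^2 + alpha |grad u|^2 has a one-sided
  derivative at every time; the convective term drops out, b(u,u,u) = 0. The transport structure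
  eta^{t+h}(s+h) - eta^t(s) = int_t^{t+h} u together with mu(s+h) <= exp(-delta h) mu(s) gives the
  energy inequality E(b) + (delta/2) int_a^b |eta|_M^2 <= E(a).

  No Lyapunov functional is needed to recover the velocity from the memory: for small s the history
  is eta^t(s) = s u(t) + int_0^s (u(t-r) - u(t)) dr, and the increments of u are bounded by the time
  integral of |eta|_M + |u|_1^2. On a window of length depending only on a bound R for the energy
  the quadratic part is absorbed, whence E(t+2) <= q(R) E(t) with q(R) < 1 as long as E(t) <= R.
  After finitely many steps the energy is below 1, and from then on the rate is that of q(1).
*)
theory Submission
  imports Defs
begin

section \<open>Calculus of smooth and compactly supported functions\<close>

section \<open>Smooth functions\<close>

text \<open>The initial history is merely an element of \<open>memory_space\<close>, so
  \<open>\<eta>\<close> need not be differentiable in s or t and the energy inequality cannot come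
  from the chain rule. It is obtained from one-sided difference quotients with errors o(h) and a
  Dini-type monotonicity criterion. Comparing the history at (t + h, s + h) with that at (t, s)
  involves \<open>\<mu>\<close> only through \<mu>(s + h) \<le> \<mu>(s), hence a singularity of the
  kernel at 0 is harmless. V is a set of representatives and not a Banach space type. V-valued
  integrals are therefore used only after pairing with bounded functionals, which turns them into
  integrals of real functions of time. The single nonlinear estimate is |b(u,v,w)| \<le> c |grad u|
  |grad v| |grad w|. In dimension three it needs the L4 norm bounded by the gradient; this and the
  Poincare inequality come from integrating along coordinate lines for test functions and passing to
  the limit in \<open>H10\<close>. The term to be absorbed is proportional to R times the square of
  the window length, which dictates how the window shrinks with R.\<close>

lemma Ck_on_Suc_imp: "Ck_on (Suc k) S f \<Longrightarrow> Ck_on k S f"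
proof (induction k arbitrary: f)
  case 0
  then show ?case
    by (auto intro!: differentiable_imp_continuous_on differentiable_at_imp_differentiable_on)
next
  case (Suc k)
  then show ?case by (metis Ck_on.simps(2))
qed

lemma frechet_derivative_add_apply:
  fixes f g :: "'a::real_normed_vector \<Rightarrow> real"
  assumes "f differentiable (at x)" "g differentiable (at x)"
  shows "frechet_derivative (\<lambda>x. f x + g x) (at x) b
    = frechet_derivative f (at x) b + frechet_derivative g (at x) b"
  using frechet_derivative_at[OF has_derivative_add[OF frechet_derivative_works[THEN iffD1, OF assms(1)]
      frechet_derivative_works[THEN iffD1, OF assms(2)]]] by metis

lemma frechet_derivative_mult_apply:
  fixes f g :: "'a::real_normed_vector \<Rightarrow> real"
  assumes "f differentiable (at x)" "g differentiable (at x)"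
  shows "frechet_derivative (\<lambda>x. f x * g x) (at x) b
    = f x * frechet_derivative g (at x) b + frechet_derivative f (at x) b * g x"
  using frechet_derivative_at[OF has_derivative_mult[OF frechet_derivative_works[THEN iffD1, OF assms(1)]
      frechet_derivative_works[THEN iffD1, OF assms(2)]]] by metis

lemma Ck_on_add:
  "Ck_on k UNIV f \<Longrightarrow> Ck_on k UNIV g \<Longrightarrow> Ck_on k UNIV (\<lambda>x. f x + g x)"
proof (induction k arbitrary: f g)
  case 0
  then show ?case by (simp add: continuous_on_add)
next
  case (Suc k)
  then have d: "f differentiable (at x)" "g differentiable (at x)" for x by auto
  show ?case
    using Suc d by (auto simp: frechet_derivative_add_apply)
qed

lemma Ck_on_mult:
  "Ck_on k UNIV f \<Longrightarrow> Ck_on k UNIV g \<Longrightarrow> Ck_on k UNIV (\<lambda>x. f x * g x)"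
proof (induction k arbitrary: f g)
  case 0
  then show ?case by (simp add: continuous_on_mult)
next
  case (Suc k)
  then have d: "f differentiable (at x)" "g differentiable (at x)" for x by auto
  have fg: "Ck_on k UNIV f" "Ck_on k UNIV g" using Suc.prems Ck_on_Suc_imp by blast+
  show ?case
    using Suc d fg by (auto simp: frechet_derivative_mult_apply intro!: Ck_on_add)
qed

lemma Ck_on_const: "Ck_on k UNIV (\<lambda>x. c)"
  by (induction k arbitrary: c) auto

text \<open>Applied to squares: this gives the integrability of fourth powers in the L4 estimates
  and the test function \<phi>^2 behind the cancellation b(u,u,u) = 0.\<close>

lemma test_fun_mult:
  assumes "test_fun S f" "test_fun S g"
  shows "test_fun S (\<lambda>x. f x * g x)"
proof -
  have sub: "closure {x. f x * g x \<noteq> 0} \<subseteq> closure {x. f x \<noteq> 0}"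
    by (intro closure_mono) auto
  have "bounded (closure {x. f x * g x \<noteq> 0})"
    using assms sub bounded_subset by (auto simp: test_fun_def compact_eq_bounded_closed)
  then show ?thesis
    using assms sub unfolding test_fun_def smooth_on_def
    by (auto intro!: Ck_on_mult simp: compact_eq_bounded_closed)
qed

lemma test_fun_lincomb:
  assumes "test_fun S f" "test_fun S g"
  shows "test_fun S (\<lambda>x. c * f x + d * g x)"
proof -
  have sub: "closure {x. c * f x + d * g x \<noteq> 0} \<subseteq> closure {x. f x \<noteq> 0} \<union> closure {x. g x \<noteq> 0}"
    unfolding closure_Un[symmetric] by (intro closure_mono) auto
  have "bounded (closure {x. f x \<noteq> 0} \<union> closure {x. g x \<noteq> 0})"
    using assms by (auto simp: test_fun_def compact_eq_bounded_closed)
  then have "bounded (closure {x. c * f x + d * g x \<noteq> 0})"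
    using sub bounded_subset by blast
  then show ?thesis
    using assms sub unfolding test_fun_def smooth_on_def
    by (auto intro!: Ck_on_add Ck_on_mult Ck_on_const simp: compact_eq_bounded_closed)
qed

lemma test_fun_differentiable: "test_fun S f \<Longrightarrow> f differentiable (at x)"
  by (auto simp: test_fun_def smooth_on_def dest!: spec[of _ "Suc 0"])

lemma test_fun_continuous: "test_fun S f \<Longrightarrow> continuous_on UNIV f"
  by (auto simp: test_fun_def smooth_on_def dest!: spec[of _ "0"])

lemma test_fun_continuous_derivative:
  "test_fun S f \<Longrightarrow> b \<in> Basis \<Longrightarrow> continuous_on UNIV (\<lambda>x. frechet_derivative f (at x) b)"
  by (auto simp: test_fun_def smooth_on_def dest!: spec[of _ "Suc 0"])

lemma test_fun_eq_0: "test_fun S f \<Longrightarrow> x \<notin> S \<Longrightarrow> f x = 0"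
  using closure_subset[of "{x. f x \<noteq> 0}"] by (auto simp: test_fun_def)

text \<open>The complement of the support is open and the function is 0 on all of it, so it has the
  derivative of the zero function there.\<close>

lemma test_fun_derivative_eq_0:
  assumes "test_fun S f" "x \<notin> closure {x. f x \<noteq> 0}"
  shows "frechet_derivative f (at x) b = 0"
proof -
  have "(f has_derivative (\<lambda>h. 0)) (at x)"
    by (rule has_derivative_transform_within_open[of "\<lambda>x. 0" _ x UNIV "- closure {x. f x \<noteq> 0}"])
      (use assms closure_subset[of "{x. f x \<noteq> 0}"] in auto)
  then show ?thesis using frechet_derivative_at by metis
qed

lemma bounded_continuous_compact_support:
  fixes f :: "'a::euclidean_space \<Rightarrow> real"
  assumes "continuous_on UNIV f" "compact K" "\<And>x. x \<notin> K \<Longrightarrow> f x = 0"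
  obtains B where "B > 0" "\<And>x. \<bar>f x\<bar> \<le> B"
proof -
  have "bounded (f ` K)"
    using assms by (intro compact_imp_bounded compact_continuous_image) (auto intro: continuous_on_subset)
  then obtain B where B: "B > 0" "\<forall>y\<in>f ` K. norm y \<le> B" by (auto simp: bounded_pos)
  show ?thesis
  proof (rule that[OF B(1)])
    show "\<bar>f x\<bar> \<le> B" for x using B assms(3)[of x] by (cases "x \<in> K") auto
  qed
qed

lemma test_fun_bounded:
  assumes "test_fun S f"
  obtains B where "B > 0" "\<And>x. \<bar>f x\<bar> \<le> B"
proof (rule bounded_continuous_compact_support[OF test_fun_continuous[OF assms]])
  show "compact (closure {x. f x \<noteq> 0})" using assms by (simp add: test_fun_def)
  show "f x = 0" if "x \<notin> closure {x. f x \<noteq> 0}" for x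
    using that closure_subset[of "{x. f x \<noteq> 0}"] by blast
qed (rule that)

lemma test_fun_derivative_bounded:
  assumes "test_fun S f" "b \<in> Basis"
  obtains B where "B > 0" "\<And>x. \<bar>frechet_derivative f (at x) b\<bar> \<le> B"
proof (rule bounded_continuous_compact_support[OF test_fun_continuous_derivative[OF assms]])
  show "compact (closure {x. f x \<noteq> 0})" using assms by (simp add: test_fun_def)
  show "frechet_derivative f (at x) b = 0" if "x \<notin> closure {x. f x \<noteq> 0}" for x
    by (rule test_fun_derivative_eq_0[OF assms(1) that])
qed (rule that)

section \<open>Smooth functions built from exp(-1/t)\<close>

subsection \<open>Flat functions\<close>

text \<open>The classical flat function is the case n = 0. The powers of 1/t are included because
  differentiation produces them, so that the family is closed under derivatives up to linear
  combinations.\<close>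

definition flat :: "nat \<Rightarrow> real \<Rightarrow> real" where
  "flat n t = (if t \<le> 0 then 0 else exp (- 1 / t) / t ^ n)"

lemma flat_nonneg: "0 \<le> flat n t" by (simp add: flat_def)
lemma flat_pos: "0 < t \<Longrightarrow> 0 < flat n t" by (simp add: flat_def)
lemma flat_0_le_1: "flat 0 t \<le> 1" by (simp add: flat_def)

lemma flat_has_derivative:
  "(flat n has_real_derivative (flat (n + 2) t - n * flat (n + 1) t)) (at t)"
proof -
  consider "t < 0" | "t > 0" | "t = 0" by linarith
  then show ?thesis
  proof cases
    case 1
    have "(flat n has_real_derivative 0) (at t)"
      by (rule has_field_derivative_transform_within_open[of "\<lambda>x. 0" _ _ "{..<0}"])
        (use 1 in \<open>auto simp: flat_def\<close>)
    then show ?thesis using 1 by (simp add: flat_def)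
  next
    case 2
    have p: "((\<lambda>t. t ^ n) has_real_derivative n * t ^ n / t) (at t)"
      using DERIV_pow[of n t] 2 by (cases n) auto
    have e: "((\<lambda>t. exp (- 1 / t)) has_real_derivative exp (- 1 / t) * (1 / t\<^sup>2)) (at t)"
      using 2 by (auto intro!: derivative_eq_intros simp: field_simps power2_eq_square)
    have "((\<lambda>t. exp (- 1 / t) / t ^ n) has_real_derivative (flat (n + 2) t - n * flat (n + 1) t)) (at t)"
    proof -
      have "(exp (- 1 / t) * (1 / t\<^sup>2) * t ^ n - exp (- 1 / t) * (n * t ^ n / t)) / (t ^ n * t ^ n)
          = exp (- 1 / t) * (1 / t\<^sup>2) / t ^ n - exp (- 1 / t) * n / (t * t ^ n)" if "t ^ n \<noteq> 0"
        using that 2 by (simp add: field_simps)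
      also have "\<dots> = flat (n + 2) t - n * flat (n + 1) t"
        using 2 by (simp add: flat_def power2_eq_square mult.assoc)
      finally show ?thesis using DERIV_divide[OF e p] 2 by simp
    qed
    then show ?thesis
      by (rule has_field_derivative_transform_within_open[of _ _ _ "{0<..}"])
        (use 2 in \<open>auto simp: flat_def\<close>)
  next
    case 3
    \<comment> \<open>With y = 1/h the right difference quotient at 0 is y^(n+1) / exp y, and y
      tends to infinity as h decreases to 0.\<close>
    have "((\<lambda>h::real. (inverse h) ^ (n + 1) / exp (inverse h)) \<longlongrightarrow> 0) (at_right 0)"
      by (rule filterlim_compose[OF tendsto_power_div_exp_0 filterlim_inverse_at_top_right])
    then have "((\<lambda>h. flat n h / h) \<longlongrightarrow> 0) (at_right 0)"
      by (rule Lim_transform_eventually)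
        (auto simp: eventually_at_right_field flat_def exp_minus field_simps intro!: exI[of _ 1])
    moreover have "((\<lambda>h. flat n h / h) \<longlongrightarrow> 0) (at_left 0)"
      by (rule Lim_transform_eventually[of "\<lambda>h. 0"])
        (auto simp: eventually_at_left_field flat_def intro!: exI[of _ "-1"])
    ultimately have "((\<lambda>h. flat n h / h) \<longlongrightarrow> 0) (at 0)"
      by (simp add: filterlim_split_at)
    then show ?thesis using 3 by (simp add: DERIV_def flat_def)
  qed
qed

text \<open>A class of functions stable under directional derivatives, hence consisting of smooth
  functions.\<close>

inductive_set flat_class :: "('a::euclidean_space \<Rightarrow> real) set" where
  const: "(\<lambda>x. c) \<in> flat_class"
| flat: "(\<lambda>x. flat n (x \<bullet> d + e)) \<in> flat_class"
| add: "f \<in> flat_class \<Longrightarrow> g \<in> flat_class \<Longrightarrow> (\<lambda>x. f x + g x) \<in> flat_class"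
| mult: "f \<in> flat_class \<Longrightarrow> g \<in> flat_class \<Longrightarrow> (\<lambda>x. f x * g x) \<in> flat_class"
| inv: "f \<in> flat_class \<Longrightarrow> (\<And>x. f x \<noteq> 0) \<Longrightarrow> (\<lambda>x. inverse (f x)) \<in> flat_class"

lemma flat_class_derivative:
  "f \<in> flat_class \<Longrightarrow> \<exists>f'. (\<forall>x. (f has_derivative f' x) (at x)) \<and> (\<forall>b. (\<lambda>x. f' x b) \<in> flat_class)"
proof (induction rule: flat_class.induct)
  case (const c)
  show ?case by (intro exI[of _ "\<lambda>x h. 0"]) (auto intro: flat_class.const)
next
  case (flat n d e)
  \<comment> \<open>The subtraction in the derivative of \<open>flat\<close> is written as adding a
    constant multiple, because the class has rules for sums and products but not for
    differences.\<close>
  let ?f' = "\<lambda>x h. (h \<bullet> d) * (flat (n + 2) (x \<bullet> d + e) + - real n * flat (n + 1) (x \<bullet> d + e))"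
  have "((\<lambda>x. flat n (x \<bullet> d + e)) has_derivative ?f' x) (at x)" for x
  proof -
    have "((\<lambda>x. x \<bullet> d + e) has_derivative (\<lambda>h. h \<bullet> d)) (at x)"
      by (auto intro!: derivative_eq_intros)
    from has_derivative_compose[OF this flat_has_derivative[unfolded has_field_derivative_def]]
    show ?thesis by (simp add: algebra_simps)
  qed
  moreover have "(\<lambda>x. ?f' x b) \<in> flat_class" for b
    by (intro flat_class.intros)
  ultimately show ?case by (intro exI[of _ ?f']) blast
next
  case (add f g)
  then obtain f' g' where
    "\<And>x. (f has_derivative f' x) (at x)" "\<And>b. (\<lambda>x. f' x b) \<in> flat_class"
    "\<And>x. (g has_derivative g' x) (at x)" "\<And>b. (\<lambda>x. g' x b) \<in> flat_class" by blast
  then show ?case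
    by (intro exI[of _ "\<lambda>x h. f' x h + g' x h"]) (auto intro: flat_class.add has_derivative_add)
next
  case (mult f g)
  then obtain f' g' where
    "\<And>x. (f has_derivative f' x) (at x)" "\<And>b. (\<lambda>x. f' x b) \<in> flat_class"
    "\<And>x. (g has_derivative g' x) (at x)" "\<And>b. (\<lambda>x. g' x b) \<in> flat_class" by blast
  note fg = this
  have "(\<lambda>x. f x * g' x b + f' x b * g x) \<in> flat_class" for b
    by (intro flat_class.intros fg mult.hyps)
  then show ?case
    using fg by (intro exI[of _ "\<lambda>x h. f x * g' x h + f' x h * g x"]) (auto intro: has_derivative_mult)
next
  case (inv f)
  then obtain f' where f':
    "\<And>x. (f has_derivative f' x) (at x)" "\<And>b. (\<lambda>x. f' x b) \<in> flat_class" by blast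
  let ?g' = "\<lambda>x h. - 1 * (inverse (f x) * f' x h * inverse (f x))"
  have "(\<lambda>x. ?g' x b) \<in> flat_class" for b
    by (intro flat_class.intros f' inv)
  moreover have "((\<lambda>x. inverse (f x)) has_derivative ?g' x) (at x)" for x
    using Deriv.has_derivative_inverse[OF inv.hyps(2) f'(1)] by simp
  ultimately show ?case by (intro exI[of _ ?g']) blast
qed

text \<open>The induction on k closes because a directional derivative of a member is again a
  member, so the hypothesis for k applies to it.\<close>

lemma flat_class_Ck: "f \<in> flat_class \<Longrightarrow> Ck_on k UNIV f"
proof (induction k arbitrary: f)
  case 0
  then obtain f' where "\<And>x. (f has_derivative f' x) (at x)" using flat_class_derivative by blast
  then show ?case
    by (auto intro!: continuous_at_imp_continuous_on has_derivative_continuous)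
next
  case (Suc k)
  then obtain f' where f': "\<And>x. (f has_derivative f' x) (at x)" "\<And>b. (\<lambda>x. f' x b) \<in> flat_class"
    using flat_class_derivative by blast
  have eq: "frechet_derivative f (at x) = f' x" for x
    using frechet_derivative_at[OF f'(1)] by metis
  show ?case
    using Suc.IH f' by (auto simp: eq differentiable_def)
qed

lemma flat_class_smooth: "f \<in> flat_class \<Longrightarrow> smooth_on UNIV f"
  by (simp add: smooth_on_def flat_class_Ck)

lemma flat_class_prod:
  "finite I \<Longrightarrow> (\<And>i. i \<in> I \<Longrightarrow> f i \<in> flat_class) \<Longrightarrow> (\<lambda>x. \<Prod>i\<in>I. f i x) \<in> flat_class"
  by (induction I rule: finite_induct) (auto intro: flat_class.const flat_class.mult)

lemma flat_class_affine:
  "f \<in> flat_class \<Longrightarrow> (\<lambda>x::real. f (c * x + d)) \<in> flat_class"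
proof (induction rule: flat_class.induct)
  case (flat n d' e)
  have "(\<lambda>x. flat n (x \<bullet> (c * d') + (d * d' + e))) \<in> flat_class"
    by (rule flat_class.flat)
  then show ?case by (simp add: algebra_simps)
next
  case (inv f)
  then show ?case using flat_class.inv[of "\<lambda>x. f (c * x + d)"] by blast
qed (simp_all add: flat_class.const flat_class.add flat_class.mult)

subsection \<open>Bump functions on boxes\<close>

text \<open>A product of flat functions of the scaled distances to the faces. It vanishes off the
  open box for every k, while the growing factor k + 1 drives it pointwise to 1 inside, under the
  constant bound 1.\<close>

definition box_bump :: "'a::euclidean_space \<Rightarrow> 'a \<Rightarrow> nat \<Rightarrow> 'a \<Rightarrow> real" where
  "box_bump a b k x =
     (\<Prod>i\<in>Basis. flat 0 (real (Suc k) * ((x - a) \<bullet> i)) * flat 0 (real (Suc k) * ((b - x) \<bullet> i)))"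

lemma box_bump_smooth: "smooth_on UNIV (box_bump a b k)"
proof -
  have "(\<lambda>x. \<Prod>i\<in>Basis. flat 0 (x \<bullet> (real (Suc k) *\<^sub>R i) + (- real (Suc k) * (a \<bullet> i)))
      * flat 0 (x \<bullet> (- real (Suc k) *\<^sub>R i) + real (Suc k) * (b \<bullet> i))) \<in> flat_class"
    by (intro flat_class_prod flat_class.mult flat_class.flat) auto
  moreover have "(\<lambda>x. \<Prod>i\<in>Basis. flat 0 (x \<bullet> (real (Suc k) *\<^sub>R i) + (- real (Suc k) * (a \<bullet> i)))
      * flat 0 (x \<bullet> (- real (Suc k) *\<^sub>R i) + real (Suc k) * (b \<bullet> i))) = box_bump a b k"
    unfolding box_bump_def by (intro ext prod.cong refl) (simp add: algebra_simps)
  ultimately show ?thesis using flat_class_smooth by metis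
qed

lemma box_bump_outside:
  assumes "x \<notin> box a b" shows "box_bump a b k x = 0"
proof -
  obtain i where "i \<in> Basis" "\<not> (a \<bullet> i < x \<bullet> i \<and> x \<bullet> i < b \<bullet> i)"
    using assms by (auto simp: mem_box)
  then show ?thesis
    unfolding box_bump_def
    by (intro prod_zero) (auto intro!: bexI[of _ i] simp: flat_def inner_diff_left mult_le_0_iff)
qed

lemma box_bump_test_fun:
  assumes "cbox a b \<subseteq> S" shows "test_fun S (box_bump a b k)"
proof -
  have "closure {x. box_bump a b k x \<noteq> 0} \<subseteq> cbox a b"
    using box_bump_outside box_subset_cbox by (intro closure_minimal) (blast intro: closed_cbox)+
  then show ?thesis
    unfolding test_fun_def using assms box_bump_smooth bounded_subset[OF bounded_cbox]
    by (auto simp: compact_eq_bounded_closed)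
qed

lemma box_bump_nonneg: "0 \<le> box_bump a b k x"
  unfolding box_bump_def by (intro prod_nonneg) (simp add: flat_nonneg)

lemma box_bump_le_1: "box_bump a b k x \<le> 1"
  unfolding box_bump_def
  by (intro prod_le_1) (auto simp: flat_nonneg flat_0_le_1 intro: mult_le_one)

lemma flat_0_scaled_tendsto:
  assumes "y > 0" shows "(\<lambda>k. flat 0 (real (Suc k) * y)) \<longlonglongrightarrow> 1"
proof -
  have "(\<lambda>k. exp (- (1 / y) * inverse (real (Suc k)))) \<longlonglongrightarrow> exp (- (1 / y) * 0)"
    by (intro tendsto_intros LIMSEQ_inverse_real_of_nat)
  moreover have "flat 0 (real (Suc k) * y) = exp (- (1 / y) * inverse (real (Suc k)))" for k
  proof -
    have "real (Suc k) * y > 0" using assms by simp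
    then show ?thesis using assms by (simp add: flat_def field_simps)
  qed
  ultimately show ?thesis by simp
qed

lemma box_bump_tendsto: "(\<lambda>k. box_bump a b k x) \<longlonglongrightarrow> indicator (box a b) x"
proof (cases "x \<in> box a b")
  case True
  have "(\<lambda>k. box_bump a b k x) \<longlonglongrightarrow> (\<Prod>i\<in>(Basis::'a set). 1 * 1)"
    unfolding box_bump_def
    using True by (intro tendsto_intros flat_0_scaled_tendsto) (auto simp: mem_box inner_diff_left)
  then show ?thesis using True by simp
qed (simp add: box_bump_outside)

subsection \<open>A smooth step\<close>

text \<open>The standard smooth transition from 0 (for x \<le> 0) to 1 (for x \<ge> 1). The
  denominator never vanishes because x and 1 - x are not both nonpositive; the form with
  \<open>inverse\<close> matches the closure rules of \<open>flat_class\<close>.\<close>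

definition smooth_step :: "real \<Rightarrow> real" where
  "smooth_step x = flat 0 x * inverse (flat 0 x + flat 0 (1 - x))"

lemma smooth_step_denom: "flat 0 x + flat 0 (1 - x) > 0"
proof (cases "x > 0")
  case True
  then show ?thesis using flat_pos[of x 0] flat_nonneg[of 0 "1 - x"] by linarith
next
  case False
  then show ?thesis using flat_pos[of "1 - x" 0] flat_nonneg[of 0 x] by linarith
qed

lemma smooth_step_flat_class: "smooth_step \<in> flat_class"
proof -
  have 1: "(\<lambda>x. flat 0 x) \<in> flat_class" using flat_class.flat[of 0 "1::real" 0] by simp
  have 2: "(\<lambda>x. flat 0 (1 - x)) \<in> flat_class" using flat_class.flat[of 0 "-1::real" 1] by simp
  have "(\<lambda>x. flat 0 x * inverse (flat 0 x + flat 0 (1 - x))) \<in> flat_class"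
    using smooth_step_denom by (intro flat_class.mult 1 flat_class.inv flat_class.add 2) (metis less_irrefl)
  then show ?thesis by (simp add: smooth_step_def[abs_def])
qed

lemma smooth_step_eq_0: "x \<le> 0 \<Longrightarrow> smooth_step x = 0"
  by (simp add: smooth_step_def flat_def)

lemma smooth_step_eq_1: "x \<ge> 1 \<Longrightarrow> smooth_step x = 1"
  by (simp add: smooth_step_def flat_def)

lemma smooth_step_bounds: "0 \<le> smooth_step x" "smooth_step x \<le> 1"
  using smooth_step_denom[of x] flat_nonneg[of 0 x] flat_nonneg[of 0 "1 - x"]
  by (simp_all add: smooth_step_def divide_inverse[symmetric])

text \<open>A smoothed indicator of the interval from a to b, supported in [a, b + e] and hence away
  from 0. Its derivative approximates point masses at a and b, which is what turns a weak time
  derivative into increments.\<close>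

lemma smooth_step_difference_test_fun:
  assumes "0 < a" "a < b" "0 < e"
  shows "test_fun {0<..} (\<lambda>t. smooth_step ((t - a) / e) - smooth_step ((t - b) / e))"
proof -
  have "(\<lambda>t. smooth_step ((1 / e) * t + (- a / e)) + (- 1) * smooth_step ((1 / e) * t + (- b / e))) \<in> flat_class"
    by (intro flat_class.intros flat_class_affine[OF smooth_step_flat_class])
  from flat_class_smooth[OF this]
  have s: "smooth_on UNIV (\<lambda>t. smooth_step ((t - a) / e) - smooth_step ((t - b) / e))"
    by (simp add: diff_divide_distrib)
  have "t \<in> {a..b + e}" if "smooth_step ((t - a) / e) - smooth_step ((t - b) / e) \<noteq> 0" for t
  proof (rule ccontr)
    assume "t \<notin> {a..b + e}"
    then consider "t < a" | "t > b + e" by (meson atLeastAtMost_iff not_le)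
    then show False
    proof cases
      case 1
      then have "(t - a) / e \<le> 0" "(t - b) / e \<le> 0" using assms by (simp_all add: divide_le_0_iff)
      then show False using that by (simp add: smooth_step_eq_0)
    next
      case 2
      then have "(t - a) / e \<ge> 1" "(t - b) / e \<ge> 1" using assms by (simp_all add: le_divide_eq)
      then show False using that by (simp add: smooth_step_eq_1)
    qed
  qed
  then have "closure {t. smooth_step ((t - a) / e) - smooth_step ((t - b) / e) \<noteq> 0} \<subseteq> {a..b + e}"
    by (intro closure_minimal) auto
  note sub = this
  moreover have "{a..b + e} \<subseteq> {0<..}" using assms by auto
  moreover have "compact (closure {t. smooth_step ((t - a) / e) - smooth_step ((t - b) / e) \<noteq> 0})"
    unfolding compact_eq_bounded_closed
    using bounded_subset[OF bounded_closed_interval sub] by simp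
  ultimately show ?thesis unfolding test_fun_def using s by blast
qed

section \<open>L2 estimates over an arbitrary measure\<close>

section \<open>Square integrable functions\<close>

text \<open>One notion of square integrability that serves components, vector fields, gradients and
  weighted histories on the half-line alike. Functions remain representatives, as in
  \<open>L2\<close>.\<close>

definition sqint :: "'a measure \<Rightarrow> ('a \<Rightarrow> 'b::euclidean_space) set" where
  "sqint M = {f \<in> borel_measurable M. integrable M (\<lambda>x. (norm (f x))\<^sup>2)}"

lemma L2_eq_sqint: "L2 \<Omega> = sqint (lebesgue_on \<Omega>)"
  by (simp add: L2_def sqint_def)

lemma sqint_measurable: "f \<in> sqint M \<Longrightarrow> f \<in> borel_measurable M"
  and sqint_integrable: "f \<in> sqint M \<Longrightarrow> integrable M (\<lambda>x. (norm (f x))\<^sup>2)"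
  by (auto simp: sqint_def)

lemma sqint_integrable_real: "(f :: _ \<Rightarrow> real) \<in> sqint M \<Longrightarrow> integrable M (\<lambda>x. (f x)\<^sup>2)"
  using sqint_integrable by force

lemma sqint_bound:
  assumes "f \<in> borel_measurable M" "integrable M h" "AE x in M. (norm (f x))\<^sup>2 \<le> h x"
  shows "f \<in> sqint M"
  unfolding sqint_def
proof (intro CollectI conjI assms(1))
  show "integrable M (\<lambda>x. (norm (f x))\<^sup>2)"
    by (rule Bochner_Integration.integrable_bound[OF assms(2)]) (use assms in auto)
qed

lemma norm_lincomb_sq_le:
  fixes x y :: "'b::real_normed_vector"
  shows "(norm (c *\<^sub>R x + d *\<^sub>R y))\<^sup>2 \<le> 2 * c\<^sup>2 * (norm x)\<^sup>2 + 2 * d\<^sup>2 * (norm y)\<^sup>2"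
proof -
  have "(norm (c *\<^sub>R x + d *\<^sub>R y))\<^sup>2 \<le> (\<bar>c\<bar> * norm x + \<bar>d\<bar> * norm y)\<^sup>2"
    using norm_triangle_ineq[of "c *\<^sub>R x" "d *\<^sub>R y"] by (intro power_mono) auto
  also have "\<dots> \<le> 2 * (\<bar>c\<bar> * norm x)\<^sup>2 + 2 * (\<bar>d\<bar> * norm y)\<^sup>2"
    using sum_squares_bound[of "\<bar>c\<bar> * norm x" "\<bar>d\<bar> * norm y"] by (simp add: power2_sum)
  finally show ?thesis by (simp add: power_mult_distrib)
qed

lemma sqint_lincomb:
  assumes "f \<in> sqint M" "g \<in> sqint M"
  shows "(\<lambda>x. c *\<^sub>R f x + d *\<^sub>R g x) \<in> sqint M"
  using assms
  by (intro sqint_bound[of _ _ "\<lambda>x. 2 * c\<^sup>2 * (norm (f x))\<^sup>2 + 2 * d\<^sup>2 * (norm (g x))\<^sup>2"])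
    (auto simp: sqint_def norm_lincomb_sq_le)

lemma sqint_diff: "f \<in> sqint M \<Longrightarrow> g \<in> sqint M \<Longrightarrow> (\<lambda>x. f x - g x) \<in> sqint M"
  using sqint_lincomb[of f M g 1 "-1"] by simp

lemma sqint_norm: "f \<in> sqint M \<Longrightarrow> (\<lambda>x. norm (f x)) \<in> sqint M"
  by (auto simp: sqint_def)

lemma sqint_mult_integrable:
  fixes f g :: "'a \<Rightarrow> real"
  assumes "f \<in> sqint M" "g \<in> sqint M"
  shows "integrable M (\<lambda>x. f x * g x)"
proof (rule Bochner_Integration.integrable_bound[of M "\<lambda>x. (f x)\<^sup>2 + (g x)\<^sup>2"])
  show "integrable M (\<lambda>x. (f x)\<^sup>2 + (g x)\<^sup>2)"
    using assms by (intro Bochner_Integration.integrable_add sqint_integrable_real)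
  show "(\<lambda>x. f x * g x) \<in> borel_measurable M"
    using assms by (auto simp: sqint_def)
  have "\<bar>a * b\<bar> \<le> a\<^sup>2 + b\<^sup>2" for a b :: real
  proof -
    have "2 * (\<bar>a\<bar> * \<bar>b\<bar>) \<le> a\<^sup>2 + b\<^sup>2"
      using sum_squares_bound[of "\<bar>a\<bar>" "\<bar>b\<bar>"] by (simp add: mult.assoc)
    moreover have "0 \<le> \<bar>a\<bar> * \<bar>b\<bar>" by simp
    ultimately show ?thesis unfolding abs_mult by linarith
  qed
  then show "AE x in M. norm (f x * g x) \<le> norm ((f x)\<^sup>2 + (g x)\<^sup>2)"
    by (intro AE_I2) (metis abs_of_nonneg add_nonneg_nonneg real_norm_def zero_le_power2)
qed

text \<open>The discriminant criterion: for B > 0 the choice l = C / B minimises the form and gives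
  A - C^2 / B. It is the common core of the Cauchy-Schwarz inequalities for \<open>sqint\<close> and
  for integrals over time intervals.\<close>

lemma quadratic_form_nonneg_imp:
  fixes A B C :: real
  assumes "\<And>l. 0 \<le> A - 2 * l * C + l\<^sup>2 * B" "0 \<le> B"
  shows "C\<^sup>2 \<le> A * B"
proof (cases "B = 0")
  case True
  have "C = 0"
  proof (rule ccontr)
    assume "C \<noteq> 0"
    \<comment> \<open>For B = 0 the form is affine in l and takes the value -1 at this
      point.\<close>
    then show False using assms(1)[of "(A + 1) / (2 * C)"] True by (simp add: field_simps)
  qed
  then show ?thesis using True by simp
next
  case False
  then have "B > 0" using assms by simp
  have "0 \<le> A - 2 * (C / B) * C + (C / B)\<^sup>2 * B" by (rule assms)
  also have "\<dots> = (A * B - C\<^sup>2) / B" using \<open>B > 0\<close> by (simp add: field_simps power2_eq_square)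
  finally show ?thesis using \<open>B > 0\<close> by (simp add: zero_le_divide_iff)
qed

lemma sqint_Cauchy_Schwarz:
  fixes f g :: "'a \<Rightarrow> real"
  assumes "f \<in> sqint M" "g \<in> sqint M"
  shows "(\<integral>x. f x * g x \<partial>M)\<^sup>2 \<le> (\<integral>x. (f x)\<^sup>2 \<partial>M) * (\<integral>x. (g x)\<^sup>2 \<partial>M)"
proof (rule quadratic_form_nonneg_imp)
  fix l
  have "0 \<le> (\<integral>x. (f x - l * g x)\<^sup>2 \<partial>M)" by simp
  also have "(\<lambda>x. (f x - l * g x)\<^sup>2) = (\<lambda>x. (f x)\<^sup>2 - 2 * l * (f x * g x) + l\<^sup>2 * (g x)\<^sup>2)"
    by (intro ext) (simp add: power2_eq_square algebra_simps)
  also have "(\<integral>x. (f x)\<^sup>2 - 2 * l * (f x * g x) + l\<^sup>2 * (g x)\<^sup>2 \<partial>M) =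
      (\<integral>x. (f x)\<^sup>2 \<partial>M) - 2 * l * (\<integral>x. f x * g x \<partial>M) + l\<^sup>2 * (\<integral>x. (g x)\<^sup>2 \<partial>M)"
    using sqint_mult_integrable[OF assms] assms[THEN sqint_integrable_real] by simp
  finally show "0 \<le> (\<integral>x. (f x)\<^sup>2 \<partial>M) - 2 * l * (\<integral>x. f x * g x \<partial>M) + l\<^sup>2 * (\<integral>x. (g x)\<^sup>2 \<partial>M)" .
qed simp

lemma sqint_Cauchy_Schwarz_norm:
  assumes "f \<in> sqint M" "g \<in> sqint M"
  shows "(\<integral>x. norm (f x) * norm (g x) \<partial>M) \<le> sqrt (\<integral>x. (norm (f x))\<^sup>2 \<partial>M) * sqrt (\<integral>x. (norm (g x))\<^sup>2 \<partial>M)"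
  unfolding real_sqrt_mult[symmetric]
  using sqint_Cauchy_Schwarz[OF assms[THEN sqint_norm]] by (intro real_le_rsqrt) simp

lemma sqint_inner_integrable:
  assumes "f \<in> sqint M" "g \<in> sqint M"
  shows "integrable M (\<lambda>x. f x \<bullet> g x)"
  using assms Cauchy_Schwarz_ineq2
  by (intro Bochner_Integration.integrable_bound[OF sqint_mult_integrable[OF assms[THEN sqint_norm]]])
    (auto simp: sqint_def)

lemma sqint_inner_Cauchy_Schwarz:
  assumes "f \<in> sqint M" "g \<in> sqint M"
  shows "\<bar>\<integral>x. f x \<bullet> g x \<partial>M\<bar> \<le> sqrt (\<integral>x. (norm (f x))\<^sup>2 \<partial>M) * sqrt (\<integral>x. (norm (g x))\<^sup>2 \<partial>M)"
proof -
  have "\<bar>\<integral>x. f x \<bullet> g x \<partial>M\<bar> \<le> (\<integral>x. \<bar>f x \<bullet> g x\<bar> \<partial>M)"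
    using integral_norm_bound[of M "\<lambda>x. f x \<bullet> g x"] by simp
  also have "\<dots> \<le> (\<integral>x. norm (f x) * norm (g x) \<partial>M)"
    using sqint_inner_integrable[OF assms] sqint_mult_integrable[OF assms[THEN sqint_norm]]
    by (intro integral_mono) (auto simp: Cauchy_Schwarz_ineq2)
  also note sqint_Cauchy_Schwarz_norm[OF assms]
  finally show ?thesis .
qed

lemma sqint_vec:
  fixes f :: "'a \<Rightarrow> 'b::euclidean_space ^ 'n"
  assumes "\<And>i. (\<lambda>x. f x $ i) \<in> sqint M" shows "f \<in> sqint M"
proof (rule sqint_bound)
  show "f \<in> borel_measurable M"
  proof (subst borel_measurable_euclidean_space, intro ballI)
    fix b :: "'b ^ 'n" assume "b \<in> Basis"
    then obtain i c where "b = axis i c" "c \<in> Basis" by (auto simp: Basis_vec_def)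
    then show "(\<lambda>x. f x \<bullet> b) \<in> borel_measurable M"
      using sqint_measurable[OF assms[of i]] by (simp add: inner_axis)
  qed
  show "integrable M (\<lambda>x. \<Sum>i\<in>UNIV. (norm (f x $ i))\<^sup>2)"
    using assms by (auto intro!: Bochner_Integration.integrable_sum sqint_integrable)
  show "AE x in M. (norm (f x))\<^sup>2 \<le> (\<Sum>i\<in>UNIV. (norm (f x $ i))\<^sup>2)"
    by (intro AE_I2) (simp add: norm_vec_def L2_set_def sum_nonneg)
qed

section \<open>Vanishing against all test functions forces vanishing almost everywhere\<close>

section \<open>The fundamental lemma of the calculus of variations\<close>

text \<open>The bumps on a closed box inside \<Omega> are admissible test functions and converge
  boundedly to the indicator of the open box, so dominated convergence with majorant |h|
  applies.\<close>

lemma box_integral_eq_0: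
  fixes h :: "'a::euclidean_space \<Rightarrow> real"
  assumes "open \<Omega>" "integrable (lebesgue_on \<Omega>) h"
    and test: "\<And>\<phi>. test_fun \<Omega> \<phi> \<Longrightarrow> (\<integral>x. h x * \<phi> x \<partial>lebesgue_on \<Omega>) = 0"
    and sub: "cbox a b \<subseteq> \<Omega>"
  shows "(\<integral>x. h x * indicator (box a b) x \<partial>lebesgue_on \<Omega>) = 0"
proof -
  have m: "f \<in> borel_measurable borel \<Longrightarrow> f \<in> borel_measurable (lebesgue_on \<Omega>)" for f :: "'a \<Rightarrow> real"
    by (intro measurable_restrict_space1 measurable_completion) simp
  have [measurable]: "h \<in> borel_measurable (lebesgue_on \<Omega>)" using assms(2) by auto
  have [measurable]: "box_bump a b k \<in> borel_measurable (lebesgue_on \<Omega>)" for k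
    using test_fun_continuous[OF box_bump_test_fun[OF sub]]
    by (intro m borel_measurable_continuous_onI)
  have [measurable]: "indicat_real (box a b) \<in> borel_measurable (lebesgue_on \<Omega>)"
    by (intro m) auto
  have "(\<lambda>k. \<integral>x. h x * box_bump a b k x \<partial>lebesgue_on \<Omega>) \<longlonglongrightarrow> (\<integral>x. h x * indicator (box a b) x \<partial>lebesgue_on \<Omega>)"
  proof (rule integral_dominated_convergence[where w="\<lambda>x. \<bar>h x\<bar>"])
    show "AE x in lebesgue_on \<Omega>. (\<lambda>k. h x * box_bump a b k x) \<longlonglongrightarrow> h x * indicator (box a b) x"
      by (intro AE_I2 tendsto_intros box_bump_tendsto)
    show "AE x in lebesgue_on \<Omega>. norm (h x * box_bump a b k x) \<le> \<bar>h x\<bar>" for k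
      by (intro AE_I2) (auto simp: abs_mult box_bump_nonneg box_bump_le_1 intro!: mult_left_le)
  qed (use assms(2) in auto)
  then show ?thesis
    using test[OF box_bump_test_fun[OF sub]] by (simp add: LIMSEQ_const_iff)
qed

lemma integrable_restrict_box:
  fixes h :: "'a::euclidean_space \<Rightarrow> real"
  assumes "integrable (lebesgue_on S) h" "S \<in> sets lebesgue" "A \<in> sets lebesgue"
  shows "integrable (lebesgue_on S) (\<lambda>x. h x * indicator A x)"
    "integrable lebesgue (\<lambda>x. indicator S x * h x * indicator A x)"
    "(\<integral>x. h x * indicator A x \<partial>lebesgue_on S) = (\<integral>x. indicator S x * h x * indicator A x \<partial>lebesgue)"
proof -
  have A: "A \<inter> S \<in> sets (lebesgue_on S)"
    using assms by (auto simp: sets_restrict_space)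
  have "integrable (lebesgue_on S) (\<lambda>x. indicator (A \<inter> S) x *\<^sub>R h x)"
    by (rule integrable_mult_indicator[OF A assms(1)])
  then show 1: "integrable (lebesgue_on S) (\<lambda>x. h x * indicator A x)"
    by (rule Bochner_Integration.integrable_cong[THEN iffD1, rotated -1]) (auto simp: indicator_def)
  show "integrable lebesgue (\<lambda>x. indicator S x * h x * indicator A x)"
    using 1 assms(2) by (subst (asm) integrable_restrict_space) (auto simp: mult.assoc)
  show "(\<integral>x. h x * indicator A x \<partial>lebesgue_on S) = (\<integral>x. indicator S x * h x * indicator A x \<partial>lebesgue)"
    using assms(2) by (subst integral_restrict_space) (auto simp: mult.assoc)
qed

text \<open>A Dynkin argument: the Borel sets A over which the part of h in the box integrates to 0
  contain all boxes, because two boxes meet in a box, and are closed under complements and countable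
  disjoint unions. Hence all Borel sets qualify, and a density with vanishing integrals is 0 almost
  everywhere.\<close>

lemma AE_box_eq_0:
  fixes h :: "'a::euclidean_space \<Rightarrow> real"
  assumes "open \<Omega>" and int: "integrable (lebesgue_on \<Omega>) h"
    and test: "\<And>\<phi>. test_fun \<Omega> \<phi> \<Longrightarrow> (\<integral>x. h x * \<phi> x \<partial>lebesgue_on \<Omega>) = 0"
    and sub: "cbox a b \<subseteq> \<Omega>"
  shows "AE x in lebesgue. x \<in> box a b \<longrightarrow> h x = 0"
proof -
  define H where "H x = indicator \<Omega> x * h x * indicator (box a b) x" for x
  have meas: "\<Omega> \<in> sets lebesgue" using assms(1) by auto
  have H: "integrable lebesgue H"
    unfolding H_def by (rule integrable_restrict_box(2)[OF int meas]) auto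
  \<comment> \<open>Boxes generate only the Borel sets, whereas h is Lebesgue measurable; a Borel
    version makes the Dynkin argument applicable.\<close>
  obtain h' where h': "h' \<in> borel_measurable lborel" "AE x in lborel. H x = h' x"
    using completion_ex_borel_measurable_real[of H lborel] H by auto
  have int_eq: "integrable lebesgue (\<lambda>x. H x * indicator A x)"
    "integrable lborel (\<lambda>x. indicator A x * h' x)"
    "(\<integral>x. indicator A x * h' x \<partial>lborel) = (\<integral>x. H x * indicator A x \<partial>lebesgue)"
    if A: "A \<in> sets borel" for A
  proof -
    have A': "A \<in> sets lebesgue" using A by auto
    show 1: "integrable lebesgue (\<lambda>x. H x * indicator A x)"
      using integrable_mult_indicator[OF A' H] by (simp add: mult.commute)
    have eq: "AE x in lebesgue. H x * indicator A x = indicator A x * h' x"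
      using AE_completion[OF h'(2)] by eventually_elim simp
    have m: "(\<lambda>x. indicator A x * h' x) \<in> borel_measurable lborel"
      using A h'(1) by auto
    have "integrable lebesgue (\<lambda>x. indicator A x * h' x)"
      by (rule integrable_cong_AE_imp[OF 1 measurable_completion[OF m]]) (use eq in auto)
    then show "integrable lborel (\<lambda>x. indicator A x * h' x)"
      using integrable_completion[OF m] by simp
    show "(\<integral>x. indicator A x * h' x \<partial>lborel) = (\<integral>x. H x * indicator A x \<partial>lebesgue)"
      using eq 1 measurable_completion[OF m]
      by (subst integral_completion[symmetric, OF m], intro integral_cong_AE) auto
  qed
  have "(\<integral>x. indicator A x * h' x \<partial>lborel) = 0" if "A \<in> sets borel" for A
  proof -
    have Int: "Int_stable (range (\<lambda>(a, b). box a b :: 'a set))"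
      by (auto simp: Int_stable_def box_Int_box)
    have whole: "(\<integral>x. h' x \<partial>lborel) = 0"
      using int_eq(3)[of UNIV] box_integral_eq_0[OF assms] integrable_restrict_box(3)[OF int meas, of "box a b"]
      by (simp add: H_def)
    have h'int: "integrable lborel h'" using int_eq(2)[of UNIV] by simp
    have pow: "range (\<lambda>(a, b). box a b :: 'a set) \<subseteq> Pow UNIV" by simp
    have sig: "A \<in> sigma_sets UNIV (range (\<lambda>(a, b). box a b :: 'a set))"
      using that unfolding borel_eq_box by simp
    from Int pow sig show ?thesis
    proof (induction rule: sigma_sets_induct_disjoint)
      case (basic A)
      then obtain l u where A: "A = box l u" by auto
      define a' where "a' = (\<Sum>i\<in>Basis. max (a \<bullet> i) (l \<bullet> i) *\<^sub>R i)"
      define b' where "b' = (\<Sum>i\<in>Basis. min (b \<bullet> i) (u \<bullet> i) *\<^sub>R i)"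
      have Int: "box a b \<inter> box l u = box a' b'"
        by (simp add: box_Int_box a'_def b'_def)
      have "cbox a' b' \<subseteq> cbox a b"
        by (auto simp: mem_box a'_def b'_def)
      then have sub': "cbox a' b' \<subseteq> \<Omega>" using sub by blast
      have "(\<integral>x. indicator A x * h' x \<partial>lborel) = (\<integral>x. H x * indicator A x \<partial>lebesgue)"
        by (rule int_eq) (simp add: A)
      also have "\<dots> = (\<integral>x. indicator \<Omega> x * h x * indicator (box a' b') x \<partial>lebesgue)"
        unfolding H_def A Int[symmetric] by (intro Bochner_Integration.integral_cong) (auto simp: indicator_def)
      also have "\<dots> = (\<integral>x. h x * indicator (box a' b') x \<partial>lebesgue_on \<Omega>)"
        by (rule integrable_restrict_box(3)[OF int meas, symmetric]) auto
      also have "\<dots> = 0" by (rule box_integral_eq_0[OF assms(1-3) sub'])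
      finally show ?case .
    next
      case empty
      show ?case by simp
    next
      case (compl A)
      then have "A \<in> sets borel" unfolding borel_eq_box by simp
      have "(\<integral>x. indicator (UNIV - A) x * h' x \<partial>lborel) = (\<integral>x. h' x - indicator A x * h' x \<partial>lborel)"
        by (intro Bochner_Integration.integral_cong) (auto simp: indicator_def)
      also have "\<dots> = 0" using whole compl h'int int_eq(2)[OF \<open>A \<in> sets borel\<close>] by simp
      finally show ?case .
    next
      case (union A)
      then have A: "A i \<in> sets borel" for i unfolding borel_eq_box by auto
      have "set_lebesgue_integral lborel (\<Union>i. A i) h' = (\<Sum>i. set_lebesgue_integral lborel (A i) h')"
      proof (rule lebesgue_integral_countable_add)
        show "set_integrable lborel (\<Union>i. A i) h'"
          unfolding set_integrable_def using int_eq(2)[of "\<Union>i. A i"] A by auto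
        show "A i \<inter> A j = {}" if "i \<noteq> j" for i j
          using union(1) that by (auto simp: disjoint_family_on_def)
      qed (use A in auto)
      then show ?case using union by (simp add: set_lebesgue_integral_def)
    qed
  qed
  then have "AE x in lborel. h' x = 0"
    using int_eq(2)[of UNIV] by (intro sigma_finite_measure.density_zero[OF sigma_finite_lborel]) (auto simp: set_lebesgue_integral_def)
  then have "AE x in lborel. H x = 0" using h'(2) by eventually_elim simp
  then have "AE x in lebesgue. H x = 0" by (rule AE_completion)
  then show ?thesis
  proof eventually_elim
    case (elim x)
    have "x \<in> box a b \<Longrightarrow> x \<in> \<Omega>" using sub box_subset_cbox[of a b] by blast
    then show ?case using elim by (auto simp: H_def)
  qed
qed

text \<open>An open set is a countable union of closed boxes contained in it, and the faces of these
  boxes are null sets, so the result on open boxes suffices.\<close>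

lemma fundamental_lemma:
  fixes h :: "'a::euclidean_space \<Rightarrow> real"
  assumes "open \<Omega>" and int: "integrable (lebesgue_on \<Omega>) h"
    and test: "\<And>\<phi>. test_fun \<Omega> \<phi> \<Longrightarrow> (\<integral>x. h x * \<phi> x \<partial>lebesgue_on \<Omega>) = 0"
  shows "AE x in lebesgue_on \<Omega>. h x = 0"
proof -
  obtain D where D: "countable D" "D \<subseteq> Pow \<Omega>" "\<And>X. X \<in> D \<Longrightarrow> \<exists>a b. X = cbox a b" "\<Union>D = \<Omega>"
    using open_countable_Union_open_cbox[OF assms(1)] by metis
  have "AE x in lebesgue. x \<in> X \<longrightarrow> h x = 0" if X: "X \<in> D" for X
  proof -
    obtain a b where ab: "X = cbox a b" using D X by blast
    have "AE x in lebesgue. x \<notin> cbox a b - box a b"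
      by (rule AE_not_in) (use negligible_frontier_interval[of a b] in \<open>simp add: negligible_iff_null_sets\<close>)
    moreover have "AE x in lebesgue. x \<in> box a b \<longrightarrow> h x = 0"
      by (rule AE_box_eq_0[OF assms]) (use D(2) X ab in auto)
    ultimately show ?thesis
      unfolding ab by eventually_elim auto
  qed
  then have "AE x in lebesgue. \<forall>X\<in>D. x \<in> X \<longrightarrow> h x = 0"
    unfolding AE_ball_countable[OF D(1)] by blast
  then have "AE x in lebesgue. x \<in> \<Omega> \<longrightarrow> h x = 0"
    by eventually_elim (use D(4) in blast)
  then show ?thesis using assms(1) by (subst AE_restrict_space_iff) auto
qed


section \<open>Weak partial derivatives, \<open>H10\<close> and the divergence-free space V\<close>

section \<open>Weak derivatives and the space of velocity fields\<close>

locale bounded_open =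
  fixes \<Omega> :: "(real^3) set"
  assumes open_dom: "open \<Omega>" and bounded_dom: "bounded \<Omega>"
begin

abbreviation "dom_measure \<equiv> lebesgue_on \<Omega>"

sublocale dom: finite_measure dom_measure
  by (intro finite_measure_lebesgue_on lmeasurable_open bounded_dom open_dom)

lemma borel_dom_measurable: "f \<in> borel_measurable borel \<Longrightarrow> f \<in> borel_measurable dom_measure"
  by (intro measurable_restrict_space1 measurable_completion) simp

lemma sqint_bounded:
  fixes f :: "real^3 \<Rightarrow> real"
  assumes "f \<in> borel_measurable dom_measure" "\<And>x. \<bar>f x\<bar> \<le> B"
  shows "f \<in> sqint dom_measure"
  by (rule sqint_bound[OF assms(1), of "\<lambda>x. B\<^sup>2"])
    (use assms(2) in \<open>auto intro!: AE_I2 simp: abs_le_square_iff[symmetric] intro: order_trans[OF _ abs_ge_self]\<close>)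

lemma sqint_integrable_1:
  fixes f :: "real^3 \<Rightarrow> real"
  assumes "f \<in> sqint dom_measure" shows "integrable dom_measure f"
  using sqint_mult_integrable[OF assms, of "\<lambda>x. 1"] sqint_bounded[of "\<lambda>x. 1" 1] by simp

lemma test_fun_sqint:
  assumes "test_fun S \<phi>" shows "\<phi> \<in> sqint dom_measure"
proof -
  obtain B where "\<And>x. \<bar>\<phi> x\<bar> \<le> B" using test_fun_bounded[OF assms] by metis
  then show ?thesis
    by (intro sqint_bounded borel_dom_measurable borel_measurable_continuous_onI test_fun_continuous[OF assms])
qed

lemma test_fun_partial_sqint:
  assumes "test_fun S \<phi>" shows "partial i \<phi> \<in> sqint dom_measure"
proof -
  have b: "axis i (1::real) \<in> Basis" by (simp add: axis_in_Basis_iff)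
  obtain B where "\<And>x. \<bar>frechet_derivative \<phi> (at x) (axis i 1)\<bar> \<le> B"
    using test_fun_derivative_bounded[OF assms b] by metis
  then show ?thesis
    unfolding partial_def[abs_def]
    by (intro sqint_bounded borel_dom_measurable borel_measurable_continuous_onI
        test_fun_continuous_derivative[OF assms b])
qed

text \<open>The difference of two candidates is square integrable on a bounded set, hence
  integrable, and it annihilates all test functions. This is what makes the choice in
  \<open>weak_partial\<close> harmless.\<close>

lemma has_weak_partial_unique:
  assumes "has_weak_partial \<Omega> i f g" "has_weak_partial \<Omega> i f g'"
  shows "AE x in dom_measure. g x = g' x"
proof -
  have g: "g \<in> sqint dom_measure" "g' \<in> sqint dom_measure"
    using assms by (auto simp: has_weak_partial_def L2_eq_sqint)
  have "AE x in dom_measure. g x - g' x = 0"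
  proof (rule fundamental_lemma[OF open_dom])
    show "integrable dom_measure (\<lambda>x. g x - g' x)"
      using sqint_integrable_1[OF sqint_diff[OF g]] .
    fix \<phi> :: "real^3 \<Rightarrow> real" assume \<phi>: "test_fun \<Omega> \<phi>"
    have "(\<integral>x. (g x - g' x) * \<phi> x \<partial>dom_measure) = (\<integral>x. g x * \<phi> x \<partial>dom_measure) - (\<integral>x. g' x * \<phi> x \<partial>dom_measure)"
      unfolding left_diff_distrib
      by (intro Bochner_Integration.integral_diff sqint_mult_integrable g test_fun_sqint[OF \<phi>])
    then show "(\<integral>x. (g x - g' x) * \<phi> x \<partial>dom_measure) = 0"
      using assms[unfolded has_weak_partial_def, THEN conjunct2, rule_format, OF \<phi>] by simp
  qed
  then show ?thesis by simp
qed

lemma has_weak_partial_lincomb: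
  assumes "f \<in> sqint dom_measure" "g \<in> sqint dom_measure"
    "has_weak_partial \<Omega> i f f'" "has_weak_partial \<Omega> i g g'"
  shows "has_weak_partial \<Omega> i (\<lambda>x. c * f x + d * g x) (\<lambda>x. c * f' x + d * g' x)"
proof -
  have f': "f' \<in> sqint dom_measure" "g' \<in> sqint dom_measure"
    using assms by (auto simp: has_weak_partial_def L2_eq_sqint)
  have int: "(\<integral>x. (c * p x + d * q x) * r x \<partial>dom_measure)
      = c * (\<integral>x. p x * r x \<partial>dom_measure) + d * (\<integral>x. q x * r x \<partial>dom_measure)"
    if "p \<in> sqint dom_measure" "q \<in> sqint dom_measure" "r \<in> sqint dom_measure" for p q r
    using sqint_mult_integrable[OF that(1,3)] sqint_mult_integrable[OF that(2,3)]
    by (simp add: distrib_right mult.assoc)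
  show ?thesis
    using assms sqint_lincomb[OF f', of c d]
    unfolding has_weak_partial_def L2_eq_sqint
    by (auto simp: int f' test_fun_sqint test_fun_partial_sqint)
qed

lemma H10_sqint: "f \<in> H10 \<Omega> \<Longrightarrow> f \<in> sqint dom_measure"
  by (auto simp: H10_def H1_def L2_eq_sqint)

lemma H10_weak_partial: "f \<in> H10 \<Omega> \<Longrightarrow> has_weak_partial \<Omega> i f (weak_partial \<Omega> i f)"
  using someI_ex[of "has_weak_partial \<Omega> i f"] by (auto simp: weak_partial_def H10_def H1_def)

lemma H10_weak_partial_sqint: "f \<in> H10 \<Omega> \<Longrightarrow> weak_partial \<Omega> i f \<in> sqint dom_measure"
  using H10_weak_partial by (auto simp: has_weak_partial_def L2_eq_sqint)

lemma H10_approx: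
  assumes "f \<in> H10 \<Omega>"
  obtains \<phi> where "\<And>n. test_fun \<Omega> (\<phi> n)"
    "(\<lambda>n::nat. \<integral>x. (f x - \<phi> n x)\<^sup>2 \<partial>dom_measure) \<longlonglongrightarrow> 0"
    "\<And>i. (\<lambda>n. \<integral>x. (weak_partial \<Omega> i f x - partial i (\<phi> n) x)\<^sup>2 \<partial>dom_measure) \<longlonglongrightarrow> 0"
proof -
  obtain \<phi> where \<phi>: "\<And>n::nat. test_fun \<Omega> (\<phi> n)"
    and lim: "(\<lambda>n. (\<integral>x. (f x - \<phi> n x)\<^sup>2 \<partial>dom_measure) +
      (\<Sum>i\<in>UNIV. \<integral>x. (weak_partial \<Omega> i f x - partial i (\<phi> n) x)\<^sup>2 \<partial>dom_measure)) \<longlonglongrightarrow> 0"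
    using assms unfolding H10_def by blast
  have s: "0 \<le> (\<Sum>i\<in>UNIV. \<integral>x. (weak_partial \<Omega> i f x - partial i (\<phi> n) x)\<^sup>2 \<partial>dom_measure)" for n
    by (intro sum_nonneg) simp
  have 1: "(\<lambda>n. \<integral>x. (f x - \<phi> n x)\<^sup>2 \<partial>dom_measure) \<longlonglongrightarrow> 0"
    by (rule tendsto_sandwich[OF _ _ tendsto_const lim]) (use s in auto)
  have 2: "(\<lambda>n. \<integral>x. (weak_partial \<Omega> i f x - partial i (\<phi> n) x)\<^sup>2 \<partial>dom_measure) \<longlonglongrightarrow> 0" for i
  proof (rule tendsto_sandwich[OF _ _ tendsto_const lim])
    have "(\<integral>x. (weak_partial \<Omega> i f x - partial i (\<phi> n) x)\<^sup>2 \<partial>dom_measure)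
      \<le> (\<Sum>i\<in>UNIV. \<integral>x. (weak_partial \<Omega> i f x - partial i (\<phi> n) x)\<^sup>2 \<partial>dom_measure)" for n
      by (rule member_le_sum) auto
    moreover have "0 \<le> (\<integral>x. (f x - \<phi> n x)\<^sup>2 \<partial>dom_measure)" for n by simp
    ultimately show "\<forall>\<^sub>F n in sequentially. (\<integral>x. (weak_partial \<Omega> i f x - partial i (\<phi> n) x)\<^sup>2 \<partial>dom_measure)
      \<le> (\<integral>x. (f x - \<phi> n x)\<^sup>2 \<partial>dom_measure) +
      (\<Sum>i\<in>UNIV. \<integral>x. (weak_partial \<Omega> i f x - partial i (\<phi> n) x)\<^sup>2 \<partial>dom_measure)"
      by (intro always_eventually allI add_increasing)
  qed auto
  show ?thesis using that \<phi> 1 2 by blast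
qed

text \<open>The function h is tied to the combination only almost everywhere, since it will be
  \<open>weak_partial\<close> of a combination, which is a chosen representative.\<close>

lemma lincomb_sq_tendsto_0:
  fixes f g :: "real^3 \<Rightarrow> real"
  assumes f: "f \<in> sqint dom_measure" "\<And>n. \<phi> n \<in> sqint dom_measure"
    "(\<lambda>n::nat. \<integral>x. (f x - \<phi> n x)\<^sup>2 \<partial>dom_measure) \<longlonglongrightarrow> 0"
    and g: "g \<in> sqint dom_measure" "\<And>n. \<psi> n \<in> sqint dom_measure"
    "(\<lambda>n::nat. \<integral>x. (g x - \<psi> n x)\<^sup>2 \<partial>dom_measure) \<longlonglongrightarrow> 0"
    and h: "AE x in dom_measure. h x = c * f x + d * g x" "h \<in> sqint dom_measure"
  shows "(\<lambda>n. \<integral>x. (h x - (c * \<phi> n x + d * \<psi> n x))\<^sup>2 \<partial>dom_measure) \<longlonglongrightarrow> 0"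
proof (rule tendsto_sandwich[OF _ _ tendsto_const])
  let ?b = "\<lambda>n. 2 * c\<^sup>2 * (\<integral>x. (f x - \<phi> n x)\<^sup>2 \<partial>dom_measure) + 2 * d\<^sup>2 * (\<integral>x. (g x - \<psi> n x)\<^sup>2 \<partial>dom_measure)"
  have "(\<integral>x. (h x - (c * \<phi> n x + d * \<psi> n x))\<^sup>2 \<partial>dom_measure) \<le> ?b n" for n
  proof -
    have i: "integrable dom_measure (\<lambda>x. (f x - \<phi> n x)\<^sup>2)" "integrable dom_measure (\<lambda>x. (g x - \<psi> n x)\<^sup>2)"
      using f g by (auto intro!: sqint_integrable_real sqint_diff)
    have "(\<integral>x. (h x - (c * \<phi> n x + d * \<psi> n x))\<^sup>2 \<partial>dom_measure)
      \<le> (\<integral>x. 2 * c\<^sup>2 * (f x - \<phi> n x)\<^sup>2 + 2 * d\<^sup>2 * (g x - \<psi> n x)\<^sup>2 \<partial>dom_measure)"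
    proof (rule integral_mono_AE)
      show "integrable dom_measure (\<lambda>x. (h x - (c * \<phi> n x + d * \<psi> n x))\<^sup>2)"
        using sqint_lincomb[OF f(2) g(2), of c n d n] h(2)
        by (intro sqint_integrable_real sqint_diff) auto
      show "AE x in dom_measure. (h x - (c * \<phi> n x + d * \<psi> n x))\<^sup>2
          \<le> 2 * c\<^sup>2 * (f x - \<phi> n x)\<^sup>2 + 2 * d\<^sup>2 * (g x - \<psi> n x)\<^sup>2"
        using h(1)
      proof eventually_elim
        case (elim x)
        show ?case
          using norm_lincomb_sq_le[of c "f x - \<phi> n x" d "g x - \<psi> n x"] elim
          by (simp add: algebra_simps)
      qed
    qed (use i in simp)
    also have "\<dots> = ?b n" using i by simp
    finally show ?thesis .
  qed
  then show "\<forall>\<^sub>F n in sequentially. (\<integral>x. (h x - (c * \<phi> n x + d * \<psi> n x))\<^sup>2 \<partial>dom_measure) \<le> ?b n"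
    by simp
  have "?b \<longlonglongrightarrow> 2 * c\<^sup>2 * 0 + 2 * d\<^sup>2 * 0" by (intro tendsto_intros f g)
  then show "?b \<longlonglongrightarrow> 0" by simp
qed simp

lemma partial_lincomb:
  assumes "test_fun S \<phi>" "test_fun S \<psi>"
  shows "partial i (\<lambda>x. c * \<phi> x + d * \<psi> x) = (\<lambda>x. c * partial i \<phi> x + d * partial i \<psi> x)"
proof
  fix x
  have d: "(\<phi> has_derivative frechet_derivative \<phi> (at x)) (at x)" "(\<psi> has_derivative frechet_derivative \<psi> (at x)) (at x)"
    using assms test_fun_differentiable frechet_derivative_works by blast+
  have "((\<lambda>x. c * \<phi> x + d * \<psi> x) has_derivative
      (\<lambda>h. c * frechet_derivative \<phi> (at x) h + d * frechet_derivative \<psi> (at x) h)) (at x)"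
    by (intro derivative_intros d)
  from frechet_derivative_at[OF this, symmetric]
  show "partial i (\<lambda>x. c * \<phi> x + d * \<psi> x) x = c * partial i \<phi> x + d * partial i \<psi> x"
    by (simp add: partial_def)
qed

text \<open>Uniqueness of weak derivatives identifies the chosen derivative of the combination with
  the combination of the chosen ones. The same combination of approximating test functions then
  shows membership in the closure.\<close>

lemma H10_lincomb:
  assumes "f \<in> H10 \<Omega>" "g \<in> H10 \<Omega>"
  shows "(\<lambda>x. c * f x + d * g x) \<in> H10 \<Omega>"
    and "AE x in dom_measure. weak_partial \<Omega> i (\<lambda>x. c * f x + d * g x) x
      = c * weak_partial \<Omega> i f x + d * weak_partial \<Omega> i g x"
proof -
  let ?h = "\<lambda>x. c * f x + d * g x"
  note sq = H10_sqint[OF assms(1)] H10_sqint[OF assms(2)]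
  note wsq = H10_weak_partial_sqint[OF assms(1)] H10_weak_partial_sqint[OF assms(2)]
  have hsq: "?h \<in> sqint dom_measure" using sqint_lincomb[OF sq, of c d] by simp
  have wp: "has_weak_partial \<Omega> i ?h (\<lambda>x. c * weak_partial \<Omega> i f x + d * weak_partial \<Omega> i g x)" for i
    by (intro has_weak_partial_lincomb sq H10_weak_partial assms)
  have wh: "has_weak_partial \<Omega> i ?h (weak_partial \<Omega> i ?h)" for i
    using someI[of "has_weak_partial \<Omega> i ?h", OF wp] by (simp add: weak_partial_def)
  show ae: "AE x in dom_measure. weak_partial \<Omega> i ?h x = c * weak_partial \<Omega> i f x + d * weak_partial \<Omega> i g x" for i
    by (rule has_weak_partial_unique[OF wh wp])
  obtain \<phi> where \<phi>: "\<And>n. test_fun \<Omega> (\<phi> n)"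
    "(\<lambda>n::nat. \<integral>x. (f x - \<phi> n x)\<^sup>2 \<partial>dom_measure) \<longlonglongrightarrow> 0"
    "\<And>i. (\<lambda>n. \<integral>x. (weak_partial \<Omega> i f x - partial i (\<phi> n) x)\<^sup>2 \<partial>dom_measure) \<longlonglongrightarrow> 0"
    using H10_approx[OF assms(1)] by blast
  obtain \<psi> where \<psi>: "\<And>n. test_fun \<Omega> (\<psi> n)"
    "(\<lambda>n::nat. \<integral>x. (g x - \<psi> n x)\<^sup>2 \<partial>dom_measure) \<longlonglongrightarrow> 0"
    "\<And>i. (\<lambda>n. \<integral>x. (weak_partial \<Omega> i g x - partial i (\<psi> n) x)\<^sup>2 \<partial>dom_measure) \<longlonglongrightarrow> 0"
    using H10_approx[OF assms(2)] by blast
  have 1: "(\<lambda>n. \<integral>x. (?h x - (c * \<phi> n x + d * \<psi> n x))\<^sup>2 \<partial>dom_measure) \<longlonglongrightarrow> 0"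
    using hsq
    by (intro lincomb_sq_tendsto_0[OF sq(1) _ \<phi>(2) sq(2) _ \<psi>(2)] test_fun_sqint[OF \<phi>(1)] test_fun_sqint[OF \<psi>(1)])
      auto
  have 2: "(\<lambda>n. \<integral>x. (weak_partial \<Omega> i ?h x - partial i (\<lambda>x. c * \<phi> n x + d * \<psi> n x) x)\<^sup>2 \<partial>dom_measure) \<longlonglongrightarrow> 0" for i
    unfolding partial_lincomb[OF \<phi>(1) \<psi>(1)]
    using wh by (intro lincomb_sq_tendsto_0[OF wsq(1) _ \<phi>(3) wsq(2) _ \<psi>(3) ae] test_fun_partial_sqint)
      (use \<phi> \<psi> in \<open>auto simp: has_weak_partial_def L2_eq_sqint\<close>)
  have "(\<lambda>n. (\<integral>x. (?h x - (c * \<phi> n x + d * \<psi> n x))\<^sup>2 \<partial>dom_measure) +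
      (\<Sum>i\<in>UNIV. \<integral>x. (weak_partial \<Omega> i ?h x - partial i (\<lambda>x. c * \<phi> n x + d * \<psi> n x) x)\<^sup>2 \<partial>dom_measure))
    \<longlonglongrightarrow> 0 + (\<Sum>i\<in>(UNIV::3 set). 0)"
    by (intro tendsto_intros 1 2)
  then show "?h \<in> H10 \<Omega>"
    unfolding H10_def H1_def L2_eq_sqint using hsq wh test_fun_lincomb[OF \<phi>(1) \<psi>(1)]
    by (auto intro!: exI[of _ "\<lambda>n x. c * \<phi> n x + d * \<psi> n x"])
qed

subsection \<open>The inner products\<close>

lemma V_H10: "u \<in> V \<Omega> \<Longrightarrow> (\<lambda>x. u x $ j) \<in> H10 \<Omega>"
  by (simp add: V_def)

lemma V_sqint: "u \<in> V \<Omega> \<Longrightarrow> u \<in> sqint dom_measure"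
  by (intro sqint_vec H10_sqint V_H10)

lemma V_grad_sqint: "u \<in> V \<Omega> \<Longrightarrow> grad \<Omega> u \<in> sqint dom_measure"
  by (intro sqint_vec) (simp add: grad_def H10_weak_partial_sqint V_H10)

lemma V_lincomb:
  assumes "u \<in> V \<Omega>" "v \<in> V \<Omega>"
  shows "(\<lambda>x. c *\<^sub>R u x + d *\<^sub>R v x) \<in> V \<Omega>"
    and "AE x in dom_measure. grad \<Omega> (\<lambda>x. c *\<^sub>R u x + d *\<^sub>R v x) x = c *\<^sub>R grad \<Omega> u x + d *\<^sub>R grad \<Omega> v x"
proof -
  let ?h = "\<lambda>x. c *\<^sub>R u x + d *\<^sub>R v x"
  have "AE x in dom_measure. \<forall>i\<in>UNIV. \<forall>j\<in>UNIV. weak_partial \<Omega> i (\<lambda>y. ?h y $ j) x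
      = c * weak_partial \<Omega> i (\<lambda>y. u y $ j) x + d * weak_partial \<Omega> i (\<lambda>y. v y $ j) x"
    using H10_lincomb(2)[OF V_H10[OF assms(1)] V_H10[OF assms(2)]]
    by (intro AE_finite_allI) auto
  then show ae: "AE x in dom_measure. grad \<Omega> ?h x = c *\<^sub>R grad \<Omega> u x + d *\<^sub>R grad \<Omega> v x"
    by eventually_elim (simp add: grad_def vec_eq_iff)
  have div: "AE x in dom_measure. (\<Sum>i\<in>UNIV. grad \<Omega> u x $ i $ i) = 0"
    "AE x in dom_measure. (\<Sum>i\<in>UNIV. grad \<Omega> v x $ i $ i) = 0"
    using assms by (auto simp: V_def)
  have "AE x in dom_measure. (\<Sum>i\<in>UNIV. grad \<Omega> ?h x $ i $ i) = 0"
    using ae div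
  proof eventually_elim
    case (elim x)
    have "(\<Sum>i\<in>UNIV. grad \<Omega> ?h x $ i $ i)
      = c * (\<Sum>i\<in>UNIV. grad \<Omega> u x $ i $ i) + d * (\<Sum>i\<in>UNIV. grad \<Omega> v x $ i $ i)"
      by (simp add: elim(1) sum.distrib sum_distrib_left)
    then show ?case using elim by simp
  qed
  then show "?h \<in> V \<Omega>"
    unfolding V_def using H10_lincomb(1)[OF V_H10[OF assms(1)] V_H10[OF assms(2)]] by simp
qed

lemma V_diff: "u \<in> V \<Omega> \<Longrightarrow> v \<in> V \<Omega> \<Longrightarrow> u - v \<in> V \<Omega>"
  using V_lincomb(1)[of u v 1 "-1"] by (simp add: fun_diff_def)

lemma grad_diff:
  "u \<in> V \<Omega> \<Longrightarrow> v \<in> V \<Omega> \<Longrightarrow> AE x in dom_measure. grad \<Omega> (u - v) x = grad \<Omega> u x - grad \<Omega> v x"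
  using V_lincomb(2)[of u v 1 "-1"] by (simp add: fun_diff_def)

lemma ip_lincomb:
  assumes "u \<in> V \<Omega>" "v \<in> V \<Omega>" "w \<in> V \<Omega>"
  shows "ip \<Omega> (\<lambda>x. c *\<^sub>R u x + d *\<^sub>R v x) w = c * ip \<Omega> u w + d * ip \<Omega> v w"
  using sqint_inner_integrable[OF assms(1,3)[THEN V_sqint]] sqint_inner_integrable[OF assms(2,3)[THEN V_sqint]]
  by (simp add: ip_def inner_add_left)

lemma ip1_lincomb:
  assumes "u \<in> V \<Omega>" "v \<in> V \<Omega>" "w \<in> V \<Omega>"
  shows "ip1 \<Omega> (\<lambda>x. c *\<^sub>R u x + d *\<^sub>R v x) w = c * ip1 \<Omega> u w + d * ip1 \<Omega> v w"
proof -
  note i = sqint_inner_integrable[OF assms(1,3)[THEN V_grad_sqint]] sqint_inner_integrable[OF assms(2,3)[THEN V_grad_sqint]]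
  have [measurable]: "grad \<Omega> w \<in> borel_measurable dom_measure"
    "grad \<Omega> (\<lambda>x. c *\<^sub>R u x + d *\<^sub>R v x) \<in> borel_measurable dom_measure"
    using assms V_lincomb(1) by (auto intro!: sqint_measurable V_grad_sqint)
  have "ip1 \<Omega> (\<lambda>x. c *\<^sub>R u x + d *\<^sub>R v x) w
    = (\<integral>x. c * (grad \<Omega> u x \<bullet> grad \<Omega> w x) + d * (grad \<Omega> v x \<bullet> grad \<Omega> w x) \<partial>dom_measure)"
    unfolding ip1_def
  proof (rule integral_cong_AE)
    show "AE x in dom_measure. grad \<Omega> (\<lambda>x. c *\<^sub>R u x + d *\<^sub>R v x) x \<bullet> grad \<Omega> w x
       = c * (grad \<Omega> u x \<bullet> grad \<Omega> w x) + d * (grad \<Omega> v x \<bullet> grad \<Omega> w x)"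
      using V_lincomb(2)[OF assms(1,2), of c d] by eventually_elim (simp add: inner_add_left)
  qed (use i in auto)
  also have "\<dots> = c * ip1 \<Omega> u w + d * ip1 \<Omega> v w" using i by (simp add: ip1_def)
  finally show ?thesis .
qed

lemma ip_commute: "ip \<Omega> u v = ip \<Omega> v u" by (simp add: ip_def inner_commute)
lemma ip1_commute: "ip1 \<Omega> u v = ip1 \<Omega> v u" by (simp add: ip1_def inner_commute)
lemma ip_nonneg: "0 \<le> ip \<Omega> u u" by (simp add: ip_def)
lemma ip1_nonneg: "0 \<le> ip1 \<Omega> u u" by (simp add: ip1_def)
lemma norm0_nonneg: "0 \<le> norm0 \<Omega> u" by (simp add: norm0_def ip_nonneg)
lemma norm1_nonneg: "0 \<le> norm1 \<Omega> u" by (simp add: norm1_def ip1_nonneg)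
lemma norm0_power2: "(norm0 \<Omega> u)\<^sup>2 = ip \<Omega> u u" by (simp add: norm0_def ip_nonneg)
lemma norm1_power2: "(norm1 \<Omega> u)\<^sup>2 = ip1 \<Omega> u u" by (simp add: norm1_def ip1_nonneg)

lemma ip_Cauchy_Schwarz: "u \<in> V \<Omega> \<Longrightarrow> v \<in> V \<Omega> \<Longrightarrow> \<bar>ip \<Omega> u v\<bar> \<le> norm0 \<Omega> u * norm0 \<Omega> v"
  using sqint_inner_Cauchy_Schwarz[OF V_sqint V_sqint] by (simp add: ip_def norm0_def power2_norm_eq_inner)

lemma ip1_Cauchy_Schwarz: "u \<in> V \<Omega> \<Longrightarrow> v \<in> V \<Omega> \<Longrightarrow> \<bar>ip1 \<Omega> u v\<bar> \<le> norm1 \<Omega> u * norm1 \<Omega> v"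
  using sqint_inner_Cauchy_Schwarz[OF V_grad_sqint V_grad_sqint]
  by (simp add: ip1_def norm1_def power2_norm_eq_inner)

lemma ip1_diff: "u \<in> V \<Omega> \<Longrightarrow> v \<in> V \<Omega> \<Longrightarrow> w \<in> V \<Omega> \<Longrightarrow> ip1 \<Omega> (u - v) w = ip1 \<Omega> u w - ip1 \<Omega> v w"
  using ip1_lincomb[of u v w 1 "-1"] by (simp add: fun_diff_def)

end

section \<open>Poincare inequality and control of the L4 norm by the gradient\<close>

section \<open>Sobolev inequalities\<close>

text \<open>The derivative of f^2 is 2 f f', and f vanishes far to the left, so f(x)^2 is an
  integral of 2 f f' ending at x. The bound by an extended integral over the whole line no longer
  depends on x and is ready for Tonelli.\<close>

lemma sq_le_nn_integral_derivative:
  fixes f f' :: "real \<Rightarrow> real"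
  assumes der: "\<And>t. (f has_real_derivative f' t) (at t)" and cont: "continuous_on UNIV f'"
    and supp: "\<And>t. R < \<bar>t\<bar> \<Longrightarrow> f t = 0"
  shows "ennreal ((f x)\<^sup>2) \<le> (\<integral>\<^sup>+t. ennreal (2 * \<bar>f t * f' t\<bar>) \<partial>lborel)"
proof -
  \<comment> \<open>A starting point to the left of the region where f can be nonzero, and not to
    the right of x.\<close>
  define a where "a = min x (- \<bar>R\<bar> - 1)"
  have "a \<le> x" "f a = 0" using supp[of a] by (auto simp: a_def)
  have cf: "isCont f t" "isCont f' t" for t
    using der[THEN DERIV_isCont] cont by (auto simp: continuous_on_eq_continuous_at)
  let ?g = "\<lambda>t. (2 * (f t * f' t)) * indicator {a..x} t"
  have "has_bochner_integral lborel ?g ((f x)\<^sup>2 - (f a)\<^sup>2)"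
    by (rule has_bochner_integral_FTC_Icc_real[OF \<open>a \<le> x\<close>])
      (use cf in \<open>auto intro!: derivative_eq_intros der continuous_intros simp: power2_eq_square\<close>)
  then have "integrable lborel ?g" "(\<integral>t. ?g t \<partial>lborel) = (f x)\<^sup>2"
    using \<open>f a = 0\<close> by (auto simp: has_bochner_integral_iff)
  then have "ennreal ((f x)\<^sup>2) \<le> (\<integral>\<^sup>+t. ennreal (norm (?g t)) \<partial>lborel)"
    using integral_norm_bound_ennreal[of lborel ?g] by (metis abs_of_nonneg real_norm_def zero_le_power2)
  also have "\<dots> \<le> (\<integral>\<^sup>+t. ennreal (2 * \<bar>f t * f' t\<bar>) \<partial>lborel)"
    by (intro nn_integral_mono ennreal_leI) (auto simp: indicator_def abs_mult)
  finally show ?thesis .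
qed

lemma ennreal_mult_le_sum_squares: "a * b \<le> a\<^sup>2 + (b::ennreal)\<^sup>2"
proof (cases "a \<le> b")
  case True
  then have "a * b \<le> b\<^sup>2" by (simp add: power2_eq_square mult_right_mono)
  then show ?thesis by (simp add: add_increasing)
next
  case False
  then have "a * b \<le> a\<^sup>2" by (simp add: power2_eq_square mult_left_mono)
  then show ?thesis by (simp add: add_increasing2)
qed

text \<open>Points of three-dimensional space are written as \<open>(z, (x, y))\<close>.\<close>

lemma ladyzhenskaya_prod:
  fixes f f1 f2 f3 :: "real \<times> real \<times> real \<Rightarrow> real"
  assumes [measurable]: "f \<in> borel_measurable borel" "f1 \<in> borel_measurable borel"
    "f2 \<in> borel_measurable borel" "f3 \<in> borel_measurable borel"
  assumes 1: "\<And>x y z. ennreal ((f (z, x, y))\<^sup>2) \<le> (\<integral>\<^sup>+x. ennreal (2 * \<bar>f (z, x, y) * f1 (z, x, y)\<bar>) \<partial>lborel)"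
    and 2: "\<And>x y z. ennreal ((f (z, x, y))\<^sup>2) \<le> (\<integral>\<^sup>+y. ennreal (2 * \<bar>f (z, x, y) * f2 (z, x, y)\<bar>) \<partial>lborel)"
    and 3: "\<And>x y z. ennreal ((f (z, x, y))\<^sup>2) \<le> (\<integral>\<^sup>+z. ennreal (2 * \<bar>f (z, x, y) * f3 (z, x, y)\<bar>) \<partial>lborel)"
  shows "(\<integral>\<^sup>+p. ennreal ((f p) ^ 4) \<partial>lborel) \<le>
    4 * (\<integral>\<^sup>+p. ennreal (2 * \<bar>f p * f3 p\<bar>) \<partial>lborel) * (\<integral>\<^sup>+p. ennreal ((f1 p)\<^sup>2 + (f2 p)\<^sup>2) \<partial>lborel)"
proof -
  define c where "c = (\<integral>\<^sup>+p. ennreal (2 * \<bar>f p * f3 p\<bar>) \<partial>lborel)"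
  define S where "S z = (\<integral>\<^sup>+q. ennreal ((f (z, q))\<^sup>2) \<partial>lborel)" for z
  define P where "P z = (\<integral>\<^sup>+q. ennreal ((f1 (z, q))\<^sup>2) \<partial>lborel)" for z
  define Q where "Q z = (\<integral>\<^sup>+q. ennreal ((f2 (z, q))\<^sup>2) \<partial>lborel)" for z
  have fst_int: "(\<integral>\<^sup>+p. g p \<partial>lborel) = (\<integral>\<^sup>+z. \<integral>\<^sup>+q. g (z, q) \<partial>lborel \<partial>lborel)"
    if "g \<in> borel_measurable borel" for g :: "real \<times> real \<times> real \<Rightarrow> ennreal"
    using that by (subst lborel_prod[symmetric], subst lborel.nn_integral_fst) (auto simp: lborel_prod)
  have snd_int: "(\<integral>\<^sup>+p. g p \<partial>lborel) = (\<integral>\<^sup>+q. \<integral>\<^sup>+z. g (z, q) \<partial>lborel \<partial>lborel)"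
    if "g \<in> borel_measurable borel" for g :: "real \<times> real \<times> real \<Rightarrow> ennreal"
    using that by (subst lborel_prod[symmetric], subst lborel_pair.nn_integral_snd) (auto simp: lborel_prod)
  have fst_int2: "(\<integral>\<^sup>+q. g q \<partial>lborel) = (\<integral>\<^sup>+x. \<integral>\<^sup>+y. g (x, y) \<partial>lborel \<partial>lborel)"
    if "g \<in> borel_measurable borel" for g :: "real \<times> real \<Rightarrow> ennreal"
    using that by (subst lborel_prod[symmetric], subst lborel.nn_integral_fst) (auto simp: lborel_prod)
  have snd_int2: "(\<integral>\<^sup>+q. g q \<partial>lborel) = (\<integral>\<^sup>+y. \<integral>\<^sup>+x. g (x, y) \<partial>lborel \<partial>lborel)"
    if "g \<in> borel_measurable borel" for g :: "real \<times> real \<Rightarrow> ennreal"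
    using that by (subst lborel_prod[symmetric], subst lborel_pair.nn_integral_snd) (auto simp: lborel_prod)
  \<comment> \<open>Using the line bound in the direction of z makes the L2 norm of f on a
    horizontal slice bounded uniformly in z.\<close>
  have S_le: "S z \<le> c" for z
  proof -
    have "S z \<le> (\<integral>\<^sup>+q. \<integral>\<^sup>+z. ennreal (2 * \<bar>f (z, q) * f3 (z, q)\<bar>) \<partial>lborel \<partial>lborel)"
      unfolding S_def by (intro nn_integral_mono) (use 3 in \<open>auto split: prod.splits\<close>)
    also have "\<dots> = c" unfolding c_def by (intro snd_int[symmetric]) measurable
    finally show ?thesis .
  qed
  have CS: "(\<integral>\<^sup>+q. ennreal (2 * \<bar>f (z, q) * g (z, q)\<bar>) \<partial>lborel)\<^sup>2 \<le> 4 * c * (\<integral>\<^sup>+q. ennreal ((g (z, q))\<^sup>2) \<partial>lborel)"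
    if [measurable]: "g \<in> borel_measurable borel" for g :: "real \<times> real \<times> real \<Rightarrow> real" and z
  proof -
    have "(\<integral>\<^sup>+q. ennreal (2 * \<bar>f (z, q) * g (z, q)\<bar>) \<partial>lborel)
        = (\<integral>\<^sup>+q. ennreal (2 * \<bar>f (z, q)\<bar>) * ennreal \<bar>g (z, q)\<bar> \<partial>lborel)"
      by (intro nn_integral_cong) (simp add: abs_mult ennreal_mult[symmetric] mult.assoc)
    then have "(\<integral>\<^sup>+q. ennreal (2 * \<bar>f (z, q) * g (z, q)\<bar>) \<partial>lborel)\<^sup>2
       \<le> (\<integral>\<^sup>+q. (ennreal (2 * \<bar>f (z, q)\<bar>))\<^sup>2 \<partial>lborel) * (\<integral>\<^sup>+q. (ennreal \<bar>g (z, q)\<bar>)\<^sup>2 \<partial>lborel)"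
      using Cauchy_Schwarz_nn_integral[of "\<lambda>q. ennreal (2 * \<bar>f (z, q)\<bar>)" lborel "\<lambda>q. ennreal \<bar>g (z, q)\<bar>"]
      by simp
    also have "(\<integral>\<^sup>+q. (ennreal (2 * \<bar>f (z, q)\<bar>))\<^sup>2 \<partial>lborel) = (\<integral>\<^sup>+q. 4 * ennreal ((f (z, q))\<^sup>2) \<partial>lborel)"
      by (intro nn_integral_cong) (simp add: ennreal_power power_mult_distrib ennreal_mult')
    also have "\<dots> = 4 * S z" unfolding S_def by (intro nn_integral_cmult) measurable
    also have "(\<integral>\<^sup>+q. (ennreal \<bar>g (z, q)\<bar>)\<^sup>2 \<partial>lborel) = (\<integral>\<^sup>+q. ennreal ((g (z, q))\<^sup>2) \<partial>lborel)"
      by (intro nn_integral_cong) (simp add: ennreal_power)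
    finally show ?thesis
      using S_le[of z] by (meson mult_left_mono mult_right_mono order_trans zero_le)
  qed
  \<comment> \<open>The planar argument: f^4 = f^2 f^2, where one factor is bounded by a function of
    x alone and the other by a function of y alone, so that the double integral factorises.\<close>
  have slice: "(\<integral>\<^sup>+q. ennreal ((f (z, q)) ^ 4) \<partial>lborel) \<le> 4 * c * (P z + Q z)" for z
  proof -
    define a where "a = (\<integral>\<^sup>+q. ennreal (2 * \<bar>f (z, q) * f1 (z, q)\<bar>) \<partial>lborel)"
    define b where "b = (\<integral>\<^sup>+q. ennreal (2 * \<bar>f (z, q) * f2 (z, q)\<bar>) \<partial>lborel)"
    define A where "A y = (\<integral>\<^sup>+x. ennreal (2 * \<bar>f (z, x, y) * f1 (z, x, y)\<bar>) \<partial>lborel)" for y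
    define B where "B x = (\<integral>\<^sup>+y. ennreal (2 * \<bar>f (z, x, y) * f2 (z, x, y)\<bar>) \<partial>lborel)" for x
    have [measurable]: "A \<in> borel_measurable borel" "B \<in> borel_measurable borel"
      unfolding A_def B_def by measurable
    have "(\<integral>\<^sup>+q. ennreal ((f (z, q)) ^ 4) \<partial>lborel) = (\<integral>\<^sup>+x. \<integral>\<^sup>+y. ennreal ((f (z, x, y)) ^ 4) \<partial>lborel \<partial>lborel)"
      by (intro fst_int2) measurable
    also have "\<dots> \<le> (\<integral>\<^sup>+x. \<integral>\<^sup>+y. B x * A y \<partial>lborel \<partial>lborel)"
    proof (intro nn_integral_mono)
      fix x y
      have "ennreal ((f (z, x, y)) ^ 4) = ennreal ((f (z, x, y))\<^sup>2) * ennreal ((f (z, x, y))\<^sup>2)"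
        by (simp add: ennreal_mult[symmetric] power2_eq_square power4_eq_xxxx mult.assoc)
      also have "\<dots> \<le> B x * A y" unfolding A_def B_def by (intro mult_mono 1 2) auto
      finally show "ennreal ((f (z, x, y)) ^ 4) \<le> B x * A y" .
    qed
    also have "\<dots> = (\<integral>\<^sup>+x. B x \<partial>lborel) * (\<integral>\<^sup>+y. A y \<partial>lborel)"
      by (simp add: nn_integral_cmult nn_integral_multc)
    also have "(\<integral>\<^sup>+x. B x \<partial>lborel) = b"
      unfolding b_def B_def by (intro fst_int2[symmetric]) measurable
    also have "(\<integral>\<^sup>+y. A y \<partial>lborel) = a"
      unfolding a_def A_def by (intro snd_int2[symmetric]) measurable
    \<comment> \<open>Trading the product for a sum of squares makes the slice bound linear in P and
      Q, so integration over z produces the full gradient integrals.\<close>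
    also have "b * a \<le> b\<^sup>2 + a\<^sup>2" by (rule ennreal_mult_le_sum_squares)
    also have "\<dots> \<le> 4 * c * Q z + 4 * c * P z"
      unfolding a_def b_def P_def Q_def by (intro add_mono CS) measurable
    also have "\<dots> = 4 * c * (P z + Q z)" by (simp add: distrib_left add.commute)
    finally show ?thesis .
  qed
  have [measurable]: "P \<in> borel_measurable borel" "Q \<in> borel_measurable borel"
    unfolding P_def Q_def by measurable
  have "(\<integral>\<^sup>+p. ennreal ((f p) ^ 4) \<partial>lborel) = (\<integral>\<^sup>+z. \<integral>\<^sup>+q. ennreal ((f (z, q)) ^ 4) \<partial>lborel \<partial>lborel)"
    by (intro fst_int) measurable
  also have "\<dots> \<le> (\<integral>\<^sup>+z. 4 * c * (P z + Q z) \<partial>lborel)"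
    by (intro nn_integral_mono slice)
  also have "\<dots> = 4 * c * (\<integral>\<^sup>+z. (P z + Q z) \<partial>lborel)"
    by (intro nn_integral_cmult) measurable
  also have "(\<integral>\<^sup>+z. (P z + Q z) \<partial>lborel) = (\<integral>\<^sup>+z. \<integral>\<^sup>+q. ennreal ((f1 (z, q))\<^sup>2 + (f2 (z, q))\<^sup>2) \<partial>lborel \<partial>lborel)"
    unfolding P_def Q_def by (intro nn_integral_cong) (simp add: nn_integral_add ennreal_plus)
  also have "\<dots> = (\<integral>\<^sup>+p. ennreal ((f1 p)\<^sup>2 + (f2 p)\<^sup>2) \<partial>lborel)"
    by (intro fst_int[symmetric]) measurable
  finally show ?thesis unfolding c_def .
qed

text \<open>The line bound for f^2 does not depend on x, so integrating it over |x| \<le> R costs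
  only the length 2 R. The factor f on the right is removed later by Young's inequality.\<close>

lemma poincare_prod:
  fixes f f1 :: "real \<times> real \<times> real \<Rightarrow> real"
  assumes [measurable]: "f \<in> borel_measurable borel" "f1 \<in> borel_measurable borel"
  assumes 1: "\<And>x y z. ennreal ((f (z, x, y))\<^sup>2) \<le> (\<integral>\<^sup>+x. ennreal (2 * \<bar>f (z, x, y) * f1 (z, x, y)\<bar>) \<partial>lborel)"
    and supp: "\<And>x y z. R < \<bar>x\<bar> \<Longrightarrow> f (z, x, y) = 0" and "0 \<le> R"
  shows "(\<integral>\<^sup>+p. ennreal ((f p)\<^sup>2) \<partial>lborel) \<le> ennreal (2 * R) * (\<integral>\<^sup>+p. ennreal (2 * \<bar>f p * f1 p\<bar>) \<partial>lborel)"
proof -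
  have int: "(\<integral>\<^sup>+p. g p \<partial>lborel) = (\<integral>\<^sup>+z. \<integral>\<^sup>+y. \<integral>\<^sup>+x. g (z, x, y) \<partial>lborel \<partial>lborel \<partial>lborel)"
    if [measurable]: "g \<in> borel_measurable borel" for g :: "real \<times> real \<times> real \<Rightarrow> ennreal"
  proof -
    have "(\<integral>\<^sup>+p. g p \<partial>lborel) = (\<integral>\<^sup>+z. \<integral>\<^sup>+q. g (z, q) \<partial>lborel \<partial>lborel)"
      using that by (subst lborel_prod[symmetric], subst lborel.nn_integral_fst) (auto simp: lborel_prod)
    also have "\<dots> = (\<integral>\<^sup>+z. \<integral>\<^sup>+y. \<integral>\<^sup>+x. g (z, x, y) \<partial>lborel \<partial>lborel \<partial>lborel)"
      by (intro nn_integral_cong, subst lborel_prod[symmetric], subst lborel_pair.nn_integral_snd) (auto simp: lborel_prod)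
    finally show ?thesis .
  qed
  have "(\<integral>\<^sup>+p. ennreal ((f p)\<^sup>2) \<partial>lborel) = (\<integral>\<^sup>+z. \<integral>\<^sup>+y. \<integral>\<^sup>+x. ennreal ((f (z, x, y))\<^sup>2) \<partial>lborel \<partial>lborel \<partial>lborel)"
    by (intro int) measurable
  also have "\<dots> \<le> (\<integral>\<^sup>+z. \<integral>\<^sup>+y. ennreal (2 * R) * (\<integral>\<^sup>+x. ennreal (2 * \<bar>f (z, x, y) * f1 (z, x, y)\<bar>) \<partial>lborel) \<partial>lborel \<partial>lborel)"
  proof (intro nn_integral_mono)
    fix z y
    let ?I = "\<integral>\<^sup>+x. ennreal (2 * \<bar>f (z, x, y) * f1 (z, x, y)\<bar>) \<partial>lborel"
    have "(\<integral>\<^sup>+x. ennreal ((f (z, x, y))\<^sup>2) \<partial>lborel) \<le> (\<integral>\<^sup>+x. ?I * indicator {-R..R} x \<partial>lborel)"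
    proof (intro nn_integral_mono)
      fix x show "ennreal ((f (z, x, y))\<^sup>2) \<le> ?I * indicator {-R..R} x"
        using 1[of z x y] supp[of x z y] by (cases "R < \<bar>x\<bar>") (auto simp: indicator_def abs_le_iff)
    qed
    also have "\<dots> = ennreal (2 * R) * ?I"
      using \<open>0 \<le> R\<close> by (subst nn_integral_cmult_indicator) (auto simp: mult.commute)
    finally show "(\<integral>\<^sup>+x. ennreal ((f (z, x, y))\<^sup>2) \<partial>lborel) \<le> ennreal (2 * R) * ?I" .
  qed
  also have "\<dots> = ennreal (2 * R) * (\<integral>\<^sup>+z. \<integral>\<^sup>+y. \<integral>\<^sup>+x. ennreal (2 * \<bar>f (z, x, y) * f1 (z, x, y)\<bar>) \<partial>lborel \<partial>lborel \<partial>lborel)"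
    by (simp add: nn_integral_cmult)
  also have "(\<integral>\<^sup>+z. \<integral>\<^sup>+y. \<integral>\<^sup>+x. ennreal (2 * \<bar>f (z, x, y) * f1 (z, x, y)\<bar>) \<partial>lborel \<partial>lborel \<partial>lborel)
    = (\<integral>\<^sup>+p. ennreal (2 * \<bar>f p * f1 p\<bar>) \<partial>lborel)"
    by (intro int[symmetric]) measurable
  finally show ?thesis .
qed

text \<open>The third coordinate comes first, so that the outer integral of the iterated product
  measure runs over z and the inner pair is the plane slice.\<close>

definition vec3 :: "real \<times> real \<times> real \<Rightarrow> real^3" where
  "vec3 p = vector [fst (snd p), snd (snd p), fst p]"

lemma vec3_nth: "vec3 (z, x, y) $ 1 = x" "vec3 (z, x, y) $ 2 = y" "vec3 (z, x, y) $ 3 = z"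
  by (simp_all add: vec3_def)

lemma vec3_eq: "vec3 p = axis 1 (fst (snd p)) + axis 2 (snd (snd p)) + axis 3 (fst p)"
  by (simp add: vec3_def vec_eq_iff forall_3 axis_def)

lemma vec3_continuous: "continuous_on UNIV vec3"
proof -
  have "continuous_on UNIV (\<lambda>p. if b then f p else 0)" if "continuous_on UNIV f"
    for b and f :: "real \<times> real \<times> real \<Rightarrow> real"
    using that by (cases b) auto
  note c = this
  show ?thesis
    unfolding vec3_eq[abs_def] axis_def by (intro continuous_intros c)
qed

lemma Basis_vec3: "(Basis :: (real^3) set) = {axis 1 1, axis 2 1, axis 3 1}"
  by (auto simp: Basis_vec_def UNIV_3)

lemma emeasure_lborel_Times:
  fixes A :: "'a::euclidean_space set" and B :: "'b::euclidean_space set"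
  assumes "A \<in> sets borel" "B \<in> sets borel"
  shows "emeasure lborel (A \<times> B) = emeasure lborel A * emeasure lborel B"
  using lborel.emeasure_pair_measure_Times[of A lborel B] assms by (simp add: lborel_prod)

text \<open>Lebesgue measure is determined by its values on boxes, and the preimage of a box under
  \<open>vec3\<close> is a product of three intervals.\<close>

lemma lborel_vec3: "(lborel :: (real^3) measure) = distr lborel borel vec3"
proof (rule lborel_eqI)
  have [measurable]: "vec3 \<in> borel_measurable borel"
    by (intro borel_measurable_continuous_onI vec3_continuous)
  fix l u :: "real^3" assume lu: "\<And>b. b \<in> Basis \<Longrightarrow> l \<bullet> b \<le> u \<bullet> b"
  have le: "l $ i \<le> u $ i" for i using lu[of "axis i 1"] by (simp add: inner_axis axis_in_Basis_iff)
  have pre: "vec3 -` box l u = {l$3<..<u$3} \<times> {l$1<..<u$1} \<times> {l$2<..<u$2}"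
    by (auto simp: box_def Basis_vec3 inner_axis vec3_nth)
  have "emeasure (distr lborel borel vec3) (box l u) = emeasure lborel ({l$3<..<u$3} \<times> {l$1<..<u$1} \<times> {l$2<..<u$2})"
    by (subst emeasure_distr) (auto simp: pre)
  also have "\<dots> = emeasure lborel {l$3<..<u$3} * (emeasure lborel {l$1<..<u$1} * emeasure lborel {l$2<..<u$2})"
    by (simp add: emeasure_lborel_Times borel_Times)
  also have "\<dots> = ennreal ((u$3 - l$3) * ((u$1 - l$1) * (u$2 - l$2)))"
    using le by (simp add: ennreal_mult)
  also have "(u$3 - l$3) * ((u$1 - l$1) * (u$2 - l$2)) = (\<Prod>b\<in>Basis. (u - l) \<bullet> b)"
    by (simp add: Basis_vec3 axis_eq_axis inner_axis)
  finally show "emeasure (distr lborel borel vec3) (box l u) = (\<Prod>b\<in>Basis. (u - l) \<bullet> b)" by simp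
qed simp

lemma nn_integral_vec3:
  assumes [measurable]: "g \<in> borel_measurable borel"
  shows "(\<integral>\<^sup>+x. g x \<partial>(lborel :: (real^3) measure)) = (\<integral>\<^sup>+p. g (vec3 p) \<partial>lborel)"
proof -
  have [measurable]: "vec3 \<in> borel_measurable borel"
    by (intro borel_measurable_continuous_onI vec3_continuous)
  show ?thesis by (subst lborel_vec3, subst nn_integral_distr) auto
qed

lemma vec3_line_derivative:
  "((\<lambda>t. vec3 (z, t, y)) has_derivative (\<lambda>h. h *\<^sub>R axis 1 1)) (at t)"
  "((\<lambda>t. vec3 (z, x, t)) has_derivative (\<lambda>h. h *\<^sub>R axis 2 1)) (at t)"
  "((\<lambda>t. vec3 (t, x, y)) has_derivative (\<lambda>h. h *\<^sub>R axis 3 1)) (at t)"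
proof -
  have "bounded_linear (axis i :: real \<Rightarrow> real^3)" for i
    unfolding linear_conv_bounded_linear[symmetric]
    by (rule linearI) (auto simp: vec_eq_iff axis_def)
  then have a: "(axis i has_derivative (axis i :: real \<Rightarrow> real^3)) (at t)" for i
    by (rule bounded_linear_imp_has_derivative)
  have e: "(axis i :: real \<Rightarrow> real^3) = (\<lambda>h. h *\<^sub>R axis i 1)" for i
    by (simp add: fun_eq_iff vec_eq_iff axis_def)
  show "((\<lambda>t. vec3 (z, t, y)) has_derivative (\<lambda>h. h *\<^sub>R axis 1 1)) (at t)"
    using has_derivative_add[OF has_derivative_add[OF a[of 1] has_derivative_const[of "axis 2 y"]]
        has_derivative_const[of "axis 3 z"]]
    by (simp add: vec3_eq e[symmetric])
  show "((\<lambda>t. vec3 (z, x, t)) has_derivative (\<lambda>h. h *\<^sub>R axis 2 1)) (at t)"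
    using has_derivative_add[OF has_derivative_add[OF has_derivative_const[of "axis 1 x"] a[of 2]]
        has_derivative_const[of "axis 3 z"]]
    by (simp add: vec3_eq e[symmetric])
  show "((\<lambda>t. vec3 (t, x, y)) has_derivative (\<lambda>h. h *\<^sub>R axis 3 1)) (at t)"
    using has_derivative_add[OF has_derivative_const[of "axis 1 x + axis 2 y"] a[of 3]]
    by (simp add: vec3_eq e[symmetric])
qed

lemma test_fun_line_derivative:
  assumes "test_fun S \<phi>" "(l has_derivative (\<lambda>h. h *\<^sub>R axis i 1)) (at t)"
  shows "((\<lambda>t. \<phi> (l t)) has_real_derivative partial i \<phi> (l t)) (at t)"
proof -
  have d: "(\<phi> has_derivative frechet_derivative \<phi> (at (l t))) (at (l t))"
    using test_fun_differentiable[OF assms(1)] frechet_derivative_works by blast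
  have lin: "frechet_derivative \<phi> (at (l t)) (h *\<^sub>R axis i 1) = partial i \<phi> (l t) * h" for h
    using linear_cmul[OF has_derivative_linear[OF d], of h] by (simp add: partial_def mult.commute)
  show ?thesis
    using has_derivative_compose[OF assms(2) d] by (simp add: has_field_derivative_def lin mult_commute_abs)
qed

lemma partial_continuous: "test_fun S \<phi> \<Longrightarrow> continuous_on UNIV (partial i \<phi>)"
  using test_fun_continuous_derivative[of S \<phi> "axis i 1"]
  by (simp add: partial_def[abs_def] axis_in_Basis_iff)

context bounded_open
begin

text \<open>The passage between extended integrals over the whole space, to which Tonelli applies,
  and the Bochner integrals over \<Omega> in the definitions of the norms.\<close>

lemma nn_integral_dom:
  fixes g :: "real^3 \<Rightarrow> real"
  assumes "g \<in> borel_measurable borel" "\<And>x. 0 \<le> g x" "\<And>x. x \<notin> \<Omega> \<Longrightarrow> g x = 0"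
    and int: "integrable dom_measure g"
  shows "(\<integral>\<^sup>+x. ennreal (g x) \<partial>lborel) = ennreal (\<integral>x. g x \<partial>dom_measure)"
proof -
  have "(\<integral>\<^sup>+x. ennreal (g x) \<partial>lborel) = (\<integral>\<^sup>+x. ennreal (g x) \<partial>lebesgue)"
    by (simp add: nn_integral_completion)
  also have "\<dots> = (\<integral>\<^sup>+x. ennreal (g x) * indicator \<Omega> x \<partial>lebesgue)"
    using assms(3) by (intro nn_integral_cong) (auto simp: indicator_def)
  also have "\<dots> = (\<integral>\<^sup>+x. ennreal (g x) \<partial>dom_measure)"
    using open_dom by (subst nn_integral_restrict_space) auto
  also have "\<dots> = ennreal (\<integral>x. g x \<partial>dom_measure)"
    using assms(2) by (intro nn_integral_eq_integral[OF int]) auto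
  finally show ?thesis .
qed

definition dirichlet :: "(real^3 \<Rightarrow> real) \<Rightarrow> real" where
  "dirichlet \<phi> = (\<Sum>i\<in>UNIV. \<integral>x. (partial i \<phi> x)\<^sup>2 \<partial>dom_measure)"

lemma partial_le_dirichlet: "(\<integral>x. (partial i \<phi> x)\<^sup>2 \<partial>dom_measure) \<le> dirichlet \<phi>"
  unfolding dirichlet_def by (rule member_le_sum) auto

lemma dirichlet_nonneg: "0 \<le> dirichlet \<phi>"
  unfolding dirichlet_def by (intro sum_nonneg) simp

text \<open>Here R is the radius of a ball about 0 containing \<Omega>. Absorbing \<phi> in
  \<open>poincare_prod\<close> gives the constant 16 R^2; with it, one factor in
  \<open>ladyzhenskaya_prod\<close> is at most (16 R^2 + 1) times the Dirichlet integral and the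
  other at most the Dirichlet integral.\<close>

lemma test_fun_inequalities:
  obtains C where "C > 0"
    "\<And>\<phi>. test_fun \<Omega> \<phi> \<Longrightarrow> (\<integral>x. (\<phi> x)\<^sup>2 \<partial>dom_measure) \<le> C * dirichlet \<phi>"
    "\<And>\<phi>. test_fun \<Omega> \<phi> \<Longrightarrow> (\<integral>x. (\<phi> x) ^ 4 \<partial>dom_measure) \<le> C * (dirichlet \<phi>)\<^sup>2"
proof -
  obtain R where R: "0 < R" "\<And>x. x \<in> \<Omega> \<Longrightarrow> norm x \<le> R"
    using bounded_dom by (auto simp: bounded_pos)
  have main: "(\<integral>x. (\<phi> x)\<^sup>2 \<partial>dom_measure) \<le> 16 * R\<^sup>2 * dirichlet \<phi> \<and>
    (\<integral>x. (\<phi> x) ^ 4 \<partial>dom_measure) \<le> 4 * (16 * R\<^sup>2 + 1) * (dirichlet \<phi>)\<^sup>2"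
    if \<phi>: "test_fun \<Omega> \<phi>" for \<phi>
  proof -
    define f where "f p = \<phi> (vec3 p)" for p
    define f' where "f' i p = partial i \<phi> (vec3 p)" for i p
    have v: "vec3 \<in> borel_measurable borel"
      by (intro borel_measurable_continuous_onI vec3_continuous)
    have m\<phi>[measurable]: "\<phi> \<in> borel_measurable borel" "partial i \<phi> \<in> borel_measurable borel" for i
      using \<phi> by (auto intro!: borel_measurable_continuous_onI test_fun_continuous partial_continuous)
    have [measurable]: "f \<in> borel_measurable borel" "f' i \<in> borel_measurable borel" for i
      unfolding f_def[abs_def] f'_def[abs_def] using v by measurable
    have sq: "\<phi> \<in> sqint dom_measure" "partial i \<phi> \<in> sqint dom_measure" for i
      using test_fun_sqint[OF \<phi>] test_fun_partial_sqint[OF \<phi>] by auto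
    have out: "x \<notin> \<Omega> \<Longrightarrow> \<phi> x = 0" "x \<notin> \<Omega> \<Longrightarrow> partial i \<phi> x = 0" for x i
      using test_fun_eq_0[OF \<phi>] test_fun_derivative_eq_0[OF \<phi>, of x] \<phi>
      by (auto simp: test_fun_def partial_def)
    have big: "\<phi> x = 0" if "R < \<bar>x $ i\<bar>" for x i
      using R(2)[of x] component_le_norm_cart[of x i] out(1)[of x] that by fastforce
    have big3: "R < \<bar>x\<bar> \<or> R < \<bar>y\<bar> \<or> R < \<bar>z\<bar> \<Longrightarrow> \<phi> (vec3 (z, x, y)) = 0" for x y z
      using big[of "vec3 (z, x, y)" 1] big[of "vec3 (z, x, y)" 2] big[of "vec3 (z, x, y)" 3] unfolding vec3_nth by blast
    have cl: "continuous_on UNIV (\<lambda>t. partial i \<phi> (l t))" if "\<And>t. (l has_derivative (\<lambda>h. h *\<^sub>R axis j 1)) (at t)"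
      for i j and l :: "real \<Rightarrow> real^3"
      by (rule continuous_on_compose2[OF partial_continuous[OF \<phi>]])
        (use has_derivative_continuous[OF that] in \<open>auto intro!: continuous_at_imp_continuous_on\<close>)
    have 1: "ennreal ((f (z, x, y))\<^sup>2) \<le> (\<integral>\<^sup>+x. ennreal (2 * \<bar>f (z, x, y) * f' 1 (z, x, y)\<bar>) \<partial>lborel)" for x y z
      unfolding f_def f'_def
      by (rule sq_le_nn_integral_derivative[OF test_fun_line_derivative[OF \<phi> vec3_line_derivative(1)]
            cl[OF vec3_line_derivative(1)], of R])
        (rule big3, simp)
    have 2: "ennreal ((f (z, x, y))\<^sup>2) \<le> (\<integral>\<^sup>+y. ennreal (2 * \<bar>f (z, x, y) * f' 2 (z, x, y)\<bar>) \<partial>lborel)" for x y z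
      unfolding f_def f'_def
      by (rule sq_le_nn_integral_derivative[OF test_fun_line_derivative[OF \<phi> vec3_line_derivative(2)]
            cl[OF vec3_line_derivative(2)], of R])
        (rule big3, simp)
    have 3: "ennreal ((f (z, x, y))\<^sup>2) \<le> (\<integral>\<^sup>+z. ennreal (2 * \<bar>f (z, x, y) * f' 3 (z, x, y)\<bar>) \<partial>lborel)" for x y z
      unfolding f_def f'_def
      by (rule sq_le_nn_integral_derivative[OF test_fun_line_derivative[OF \<phi> vec3_line_derivative(3)]
            cl[OF vec3_line_derivative(3)], of R])
        (rule big3, simp)
    have supp: "f (z, x, y) = 0" if "R < \<bar>x\<bar>" for x y z using big3 that by (simp add: f_def)
    have i2: "integrable dom_measure (\<lambda>x. (\<phi> x)\<^sup>2)" "integrable dom_measure (\<lambda>x. (partial i \<phi> x)\<^sup>2)" for i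
      using sq[THEN sqint_integrable_real] by auto
    have i11: "integrable dom_measure (\<lambda>x. 2 * \<bar>\<phi> x * partial i \<phi> x\<bar>)" for i
      using sqint_mult_integrable[OF sq] by auto
    have i4: "integrable dom_measure (\<lambda>x. (\<phi> x) ^ 4)"
      using sqint_mult_integrable[OF test_fun_sqint[OF test_fun_mult[OF \<phi> \<phi>]] test_fun_sqint[OF test_fun_mult[OF \<phi> \<phi>]]]
      by (simp add: power4_eq_xxxx mult.assoc)
    have N2: "(\<integral>\<^sup>+p. ennreal ((f p)\<^sup>2) \<partial>lborel) = ennreal (\<integral>x. (\<phi> x)\<^sup>2 \<partial>dom_measure)"
      unfolding f_def
      by (subst nn_integral_vec3[symmetric, of "\<lambda>x. ennreal ((\<phi> x)\<^sup>2)"], measurable, rule nn_integral_dom)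
        (use out i2 in auto)
    have N4: "(\<integral>\<^sup>+p. ennreal ((f p) ^ 4) \<partial>lborel) = ennreal (\<integral>x. (\<phi> x) ^ 4 \<partial>dom_measure)"
      unfolding f_def
      by (subst nn_integral_vec3[symmetric, of "\<lambda>x. ennreal ((\<phi> x) ^ 4)"], measurable, rule nn_integral_dom)
        (use out i4 in auto)
    have N11: "(\<integral>\<^sup>+p. ennreal (2 * \<bar>f p * f' i p\<bar>) \<partial>lborel)
        = ennreal (\<integral>x. 2 * \<bar>\<phi> x * partial i \<phi> x\<bar> \<partial>dom_measure)" for i
      unfolding f_def f'_def
      by (subst nn_integral_vec3[symmetric, of "\<lambda>x. ennreal (2 * \<bar>\<phi> x * partial i \<phi> x\<bar>)"], measurable, rule nn_integral_dom)
        (use out i11 in auto)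
    have ND: "(\<integral>\<^sup>+p. ennreal ((f' 1 p)\<^sup>2 + (f' 2 p)\<^sup>2) \<partial>lborel)
        = ennreal (\<integral>x. (partial 1 \<phi> x)\<^sup>2 + (partial 2 \<phi> x)\<^sup>2 \<partial>dom_measure)"
      unfolding f'_def
      by (subst nn_integral_vec3[symmetric, of "\<lambda>x. ennreal ((partial 1 \<phi> x)\<^sup>2 + (partial 2 \<phi> x)\<^sup>2)"], measurable, rule nn_integral_dom)
        (use out i2 in auto)
    have "ennreal (\<integral>x. (\<phi> x)\<^sup>2 \<partial>dom_measure)
        \<le> ennreal (2 * R) * ennreal (\<integral>x. 2 * \<bar>\<phi> x * partial 1 \<phi> x\<bar> \<partial>dom_measure)"
      unfolding N2[symmetric] N11[symmetric]
      by (rule poincare_prod[OF _ _ 1 supp]) (use R(1) in simp_all)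
    then have "(\<integral>x. (\<phi> x)\<^sup>2 \<partial>dom_measure) \<le> (2 * R) * (\<integral>x. 2 * \<bar>\<phi> x * partial 1 \<phi> x\<bar> \<partial>dom_measure)"
      using R(1) by (simp add: ennreal_mult[symmetric] ennreal_le_iff)
    also have "\<dots> = (\<integral>x. 4 * R * \<bar>\<phi> x * partial 1 \<phi> x\<bar> \<partial>dom_measure)" by simp
    \<comment> \<open>Young's inequality, weighted so that exactly half of the left-hand side
      reappears on the right and can be absorbed.\<close>
    also have "\<dots> \<le> (\<integral>x. 1 / 2 * (\<phi> x)\<^sup>2 + 8 * R\<^sup>2 * (partial 1 \<phi> x)\<^sup>2 \<partial>dom_measure)"
    proof (rule integral_mono)
      fix x
      show "4 * R * \<bar>\<phi> x * partial 1 \<phi> x\<bar> \<le> 1 / 2 * (\<phi> x)\<^sup>2 + 8 * R\<^sup>2 * (partial 1 \<phi> x)\<^sup>2"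
        using zero_le_power2[of "\<bar>\<phi> x\<bar> - 4 * R * \<bar>partial 1 \<phi> x\<bar>"]
        by (simp add: power2_diff abs_mult power_mult_distrib algebra_simps)
    qed (use i2 i11[of 1] in auto)
    also have "\<dots> = 1 / 2 * (\<integral>x. (\<phi> x)\<^sup>2 \<partial>dom_measure) + 8 * R\<^sup>2 * (\<integral>x. (partial 1 \<phi> x)\<^sup>2 \<partial>dom_measure)"
      using i2 by simp
    also have "\<dots> \<le> 1 / 2 * (\<integral>x. (\<phi> x)\<^sup>2 \<partial>dom_measure) + 8 * R\<^sup>2 * dirichlet \<phi>"
      by (intro add_left_mono mult_left_mono partial_le_dirichlet) simp
    finally have P: "(\<integral>x. (\<phi> x)\<^sup>2 \<partial>dom_measure) \<le> 16 * R\<^sup>2 * dirichlet \<phi>" by simp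
    define A where "A = (\<integral>x. 2 * \<bar>\<phi> x * partial 3 \<phi> x\<bar> \<partial>dom_measure)"
    define B where "B = (\<integral>x. (partial 1 \<phi> x)\<^sup>2 + (partial 2 \<phi> x)\<^sup>2 \<partial>dom_measure)"
    have AB: "0 \<le> A" "0 \<le> B" by (simp_all add: A_def B_def)
    have "A \<le> (\<integral>x. (\<phi> x)\<^sup>2 + (partial 3 \<phi> x)\<^sup>2 \<partial>dom_measure)"
      unfolding A_def
    proof (rule integral_mono)
      fix x
      show "2 * \<bar>\<phi> x * partial 3 \<phi> x\<bar> \<le> (\<phi> x)\<^sup>2 + (partial 3 \<phi> x)\<^sup>2"
        using sum_squares_bound[of "\<bar>\<phi> x\<bar>" "\<bar>partial 3 \<phi> x\<bar>"] by (simp add: abs_mult mult.assoc)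
    qed (use i2 i11[of 3] in auto)
    also have "\<dots> = (\<integral>x. (\<phi> x)\<^sup>2 \<partial>dom_measure) + (\<integral>x. (partial 3 \<phi> x)\<^sup>2 \<partial>dom_measure)"
      using i2 by simp
    also have "\<dots> \<le> 16 * R\<^sup>2 * dirichlet \<phi> + dirichlet \<phi>"
      by (intro add_mono P partial_le_dirichlet)
    finally have A: "A \<le> (16 * R\<^sup>2 + 1) * dirichlet \<phi>" by (simp add: distrib_right)
    have "B = (\<integral>x. (partial 1 \<phi> x)\<^sup>2 \<partial>dom_measure) + (\<integral>x. (partial 2 \<phi> x)\<^sup>2 \<partial>dom_measure)"
      unfolding B_def using i2 by simp
    moreover have "(\<integral>x. (partial 3 \<phi> x)\<^sup>2 \<partial>dom_measure) \<ge> 0" by simp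
    ultimately have B: "B \<le> dirichlet \<phi>" unfolding dirichlet_def sum_3 by linarith
    have "ennreal (\<integral>x. (\<phi> x) ^ 4 \<partial>dom_measure) \<le> 4 * ennreal A * ennreal B"
      unfolding N4[symmetric] A_def B_def N11[symmetric] ND[symmetric]
      by (rule ladyzhenskaya_prod[OF _ _ _ _ 1 2 3]) auto
    also have "\<dots> = ennreal (4 * A * B)"
      using AB by (simp add: ennreal_mult)
    finally have "(\<integral>x. (\<phi> x) ^ 4 \<partial>dom_measure) \<le> 4 * A * B"
      using AB by (simp add: ennreal_le_iff)
    also have "\<dots> \<le> 4 * ((16 * R\<^sup>2 + 1) * dirichlet \<phi>) * dirichlet \<phi>"
      using AB by (intro mult_mono A B mult_nonneg_nonneg dirichlet_nonneg) auto
    finally show ?thesis using P unfolding power2_eq_square[of "dirichlet \<phi>"] by (simp only: mult.assoc)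
  qed
  show ?thesis
  proof (rule that[of "4 * (16 * R\<^sup>2 + 1)"])
    show "4 * (16 * R\<^sup>2 + 1) > 0" by (simp add: add_nonneg_pos)
    fix \<phi> assume \<phi>: "test_fun \<Omega> \<phi>"
    have "16 * R\<^sup>2 * dirichlet \<phi> \<le> 4 * (16 * R\<^sup>2 + 1) * dirichlet \<phi>"
      by (intro mult_right_mono dirichlet_nonneg) (simp add: algebra_simps)
    then show "(\<integral>x. (\<phi> x)\<^sup>2 \<partial>dom_measure) \<le> 4 * (16 * R\<^sup>2 + 1) * dirichlet \<phi>"
      using main[OF \<phi>] by linarith
    show "(\<integral>x. (\<phi> x) ^ 4 \<partial>dom_measure) \<le> 4 * (16 * R\<^sup>2 + 1) * (dirichlet \<phi>)\<^sup>2"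
      using main[OF \<phi>] by simp
  qed
qed

end

text \<open>Hoelder's inequality with exponents 4, 2, 4, obtained by applying Cauchy-Schwarz first
  to q and p r, then to p^2 and r^2.\<close>

lemma sqint_triple_product:
  fixes p q r :: "'a \<Rightarrow> real"
  assumes [measurable]: "p \<in> borel_measurable M" "r \<in> borel_measurable M"
    and p: "(\<lambda>x. (p x)\<^sup>2) \<in> sqint M" and r: "(\<lambda>x. (r x)\<^sup>2) \<in> sqint M" and q: "q \<in> sqint M"
  shows "integrable M (\<lambda>x. p x * q x * r x)"
    and "\<bar>\<integral>x. p x * q x * r x \<partial>M\<bar> \<le>
      sqrt (\<integral>x. (q x)\<^sup>2 \<partial>M) * sqrt (sqrt (\<integral>x. (p x) ^ 4 \<partial>M) * sqrt (\<integral>x. (r x) ^ 4 \<partial>M))"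
proof -
  have pr2: "integrable M (\<lambda>x. (p x * r x)\<^sup>2)"
    using sqint_mult_integrable[OF p r] by (simp add: power_mult_distrib)
  then have pr: "(\<lambda>x. p x * r x) \<in> sqint M" by (simp add: sqint_def)
  show "integrable M (\<lambda>x. p x * q x * r x)"
    using sqint_mult_integrable[OF pr q] by (simp add: mult_ac)
  have "(\<integral>x. p x * q x * r x \<partial>M)\<^sup>2 \<le> (\<integral>x. (q x)\<^sup>2 \<partial>M) * (\<integral>x. (p x * r x)\<^sup>2 \<partial>M)"
    using sqint_Cauchy_Schwarz[OF q pr] by (simp add: mult_ac)
  also have "(\<integral>x. (p x * r x)\<^sup>2 \<partial>M) = \<bar>\<integral>x. (p x)\<^sup>2 * (r x)\<^sup>2 \<partial>M\<bar>"
    by (subst abs_of_nonneg) (auto simp: power_mult_distrib)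
  also have "(\<integral>x. (q x)\<^sup>2 \<partial>M) * \<dots> \<le> (\<integral>x. (q x)\<^sup>2 \<partial>M) * (sqrt (\<integral>x. (p x) ^ 4 \<partial>M) * sqrt (\<integral>x. (r x) ^ 4 \<partial>M))"
    using sqint_inner_Cauchy_Schwarz[OF p r] by (intro mult_left_mono) auto
  finally have "sqrt ((\<integral>x. p x * q x * r x \<partial>M)\<^sup>2)
      \<le> sqrt ((\<integral>x. (q x)\<^sup>2 \<partial>M) * (sqrt (\<integral>x. (p x) ^ 4 \<partial>M) * sqrt (\<integral>x. (r x) ^ 4 \<partial>M)))"
    by (rule real_sqrt_le_mono)
  then show "\<bar>\<integral>x. p x * q x * r x \<partial>M\<bar> \<le>
      sqrt (\<integral>x. (q x)\<^sup>2 \<partial>M) * sqrt (sqrt (\<integral>x. (p x) ^ 4 \<partial>M) * sqrt (\<integral>x. (r x) ^ 4 \<partial>M))"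
    by (simp add: real_sqrt_mult)
qed

lemma sqint_norm_tendsto:
  fixes f :: "'a \<Rightarrow> real"
  assumes f: "f \<in> sqint M" "\<And>n. \<phi> n \<in> sqint M"
    and lim: "(\<lambda>n::nat. \<integral>x. (f x - \<phi> n x)\<^sup>2 \<partial>M) \<longlonglongrightarrow> 0"
  shows "(\<lambda>n. \<integral>x. (\<phi> n x)\<^sup>2 \<partial>M) \<longlonglongrightarrow> (\<integral>x. (f x)\<^sup>2 \<partial>M)"
proof -
  note d = sqint_diff[OF f(1) f(2)]
  have eq: "(\<integral>x. (\<phi> n x)\<^sup>2 \<partial>M)
      = (\<integral>x. (f x)\<^sup>2 \<partial>M) - 2 * (\<integral>x. f x * (f x - \<phi> n x) \<partial>M) + (\<integral>x. (f x - \<phi> n x)\<^sup>2 \<partial>M)" for n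
  proof -
    have "(\<integral>x. (\<phi> n x)\<^sup>2 \<partial>M) = (\<integral>x. (f x)\<^sup>2 - 2 * (f x * (f x - \<phi> n x)) + (f x - \<phi> n x)\<^sup>2 \<partial>M)"
      by (intro Bochner_Integration.integral_cong) (auto simp: power2_eq_square algebra_simps)
    then show ?thesis
      using sqint_integrable_real[OF f(1)] sqint_integrable_real[OF d] sqint_mult_integrable[OF f(1) d] by simp
  qed
  have "(\<lambda>n. \<integral>x. f x * (f x - \<phi> n x) \<partial>M) \<longlonglongrightarrow> 0"
  proof (rule Lim_null_comparison)
    show "\<forall>\<^sub>F n in sequentially. norm (\<integral>x. f x * (f x - \<phi> n x) \<partial>M)
        \<le> sqrt (\<integral>x. (f x)\<^sup>2 \<partial>M) * sqrt (\<integral>x. (f x - \<phi> n x)\<^sup>2 \<partial>M)"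
      using sqint_inner_Cauchy_Schwarz[OF f(1) d] by (intro always_eventually allI) simp
    have "(\<lambda>n. sqrt (\<integral>x. (f x)\<^sup>2 \<partial>M) * sqrt (\<integral>x. (f x - \<phi> n x)\<^sup>2 \<partial>M)) \<longlonglongrightarrow> sqrt (\<integral>x. (f x)\<^sup>2 \<partial>M) * sqrt 0"
      by (intro tendsto_intros lim)
    then show "(\<lambda>n. sqrt (\<integral>x. (f x)\<^sup>2 \<partial>M) * sqrt (\<integral>x. (f x - \<phi> n x)\<^sup>2 \<partial>M)) \<longlonglongrightarrow> 0" by simp
  qed
  then have "(\<lambda>n. (\<integral>x. (f x)\<^sup>2 \<partial>M) - 2 * (\<integral>x. f x * (f x - \<phi> n x) \<partial>M) + (\<integral>x. (f x - \<phi> n x)\<^sup>2 \<partial>M))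
      \<longlonglongrightarrow> (\<integral>x. (f x)\<^sup>2 \<partial>M) - 2 * 0 + 0"
    by (intro tendsto_intros lim)
  then show ?thesis by (simp add: eq)
qed

context bounded_open
begin

text \<open>Fixing one constant for both inequalities here makes all later bounds depend on the
  domain, and not on the function or the solution.\<close>

definition sobolev_constant :: real where
  "sobolev_constant = (SOME C. C > 0 \<and>
    (\<forall>\<phi>. test_fun \<Omega> \<phi> \<longrightarrow> (\<integral>x. (\<phi> x)\<^sup>2 \<partial>dom_measure) \<le> C * dirichlet \<phi>) \<and>
    (\<forall>\<phi>. test_fun \<Omega> \<phi> \<longrightarrow> (\<integral>x. (\<phi> x) ^ 4 \<partial>dom_measure) \<le> C * (dirichlet \<phi>)\<^sup>2))"

lemma sobolev_constant:
  shows sobolev_constant_pos: "sobolev_constant > 0"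
    and test_fun_poincare: "test_fun \<Omega> \<phi> \<Longrightarrow> (\<integral>x. (\<phi> x)\<^sup>2 \<partial>dom_measure) \<le> sobolev_constant * dirichlet \<phi>"
    and test_fun_ladyzhenskaya:
      "test_fun \<Omega> \<phi> \<Longrightarrow> (\<integral>x. (\<phi> x) ^ 4 \<partial>dom_measure) \<le> sobolev_constant * (dirichlet \<phi>)\<^sup>2"
proof -
  have "\<exists>C. C > 0 \<and>
    (\<forall>\<phi>. test_fun \<Omega> \<phi> \<longrightarrow> (\<integral>x. (\<phi> x)\<^sup>2 \<partial>dom_measure) \<le> C * dirichlet \<phi>) \<and>
    (\<forall>\<phi>. test_fun \<Omega> \<phi> \<longrightarrow> (\<integral>x. (\<phi> x) ^ 4 \<partial>dom_measure) \<le> C * (dirichlet \<phi>)\<^sup>2)"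
    by (rule test_fun_inequalities) blast
  from someI_ex[OF this, folded sobolev_constant_def]
  show "sobolev_constant > 0"
    "test_fun \<Omega> \<phi> \<Longrightarrow> (\<integral>x. (\<phi> x)\<^sup>2 \<partial>dom_measure) \<le> sobolev_constant * dirichlet \<phi>"
    "test_fun \<Omega> \<phi> \<Longrightarrow> (\<integral>x. (\<phi> x) ^ 4 \<partial>dom_measure) \<le> sobolev_constant * (dirichlet \<phi>)\<^sup>2"
    by blast+
qed

text \<open>The L2 inequality passes to the limit directly. For the L4 norm no convergence is known
  in advance, so Fatou's lemma is used along a subsequence converging almost everywhere. The limits
  h and G are kept general so that the result also applies to differences f - \<phi>.\<close>

lemma limit_inequalities:
  fixes h :: "real^3 \<Rightarrow> real" and G :: "3 \<Rightarrow> real^3 \<Rightarrow> real"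
  assumes h: "h \<in> sqint dom_measure" and G: "\<And>i. G i \<in> sqint dom_measure"
    and \<psi>: "\<And>n. test_fun \<Omega> (\<psi> n)"
    and lim_h: "(\<lambda>n::nat. \<integral>x. (h x - \<psi> n x)\<^sup>2 \<partial>dom_measure) \<longlonglongrightarrow> 0"
    and lim_G: "\<And>i. (\<lambda>n. \<integral>x. (G i x - partial i (\<psi> n) x)\<^sup>2 \<partial>dom_measure) \<longlonglongrightarrow> 0"
  defines "D \<equiv> \<Sum>i\<in>UNIV. \<integral>x. (G i x)\<^sup>2 \<partial>dom_measure"
  shows "(\<integral>x. (h x)\<^sup>2 \<partial>dom_measure) \<le> sobolev_constant * D"
    and "(\<lambda>x. (h x)\<^sup>2) \<in> sqint dom_measure"
    and "(\<integral>x. (h x) ^ 4 \<partial>dom_measure) \<le> sobolev_constant * D\<^sup>2"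
proof -
  note \<psi>sq = test_fun_sqint[OF \<psi>] and \<psi>'sq = test_fun_partial_sqint[OF \<psi>]
  have [measurable]: "h \<in> borel_measurable dom_measure" "\<psi> n \<in> borel_measurable dom_measure" for n
    using h \<psi>sq by (auto intro: sqint_measurable)
  have D_lim: "(\<lambda>n. dirichlet (\<psi> n)) \<longlonglongrightarrow> D"
    unfolding dirichlet_def D_def by (intro tendsto_sum sqint_norm_tendsto G \<psi>'sq lim_G)
  show "(\<integral>x. (h x)\<^sup>2 \<partial>dom_measure) \<le> sobolev_constant * D"
    by (rule LIMSEQ_le[OF sqint_norm_tendsto[OF h \<psi>sq lim_h] tendsto_mult_left[OF D_lim]])
      (auto intro!: test_fun_poincare \<psi>)
  have "\<exists>r::nat\<Rightarrow>nat. strict_mono r \<and> (AE x in dom_measure. (\<lambda>n. (h x - \<psi> (r n) x)\<^sup>2) \<longlonglongrightarrow> 0)"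
    by (rule tendsto_L1_AE_subseq) (use sqint_diff[OF h \<psi>sq] lim_h in \<open>auto intro: sqint_integrable_real\<close>)
  then obtain r :: "nat \<Rightarrow> nat" where r: "strict_mono r"
    "AE x in dom_measure. (\<lambda>n. (h x - \<psi> (r n) x)\<^sup>2) \<longlonglongrightarrow> 0" by blast
  have ae: "AE x in dom_measure. ennreal ((h x) ^ 4) = liminf (\<lambda>n. ennreal ((\<psi> (r n) x) ^ 4))"
    using r(2)
  proof eventually_elim
    case (elim x)
    have "(\<lambda>n. \<bar>h x - \<psi> (r n) x\<bar>) \<longlonglongrightarrow> 0"
      using tendsto_real_sqrt[OF elim] by simp
    then have "(\<lambda>n. h x - (h x - \<psi> (r n) x)) \<longlonglongrightarrow> h x - 0"
      by (intro tendsto_diff tendsto_const) (simp add: tendsto_rabs_zero_iff)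
    then have "(\<lambda>n. ennreal ((\<psi> (r n) x) ^ 4)) \<longlonglongrightarrow> ennreal ((h x) ^ 4)"
      by (intro tendsto_ennrealI tendsto_power) simp
    then show ?case by (rule lim_imp_Liminf[OF trivial_limit_sequentially, symmetric])
  qed
  have i4: "integrable dom_measure (\<lambda>x. (\<psi> n x) ^ 4)" for n
    using sqint_mult_integrable[OF test_fun_sqint[OF test_fun_mult[OF \<psi> \<psi>]] test_fun_sqint[OF test_fun_mult[OF \<psi> \<psi>]]]
    by (simp add: power4_eq_xxxx mult.assoc)
  have "(\<integral>\<^sup>+x. ennreal ((h x) ^ 4) \<partial>dom_measure) = (\<integral>\<^sup>+x. liminf (\<lambda>n. ennreal ((\<psi> (r n) x) ^ 4)) \<partial>dom_measure)"
    by (rule nn_integral_cong_AE[OF ae])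
  also have "\<dots> \<le> liminf (\<lambda>n. \<integral>\<^sup>+x. ennreal ((\<psi> (r n) x) ^ 4) \<partial>dom_measure)"
    by (rule nn_integral_liminf) measurable
  also have "\<dots> \<le> liminf (\<lambda>n. ennreal (sobolev_constant * (dirichlet (\<psi> (r n)))\<^sup>2))"
    using i4 by (intro Liminf_mono always_eventually allI)
      (subst nn_integral_eq_integral, auto intro!: ennreal_leI test_fun_ladyzhenskaya \<psi>)
  also have "\<dots> = ennreal (sobolev_constant * D\<^sup>2)"
    using LIMSEQ_subseq_LIMSEQ[OF D_lim r(1)]
    by (intro lim_imp_Liminf tendsto_ennrealI tendsto_intros) (auto simp: o_def)
  finally have fin: "(\<integral>\<^sup>+x. ennreal ((h x) ^ 4) \<partial>dom_measure) \<le> ennreal (sobolev_constant * D\<^sup>2)" .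
  have int: "integrable dom_measure (\<lambda>x. (h x) ^ 4)"
    by (rule integrableI_bounded) (use fin in \<open>auto simp: le_less_trans[OF fin]\<close>)
  then show "(\<lambda>x. (h x)\<^sup>2) \<in> sqint dom_measure"
    by (simp add: sqint_def power_mult[symmetric])
  show "(\<integral>x. (h x) ^ 4 \<partial>dom_measure) \<le> sobolev_constant * D\<^sup>2"
    using fin int sobolev_constant_pos
    by (subst (asm) nn_integral_eq_integral) (auto simp: ennreal_le_iff)
qed

lemma H10_inequalities:
  assumes f: "f \<in> H10 \<Omega>"
  defines "D \<equiv> \<Sum>i\<in>UNIV. \<integral>x. (weak_partial \<Omega> i f x)\<^sup>2 \<partial>dom_measure"
  shows "(\<integral>x. (f x)\<^sup>2 \<partial>dom_measure) \<le> sobolev_constant * D"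
    and "(\<lambda>x. (f x)\<^sup>2) \<in> sqint dom_measure"
    and "(\<integral>x. (f x) ^ 4 \<partial>dom_measure) \<le> sobolev_constant * D\<^sup>2"
proof -
  obtain \<phi> where \<phi>: "\<And>n. test_fun \<Omega> (\<phi> n)"
    "(\<lambda>n::nat. \<integral>x. (f x - \<phi> n x)\<^sup>2 \<partial>dom_measure) \<longlonglongrightarrow> 0"
    "\<And>i. (\<lambda>n. \<integral>x. (weak_partial \<Omega> i f x - partial i (\<phi> n) x)\<^sup>2 \<partial>dom_measure) \<longlonglongrightarrow> 0"
    using H10_approx[OF f] by blast
  note * = limit_inequalities[OF H10_sqint[OF f] H10_weak_partial_sqint[OF f] \<phi>]
  show "(\<integral>x. (f x)\<^sup>2 \<partial>dom_measure) \<le> sobolev_constant * D"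
    "(\<lambda>x. (f x)\<^sup>2) \<in> sqint dom_measure"
    "(\<integral>x. (f x) ^ 4 \<partial>dom_measure) \<le> sobolev_constant * D\<^sup>2"
    using * by (auto simp: D_def)
qed

text \<open>Applying \<open>limit_inequalities\<close> to the error f - \<phi> n itself bounds its
  L4 norm by its gradient error, which tends to 0. Dropping an initial segment of the sequence makes
  the Dirichlet integrals uniformly bounded.\<close>

lemma H10_approx_L4:
  assumes f: "f \<in> H10 \<Omega>"
  obtains \<phi> where "\<And>n. test_fun \<Omega> (\<phi> n)"
    "\<And>i. (\<lambda>n::nat. \<integral>x. (weak_partial \<Omega> i f x - partial i (\<phi> n) x)\<^sup>2 \<partial>dom_measure) \<longlonglongrightarrow> 0"
    "\<And>n. (\<lambda>x. (f x - \<phi> n x)\<^sup>2) \<in> sqint dom_measure"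
    "(\<lambda>n. \<integral>x. (f x - \<phi> n x) ^ 4 \<partial>dom_measure) \<longlonglongrightarrow> 0"
    "\<And>n. dirichlet (\<phi> n) \<le> 1 + (\<Sum>i\<in>UNIV. \<integral>x. (weak_partial \<Omega> i f x)\<^sup>2 \<partial>dom_measure)"
proof -
  obtain \<phi>0 where \<phi>0: "\<And>n. test_fun \<Omega> (\<phi>0 n)"
    "(\<lambda>n::nat. \<integral>x. (f x - \<phi>0 n x)\<^sup>2 \<partial>dom_measure) \<longlonglongrightarrow> 0"
    "\<And>i. (\<lambda>n. \<integral>x. (weak_partial \<Omega> i f x - partial i (\<phi>0 n) x)\<^sup>2 \<partial>dom_measure) \<longlonglongrightarrow> 0"
    using H10_approx[OF f] by blast
  let ?D = "\<Sum>i\<in>UNIV. \<integral>x. (weak_partial \<Omega> i f x)\<^sup>2 \<partial>dom_measure"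
  note fsq = H10_sqint[OF f] H10_weak_partial_sqint[OF f]
  have "(\<lambda>n. dirichlet (\<phi>0 n)) \<longlonglongrightarrow> ?D"
    unfolding dirichlet_def
    by (intro tendsto_sum sqint_norm_tendsto fsq test_fun_partial_sqint[OF \<phi>0(1)] \<phi>0(3))
  then have "\<forall>\<^sub>F n in sequentially. dirichlet (\<phi>0 n) < 1 + ?D"
    by (rule order_tendstoD) simp
  then obtain N where N: "\<And>n. n \<ge> N \<Longrightarrow> dirichlet (\<phi>0 n) < 1 + ?D"
    by (auto simp: eventually_sequentially)
  define \<phi> where "\<phi> n = \<phi>0 (n + N)" for n
  have \<phi>: "test_fun \<Omega> (\<phi> n)" "dirichlet (\<phi> n) \<le> 1 + ?D" for n
    using \<phi>0(1) N[of "n + N"] by (auto simp: \<phi>_def)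
  have lim: "(\<lambda>n. \<integral>x. (f x - \<phi> n x)\<^sup>2 \<partial>dom_measure) \<longlonglongrightarrow> 0"
    "\<And>i. (\<lambda>n. \<integral>x. (weak_partial \<Omega> i f x - partial i (\<phi> n) x)\<^sup>2 \<partial>dom_measure) \<longlonglongrightarrow> 0"
    unfolding \<phi>_def using \<phi>0(2,3)[THEN LIMSEQ_ignore_initial_segment] by auto
  define e where "e n = (\<Sum>i\<in>UNIV. \<integral>x. (weak_partial \<Omega> i f x - partial i (\<phi> n) x)\<^sup>2 \<partial>dom_measure)" for n
  have diff: "(\<lambda>x. (f x - \<phi> n x)\<^sup>2) \<in> sqint dom_measure"
    "(\<integral>x. (f x - \<phi> n x) ^ 4 \<partial>dom_measure) \<le> sobolev_constant * (e n)\<^sup>2" for n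
  proof -
    have tf: "test_fun \<Omega> (\<lambda>x. \<phi> m x - \<phi> n x)" for m
      using test_fun_lincomb[OF \<phi>(1) \<phi>(1), of 1 m "-1" n] by simp
    have p: "partial i (\<lambda>x. \<phi> m x - \<phi> n x) = (\<lambda>x. partial i (\<phi> m) x - partial i (\<phi> n) x)" for i m
      using partial_lincomb[OF \<phi>(1) \<phi>(1), of i 1 m "-1" n] by simp
    \<comment> \<open>Here n is fixed and m runs: the error at stage n is the limit of the test
      functions \<phi> m - \<phi> n.\<close>
    have l1: "(\<lambda>m. \<integral>x. ((f x - \<phi> n x) - (\<phi> m x - \<phi> n x))\<^sup>2 \<partial>dom_measure) \<longlonglongrightarrow> 0"
      using lim(1) by simp
    have l2: "(\<lambda>m. \<integral>x. ((weak_partial \<Omega> i f x - partial i (\<phi> n) x) - partial i (\<lambda>x. \<phi> m x - \<phi> n x) x)\<^sup>2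
        \<partial>dom_measure) \<longlonglongrightarrow> 0" for i
      unfolding p using lim(2)[of i] by simp
    note li = limit_inequalities[OF sqint_diff[OF fsq(1) test_fun_sqint[OF \<phi>(1)]]
        sqint_diff[OF fsq(2) test_fun_partial_sqint[OF \<phi>(1)]] tf l1 l2]
    show "(\<lambda>x. (f x - \<phi> n x)\<^sup>2) \<in> sqint dom_measure" by (rule li(2))
    show "(\<integral>x. (f x - \<phi> n x) ^ 4 \<partial>dom_measure) \<le> sobolev_constant * (e n)\<^sup>2"
      unfolding e_def by (rule li(3))
  qed
  have "e \<longlonglongrightarrow> (\<Sum>i\<in>(UNIV::3 set). 0)"
    unfolding e_def[abs_def] by (intro tendsto_sum lim)
  then have "e \<longlonglongrightarrow> 0" by simp
  then have "(\<lambda>n. sobolev_constant * (e n)\<^sup>2) \<longlonglongrightarrow> sobolev_constant * 0\<^sup>2"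
    by (intro tendsto_intros)
  then have up: "(\<lambda>n. sobolev_constant * (e n)\<^sup>2) \<longlonglongrightarrow> 0" by simp
  have "(\<lambda>n. \<integral>x. (f x - \<phi> n x) ^ 4 \<partial>dom_measure) \<longlonglongrightarrow> 0"
    by (rule tendsto_sandwich[OF _ _ tendsto_const up])
      (intro always_eventually allI, simp, intro always_eventually allI diff(2))
  show ?thesis by (rule that[OF \<phi>(1) lim(2) diff(1) \<open>(\<lambda>n. \<integral>x. (f x - \<phi> n x) ^ 4 \<partial>dom_measure) \<longlonglongrightarrow> 0\<close> \<phi>(2)])
qed

lemma ip1_self_eq:
  assumes "u \<in> V \<Omega>"
  shows "ip1 \<Omega> u u = (\<Sum>j\<in>UNIV. \<Sum>i\<in>UNIV. \<integral>x. (weak_partial \<Omega> i (\<lambda>y. u y $ j) x)\<^sup>2 \<partial>dom_measure)"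
proof -
  have i: "integrable dom_measure (\<lambda>x. (weak_partial \<Omega> i (\<lambda>y. u y $ j) x)\<^sup>2)" for i j
    by (intro sqint_integrable_real H10_weak_partial_sqint V_H10 assms)
  have "ip1 \<Omega> u u = (\<integral>x. (\<Sum>j\<in>UNIV. \<Sum>i\<in>UNIV. (weak_partial \<Omega> i (\<lambda>y. u y $ j) x)\<^sup>2) \<partial>dom_measure)"
    unfolding ip1_def grad_def inner_vec_def
    by (subst sum.swap) (simp add: power2_eq_square)
  also have "\<dots> = (\<Sum>j\<in>UNIV. \<Sum>i\<in>UNIV. \<integral>x. (weak_partial \<Omega> i (\<lambda>y. u y $ j) x)\<^sup>2 \<partial>dom_measure)"
    using i by (simp add: Bochner_Integration.integral_sum Bochner_Integration.integrable_sum)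
  finally show ?thesis .
qed

lemma V_component_dirichlet_le:
  assumes "u \<in> V \<Omega>"
  shows "(\<Sum>i\<in>UNIV. \<integral>x. (weak_partial \<Omega> i (\<lambda>y. u y $ j) x)\<^sup>2 \<partial>dom_measure) \<le> (norm1 \<Omega> u)\<^sup>2"
  unfolding norm1_power2 ip1_self_eq[OF assms]
  by (rule member_le_sum) (auto intro: sum_nonneg)

lemma V_partial_le:
  assumes "u \<in> V \<Omega>"
  shows "(\<integral>x. (weak_partial \<Omega> i (\<lambda>y. u y $ j) x)\<^sup>2 \<partial>dom_measure) \<le> (norm1 \<Omega> u)\<^sup>2"
proof -
  have "(\<integral>x. (weak_partial \<Omega> i (\<lambda>y. u y $ j) x)\<^sup>2 \<partial>dom_measure)
      \<le> (\<Sum>i\<in>UNIV. \<integral>x. (weak_partial \<Omega> i (\<lambda>y. u y $ j) x)\<^sup>2 \<partial>dom_measure)"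
    by (rule member_le_sum) auto
  then show ?thesis using V_component_dirichlet_le[OF assms, of j] by simp
qed

lemma poincare:
  assumes "u \<in> V \<Omega>" shows "ip \<Omega> u u \<le> sobolev_constant * ip1 \<Omega> u u"
proof -
  have i: "integrable dom_measure (\<lambda>x. (u x $ j)\<^sup>2)" for j
    by (intro sqint_integrable_real H10_sqint V_H10 assms)
  have "ip \<Omega> u u = (\<Sum>j\<in>UNIV. \<integral>x. (u x $ j)\<^sup>2 \<partial>dom_measure)"
    using i by (simp add: ip_def inner_vec_def power2_eq_square)
  also have "\<dots> \<le> (\<Sum>j\<in>UNIV. sobolev_constant * (\<Sum>i\<in>UNIV. \<integral>x. (weak_partial \<Omega> i (\<lambda>y. u y $ j) x)\<^sup>2 \<partial>dom_measure))"
    by (intro sum_mono H10_inequalities V_H10 assms)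
  finally show ?thesis by (simp add: ip1_self_eq[OF assms] sum_distrib_left)
qed

lemma norm0_le: "u \<in> V \<Omega> \<Longrightarrow> norm0 \<Omega> u \<le> sqrt sobolev_constant * norm1 \<Omega> u"
  unfolding norm0_def norm1_def real_sqrt_mult[symmetric] by (intro real_sqrt_le_mono poincare)

lemma V_component_L4:
  assumes "u \<in> V \<Omega>"
  shows "(\<lambda>x. (u x $ j)\<^sup>2) \<in> sqint dom_measure"
    and "(\<integral>x. (u x $ j) ^ 4 \<partial>dom_measure) \<le> sobolev_constant * (norm1 \<Omega> u) ^ 4"
proof -
  show "(\<lambda>x. (u x $ j)\<^sup>2) \<in> sqint dom_measure"
    by (rule H10_inequalities(2)[OF V_H10[OF assms]])
  have "(\<integral>x. (u x $ j) ^ 4 \<partial>dom_measure) \<le>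
      sobolev_constant * (\<Sum>i\<in>UNIV. \<integral>x. (weak_partial \<Omega> i (\<lambda>y. u y $ j) x)\<^sup>2 \<partial>dom_measure)\<^sup>2"
    by (rule H10_inequalities(3)[OF V_H10[OF assms]])
  also have "\<dots> \<le> sobolev_constant * ((norm1 \<Omega> u)\<^sup>2)\<^sup>2"
    using sobolev_constant_pos V_component_dirichlet_le[OF assms]
    by (intro mult_left_mono power_mono) (auto intro: sum_nonneg)
  finally show "(\<integral>x. (u x $ j) ^ 4 \<partial>dom_measure) \<le> sobolev_constant * (norm1 \<Omega> u) ^ 4"
    by (simp add: power_mult[symmetric])
qed

section \<open>The convective form: boundedness and cancellation\<close>

subsection \<open>The trilinear form\<close>

lemma trilinear_term:
  assumes "u \<in> V \<Omega>" "v \<in> V \<Omega>" "w \<in> V \<Omega>"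
  shows "integrable dom_measure (\<lambda>x. u x $ i * weak_partial \<Omega> i (\<lambda>y. v y $ j) x * w x $ j)"
    and "\<bar>\<integral>x. u x $ i * weak_partial \<Omega> i (\<lambda>y. v y $ j) x * w x $ j \<partial>dom_measure\<bar>
      \<le> sqrt sobolev_constant * norm1 \<Omega> u * norm1 \<Omega> v * norm1 \<Omega> w"
proof -
  note * = sqint_triple_product[OF sqint_measurable[OF H10_sqint[OF V_H10[OF assms(1)]]]
      sqint_measurable[OF H10_sqint[OF V_H10[OF assms(3)]]] V_component_L4(1)[OF assms(1)]
      V_component_L4(1)[OF assms(3)] H10_weak_partial_sqint[OF V_H10[OF assms(2)]]]
  show "integrable dom_measure (\<lambda>x. u x $ i * weak_partial \<Omega> i (\<lambda>y. v y $ j) x * w x $ j)"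
    by (rule *(1))
  have r4: "sqrt (sobolev_constant * (norm1 \<Omega> u) ^ 4) = sqrt sobolev_constant * (norm1 \<Omega> u)\<^sup>2" for u
    using norm1_nonneg[of u] real_sqrt_abs[of "(norm1 \<Omega> u)\<^sup>2"] by (simp add: real_sqrt_mult power_mult[symmetric])
  have "\<bar>\<integral>x. u x $ i * weak_partial \<Omega> i (\<lambda>y. v y $ j) x * w x $ j \<partial>dom_measure\<bar>
    \<le> sqrt (\<integral>x. (weak_partial \<Omega> i (\<lambda>y. v y $ j) x)\<^sup>2 \<partial>dom_measure) *
      sqrt (sqrt (\<integral>x. (u x $ i) ^ 4 \<partial>dom_measure) * sqrt (\<integral>x. (w x $ j) ^ 4 \<partial>dom_measure))"
    by (rule *(2))
  also have "\<dots> \<le> sqrt ((norm1 \<Omega> v)\<^sup>2) *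
      sqrt (sqrt (sobolev_constant * (norm1 \<Omega> u) ^ 4) * sqrt (sobolev_constant * (norm1 \<Omega> w) ^ 4))"
    using sobolev_constant_pos norm1_nonneg
    by (intro mult_mono real_sqrt_le_mono V_partial_le V_component_L4 assms)
      (auto intro!: mult_nonneg_nonneg)
  also have "\<dots> = sqrt sobolev_constant * norm1 \<Omega> u * norm1 \<Omega> v * norm1 \<Omega> w"
    unfolding r4 using sobolev_constant_pos norm1_nonneg
    by (simp add: real_sqrt_mult mult_ac real_sqrt_mult_self)
  finally show "\<bar>\<integral>x. u x $ i * weak_partial \<Omega> i (\<lambda>y. v y $ j) x * w x $ j \<partial>dom_measure\<bar>
      \<le> sqrt sobolev_constant * norm1 \<Omega> u * norm1 \<Omega> v * norm1 \<Omega> w" .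
qed

lemma convective_eq:
  "(u x v* grad \<Omega> v x) \<bullet> w x = (\<Sum>j\<in>UNIV. \<Sum>i\<in>UNIV. u x $ i * weak_partial \<Omega> i (\<lambda>y. v y $ j) x * w x $ j)"
  by (simp add: inner_vec_def vector_matrix_mult_def grad_def sum_distrib_right)

lemma trilinear_eq:
  assumes "u \<in> V \<Omega>" "v \<in> V \<Omega>" "w \<in> V \<Omega>"
  shows "integrable dom_measure (\<lambda>x. (u x v* grad \<Omega> v x) \<bullet> w x)"
    and "trilinear \<Omega> u v w = (\<Sum>j\<in>UNIV. \<Sum>i\<in>UNIV.
      \<integral>x. u x $ i * weak_partial \<Omega> i (\<lambda>y. v y $ j) x * w x $ j \<partial>dom_measure)"
  unfolding trilinear_def convective_eq using trilinear_term(1)[OF assms] by simp_all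

text \<open>Nine is the number of index pairs (i, j) in the convective term; each summand is bounded
  with the constant \<open>sqrt sobolev_constant\<close>.\<close>

definition trilinear_constant :: real where
  "trilinear_constant = 9 * sqrt sobolev_constant"

lemma trilinear_constant_pos: "trilinear_constant > 0"
  by (simp add: trilinear_constant_def sobolev_constant_pos)

lemma trilinear_bound:
  assumes "u \<in> V \<Omega>" "v \<in> V \<Omega>" "w \<in> V \<Omega>"
  shows "\<bar>trilinear \<Omega> u v w\<bar> \<le> trilinear_constant * norm1 \<Omega> u * norm1 \<Omega> v * norm1 \<Omega> w"
proof -
  have "\<bar>trilinear \<Omega> u v w\<bar> \<le> (\<Sum>j\<in>(UNIV::3 set). \<Sum>i\<in>(UNIV::3 set).
      sqrt sobolev_constant * norm1 \<Omega> u * norm1 \<Omega> v * norm1 \<Omega> w)"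
    unfolding trilinear_eq(2)[OF assms]
    by (intro order_trans[OF sum_abs] sum_mono trilinear_term(2) assms)
  then show ?thesis by (simp add: trilinear_constant_def)
qed

lemma trilinear_diff_left:
  assumes "u \<in> V \<Omega>" "u' \<in> V \<Omega>" "v \<in> V \<Omega>" "w \<in> V \<Omega>"
  shows "trilinear \<Omega> (u - u') v w = trilinear \<Omega> u v w - trilinear \<Omega> u' v w"
  using trilinear_eq(1)[OF assms(1,3,4)] trilinear_eq(1)[OF assms(2,3,4)]
  by (simp add: trilinear_def vector_matrix_mult_diff_distrib inner_diff_left)

lemma trilinear_diff_middle:
  assumes "u \<in> V \<Omega>" "v \<in> V \<Omega>" "v' \<in> V \<Omega>" "w \<in> V \<Omega>"
  shows "trilinear \<Omega> u (v - v') w = trilinear \<Omega> u v w - trilinear \<Omega> u v' w"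
proof -
  note i = trilinear_eq(1)[OF assms(1,2,4)] trilinear_eq(1)[OF assms(1,3,4)]
    trilinear_eq(1)[OF assms(1) V_diff[OF assms(2,3)] assms(4)]
  have "trilinear \<Omega> u (v - v') w
      = (\<integral>x. (u x v* grad \<Omega> v x) \<bullet> w x - (u x v* grad \<Omega> v' x) \<bullet> w x \<partial>dom_measure)"
    unfolding trilinear_def
  proof (rule integral_cong_AE)
    show "AE x in dom_measure. (u x v* grad \<Omega> (v - v') x) \<bullet> w x
        = (u x v* grad \<Omega> v x) \<bullet> w x - (u x v* grad \<Omega> v' x) \<bullet> w x"
      using grad_diff[OF assms(2,3)]
      by eventually_elim (simp add: inner_diff_left[symmetric] vector_matrix_mult_diff_rdistrib)
  qed (use i in auto)
  then show ?thesis using i by (simp add: trilinear_def)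
qed

text \<open>For a test function the integrand summed over i is half of u \<cdot> grad(\<phi>^2), and
  its integral vanishes because the weak divergence of u does. Convergence of the gradients in L2
  and of the functions in L4, against u in L4, carries the identity over to f.\<close>

lemma convective_antisymmetric:
  assumes u: "u \<in> V \<Omega>" and f: "f \<in> H10 \<Omega>"
  shows "(\<Sum>i\<in>UNIV. \<integral>x. u x $ i * weak_partial \<Omega> i f x * f x \<partial>dom_measure) = 0"
proof -
  obtain \<phi> where \<phi>: "\<And>n. test_fun \<Omega> (\<phi> n)"
    "\<And>i. (\<lambda>n::nat. \<integral>x. (weak_partial \<Omega> i f x - partial i (\<phi> n) x)\<^sup>2 \<partial>dom_measure) \<longlonglongrightarrow> 0"
    "\<And>n. (\<lambda>x. (f x - \<phi> n x)\<^sup>2) \<in> sqint dom_measure"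
    "(\<lambda>n. \<integral>x. (f x - \<phi> n x) ^ 4 \<partial>dom_measure) \<longlonglongrightarrow> 0"
    "\<And>n. dirichlet (\<phi> n) \<le> 1 + (\<Sum>i\<in>UNIV. \<integral>x. (weak_partial \<Omega> i f x)\<^sup>2 \<partial>dom_measure)"
    using H10_approx_L4[OF f] by blast
  define D where "D = 1 + (\<Sum>i\<in>UNIV. \<integral>x. (weak_partial \<Omega> i f x)\<^sup>2 \<partial>dom_measure)"
  note uH = V_H10[OF u] and fsq = H10_sqint[OF f] H10_weak_partial_sqint[OF f]
  note \<phi>sq = test_fun_sqint[OF \<phi>(1)] test_fun_partial_sqint[OF \<phi>(1)]
  have \<phi>2: "test_fun \<Omega> (\<lambda>x. (\<phi> n x)\<^sup>2)" for n
    using test_fun_mult[OF \<phi>(1) \<phi>(1)] by (simp add: power2_eq_square)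
  have part2: "partial i (\<lambda>x. (\<phi> n x)\<^sup>2) x = 2 * (partial i (\<phi> n) x * \<phi> n x)" for i n x
    using frechet_derivative_mult_apply[OF test_fun_differentiable[OF \<phi>(1)] test_fun_differentiable[OF \<phi>(1)]]
    by (simp add: partial_def power2_eq_square)
  have smooth: "(\<Sum>i\<in>UNIV. \<integral>x. u x $ i * partial i (\<phi> n) x * \<phi> n x \<partial>dom_measure) = 0" for n
  proof -
    have "2 * (\<integral>x. u x $ i * partial i (\<phi> n) x * \<phi> n x \<partial>dom_measure)
        = - (\<integral>x. weak_partial \<Omega> i (\<lambda>y. u y $ i) x * (\<phi> n x)\<^sup>2 \<partial>dom_measure)" for i
    proof -
      have "2 * (\<integral>x. u x $ i * partial i (\<phi> n) x * \<phi> n x \<partial>dom_measure)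
          = (\<integral>x. u x $ i * partial i (\<lambda>x. (\<phi> n x)\<^sup>2) x \<partial>dom_measure)"
        unfolding part2 by (subst integral_mult_right_zero[symmetric]) (simp add: mult_ac)
      then show ?thesis
        using H10_weak_partial[OF uH, of i i] \<phi>2[of n] by (simp add: has_weak_partial_def)
    qed
    then have "2 * (\<Sum>i\<in>UNIV. \<integral>x. u x $ i * partial i (\<phi> n) x * \<phi> n x \<partial>dom_measure)
        = - (\<Sum>i\<in>UNIV. \<integral>x. weak_partial \<Omega> i (\<lambda>y. u y $ i) x * (\<phi> n x)\<^sup>2 \<partial>dom_measure)"
      by (simp add: sum_distrib_left sum_negf)
    also have "(\<Sum>i\<in>UNIV. \<integral>x. weak_partial \<Omega> i (\<lambda>y. u y $ i) x * (\<phi> n x)\<^sup>2 \<partial>dom_measure)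
        = (\<integral>x. (\<Sum>i\<in>UNIV. weak_partial \<Omega> i (\<lambda>y. u y $ i) x) * (\<phi> n x)\<^sup>2 \<partial>dom_measure)"
      unfolding sum_distrib_right
      by (intro Bochner_Integration.integral_sum[symmetric] sqint_mult_integrable H10_weak_partial_sqint uH
          test_fun_sqint[OF \<phi>2])
    also have "\<dots> = 0"
    proof (rule integral_eq_zero_AE)
      have "AE x in dom_measure. (\<Sum>i\<in>UNIV. grad \<Omega> u x $ i $ i) = 0" using u by (simp add: V_def)
      then show "AE x in dom_measure. (\<Sum>i\<in>UNIV. weak_partial \<Omega> i (\<lambda>y. u y $ i) x) * (\<phi> n x)\<^sup>2 = 0"
        by eventually_elim (simp add: grad_def)
    qed
    finally show ?thesis by simp
  qed
  have "(\<lambda>n. \<integral>x. u x $ i * partial i (\<phi> n) x * \<phi> n x \<partial>dom_measure)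
      \<longlonglongrightarrow> (\<integral>x. u x $ i * weak_partial \<Omega> i f x * f x \<partial>dom_measure)" for i
  proof -
    define A where "A = sqrt (\<integral>x. (u x $ i) ^ 4 \<partial>dom_measure)"
    have A: "0 \<le> A" by (simp add: A_def)
    have mu: "(\<lambda>x. u x $ i) \<in> borel_measurable dom_measure" by (rule sqint_measurable[OF H10_sqint[OF uH]])
    note ui = V_component_L4(1)[OF u, of i]
    have d: "(\<lambda>x. weak_partial \<Omega> i f x - partial i (\<phi> n) x) \<in> sqint dom_measure" for n
      by (intro sqint_diff fsq \<phi>sq)
    have md: "(\<lambda>x. f x - \<phi> n x) \<in> borel_measurable dom_measure" for n
      by (intro sqint_measurable sqint_diff fsq \<phi>sq)
    note t1 = sqint_triple_product[OF mu sqint_measurable[OF \<phi>sq(1)] ui test_fun_sqint[OF \<phi>2] d]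
    note t2 = sqint_triple_product[OF mu md ui \<phi>(3) fsq(2)[of i]]
    note t3 = sqint_triple_product[OF mu sqint_measurable[OF \<phi>sq(1)] ui test_fun_sqint[OF \<phi>2] \<phi>sq(2)[of i]]
    note t4 = sqint_triple_product[OF mu sqint_measurable[OF fsq(1)] ui H10_inequalities(2)[OF f] fsq(2)[of i]]
    \<comment> \<open>The derivative is exchanged first and the factor f second. The first error
      needs the \<phi> n bounded in L4, which the uniform Dirichlet bound D provides.\<close>
    let ?b = "\<lambda>n. sqrt (\<integral>x. (weak_partial \<Omega> i f x - partial i (\<phi> n) x)\<^sup>2 \<partial>dom_measure) *
        sqrt (A * sqrt (sobolev_constant * D\<^sup>2)) +
      sqrt (\<integral>x. (weak_partial \<Omega> i f x)\<^sup>2 \<partial>dom_measure) * sqrt (A * sqrt (\<integral>x. (f x - \<phi> n x) ^ 4 \<partial>dom_measure))"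
    have "(\<lambda>n. (\<integral>x. u x $ i * weak_partial \<Omega> i f x * f x \<partial>dom_measure)
      - (\<integral>x. u x $ i * partial i (\<phi> n) x * \<phi> n x \<partial>dom_measure)) \<longlonglongrightarrow> 0"
    proof (rule Lim_null_comparison)
      have "norm ((\<integral>x. u x $ i * weak_partial \<Omega> i f x * f x \<partial>dom_measure)
        - (\<integral>x. u x $ i * partial i (\<phi> n) x * \<phi> n x \<partial>dom_measure)) \<le> ?b n" for n
      proof -
        have "(\<integral>x. u x $ i * weak_partial \<Omega> i f x * f x \<partial>dom_measure)
            - (\<integral>x. u x $ i * partial i (\<phi> n) x * \<phi> n x \<partial>dom_measure)
          = (\<integral>x. u x $ i * weak_partial \<Omega> i f x * f x - u x $ i * partial i (\<phi> n) x * \<phi> n x \<partial>dom_measure)"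
          using t3(1) t4(1) by simp
        also have "\<dots> = (\<integral>x. u x $ i * (weak_partial \<Omega> i f x - partial i (\<phi> n) x) * \<phi> n x
            + u x $ i * weak_partial \<Omega> i f x * (f x - \<phi> n x) \<partial>dom_measure)"
          by (intro Bochner_Integration.integral_cong) (auto simp: algebra_simps)
        also have "\<dots> = (\<integral>x. u x $ i * (weak_partial \<Omega> i f x - partial i (\<phi> n) x) * \<phi> n x \<partial>dom_measure)
            + (\<integral>x. u x $ i * weak_partial \<Omega> i f x * (f x - \<phi> n x) \<partial>dom_measure)"
          by (intro Bochner_Integration.integral_add t1(1) t2(1))
        finally have eq: "norm ((\<integral>x. u x $ i * weak_partial \<Omega> i f x * f x \<partial>dom_measure)
            - (\<integral>x. u x $ i * partial i (\<phi> n) x * \<phi> n x \<partial>dom_measure))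
          \<le> \<bar>\<integral>x. u x $ i * (weak_partial \<Omega> i f x - partial i (\<phi> n) x) * \<phi> n x \<partial>dom_measure\<bar>
            + \<bar>\<integral>x. u x $ i * weak_partial \<Omega> i f x * (f x - \<phi> n x) \<partial>dom_measure\<bar>"
          by simp
        have "(\<integral>x. (\<phi> n x) ^ 4 \<partial>dom_measure) \<le> sobolev_constant * D\<^sup>2"
          using \<phi>(5)[of n] dirichlet_nonneg sobolev_constant_pos
          by (intro order_trans[OF test_fun_ladyzhenskaya[OF \<phi>(1)]] mult_left_mono power_mono) (auto simp: D_def)
        then have "sqrt (\<integral>x. (weak_partial \<Omega> i f x - partial i (\<phi> n) x)\<^sup>2 \<partial>dom_measure) *
            sqrt (A * sqrt (\<integral>x. (\<phi> n x) ^ 4 \<partial>dom_measure))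
          \<le> sqrt (\<integral>x. (weak_partial \<Omega> i f x - partial i (\<phi> n) x)\<^sup>2 \<partial>dom_measure) *
            sqrt (A * sqrt (sobolev_constant * D\<^sup>2))"
          using A by (intro mult_left_mono real_sqrt_le_mono) auto
        then show ?thesis using eq t1(2)[of n n] t2(2)[of n] unfolding A_def by linarith
      qed
      then show "\<forall>\<^sub>F n in sequentially. norm ((\<integral>x. u x $ i * weak_partial \<Omega> i f x * f x \<partial>dom_measure)
        - (\<integral>x. u x $ i * partial i (\<phi> n) x * \<phi> n x \<partial>dom_measure)) \<le> ?b n" by simp
      have "?b \<longlonglongrightarrow> sqrt 0 * sqrt (A * sqrt (sobolev_constant * D\<^sup>2)) +
          sqrt (\<integral>x. (weak_partial \<Omega> i f x)\<^sup>2 \<partial>dom_measure) * sqrt (A * sqrt 0)"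
        by (intro tendsto_intros \<phi>)
      then show "?b \<longlonglongrightarrow> 0" by simp
    qed
    from tendsto_diff[OF tendsto_const[of "\<integral>x. u x $ i * weak_partial \<Omega> i f x * f x \<partial>dom_measure"] this]
    show ?thesis by simp
  qed
  then have "(\<lambda>n. \<Sum>i\<in>UNIV. \<integral>x. u x $ i * partial i (\<phi> n) x * \<phi> n x \<partial>dom_measure)
      \<longlonglongrightarrow> (\<Sum>i\<in>UNIV. \<integral>x. u x $ i * weak_partial \<Omega> i f x * f x \<partial>dom_measure)"
    by (intro tendsto_sum)
  then show ?thesis using smooth by (simp add: LIMSEQ_const_iff)
qed

text \<open>The sum over i vanishes for each component j of u separately.\<close>

lemma trilinear_self:
  assumes "u \<in> V \<Omega>" shows "trilinear \<Omega> u u u = 0"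
  unfolding trilinear_eq(2)[OF assms assms assms]
  using convective_antisymmetric[OF assms V_H10[OF assms]] by simp

end

section \<open>V-valued measurability and integrals seen through bounded functionals\<close>

section \<open>Functions of time with values in the space of velocity fields\<close>

lemma lebesgue_measurable_AE_cong:
  fixes f g :: "'a::euclidean_space \<Rightarrow> real"
  assumes g: "g \<in> borel_measurable lebesgue" and ae: "AE x in lebesgue. g x = f x"
  shows "f \<in> borel_measurable lebesgue"
proof (rule measurableI)
  fix A :: "real set" assume A: "A \<in> sets borel"
  show "f -` A \<inter> space lebesgue \<in> sets lebesgue"
  proof (rule completion.in_sets_AE)
    show "AE x in lebesgue. (x \<in> g -` A \<inter> space lebesgue) = (x \<in> f -` A \<inter> space lebesgue)"
      using ae by eventually_elim simp
    show "g -` A \<inter> space lebesgue \<in> sets lebesgue" using measurable_sets[OF g A] .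
  qed simp
qed simp

text \<open>Strong measurability supplies only convergence almost everywhere; completeness of
  Lebesgue measure still makes the limit measurable. Extension by 0 reduces the claim to the whole
  space.\<close>

lemma lebesgue_on_measurable_AE_LIMSEQ:
  fixes f :: "'a::euclidean_space \<Rightarrow> real" and F :: "nat \<Rightarrow> 'a \<Rightarrow> real"
  assumes S: "S \<in> sets lebesgue" and F: "\<And>n. F n \<in> borel_measurable (lebesgue_on S)"
    and ae: "AE x in lebesgue_on S. (\<lambda>n. F n x) \<longlonglongrightarrow> f x"
  shows "f \<in> borel_measurable (lebesgue_on S)"
proof -
  have F': "(\<lambda>x. indicator S x * F n x) \<in> borel_measurable lebesgue" for n
    using F[of n] S by (simp add: borel_measurable_restrict_space_iff)
  have "AE x in lebesgue. x \<in> S \<longrightarrow> (\<lambda>n. F n x) \<longlonglongrightarrow> f x"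
    using ae S by (simp add: AE_restrict_space_iff)
  then have "AE x in lebesgue. lim (\<lambda>n. indicator S x * F n x) = indicator S x * f x"
  proof eventually_elim
    case (elim x)
    then show ?case by (cases "x \<in> S") (simp_all add: limI)
  qed
  then have "(\<lambda>x. indicator S x * f x) \<in> borel_measurable lebesgue"
    by (rule lebesgue_measurable_AE_cong[OF borel_measurable_lim_metric[OF F']])
  then show ?thesis using S by (simp add: borel_measurable_restrict_space_iff)
qed

context bounded_open
begin

lemma V_zero: "w \<in> V \<Omega> \<Longrightarrow> (\<lambda>x. 0) \<in> V \<Omega>"
  using V_lincomb(1)[of w w 0 0] by simp

text \<open>The triangle inequality for a seminorm on representatives: the square of the norm of u
  is split as an inner product with u, Cauchy-Schwarz is applied to both parts, and a nonzero norm
  is cancelled.\<close>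

lemma norm1_le_add:
  assumes "u \<in> V \<Omega>" "v \<in> V \<Omega>"
  shows "norm1 \<Omega> u \<le> norm1 \<Omega> (u - v) + norm1 \<Omega> v"
proof (cases "norm1 \<Omega> u = 0")
  case True
  then show ?thesis using norm1_nonneg[of "u - v"] norm1_nonneg[of v] by simp
next
  case False
  have "norm1 \<Omega> u * norm1 \<Omega> u = ip1 \<Omega> (u - v) u + ip1 \<Omega> v u"
    using ip1_diff[OF assms assms(1)] norm1_power2[of u] by (simp add: power2_eq_square)
  also have "\<dots> \<le> norm1 \<Omega> (u - v) * norm1 \<Omega> u + norm1 \<Omega> v * norm1 \<Omega> u"
    using ip1_Cauchy_Schwarz[OF V_diff[OF assms] assms(1)] ip1_Cauchy_Schwarz[OF assms(2,1)] by linarith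
  also have "\<dots> = (norm1 \<Omega> (u - v) + norm1 \<Omega> v) * norm1 \<Omega> u"
    by (rule distrib_right[symmetric])
  finally show ?thesis
    by (rule mult_right_le_imp_le) (use False norm1_nonneg[of u] in linarith)
qed

lemma ip1_diff_right:
  "u \<in> V \<Omega> \<Longrightarrow> v \<in> V \<Omega> \<Longrightarrow> w \<in> V \<Omega> \<Longrightarrow> ip1 \<Omega> w (u - v) = ip1 \<Omega> w u - ip1 \<Omega> w v"
  by (metis ip1_diff ip1_commute)

lemma norm1_diff_commute:
  assumes "u \<in> V \<Omega>" "v \<in> V \<Omega>" shows "norm1 \<Omega> (u - v) = norm1 \<Omega> (v - u)"
proof -
  have "ip1 \<Omega> (u - v) (u - v) = ip1 \<Omega> (v - u) (v - u)"
    unfolding ip1_diff[OF assms V_diff[OF assms]] ip1_diff[OF assms(2,1) V_diff[OF assms(2,1)]]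
    using ip1_diff_right[OF assms assms(1)] ip1_diff_right[OF assms assms(2)]
      ip1_diff_right[OF assms(2,1) assms(1)] ip1_diff_right[OF assms(2,1) assms(2)] by linarith
  then show ?thesis unfolding norm1_def by (rule arg_cong)
qed

lemma norm1_diff_le:
  assumes "u \<in> V \<Omega>" "v \<in> V \<Omega>" shows "\<bar>norm1 \<Omega> u - norm1 \<Omega> v\<bar> \<le> norm1 \<Omega> (u - v)"
  unfolding abs_le_iff using norm1_le_add[OF assms] norm1_le_add[OF assms(2,1)] norm1_diff_commute[OF assms] by simp

lemma ip1_diff_le:
  assumes "u \<in> V \<Omega>" "v \<in> V \<Omega>" "u' \<in> V \<Omega>" "v' \<in> V \<Omega>"
  shows "\<bar>ip1 \<Omega> u v - ip1 \<Omega> u' v'\<bar> \<le> norm1 \<Omega> (u - u') * norm1 \<Omega> (v - v')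
     + norm1 \<Omega> (u - u') * norm1 \<Omega> v' + norm1 \<Omega> u' * norm1 \<Omega> (v - v')"
proof -
  have 1: "\<bar>ip1 \<Omega> (u - u') (v - v')\<bar> \<le> norm1 \<Omega> (u - u') * norm1 \<Omega> (v - v')"
    by (rule ip1_Cauchy_Schwarz[OF V_diff[OF assms(1,3)] V_diff[OF assms(2,4)]])
  have 2: "\<bar>ip1 \<Omega> (u - u') v'\<bar> \<le> norm1 \<Omega> (u - u') * norm1 \<Omega> v'"
    by (rule ip1_Cauchy_Schwarz[OF V_diff[OF assms(1,3)] assms(4)])
  have 3: "\<bar>ip1 \<Omega> u' (v - v')\<bar> \<le> norm1 \<Omega> u' * norm1 \<Omega> (v - v')"
    by (rule ip1_Cauchy_Schwarz[OF assms(3) V_diff[OF assms(2,4)]])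
  have "ip1 \<Omega> u v - ip1 \<Omega> u' v' = ip1 \<Omega> (u - u') (v - v') + ip1 \<Omega> (u - u') v' + ip1 \<Omega> u' (v - v')"
    unfolding ip1_diff[OF assms(1,3) V_diff[OF assms(2,4)]] ip1_diff[OF assms(1,3,4)]
      ip1_diff_right[OF assms(2,4) assms(1)] ip1_diff_right[OF assms(2,4) assms(3)] by simp
  with 1 2 3 show ?thesis unfolding abs_le_iff by linarith
qed

lemma ip1_tendsto:
  assumes V: "\<And>n. u n \<in> V \<Omega>" "\<And>n. v n \<in> V \<Omega>" "u' \<in> V \<Omega>" "v' \<in> V \<Omega>"
    and lim: "((\<lambda>n. norm1 \<Omega> (u n - u')) \<longlongrightarrow> 0) F" "((\<lambda>n. norm1 \<Omega> (v n - v')) \<longlongrightarrow> 0) F"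
  shows "((\<lambda>n. ip1 \<Omega> (u n) (v n)) \<longlongrightarrow> ip1 \<Omega> u' v') F"
proof -
  let ?b = "\<lambda>n. norm1 \<Omega> (u n - u') * norm1 \<Omega> (v n - v') + norm1 \<Omega> (u n - u') * norm1 \<Omega> v'
    + norm1 \<Omega> u' * norm1 \<Omega> (v n - v')"
  have "((\<lambda>n. ip1 \<Omega> (u n) (v n) - ip1 \<Omega> u' v') \<longlongrightarrow> 0) F"
  proof (rule Lim_null_comparison)
    show "\<forall>\<^sub>F n in F. norm (ip1 \<Omega> (u n) (v n) - ip1 \<Omega> u' v') \<le> ?b n"
      by (intro always_eventually allI) (simp add: ip1_diff_le V)
    have "(?b \<longlongrightarrow> 0 * 0 + 0 * norm1 \<Omega> v' + norm1 \<Omega> u' * 0) F"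
      by (intro tendsto_intros lim)
    then show "(?b \<longlongrightarrow> 0) F" by simp
  qed
  then show ?thesis by (simp add: LIM_zero_iff)
qed

text \<open>The substitute for the dual space of V. Linearity and the bound are demanded on V only,
  and by the bound such a functional does not distinguish elements of V at \<open>norm1\<close>
  distance 0.\<close>

definition V_functional :: "(vfield \<Rightarrow> real) \<Rightarrow> bool" where
  "V_functional l \<longleftrightarrow>
    (\<forall>u\<in>V \<Omega>. \<forall>v\<in>V \<Omega>. \<forall>c d. l (\<lambda>x. c *\<^sub>R u x + d *\<^sub>R v x) = c * l u + d * l v) \<and>
    (\<exists>K\<ge>0. \<forall>u\<in>V \<Omega>. \<bar>l u\<bar> \<le> K * norm1 \<Omega> u)"

lemma V_functionalD:
  "V_functional l \<Longrightarrow> u \<in> V \<Omega> \<Longrightarrow> v \<in> V \<Omega> \<Longrightarrow> l (\<lambda>x. c *\<^sub>R u x + d *\<^sub>R v x) = c * l u + d * l v"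
  unfolding V_functional_def by blast

lemma V_functional_diff:
  assumes "V_functional l" "u \<in> V \<Omega>" "v \<in> V \<Omega>" shows "l (u - v) = l u - l v"
proof -
  have "l (\<lambda>x. 1 *\<^sub>R u x + (-1) *\<^sub>R v x) = 1 * l u + (-1) * l v"
    by (rule V_functionalD[OF assms, of 1 "-1"])
  then show ?thesis by (simp add: fun_diff_def)
qed

lemma V_functional_zero:
  assumes "V_functional l" "w \<in> V \<Omega>" shows "l (\<lambda>x. 0) = 0"
proof -
  have "l (\<lambda>x. 0 *\<^sub>R w x + 0 *\<^sub>R w x) = 0 * l w + 0 * l w"
    by (rule V_functionalD[OF assms assms(2), of 0 0])
  then show ?thesis by simp
qed

lemma V_functional_scale:
  assumes "V_functional l" "w \<in> V \<Omega>" shows "l (\<lambda>x. c *\<^sub>R w x) = c * l w"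
proof -
  have "l (\<lambda>x. c *\<^sub>R w x + 0 *\<^sub>R w x) = c * l w + 0 * l w"
    by (rule V_functionalD[OF assms assms(2), of c 0])
  then show ?thesis by simp
qed

lemma V_functional_sum:
  assumes "V_functional l" "w \<in> V \<Omega>" "finite A" "A \<subseteq> V \<Omega>"
  shows "(\<lambda>x. \<Sum>y\<in>A. c y *\<^sub>R y x) \<in> V \<Omega> \<and> l (\<lambda>x. \<Sum>y\<in>A. c y *\<^sub>R y x) = (\<Sum>y\<in>A. c y * l y)"
  using assms(3,4)
proof (induction A rule: finite_induct)
  case empty
  then show ?case using V_zero V_functional_zero assms by simp
next
  case (insert a A)
  then have IH: "(\<lambda>x. \<Sum>y\<in>A. c y *\<^sub>R y x) \<in> V \<Omega>" "l (\<lambda>x. \<Sum>y\<in>A. c y *\<^sub>R y x) = (\<Sum>y\<in>A. c y * l y)"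
    "a \<in> V \<Omega>" by auto
  have "l (\<lambda>x. c a *\<^sub>R a x + 1 *\<^sub>R (\<Sum>y\<in>A. c y *\<^sub>R y x)) = c a * l a + 1 * l (\<lambda>x. \<Sum>y\<in>A. c y *\<^sub>R y x)"
    by (rule V_functionalD[OF assms(1) IH(3,1)])
  then show ?case
    using V_lincomb(1)[OF IH(3) IH(1), of "c a" 1] insert IH by simp
qed

lemma V_functional_tendsto:
  assumes l: "V_functional l" and V: "\<And>n. u n \<in> V \<Omega>" "u' \<in> V \<Omega>"
    and lim: "((\<lambda>n. norm1 \<Omega> (u n - u')) \<longlongrightarrow> 0) F"
  shows "((\<lambda>n. l (u n)) \<longlongrightarrow> l u') F"
proof -
  obtain K where K: "\<And>u. u \<in> V \<Omega> \<Longrightarrow> \<bar>l u\<bar> \<le> K * norm1 \<Omega> u"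
    using l unfolding V_functional_def by blast
  have "((\<lambda>n. l (u n) - l u') \<longlongrightarrow> 0) F"
  proof (rule Lim_null_comparison)
    show "\<forall>\<^sub>F n in F. norm (l (u n) - l u') \<le> K * norm1 \<Omega> (u n - u')"
      using K[OF V_diff[OF V(1) V(2)]] V_functional_diff[OF l V(1) V(2)]
      by (intro always_eventually allI) (simp del: fun_diff_def)
    show "((\<lambda>n. K * norm1 \<Omega> (u n - u')) \<longlongrightarrow> 0) F"
      using tendsto_mult[OF tendsto_const[of K] lim] by simp
  qed
  then show ?thesis by (simp add: LIM_zero_iff)
qed

lemma V_functional_ip1: "v \<in> V \<Omega> \<Longrightarrow> V_functional (\<lambda>u. ip1 \<Omega> u v)"
  unfolding V_functional_def
  by (auto simp: ip1_lincomb intro!: exI[of _ "norm1 \<Omega> v"] norm1_nonneg)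
    (metis ip1_Cauchy_Schwarz mult.commute)

lemma V_functional_ip: 
  assumes "v \<in> V \<Omega>" shows "V_functional (\<lambda>u. ip \<Omega> u v)"
proof -
  have "\<bar>ip \<Omega> u v\<bar> \<le> (sqrt sobolev_constant * norm0 \<Omega> v) * norm1 \<Omega> u" if "u \<in> V \<Omega>" for u
  proof -
    have "\<bar>ip \<Omega> u v\<bar> \<le> norm0 \<Omega> u * norm0 \<Omega> v" by (rule ip_Cauchy_Schwarz[OF that assms])
    also have "\<dots> \<le> (sqrt sobolev_constant * norm1 \<Omega> u) * norm0 \<Omega> v"
      by (intro mult_right_mono norm0_le that norm0_nonneg)
    finally show ?thesis by (simp add: mult_ac)
  qed
  moreover have "0 \<le> sqrt sobolev_constant * norm0 \<Omega> v"
    using sobolev_constant_pos norm0_nonneg by simp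
  ultimately show ?thesis
    unfolding V_functional_def using assms by (auto simp: ip_lincomb)
qed

lemma V_functional_lincomb:
  assumes "V_functional l" "V_functional m" shows "V_functional (\<lambda>u. c * l u + d * m u)"
proof -
  obtain K where K: "K \<ge> 0" "\<And>u. u \<in> V \<Omega> \<Longrightarrow> \<bar>l u\<bar> \<le> K * norm1 \<Omega> u"
    using assms(1) unfolding V_functional_def by blast
  obtain L where L: "L \<ge> 0" "\<And>u. u \<in> V \<Omega> \<Longrightarrow> \<bar>m u\<bar> \<le> L * norm1 \<Omega> u"
    using assms(2) unfolding V_functional_def by blast
  have "\<bar>c * l u + d * m u\<bar> \<le> (\<bar>c\<bar> * K + \<bar>d\<bar> * L) * norm1 \<Omega> u" if "u \<in> V \<Omega>" for u
  proof -
    have "\<bar>c * l u + d * m u\<bar> \<le> \<bar>c\<bar> * \<bar>l u\<bar> + \<bar>d\<bar> * \<bar>m u\<bar>"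
      by (metis abs_mult abs_triangle_ineq)
    also have "\<dots> \<le> \<bar>c\<bar> * (K * norm1 \<Omega> u) + \<bar>d\<bar> * (L * norm1 \<Omega> u)"
      by (intro add_mono mult_left_mono K L that) auto
    finally show ?thesis by (simp add: algebra_simps)
  qed
  moreover have "0 \<le> \<bar>c\<bar> * K + \<bar>d\<bar> * L" using K(1) L(1) by simp
  moreover have "c * l (\<lambda>x. a *\<^sub>R u x + b *\<^sub>R v x) + d * m (\<lambda>x. a *\<^sub>R u x + b *\<^sub>R v x)
      = a * (c * l u + d * m u) + b * (c * l v + d * m v)" if "u \<in> V \<Omega>" "v \<in> V \<Omega>" for u v a b
  proof -
    have "l (\<lambda>x. a *\<^sub>R u x + b *\<^sub>R v x) = a * l u + b * l v" "m (\<lambda>x. a *\<^sub>R u x + b *\<^sub>R v x) = a * m u + b * m v"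
      using assms that unfolding V_functional_def by blast+
    then show ?thesis by (simp add: algebra_simps)
  qed
  ultimately show ?thesis unfolding V_functional_def by blast
qed

lemma strongly_measurable_functional:
  assumes S: "S \<in> sets lebesgue" and F: "strongly_measurable \<Omega> (lebesgue_on S) F" and l: "V_functional l"
  shows "(\<lambda>t. l (F t)) \<in> borel_measurable (lebesgue_on S)"
proof -
  obtain X where X: "\<And>n::nat. simple_function (lebesgue_on S) (X n)"
    "\<And>n t. t \<in> space (lebesgue_on S) \<Longrightarrow> X n t \<in> V \<Omega>"
    "AE t in lebesgue_on S. (\<lambda>n. norm1 \<Omega> (X n t - F t)) \<longlonglongrightarrow> 0"
    and FV: "\<And>t. t \<in> space (lebesgue_on S) \<Longrightarrow> F t \<in> V \<Omega>"
    using F unfolding strongly_measurable_def by blast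
  show ?thesis
  proof (rule lebesgue_on_measurable_AE_LIMSEQ[OF S])
    show "(\<lambda>t. l (X n t)) \<in> borel_measurable (lebesgue_on S)" for n
      using simple_function_compose[OF X(1)[of n], of l]
      by (intro borel_measurable_simple_function) (simp add: o_def)
    show "AE t in lebesgue_on S. (\<lambda>n. l (X n t)) \<longlonglongrightarrow> l (F t)"
      using X(3) AE_space by eventually_elim (intro V_functional_tendsto l X FV)
  qed
qed

lemma strongly_measurable_ip1:
  assumes S: "S \<in> sets lebesgue" and F: "strongly_measurable \<Omega> (lebesgue_on S) F"
    and G: "strongly_measurable \<Omega> (lebesgue_on S) G"
  shows "(\<lambda>t. ip1 \<Omega> (F t) (G t)) \<in> borel_measurable (lebesgue_on S)"
proof -
  obtain X where X: "\<And>n::nat. simple_function (lebesgue_on S) (X n)"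
    "\<And>n t. t \<in> space (lebesgue_on S) \<Longrightarrow> X n t \<in> V \<Omega>"
    "AE t in lebesgue_on S. (\<lambda>n. norm1 \<Omega> (X n t - F t)) \<longlonglongrightarrow> 0"
    and FV: "\<And>t. t \<in> space (lebesgue_on S) \<Longrightarrow> F t \<in> V \<Omega>"
    using F unfolding strongly_measurable_def by blast
  obtain Y where Y: "\<And>n::nat. simple_function (lebesgue_on S) (Y n)"
    "\<And>n t. t \<in> space (lebesgue_on S) \<Longrightarrow> Y n t \<in> V \<Omega>"
    "AE t in lebesgue_on S. (\<lambda>n. norm1 \<Omega> (Y n t - G t)) \<longlonglongrightarrow> 0"
    and GV: "\<And>t. t \<in> space (lebesgue_on S) \<Longrightarrow> G t \<in> V \<Omega>"
    using G unfolding strongly_measurable_def by blast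
  show ?thesis
  proof (rule lebesgue_on_measurable_AE_LIMSEQ[OF S])
    show "(\<lambda>t. ip1 \<Omega> (X n t) (Y n t)) \<in> borel_measurable (lebesgue_on S)" for n
      by (intro borel_measurable_simple_function simple_function_compose2[OF X(1) Y(1), of "ip1 \<Omega>"])
    show "AE t in lebesgue_on S. (\<lambda>n. ip1 \<Omega> (X n t) (Y n t)) \<longlonglongrightarrow> ip1 \<Omega> (F t) (G t)"
      using X(3) Y(3) AE_space by eventually_elim (intro ip1_tendsto X Y FV GV)
  qed
qed

lemma strongly_measurable_norm1:
  assumes "S \<in> sets lebesgue" "strongly_measurable \<Omega> (lebesgue_on S) F"
  shows "(\<lambda>t. norm1 \<Omega> (F t)) \<in> borel_measurable (lebesgue_on S)"
proof -
  have [measurable]: "(\<lambda>t. ip1 \<Omega> (F t) (F t)) \<in> borel_measurable (lebesgue_on S)"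
    by (rule strongly_measurable_ip1[OF assms(1,2,2)])
  show ?thesis unfolding norm1_def by measurable
qed

lemma strongly_measurable_diff:
  assumes F: "strongly_measurable \<Omega> M F" and G: "strongly_measurable \<Omega> M G"
  shows "strongly_measurable \<Omega> M (\<lambda>t. F t - G t)"
proof -
  obtain X where X: "\<And>n::nat. simple_function M (X n)"
    "\<And>n t. t \<in> space M \<Longrightarrow> X n t \<in> V \<Omega>"
    "AE t in M. (\<lambda>n. norm1 \<Omega> (X n t - F t)) \<longlonglongrightarrow> 0"
    and FV: "\<And>t. t \<in> space M \<Longrightarrow> F t \<in> V \<Omega>"
    using F unfolding strongly_measurable_def by blast
  obtain Y where Y: "\<And>n::nat. simple_function M (Y n)"
    "\<And>n t. t \<in> space M \<Longrightarrow> Y n t \<in> V \<Omega>"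
    "AE t in M. (\<lambda>n. norm1 \<Omega> (Y n t - G t)) \<longlonglongrightarrow> 0"
    and GV: "\<And>t. t \<in> space M \<Longrightarrow> G t \<in> V \<Omega>"
    using G unfolding strongly_measurable_def by blast
  have "simple_function M (\<lambda>t. X n t - Y n t)" for n
    by (rule simple_function_compose2[OF X(1) Y(1), of "(-)"])
  moreover have "AE t in M. (\<lambda>n. norm1 \<Omega> ((X n t - Y n t) - (F t - G t))) \<longlonglongrightarrow> 0"
    using X(3) Y(3) AE_space
  proof eventually_elim
    case (elim t)
    have "norm1 \<Omega> ((X n t - Y n t) - (F t - G t)) \<le> norm1 \<Omega> (X n t - F t) + norm1 \<Omega> (Y n t - G t)" for n
    proof -
      have "(X n t - Y n t) - (F t - G t) = (X n t - F t) - (Y n t - G t)" by (simp add: fun_eq_iff)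
      moreover have "norm1 \<Omega> ((X n t - F t) - (Y n t - G t)) \<le> norm1 \<Omega> (X n t - F t) + norm1 \<Omega> (Y n t - G t)"
      proof -
        have V: "X n t - F t \<in> V \<Omega>" "Y n t - G t \<in> V \<Omega>" using elim(3) X Y FV GV V_diff by auto
        have "norm1 \<Omega> ((X n t - F t) - (Y n t - G t))
          \<le> norm1 \<Omega> (((X n t - F t) - (Y n t - G t)) - (X n t - F t)) + norm1 \<Omega> (X n t - F t)"
          by (rule norm1_le_add[OF V_diff[OF V] V(1)])
        also have "norm1 \<Omega> (((X n t - F t) - (Y n t - G t)) - (X n t - F t))
          = norm1 \<Omega> ((X n t - F t) - ((X n t - F t) - (Y n t - G t)))"
          by (rule norm1_diff_commute[OF V_diff[OF V] V(1)])
        also have "(X n t - F t) - ((X n t - F t) - (Y n t - G t)) = Y n t - G t" by (simp add: fun_eq_iff)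
        finally show ?thesis by (simp only: add.commute)
      qed
      ultimately show ?thesis by simp
    qed
    moreover have "(\<lambda>n. norm1 \<Omega> (X n t - F t) + norm1 \<Omega> (Y n t - G t)) \<longlonglongrightarrow> 0"
      using tendsto_add[OF elim(1,2)] by simp
    ultimately show ?case
      by (intro tendsto_sandwich[OF _ _ tendsto_const \<open>(\<lambda>n. norm1 \<Omega> (X n t - F t) + norm1 \<Omega> (Y n t - G t)) \<longlonglongrightarrow> 0\<close>])
        (auto simp: norm1_nonneg)
  qed
  ultimately show ?thesis
    unfolding strongly_measurable_def using X(2) Y(2) FV GV V_diff
    by (intro conjI ballI exI[of _ "\<lambda>n t. X n t - Y n t"]) auto
qed

lemma strongly_measurable_const: "v \<in> V \<Omega> \<Longrightarrow> strongly_measurable \<Omega> M (\<lambda>t. v)"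
proof -
  assume v: "v \<in> V \<Omega>"
  have "norm1 \<Omega> (v - v) = 0" using ip1_diff[OF v v V_diff[OF v v]] by (simp add: norm1_def)
  then show ?thesis
    unfolding strongly_measurable_def using v by (intro conjI ballI exI[of _ "\<lambda>n t. v"]) auto
qed

text \<open>A functional maps the approximating V-valued simple functions to real ones and enlarges
  the L1 error at most by its bound K, so the definition of the V-valued integral becomes that of
  the Bochner integral.\<close>

lemma V_integral_functional:
  assumes S: "S \<in> sets lebesgue" and F: "has_V_integral \<Omega> (lebesgue_on S) F w" and l: "V_functional l"
  shows "has_bochner_integral (lebesgue_on S) (\<lambda>t. l (F t)) (l w)"
proof -
  let ?M = "lebesgue_on S"
  obtain X where w: "w \<in> V \<Omega>" and sF: "strongly_measurable \<Omega> ?M F"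
    and X: "\<And>n::nat. simple_function ?M (X n)" "\<And>n t. t \<in> space ?M \<Longrightarrow> X n t \<in> V \<Omega>"
    "\<And>n. emeasure ?M {t \<in> space ?M. X n t \<noteq> (\<lambda>x. 0)} \<noteq> \<infinity>"
    "(\<lambda>n. \<integral>\<^sup>+t. ennreal (norm1 \<Omega> (X n t - F t)) \<partial>?M) \<longlonglongrightarrow> 0"
    "(\<lambda>n. norm1 \<Omega> (simple_V_integral ?M (X n) - w)) \<longlonglongrightarrow> 0"
    using F unfolding has_V_integral_def by blast
  have FV: "F t \<in> V \<Omega>" if "t \<in> space ?M" for t using sF that by (auto simp: strongly_measurable_def)
  obtain K where K: "K \<ge> 0" "\<And>u. u \<in> V \<Omega> \<Longrightarrow> \<bar>l u\<bar> \<le> K * norm1 \<Omega> u"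
    using l unfolding V_functional_def by blast
  have fin: "finite (X n ` space ?M)" for n using X(1) by (simp add: simple_function_def)
  have sub: "X n ` space ?M \<subseteq> V \<Omega>" for n using X(2) by auto
  have SV: "simple_V_integral ?M (X n) \<in> V \<Omega>"
    "l (simple_V_integral ?M (X n)) = (\<Sum>y\<in>X n ` space ?M. measure ?M {t \<in> space ?M. X n t = y} * l y)" for n
    unfolding simple_V_integral_def using V_functional_sum[OF l w fin sub] by auto
  have sb: "Bochner_Integration.simple_bochner_integrable ?M (\<lambda>t. l (X n t))" for n
  proof (rule simple_bochner_integrable.intros)
    show "simple_function ?M (\<lambda>t. l (X n t))"
      using simple_function_compose[OF X(1)[of n], of l] by (simp add: o_def)
    have "{t \<in> space ?M. X n t \<noteq> (\<lambda>x. 0)} = X n -` (- {\<lambda>x. 0}) \<inter> space ?M" by auto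
    then have m: "{t \<in> space ?M. X n t \<noteq> (\<lambda>x. 0)} \<in> sets ?M"
      using simple_functionD(2)[OF X(1)] by metis
    have "emeasure ?M {t \<in> space ?M. l (X n t) \<noteq> 0} \<le> emeasure ?M {t \<in> space ?M. X n t \<noteq> (\<lambda>x. 0)}"
      using V_functional_zero[OF l w] by (intro emeasure_mono m) auto
    then show "emeasure ?M {t \<in> space ?M. l (X n t) \<noteq> 0} \<noteq> \<infinity>"
      using X(3)[of n] by (auto simp: top_unique)
  qed
  show ?thesis
  proof (rule has_bochner_integral.intros)
    show "(\<lambda>t. l (F t)) \<in> borel_measurable ?M" by (rule strongly_measurable_functional[OF S sF l])
    show "Bochner_Integration.simple_bochner_integrable ?M (\<lambda>t. l (X n t))" for n by (rule sb)
    show "(\<lambda>n. \<integral>\<^sup>+t. ennreal (norm (l (F t) - l (X n t))) \<partial>?M) \<longlonglongrightarrow> 0"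
    proof (rule tendsto_sandwich[OF _ _ tendsto_const])
      have nm: "(\<lambda>t. norm1 \<Omega> (X n t - F t)) \<in> borel_measurable ?M" for n
      proof -
        have sX: "strongly_measurable \<Omega> ?M (X n)"
          unfolding strongly_measurable_def
        proof (intro conjI ballI exI[of _ "\<lambda>_. X n"] allI)
          show "AE t in ?M. (\<lambda>_::nat. norm1 \<Omega> (X n t - X n t)) \<longlonglongrightarrow> 0"
            using AE_space
          proof eventually_elim
            case (elim t)
            have "norm1 \<Omega> (X n t - X n t) = 0"
              using ip1_diff[OF X(2)[OF elim] X(2)[OF elim] V_diff[OF X(2)[OF elim] X(2)[OF elim]]] by (simp add: norm1_def)
            then show ?case by simp
          qed
        qed (use X in auto)
        show ?thesis
          by (rule strongly_measurable_norm1[OF S strongly_measurable_diff[OF sX sF]])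
      qed
      have "(\<integral>\<^sup>+t. ennreal (norm (l (F t) - l (X n t))) \<partial>?M)
          \<le> ennreal K * (\<integral>\<^sup>+t. ennreal (norm1 \<Omega> (X n t - F t)) \<partial>?M)" for n
      proof -
        have "(\<integral>\<^sup>+t. ennreal (norm (l (F t) - l (X n t))) \<partial>?M)
            \<le> (\<integral>\<^sup>+t. ennreal K * ennreal (norm1 \<Omega> (X n t - F t)) \<partial>?M)"
        proof (intro nn_integral_mono)
          fix t assume t: "t \<in> space ?M"
          have "norm (l (F t) - l (X n t)) = \<bar>l (X n t - F t)\<bar>"
            using V_functional_diff[OF l X(2)[OF t] FV[OF t]] by (simp del: fun_diff_def)
          also have "\<dots> \<le> K * norm1 \<Omega> (X n t - F t)" by (intro K V_diff X FV t)
          finally show "ennreal (norm (l (F t) - l (X n t))) \<le> ennreal K * ennreal (norm1 \<Omega> (X n t - F t))"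
            using K(1) norm1_nonneg by (simp add: ennreal_mult[symmetric] ennreal_leI)
        qed
        also have "\<dots> = ennreal K * (\<integral>\<^sup>+t. ennreal (norm1 \<Omega> (X n t - F t)) \<partial>?M)"
          using nm by (intro nn_integral_cmult) auto
        finally show ?thesis .
      qed
      then show "\<forall>\<^sub>F n in sequentially. (\<integral>\<^sup>+t. ennreal (norm (l (F t) - l (X n t))) \<partial>?M)
          \<le> ennreal K * (\<integral>\<^sup>+t. ennreal (norm1 \<Omega> (X n t - F t)) \<partial>?M)" by simp
      have "(\<lambda>n. ennreal K * (\<integral>\<^sup>+t. ennreal (norm1 \<Omega> (X n t - F t)) \<partial>?M)) \<longlonglongrightarrow> ennreal K * 0"
        by (intro ennreal_tendsto_cmult X) simp
      then show "(\<lambda>n. ennreal K * (\<integral>\<^sup>+t. ennreal (norm1 \<Omega> (X n t - F t)) \<partial>?M)) \<longlonglongrightarrow> 0" by simp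
    qed simp
    \<comment> \<open>The functional may take equal values on different values of X n, so the sum is
      regrouped according to the values of X n.\<close>
    have "Bochner_Integration.simple_bochner_integral ?M (\<lambda>t. l (X n t)) = l (simple_V_integral ?M (X n))" for n
      unfolding SV(2)
      by (subst simple_bochner_integral_partition[OF sb X(1)[of n], where v=l]) auto
    then show "(\<lambda>n. Bochner_Integration.simple_bochner_integral ?M (\<lambda>t. l (X n t))) \<longlonglongrightarrow> l w"
      using V_functional_tendsto[OF l SV(1) w X(5)] by simp
  qed
qed

end

section \<open>From distributional derivatives to increments, and a Dini criterion\<close>

section \<open>Recovering a function from its distributional derivative\<close>

lemma smooth_step_derivative:
  "(smooth_step has_real_derivative deriv smooth_step x) (at x)"
  "continuous_on UNIV (deriv smooth_step)"
proof -
  have s: "smooth_on UNIV smooth_step" by (rule flat_class_smooth[OF smooth_step_flat_class])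
  then have "Ck_on (Suc 0) UNIV smooth_step" by (simp only: smooth_on_def)
  then have d: "smooth_step differentiable (at x)"
    and c: "continuous_on UNIV (\<lambda>x. frechet_derivative smooth_step (at x) 1)" for x
    by simp_all
  show *: "(smooth_step has_real_derivative deriv smooth_step x) (at x)" for x
    by (simp add: DERIV_deriv_iff_real_differentiable d)
  have "frechet_derivative smooth_step (at x) 1 = deriv smooth_step x" for x
    unfolding frechet_derivative_at[OF *[of x, unfolded has_field_derivative_def], symmetric] by (rule mult_1_right)
  then show "continuous_on UNIV (deriv smooth_step)" using c by (simp only:)
qed

lemma smooth_step_derivative_eq_0:
  assumes "x < 0 \<or> 1 < x" shows "deriv smooth_step x = 0"
proof -
  have "(smooth_step has_real_derivative 0) (at x)"
    using assms
  proof
    assume x: "x < 0"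
    show ?thesis
      by (rule has_field_derivative_transform_within_open[of "\<lambda>x. 0" _ _ "{..<0}"])
        (use x in \<open>auto simp: smooth_step_eq_0\<close>)
  next
    assume x: "1 < x"
    show ?thesis
      by (rule has_field_derivative_transform_within_open[of "\<lambda>x. 1" _ _ "{1<..}"])
        (use x in \<open>auto simp: smooth_step_eq_1\<close>)
  qed
  then show ?thesis by (rule DERIV_imp_deriv)
qed

lemma smooth_step_derivative_bounded:
  obtains B where "B > 0" "\<And>x. \<bar>deriv smooth_step x\<bar> \<le> B"
proof (rule bounded_continuous_compact_support[OF smooth_step_derivative(2), of "{0..1}"])
  show "deriv smooth_step x = 0" if "x \<notin> {0..1}" for x
    using that by (intro smooth_step_derivative_eq_0) auto
  show "compact {0..1::real}" by simp
  fix B :: real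
  assume "0 < B" "\<And>x. \<bar>deriv smooth_step x\<bar> \<le> B"
  then show thesis by (rule that)
qed

lemma integral_lebesgue_on_interval:
  fixes f :: "real \<Rightarrow> real"
  assumes "continuous_on {a..b} f" "{a..b} \<subseteq> S" "S \<in> sets lebesgue" "\<And>t. t \<notin> {a..b} \<Longrightarrow> f t = 0"
  shows "integrable (lebesgue_on S) f" "(\<integral>t. f t \<partial>lebesgue_on S) = integral {a..b} f"
proof -
  have i: "integrable (lebesgue_on {a..b}) f"
    using continuous_imp_integrable_real[OF assms(1)] .
  have eq: "indicat_real S t * f t = indicat_real {a..b} t * f t" for t
    using assms(2,4) by (auto simp: indicator_def)
  show "integrable (lebesgue_on S) f"
    using i assms(3) by (simp add: integrable_restrict_space eq)
  have "(\<integral>t. f t \<partial>lebesgue_on S) = (\<integral>t. f t \<partial>lebesgue_on {a..b})"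
    using assms(3) by (simp add: integral_restrict_space eq)
  then show "(\<integral>t. f t \<partial>lebesgue_on S) = integral {a..b} f"
    using lebesgue_integral_eq_integral[OF i] by simp
qed

text \<open>The derivative of the scaled step is an approximate identity supported in \<open>[a, a + e]\<close>.\<close>

lemma smooth_step_mollifier:
  fixes Y :: "real \<Rightarrow> real"
  assumes Y: "continuous_on {0..} Y" and a: "0 < a"
  defines "m \<equiv> \<lambda>e t. deriv smooth_step ((t - a) / e) / e"
  shows "((\<lambda>e. \<integral>t. m e t * Y t \<partial>lebesgue_on {0<..}) \<longlongrightarrow> Y a) (at_right 0)"
    and "e > 0 \<Longrightarrow> integrable (lebesgue_on {0<..}) (\<lambda>t. m e t * Y t)"
proof -
  obtain B where B: "B > 0" "\<And>x. \<bar>deriv smooth_step x\<bar> \<le> B"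
    by (rule smooth_step_derivative_bounded) blast
  have cont: "continuous_on {a..a + e} (m e)" if "e > 0" for e
    unfolding m_def using that
    by (intro continuous_intros continuous_on_compose2[OF smooth_step_derivative(2)]) auto
  have contY: "continuous_on {a..a + e} Y" if "e > 0" for e
    using a by (intro continuous_on_subset[OF Y]) auto
  have out: "m e t = 0" if "e > 0" "t \<notin> {a..a + e}" for e t
  proof -
    have "(t - a) / e < 0 \<or> 1 < (t - a) / e" using that by (auto simp: field_simps)
    then show ?thesis unfolding m_def by (simp add: smooth_step_derivative_eq_0)
  qed
  have int: "integrable (lebesgue_on {0<..}) (\<lambda>t. m e t * Y t)"
    "(\<integral>t. m e t * Y t \<partial>lebesgue_on {0<..}) = integral {a..a + e} (\<lambda>t. m e t * Y t)" if "e > 0" for e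
  proof -
    have c: "continuous_on {a..a + e} (\<lambda>t. m e t * Y t)"
      by (rule continuous_on_mult[OF cont[OF that] contY[OF that]])
    have s: "{a..a + e} \<subseteq> {0<..}" using a by auto
    have z: "m e t * Y t = 0" if "t \<notin> {a..a + e}" for t using out[OF \<open>e > 0\<close> that] by simp
    show "integrable (lebesgue_on {0<..}) (\<lambda>t. m e t * Y t)"
      "(\<integral>t. m e t * Y t \<partial>lebesgue_on {0<..}) = integral {a..a + e} (\<lambda>t. m e t * Y t)"
      using integral_lebesgue_on_interval[OF c s _ z] by auto
  qed
  show "e > 0 \<Longrightarrow> integrable (lebesgue_on {0<..}) (\<lambda>t. m e t * Y t)" by (rule int)
  have mass: "(m e has_integral 1) {a..a + e}" if "e > 0" for e
  proof -
    have "((\<lambda>t. smooth_step ((t - a) / e)) has_vector_derivative m e t) (at t within {a..a + e})" for t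
    proof -
      have "((\<lambda>t. smooth_step ((t - a) / e)) has_real_derivative deriv smooth_step ((t - a) / e) * (1 / e)) (at t)"
        by (rule DERIV_chain2[OF smooth_step_derivative(1)])
          (use that in \<open>auto intro!: derivative_eq_intros\<close>)
      then show ?thesis
        by (simp add: m_def has_real_derivative_iff_has_vector_derivative has_vector_derivative_at_within)
    qed
    then have "(m e has_integral (smooth_step ((a + e - a) / e) - smooth_step ((a - a) / e))) {a..a + e}"
      using that by (intro fundamental_theorem_of_calculus) auto
    then show ?thesis using that by (simp add: smooth_step_eq_0 smooth_step_eq_1)
  qed
  show "((\<lambda>e. \<integral>t. m e t * Y t \<partial>lebesgue_on {0<..}) \<longlongrightarrow> Y a) (at_right 0)"
  proof (rule tendstoI)
    fix r :: real assume "r > 0"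
    have "continuous (at a within {0..}) Y" using Y a by (simp add: continuous_on_eq_continuous_within)
    \<comment> \<open>The mollifier is at most B / e on an interval of length e, so the tolerance r
      / (2 B) for Y produces a total error of at most r / 2.\<close>
    then obtain d where d: "d > 0" "\<And>t. t \<in> {0..} \<Longrightarrow> dist t a < d \<Longrightarrow> dist (Y t) (Y a) < r / (2 * B)"
      unfolding continuous_within_eps_delta using \<open>r > 0\<close> B(1)
      by (auto dest!: spec[of _ "r / (2 * B)"])
    have "dist (\<integral>t. m e t * Y t \<partial>lebesgue_on {0<..}) (Y a) < r" if e: "0 < e" "e < d" for e
    proof -
      have i1: "((\<lambda>t. m e t * Y t) has_integral (\<integral>t. m e t * Y t \<partial>lebesgue_on {0<..})) {a..a + e}"
        unfolding int(2)[OF e(1)]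
        by (intro integrable_integral integrable_continuous_real continuous_intros cont contY e)
      have i2: "((\<lambda>t. m e t * Y a) has_integral 1 * Y a) {a..a + e}"
        by (rule has_integral_mult_left[OF mass[OF e(1)]])
      have "((\<lambda>t. m e t * (Y t - Y a)) has_integral ((\<integral>t. m e t * Y t \<partial>lebesgue_on {0<..}) - Y a)) (cbox a (a + e))"
        using has_integral_diff[OF i1 i2] by (simp add: right_diff_distrib)
      then have "norm ((\<integral>t. m e t * Y t \<partial>lebesgue_on {0<..}) - Y a) \<le> (r / (2 * e)) * measure lborel (cbox a (a + e))"
      proof (rule has_integral_bound[rotated])
        show "0 \<le> r / (2 * e)" using \<open>r > 0\<close> e by simp
        fix t assume "t \<in> cbox a (a + e)"
        then have t: "a \<le> t" "t \<le> a + e" by auto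
        have "dist (Y t) (Y a) < r / (2 * B)" using t a e by (intro d) (auto simp: dist_real_def)
        then have "\<bar>m e t\<bar> * \<bar>Y t - Y a\<bar> \<le> (B / e) * (r / (2 * B))"
          using B(2)[of "(t - a) / e"] e
          by (intro mult_mono) (auto simp: m_def dist_real_def divide_right_mono)
        then show "norm (m e t * (Y t - Y a)) \<le> r / (2 * e)"
          using B(1) by (simp add: abs_mult)
      qed
      also have "\<dots> = r / 2" using e by simp
      finally show ?thesis using \<open>r > 0\<close> by (simp add: dist_real_def)
    qed
    then show "\<forall>\<^sub>F e in at_right 0. dist (\<integral>t. m e t * Y t \<partial>lebesgue_on {0<..}) (Y a) < r"
      unfolding eventually_at_right_field using d(1) by (intro exI[of _ d]) auto
  qed
qed

text \<open>Tested with smoothed indicators of [a, b], the left side tends to Y a - Y b and the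
  right side to the integral of N. The endpoint 0, which no support may contain, is reached by
  continuity.\<close>

lemma weak_derivative_imp_integral:
  fixes Y N :: "real \<Rightarrow> real"
  assumes Y: "continuous_on {0..} Y" and N: "continuous_on {0..} N"
    and weak: "\<And>\<psi>. test_fun {0<..} \<psi> \<Longrightarrow>
      (\<integral>t. deriv \<psi> t * Y t \<partial>lebesgue_on {0<..}) = (\<integral>t. \<psi> t * N t \<partial>lebesgue_on {0<..})"
    and ab: "0 \<le> a" "a \<le> b"
  shows "Y b - Y a = - integral {a..b} N"
proof -
  have pos: "Y b - Y a = - integral {a..b} N" if ab: "0 < a" "a < b" for a b
  proof -
    define m where "m = (\<lambda>c e t. deriv smooth_step ((t - c) / e) / e)"
    define \<psi> where "\<psi> e t = smooth_step ((t - a) / e) - smooth_step ((t - b) / e)" for e t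
    have cN: "continuous_on {a..b + 1} N" using ab by (intro continuous_on_subset[OF N]) auto
    have "bounded (N ` {a..b + 1})"
      by (intro compact_imp_bounded compact_continuous_image cN) simp
    then obtain C where C: "C > 0" "\<And>t. t \<in> {a..b + 1} \<Longrightarrow> \<bar>N t\<bar> \<le> C"
      by (auto simp: bounded_pos)
    have lim1: "((\<lambda>e. \<integral>t. deriv (\<psi> e) t * Y t \<partial>lebesgue_on {0<..}) \<longlongrightarrow> Y a - Y b) (at_right 0)"
    proof (rule Lim_transform_eventually)
      show "((\<lambda>e. (\<integral>t. m a e t * Y t \<partial>lebesgue_on {0<..}) - (\<integral>t. m b e t * Y t \<partial>lebesgue_on {0<..})) \<longlongrightarrow> Y a - Y b) (at_right 0)"
        unfolding m_def using ab by (intro tendsto_diff smooth_step_mollifier(1)[OF Y]) auto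
      have "(\<integral>t. m a e t * Y t \<partial>lebesgue_on {0<..}) - (\<integral>t. m b e t * Y t \<partial>lebesgue_on {0<..})
          = (\<integral>t. deriv (\<psi> e) t * Y t \<partial>lebesgue_on {0<..})" if e: "e > 0" for e
      proof -
        have "(\<psi> e has_real_derivative m a e t - m b e t) (at t)" for t
        proof -
          have "((\<lambda>t. smooth_step ((t - c) / e)) has_real_derivative m c e t) (at t)" for c
          proof -
            have "((\<lambda>t. smooth_step ((t - c) / e)) has_real_derivative deriv smooth_step ((t - c) / e) * (1 / e)) (at t)"
              by (rule DERIV_chain2[OF smooth_step_derivative(1)])
                (use e in \<open>auto intro!: derivative_eq_intros\<close>)
            then show ?thesis by (simp add: m_def)
          qed
          then show ?thesis unfolding \<psi>_def[abs_def] by (intro DERIV_diff)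
        qed
        then have "deriv (\<psi> e) t = m a e t - m b e t" for t by (rule DERIV_imp_deriv)
        then show ?thesis
          using smooth_step_mollifier(2)[OF Y, of a e] smooth_step_mollifier(2)[OF Y, of b e] ab e
          by (simp add: left_diff_distrib m_def)
      qed
      then show "\<forall>\<^sub>F e in at_right 0. (\<integral>t. m a e t * Y t \<partial>lebesgue_on {0<..}) - (\<integral>t. m b e t * Y t \<partial>lebesgue_on {0<..})
          = (\<integral>t. deriv (\<psi> e) t * Y t \<partial>lebesgue_on {0<..})"
        unfolding eventually_at_right_field by (intro exI[of _ 1]) auto
    qed
    \<comment> \<open>Dominated convergence works along sequences, so the smoothing width is
      discretised; widths at most 1 keep all supports inside [a, b + 1].\<close>
    define ee where "ee n = inverse (real (Suc n))" for n
    have ee: "0 < ee n" "ee n \<le> 1" for n by (auto simp: ee_def field_simps)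
    have "filterlim ee (at_right 0) sequentially"
      unfolding filterlim_at using ee(1) LIMSEQ_inverse_real_of_nat by (auto simp: ee_def[abs_def] simp del: of_nat_Suc)
    from filterlim_compose[OF lim1 this]
    have L1: "(\<lambda>n. \<integral>t. deriv (\<psi> (ee n)) t * Y t \<partial>lebesgue_on {0<..}) \<longlonglongrightarrow> Y a - Y b" .
    have mN: "(\<lambda>t. indicator {a..b + 1} t * N t) \<in> borel_measurable borel"
      using borel_measurable_continuous_on_indicator[OF _ cN] by simp
    have ps: "continuous_on UNIV smooth_step"
      using smooth_step_derivative(1) by (auto intro!: continuous_at_imp_continuous_on DERIV_isCont)
    have m\<psi>: "\<psi> (ee n) \<in> borel_measurable borel" for n
      unfolding \<psi>_def[abs_def] using ee(1)[of n]
      by (intro borel_measurable_continuous_onI continuous_intros continuous_on_compose2[OF ps]) auto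
    have \<psi>0: "\<psi> (ee n) t = 0" if "t \<notin> {a..b + 1}" for n t
    proof -
      have "t < a \<or> t > b + 1" using that by auto
      then show ?thesis
      proof
        assume "t < a"
        then have "(t - a) / ee n \<le> 0" "(t - b) / ee n \<le> 0"
          using ee(1)[of n] ab by (simp_all add: divide_le_0_iff)
        then show ?thesis by (simp add: \<psi>_def smooth_step_eq_0)
      next
        assume "t > b + 1"
        then have "(t - a) / ee n \<ge> 1" "(t - b) / ee n \<ge> 1"
          using ee[of n] ab by (simp_all add: le_divide_eq)
        then show ?thesis by (simp add: \<psi>_def smooth_step_eq_1)
      qed
    qed
    have L2: "(\<lambda>n. \<integral>t. \<psi> (ee n) t * N t \<partial>lebesgue_on {0<..}) \<longlonglongrightarrow> integral {a..b} N"
    proof -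
      have eq: "(\<integral>t. \<psi> (ee n) t * N t \<partial>lebesgue_on {0<..}) = (\<integral>t. \<psi> (ee n) t * (indicator {a..b + 1} t * N t) \<partial>lborel)" for n
      proof -
        have "(\<integral>t. \<psi> (ee n) t * N t \<partial>lebesgue_on {0<..}) = (\<integral>t. indicator {0<..} t *\<^sub>R (\<psi> (ee n) t * N t) \<partial>lebesgue)"
          by (rule integral_restrict_space) auto
        also have "\<dots> = (\<integral>t. \<psi> (ee n) t * (indicator {a..b + 1} t * N t) \<partial>lebesgue)"
        proof (rule Bochner_Integration.integral_cong[OF refl])
          fix t :: real
          show "indicator {0<..} t *\<^sub>R (\<psi> (ee n) t * N t) = \<psi> (ee n) t * (indicator {a..b + 1} t * N t)"
            using \<psi>0[of t n] ab by (cases "t \<in> {a..b + 1}") auto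
        qed
        also have "\<dots> = (\<integral>t. \<psi> (ee n) t * (indicator {a..b + 1} t * N t) \<partial>lborel)"
          using mN m\<psi> by (intro integral_completion) auto
        finally show ?thesis .
      qed
      have "(\<lambda>n. \<integral>t. \<psi> (ee n) t * (indicator {a..b + 1} t * N t) \<partial>lborel)
          \<longlonglongrightarrow> (\<integral>t. indicator {a<..b} t * (indicator {a..b + 1} t * N t) \<partial>lborel)"
      proof (rule integral_dominated_convergence[where w="\<lambda>t. C * indicator {a..b + 1} t"])
        show "AE t in lborel. norm (\<psi> (ee n) t * (indicator {a..b + 1} t * N t)) \<le> C * indicator {a..b + 1} t" for n
        proof (intro AE_I2)
          fix t
          have "\<bar>\<psi> (ee n) t\<bar> \<le> 1"
            unfolding \<psi>_def abs_le_iff using smooth_step_bounds[of "(t - a) / ee n"] smooth_step_bounds[of "(t - b) / ee n"]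
            by simp
          then have "\<bar>\<psi> (ee n) t\<bar> * \<bar>N t\<bar> \<le> 1 * C" if "t \<in> {a..b + 1}"
            using C that by (intro mult_mono) auto
          then show "norm (\<psi> (ee n) t * (indicator {a..b + 1} t * N t)) \<le> C * indicator {a..b + 1} t"
            by (auto simp: abs_mult indicator_def)
        qed
        show "AE t in lborel. (\<lambda>n. \<psi> (ee n) t * (indicator {a..b + 1} t * N t)) \<longlonglongrightarrow> indicator {a<..b} t * (indicator {a..b + 1} t * N t)"
        proof (intro AE_I2 tendsto_mult_right)
          fix t
          have st: "(\<lambda>n. smooth_step ((t - c) / ee n)) \<longlonglongrightarrow> (if t \<le> c then 0 else 1)" for c
          proof (cases "t \<le> c")
            case True
            then have "smooth_step ((t - c) / ee n) = 0" for n
              using ee(1)[of n] by (intro smooth_step_eq_0) (simp add: divide_le_0_iff)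
            then show ?thesis using True by simp
          next
            case False
            then obtain n0 where n0: "1 / (t - c) < real n0" using reals_Archimedean2 by blast
            have "smooth_step ((t - c) / ee n) = 1" if "n \<ge> n0" for n
            proof (rule smooth_step_eq_1)
              have "1 / (t - c) \<le> real (Suc n)" using n0 that by linarith
              then show "1 \<le> (t - c) / ee n" using False by (simp add: ee_def field_simps)
            qed
            then show ?thesis
              using False by (intro tendsto_eventually) (auto simp: eventually_sequentially)
          qed
          have "(\<lambda>n. \<psi> (ee n) t) \<longlonglongrightarrow> (if t \<le> a then 0 else 1) - (if t \<le> b then 0 else 1)"
            unfolding \<psi>_def by (intro tendsto_diff st)
          also have "(if t \<le> a then 0 else 1) - (if t \<le> b then 0 else 1) = (indicator {a<..b} t :: real)"
            using ab by (auto simp: indicator_def)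
          finally show "(\<lambda>n. \<psi> (ee n) t) \<longlonglongrightarrow> indicator {a<..b} t" .
        qed
        show "integrable lborel (\<lambda>t. C * indicator {a..b + 1} t)"
          using ab by (intro integrable_mult_right integrable_real_indicator) auto
      qed (use mN m\<psi> in auto)
      also have "(\<integral>t. indicator {a<..b} t * (indicator {a..b + 1} t * N t) \<partial>lborel) = integral {a..b} N"
      proof -
        have "(\<integral>t. indicator {a<..b} t * (indicator {a..b + 1} t * N t) \<partial>lborel)
            = (\<integral>t. N t * indicator {a..b} t \<partial>lborel)"
        proof (rule integral_cong_AE)
          have "AE t in lborel. t \<noteq> a" by (rule AE_lborel_singleton)
          then show "AE t in lborel. indicator {a<..b} t * (indicator {a..b + 1} t * N t) = N t * indicator {a..b} t"
            by eventually_elim (auto simp: indicator_def)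
          have "continuous_on {a..b} N" by (rule continuous_on_subset[OF cN]) auto
          from borel_measurable_continuous_on_indicator[OF _ this]
          show "(\<lambda>t. N t * indicator {a..b} t) \<in> borel_measurable lborel" by (simp add: mult.commute)
        qed (use mN in auto)
        also have "\<dots> = integral {a..b} N"
        proof -
          have c: "continuous_on {a..b} N" by (rule continuous_on_subset[OF cN]) auto
          then have "set_integrable lborel {a..b} N" by (rule borel_integrable_atLeastAtMost')
          from set_borel_integral_eq_integral(2)[OF this] show ?thesis
            by (simp add: set_lebesgue_integral_def mult.commute)
        qed
        finally show ?thesis .
      qed
      finally show ?thesis by (simp add: eq)
    qed
    have "(\<integral>t. deriv (\<psi> (ee n)) t * Y t \<partial>lebesgue_on {0<..}) = (\<integral>t. \<psi> (ee n) t * N t \<partial>lebesgue_on {0<..})" for n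
      by (rule weak) (use smooth_step_difference_test_fun[OF ab ee(1)[of n]] in \<open>simp add: \<psi>_def[abs_def]\<close>)
    then have "Y a - Y b = integral {a..b} N" using L1 L2 LIMSEQ_unique by simp
    then show ?thesis by simp
  qed
  show ?thesis
  proof (cases "a = b")
    case True
    then show ?thesis by simp
  next
    case False
    then have "a < b" using ab by simp
    show ?thesis
    proof (cases "a > 0")
      case True
      then show ?thesis using pos \<open>a < b\<close> by blast
    next
      case False
      then have [simp]: "a = 0" using ab by simp
      have "0 < b" using \<open>a < b\<close> by simp
      \<comment> \<open>This function is continuous on [0, b] and vanishes on the open interval by
        the case already settled, hence also at 0.\<close>
      let ?D = "\<lambda>t. Y b - Y t + (integral {0..b} N - integral {0..t} N)"
      have Ni: "N integrable_on {0..b}"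
        by (intro integrable_continuous_real continuous_on_subset[OF N]) auto
      have zero: "?D t = 0" if "t \<in> {0<..<b}" for t
      proof -
        have "integral {0..t} N + integral {t..b} N = integral {0..b} N"
          using that Ni by (intro Henstock_Kurzweil_Integration.integral_combine) auto
        then show ?thesis using pos[of t b] that by simp
      qed
      have "continuous_on {0..b} ?D"
        by (intro continuous_intros continuous_on_subset[OF Y] indefinite_integral_continuous_1 Ni) auto
      from continuous_on_Icc_at_rightD[OF this \<open>0 < b\<close>]
      have "(?D \<longlongrightarrow> ?D 0) (at_right 0)" .
      moreover have "(?D \<longlongrightarrow> 0) (at_right 0)"
        by (rule Lim_transform_eventually[OF tendsto_const])
          (use zero \<open>0 < b\<close> in \<open>auto simp: eventually_at_right_field intro!: exI[of _ b]\<close>)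
      ultimately have "?D 0 = 0" using tendsto_unique trivial_limit_at_right_real by blast
      then show ?thesis by simp
    qed
  qed
qed

text \<open>Only a one-sided upper bound on difference quotients is available for the energy. With
  slack \<epsilon> in the slope, the points where f lies below the line of slope \<epsilon> from (a,
  f a) form a compact set; at its last point the hypothesis allows a further step to the right
  unless that point is b.\<close>

lemma dini_nonincreasing:
  fixes f :: "real \<Rightarrow> real"
  assumes cont: "continuous_on {a..b} f" and "a \<le> b"
    and dini: "\<And>t \<epsilon>. a \<le> t \<Longrightarrow> t < b \<Longrightarrow> 0 < \<epsilon> \<Longrightarrow> \<exists>d>0. \<forall>h. 0 < h \<and> h < d \<longrightarrow> f (t + h) - f t \<le> \<epsilon> * h"
  shows "f b \<le> f a"
proof (rule field_le_epsilon)
  fix e :: real assume "e > 0"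
  \<comment> \<open>The summand 1 keeps the quotient meaningful when a = b; the total slack
    \<epsilon> (b - a) stays below e.\<close>
  define \<epsilon> where "\<epsilon> = e / (b - a + 1)"
  have \<epsilon>: "\<epsilon> > 0" using \<open>e > 0\<close> \<open>a \<le> b\<close> by (simp add: \<epsilon>_def)
  define k where "k t = f t - f a - \<epsilon> * (t - a)" for t
  have kc: "continuous_on {a..b} k" unfolding k_def by (intro continuous_intros cont)
  have "k b \<le> 0"
  proof (rule ccontr)
    assume kb: "\<not> k b \<le> 0"
    define T where "T = {a..b} \<inter> k -` {..0}"
    have "closed T" unfolding T_def by (intro continuous_closed_preimage kc) auto
    moreover have "bounded T" unfolding T_def by (rule bounded_subset[OF bounded_closed_interval[of a b]]) auto
    ultimately have "compact T" by (simp add: compact_eq_bounded_closed)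
    moreover have "a \<in> T" using \<open>a \<le> b\<close> by (simp add: T_def k_def)
    ultimately obtain c where c: "c \<in> T" "\<And>t. t \<in> T \<Longrightarrow> t \<le> c"
      using compact_attains_sup[of T] by blast
    have cb: "a \<le> c" "c < b" "k c \<le> 0"
      using c(1) kb by (auto simp: T_def less_le)
    obtain d where d: "d > 0" "\<And>h. 0 < h \<Longrightarrow> h < d \<Longrightarrow> f (c + h) - f c \<le> \<epsilon> * h"
      using dini[OF cb(1,2) \<epsilon>] by blast
    define h where "h = min (d / 2) (b - c)"
    have h: "0 < h" "h < d" "c + h \<le> b" using d(1) cb by (auto simp: h_def)
    have "k (c + h) = k c + (f (c + h) - f c - \<epsilon> * h)" by (simp add: k_def algebra_simps)
    also have "\<dots> \<le> 0" using d(2)[OF h(1,2)] cb(3) by simp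
    finally have "c + h \<in> T" using h cb by (simp add: T_def)
    then show False using c(2)[of "c + h"] h(1) by simp
  qed
  moreover have "\<epsilon> * (b - a) \<le> e"
    using \<open>e > 0\<close> \<open>a \<le> b\<close> by (simp add: \<epsilon>_def field_simps)
  ultimately show "f b \<le> f a + e" by (simp add: k_def)
qed

section \<open>Consequences of the assumptions on the kernel\<close>

section \<open>The memory kernel\<close>

lemma AE_half_line_iff:
  "(AE s in lebesgue_on {0<..}. P s) \<longleftrightarrow> negligible {s::real. 0 < s \<and> \<not> P s}"
proof -
  have "(AE s in lebesgue_on {0<..}. P s) \<longleftrightarrow> (AE s in lebesgue. s \<in> {0<..} \<longrightarrow> P s)"
    by (rule AE_restrict_space_iff) auto
  also have "\<dots> \<longleftrightarrow> {s. \<not> (s \<in> {0<..} \<longrightarrow> P s)} \<in> null_sets lebesgue"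
    by (subst completion.AE_iff_null_sets) simp
  finally show ?thesis by (simp add: negligible_iff_null_sets)
qed

text \<open>Translations preserve null sets. This allows the history formula at time t + h to be
  read at s + h for almost every s.\<close>

lemma AE_half_line_shift:
  assumes "AE s in lebesgue_on {0<..}. P s" "0 \<le> h"
  shows "AE s in lebesgue_on {0<..}. P (s + h :: real)"
proof -
  have "negligible {s::real. 0 < s \<and> \<not> P s}" using assms(1) by (simp add: AE_half_line_iff)
  then have "negligible ((+) (- h) ` {s::real. 0 < s \<and> \<not> P s})" by (rule negligible_translation)
  moreover have "{s::real. 0 < s \<and> \<not> P (s + h)} \<subseteq> (+) (- h) ` {s::real. 0 < s \<and> \<not> P s}"
  proof
    fix s assume "s \<in> {s::real. 0 < s \<and> \<not> P (s + h)}"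
    then have "s + h \<in> {s::real. 0 < s \<and> \<not> P s}" "s = - h + (s + h)" using assms(2) by auto
    then show "s \<in> (+) (- h) ` {s::real. 0 < s \<and> \<not> P s}" by blast
  qed
  ultimately show ?thesis unfolding AE_half_line_iff by (rule negligible_subset)
qed

lemma half_line_integral_shift:
  fixes f :: "real \<Rightarrow> real"
  assumes f: "integrable (lebesgue_on {0<..}) f" and "0 \<le> h"
  shows "integrable (lebesgue_on {0<..}) (\<lambda>s. f (s + h))"
    and "(\<integral>s. f (s + h) \<partial>lebesgue_on {0<..}) = (\<integral>s. indicator {h<..} s * f s \<partial>lebesgue_on {0<..})"
proof -
  let ?F = "\<lambda>s. indicat_real {h<..} s * f s"
  have "integrable lebesgue (\<lambda>s. indicat_real {0<..} s * f s)"
    using f by (simp add: integrable_restrict_space)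
  from integrable_mult_indicator[OF _ this, of "{h<..}"]
  have "integrable lebesgue (\<lambda>s. indicat_real {h<..} s * (indicat_real {0<..} s * f s))" by simp
  moreover have eq: "indicat_real {h<..} s * (indicat_real {0<..} s * f s) = ?F s"
    "indicat_real {0<..} s * ?F s = ?F s" for s
    using assms(2) by (auto simp: indicator_def)
  ultimately have "has_bochner_integral lebesgue ?F (\<integral>s. ?F s \<partial>lebesgue)"
    by (simp add: has_bochner_integral_iff)
  then have "has_bochner_integral lebesgue (\<lambda>s. ?F (h + 1 * s)) ((\<integral>s. ?F s \<partial>lebesgue) /\<^sub>R \<bar>1\<bar>)"
    by (subst (asm) has_bochner_integral_lebesgue_real_affine_iff[of 1 _ _ h]) simp_all
  moreover have "?F (h + 1 * s) = indicat_real {0<..} s * f (s + h)" for s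
    by (auto simp: indicator_def add.commute)
  ultimately have *: "has_bochner_integral lebesgue (\<lambda>s. indicat_real {0<..} s * f (s + h)) (\<integral>s. ?F s \<partial>lebesgue)"
    by simp
  then show "integrable (lebesgue_on {0<..}) (\<lambda>s. f (s + h))"
    by (simp add: integrable_restrict_space has_bochner_integral_iff)
  have "(\<integral>s. f (s + h) \<partial>lebesgue_on {0<..}) = (\<integral>s. ?F s \<partial>lebesgue)"
    using * by (simp add: integral_restrict_space has_bochner_integral_iff)
  also have "\<dots> = (\<integral>s. ?F s \<partial>lebesgue_on {0<..})"
    by (subst integral_restrict_space) (simp_all only: eq(2) real_scaleR_def, simp_all)
  finally show "(\<integral>s. f (s + h) \<partial>lebesgue_on {0<..}) = (\<integral>s. ?F s \<partial>lebesgue_on {0<..})" .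
qed

text \<open>The form in which the kernel enters the decay proof: the differential inequality in
  integrated form, and a lower bound m near 0, where the velocity is recovered from the
  history.\<close>

locale decaying_kernel =
  fixes \<mu> :: "real \<Rightarrow> real" and \<delta> m s1 :: real
  assumes mu_nonneg: "0 < s \<Longrightarrow> 0 \<le> \<mu> s"
    and mu_antimono: "0 < r \<Longrightarrow> r \<le> s \<Longrightarrow> \<mu> s \<le> \<mu> r"
    and mu_continuous: "continuous_on {0<..} \<mu>"
    and mu_integrable: "integrable (lebesgue_on {0<..}) \<mu>"
    and delta_pos: "0 < \<delta>"
    and mu_decay: "0 < s \<Longrightarrow> 0 \<le> h \<Longrightarrow> \<mu> (s + h) \<le> exp (- \<delta> * h) * \<mu> s"
    and m_pos: "0 < m" and s1_pos: "0 < s1"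
    and mu_ge: "0 < s \<Longrightarrow> s \<le> s1 \<Longrightarrow> m \<le> \<mu> s"

text \<open>Smoothness of \<open>g\<close> makes \<open>\<mu>\<close> continuously differentiable, so that the differential
  inequality holds everywhere.\<close>

lemma memory_kernel_decaying:
  assumes "memory_kernel g \<mu>"
  obtains \<delta> m s1 where "decaying_kernel \<mu> \<delta> m s1"
proof -
  from assms have sm: "smooth_on {0<..} g" and mu: "\<And>s. s > 0 \<Longrightarrow> \<mu> s = - deriv g s"
    and nn: "\<And>s. s > 0 \<Longrightarrow> 0 \<le> \<mu> s" and anti: "\<And>r s. 0 < r \<Longrightarrow> r \<le> s \<Longrightarrow> \<mu> s \<le> \<mu> r"
    and int: "integrable (lebesgue_on {0<..}) \<mu>" and pos: "0 < (\<integral>s. \<mu> s \<partial>lebesgue_on {0<..})"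
    and ex: "\<exists>\<delta>>0. AE s in lebesgue_on {0<..}. deriv \<mu> s + \<delta> * \<mu> s \<le> 0"
    unfolding memory_kernel_def by blast+
  obtain \<delta> where \<delta>: "\<delta> > 0" "AE s in lebesgue_on {0<..}. deriv \<mu> s + \<delta> * \<mu> s \<le> 0"
    using ex by blast
  have "Ck_on (Suc (Suc 0)) {0<..} g" using sm by (simp only: smooth_on_def)
  then have gd: "g differentiable (at x)"
    and g1d: "(\<lambda>x. frechet_derivative g (at x) 1) differentiable (at x)"
    and g2c: "continuous_on {0<..} (\<lambda>x. frechet_derivative (\<lambda>x. frechet_derivative g (at x) 1) (at x) 1)"
    if "x > 0" for x
    using that by auto
  have fr1: "frechet_derivative f (at x) 1 = deriv f x" if "f differentiable (at x)" for f :: "real \<Rightarrow> real" and x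
  proof -
    have "(f has_real_derivative deriv f x) (at x)"
      using that by (simp add: DERIV_deriv_iff_real_differentiable)
    from frechet_derivative_at[OF this[unfolded has_field_derivative_def], symmetric]
    show ?thesis by simp
  qed
  define h where "h x = frechet_derivative (\<lambda>x. frechet_derivative g (at x) 1) (at x) 1" for x
  have hc: "continuous_on {0<..} h" using g2c[of 1] by (simp add: h_def[abs_def])
  have mud: "(\<mu> has_real_derivative - h x) (at x)" if x: "x > 0" for x
  proof -
    have "((\<lambda>x. frechet_derivative g (at x) 1) has_real_derivative h x) (at x)"
      unfolding h_def fr1[OF g1d[OF x]] using g1d[OF x] by (simp add: DERIV_deriv_iff_real_differentiable)
    then have "((\<lambda>x. - frechet_derivative g (at x) 1) has_real_derivative - h x) (at x)"
      by (rule DERIV_minus)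
    then show ?thesis
      by (rule has_field_derivative_transform_within_open[where S="{0<..}"])
        (use x in \<open>auto simp: mu fr1 gd\<close>)
  qed
  have muc: "continuous_on {0<..} \<mu>"
    using mud by (auto intro!: continuous_at_imp_continuous_on DERIV_isCont)
  have ineq: "- h s + \<delta> * \<mu> s \<le> 0" if "s > 0" for s
  proof (rule ccontr)
    assume "\<not> - h s + \<delta> * \<mu> s \<le> 0"
    \<comment> \<open>By continuity the inequality would fail on a nonempty open set, which cannot
      be null.\<close>
    let ?S = "{0<..} \<inter> (\<lambda>s. - h s + \<delta> * \<mu> s) -` {0<..}"
    have "open ?S"
      by (intro continuous_open_preimage continuous_intros hc muc)
    moreover have "s \<in> ?S" using that \<open>\<not> - h s + \<delta> * \<mu> s \<le> 0\<close> by auto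
    ultimately have "\<not> negligible ?S" using open_not_negligible by blast
    moreover have "negligible {s. 0 < s \<and> \<not> deriv \<mu> s + \<delta> * \<mu> s \<le> 0}"
      using \<delta>(2) unfolding AE_half_line_iff .
    then have "negligible ?S"
      by (rule negligible_subset) (use mud DERIV_imp_deriv in fastforce)
    ultimately show False by blast
  qed
  have decay: "\<mu> (s + r) \<le> exp (- \<delta> * r) * \<mu> s" if "s > 0" "r \<ge> 0" for s r
  proof -
    have "\<mu> (s + r) * exp (\<delta> * (s + r)) \<le> \<mu> s * exp (\<delta> * s)"
    proof (rule DERIV_nonpos_imp_nonincreasing[of s "s + r" "\<lambda>s. \<mu> s * exp (\<delta> * s)"])
      fix x assume "s \<le> x"
      then have x: "x > 0" using that by simp
      have "((\<lambda>s. \<mu> s * exp (\<delta> * s)) has_real_derivative (- h x + \<delta> * \<mu> x) * exp (\<delta> * x)) (at x)"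
        by (rule derivative_eq_intros mud[OF x] refl | simp add: algebra_simps)+
      moreover have "(- h x + \<delta> * \<mu> x) * exp (\<delta> * x) \<le> 0"
        using ineq[OF x] by (simp add: mult_le_0_iff)
      ultimately show "\<exists>y. ((\<lambda>s. \<mu> s * exp (\<delta> * s)) has_real_derivative y) (at x) \<and> y \<le> 0" by blast
    qed (use that in simp)
    then have "\<mu> (s + r) * exp (\<delta> * (s + r)) * exp (- \<delta> * (s + r)) \<le> \<mu> s * exp (\<delta> * s) * exp (- \<delta> * (s + r))"
      by (rule mult_right_mono) simp
    then show ?thesis by (simp add: mult.assoc exp_add[symmetric] algebra_simps)
  qed
  have "\<exists>s>0. \<mu> s > 0"
  proof (rule ccontr)
    assume "\<not> (\<exists>s>0. \<mu> s > 0)"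
    then have z: "\<mu> s = 0" if "s > 0" for s using nn[OF that] that by force
    have "(\<integral>s. \<mu> s \<partial>lebesgue_on {0<..}) = (\<integral>s. 0 \<partial>lebesgue_on {(0::real)<..})"
      by (rule Bochner_Integration.integral_cong[OF refl]) (simp add: z)
    then show False using pos by simp
  qed
  \<comment> \<open>Since \<open>\<mu>\<close> is nonincreasing, its value at s1 serves as the lower
    bound m on (0, s1].\<close>
  then obtain s1 where s1: "s1 > 0" "\<mu> s1 > 0" by blast
  have "decaying_kernel \<mu> \<delta> (\<mu> s1) s1"
    by unfold_locales (use nn anti muc int \<delta>(1) decay s1 in auto)
  then show ?thesis by (rule that)
qed

section \<open>The weighted space of histories\<close>

section \<open>The memory space\<close>

locale voigt = bounded_open \<Omega> + decaying_kernel \<mu> \<delta> m s1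
  for \<Omega> :: "(real^3) set" and \<mu> :: "real \<Rightarrow> real" and \<delta> m s1 :: real +
  fixes \<alpha> :: real
  assumes alpha_pos: "0 < \<alpha>"
begin

abbreviation "half_line \<equiv> lebesgue_on {(0::real)<..}"

definition kappa :: real where "kappa = (\<integral>s. \<mu> s \<partial>half_line)"

lemma mu_measurable: "\<mu> \<in> borel_measurable half_line"
  using mu_integrable by auto

lemma kappa_nonneg: "0 \<le> kappa"
  unfolding kappa_def by (intro integral_nonneg_AE AE_I2) (use mu_nonneg in auto)

lemma memory_V: "\<eta> \<in> memory_space \<Omega> \<mu> \<Longrightarrow> 0 < s \<Longrightarrow> \<eta> s \<in> V \<Omega>"
  by (auto simp: memory_space_def strongly_measurable_def)

lemma memory_strongly_measurable:
  "\<eta> \<in> memory_space \<Omega> \<mu> \<Longrightarrow> strongly_measurable \<Omega> half_line \<eta>"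
  by (simp add: memory_space_def)

text \<open>Multiplying by the square root of the weight reduces the memory space to plain L2 on the
  half-line, so the Cauchy-Schwarz inequality for \<open>sqint\<close> becomes available.\<close>

lemma memory_sqint:
  assumes "\<eta> \<in> memory_space \<Omega> \<mu>"
  shows "(\<lambda>s. sqrt (\<mu> s) * norm1 \<Omega> (\<eta> s)) \<in> sqint half_line"
proof -
  have [measurable]: "(\<lambda>s. norm1 \<Omega> (\<eta> s)) \<in> borel_measurable half_line"
    by (intro strongly_measurable_norm1 memory_strongly_measurable assms) auto
  note [measurable] = mu_measurable
  have i: "integrable half_line (\<lambda>s. \<mu> s * (norm1 \<Omega> (\<eta> s))\<^sup>2)"
    using assms by (simp add: memory_space_def)
  show ?thesis
  proof (rule sqint_bound[OF _ i])
    show "AE s in half_line. (norm (sqrt (\<mu> s) * norm1 \<Omega> (\<eta> s)))\<^sup>2 \<le> \<mu> s * (norm1 \<Omega> (\<eta> s))\<^sup>2"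
      by (intro AE_I2) (use mu_nonneg in \<open>auto simp: power_mult_distrib\<close>)
  qed measurable
qed

lemma memory_norm_prod:
  assumes "\<eta> \<in> memory_space \<Omega> \<mu>" "\<xi> \<in> memory_space \<Omega> \<mu>"
  shows "integrable half_line (\<lambda>s. \<mu> s * (norm1 \<Omega> (\<eta> s) * norm1 \<Omega> (\<xi> s)))"
    and "(\<integral>s. \<mu> s * (norm1 \<Omega> (\<eta> s) * norm1 \<Omega> (\<xi> s)) \<partial>half_line)
      \<le> norm_memory \<Omega> \<mu> \<eta> * norm_memory \<Omega> \<mu> \<xi>"
proof -
  have eq: "(sqrt (\<mu> s) * a) * (sqrt (\<mu> s) * b) = \<mu> s * (a * b)" if "s \<in> space half_line" for s a b
  proof -
    have "(sqrt (\<mu> s) * a) * (sqrt (\<mu> s) * b) = (sqrt (\<mu> s) * sqrt (\<mu> s)) * (a * b)" by (simp only: mult_ac)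
    then show ?thesis using mu_nonneg[of s] that by simp
  qed
  have nm: "(\<integral>s. (sqrt (\<mu> s) * norm1 \<Omega> (\<zeta> s))\<^sup>2 \<partial>half_line) = ip_memory \<Omega> \<mu> \<zeta> \<zeta>" for \<zeta>
    unfolding ip_memory_def
    by (intro Bochner_Integration.integral_cong) (auto simp: power_mult_distrib mu_nonneg norm1_power2)
  show "integrable half_line (\<lambda>s. \<mu> s * (norm1 \<Omega> (\<eta> s) * norm1 \<Omega> (\<xi> s)))"
    using sqint_mult_integrable[OF assms[THEN memory_sqint]]
    by (subst Bochner_Integration.integrable_cong[OF refl eq[symmetric]])
  have "(\<integral>s. \<mu> s * (norm1 \<Omega> (\<eta> s) * norm1 \<Omega> (\<xi> s)) \<partial>half_line)
      = (\<integral>s. (sqrt (\<mu> s) * norm1 \<Omega> (\<eta> s)) * (sqrt (\<mu> s) * norm1 \<Omega> (\<xi> s)) \<partial>half_line)"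
    by (rule Bochner_Integration.integral_cong[OF refl eq[symmetric]])
  also have "\<dots> \<le> \<bar>\<integral>s. (sqrt (\<mu> s) * norm1 \<Omega> (\<eta> s)) * (sqrt (\<mu> s) * norm1 \<Omega> (\<xi> s)) \<partial>half_line\<bar>" by simp
  also have "\<dots> \<le> norm_memory \<Omega> \<mu> \<eta> * norm_memory \<Omega> \<mu> \<xi>"
    using sqint_inner_Cauchy_Schwarz[OF assms[THEN memory_sqint]] by (simp add: nm norm_memory_def)
  finally show "(\<integral>s. \<mu> s * (norm1 \<Omega> (\<eta> s) * norm1 \<Omega> (\<xi> s)) \<partial>half_line)
      \<le> norm_memory \<Omega> \<mu> \<eta> * norm_memory \<Omega> \<mu> \<xi>" .
qed

lemma memory_ip1_measurable:
  "\<eta> \<in> memory_space \<Omega> \<mu> \<Longrightarrow> \<xi> \<in> memory_space \<Omega> \<mu> \<Longrightarrow>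
    (\<lambda>s. ip1 \<Omega> (\<eta> s) (\<xi> s)) \<in> borel_measurable half_line"
  by (intro strongly_measurable_ip1 memory_strongly_measurable) auto

lemma memory_ip1_bound:
  assumes "\<eta> \<in> memory_space \<Omega> \<mu>" "\<xi> \<in> memory_space \<Omega> \<mu>" "0 < s"
  shows "\<bar>\<mu> s * ip1 \<Omega> (\<eta> s) (\<xi> s)\<bar> \<le> \<mu> s * (norm1 \<Omega> (\<eta> s) * norm1 \<Omega> (\<xi> s))"
  unfolding abs_mult abs_of_nonneg[OF mu_nonneg[OF assms(3)]]
  by (intro mult_left_mono ip1_Cauchy_Schwarz memory_V assms mu_nonneg)

lemma memory_integrable:
  assumes "\<eta> \<in> memory_space \<Omega> \<mu>" "\<xi> \<in> memory_space \<Omega> \<mu>"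
  shows "integrable half_line (\<lambda>s. \<mu> s * ip1 \<Omega> (\<eta> s) (\<xi> s))"
proof (rule Bochner_Integration.integrable_bound[OF memory_norm_prod(1)[OF assms]])
  show "(\<lambda>s. \<mu> s * ip1 \<Omega> (\<eta> s) (\<xi> s)) \<in> borel_measurable half_line"
    by (intro borel_measurable_times mu_measurable memory_ip1_measurable assms)
  show "AE s in half_line. norm (\<mu> s * ip1 \<Omega> (\<eta> s) (\<xi> s)) \<le> norm (\<mu> s * (norm1 \<Omega> (\<eta> s) * norm1 \<Omega> (\<xi> s)))"
  proof (intro AE_I2)
    fix s assume "s \<in> space half_line"
    then have "0 < s" by simp
    from memory_ip1_bound[OF assms this]
    show "norm (\<mu> s * ip1 \<Omega> (\<eta> s) (\<xi> s)) \<le> norm (\<mu> s * (norm1 \<Omega> (\<eta> s) * norm1 \<Omega> (\<xi> s)))"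
      unfolding real_norm_def by (rule order_trans) (rule abs_ge_self)
  qed
qed

lemma ip_memory_Cauchy_Schwarz:
  assumes "\<eta> \<in> memory_space \<Omega> \<mu>" "\<xi> \<in> memory_space \<Omega> \<mu>"
  shows "\<bar>ip_memory \<Omega> \<mu> \<eta> \<xi>\<bar> \<le> norm_memory \<Omega> \<mu> \<eta> * norm_memory \<Omega> \<mu> \<xi>"
proof -
  have "\<bar>ip_memory \<Omega> \<mu> \<eta> \<xi>\<bar> \<le> (\<integral>s. \<bar>\<mu> s * ip1 \<Omega> (\<eta> s) (\<xi> s)\<bar> \<partial>half_line)"
    using integral_norm_bound[of half_line "\<lambda>s. \<mu> s * ip1 \<Omega> (\<eta> s) (\<xi> s)"] unfolding ip_memory_def real_norm_def .
  also have "\<dots> \<le> (\<integral>s. \<mu> s * (norm1 \<Omega> (\<eta> s) * norm1 \<Omega> (\<xi> s)) \<partial>half_line)"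
    by (intro integral_mono integrable_abs memory_integrable memory_norm_prod(1) assms memory_ip1_bound) simp
  also note memory_norm_prod(2)[OF assms]
  finally show ?thesis .
qed

lemma ip_memory_nonneg: "0 \<le> ip_memory \<Omega> \<mu> \<eta> \<eta>"
  unfolding ip_memory_def
  by (intro integral_nonneg_AE AE_I2) (auto intro!: mult_nonneg_nonneg mu_nonneg ip1_nonneg)

lemma norm_memory_nonneg: "0 \<le> norm_memory \<Omega> \<mu> \<eta>"
  by (simp add: norm_memory_def ip_memory_nonneg)

lemma norm_memory_power2: "(norm_memory \<Omega> \<mu> \<eta>)\<^sup>2 = ip_memory \<Omega> \<mu> \<eta> \<eta>"
  by (simp add: norm_memory_def ip_memory_nonneg)

lemma memory_diff:
  assumes "\<eta> \<in> memory_space \<Omega> \<mu>" "\<xi> \<in> memory_space \<Omega> \<mu>"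
  shows "\<eta> - \<xi> \<in> memory_space \<Omega> \<mu>"
proof -
  have sm: "strongly_measurable \<Omega> half_line (\<lambda>s. \<eta> s - \<xi> s)"
    by (intro strongly_measurable_diff memory_strongly_measurable assms)
  have "integrable half_line (\<lambda>s. \<mu> s * ip1 \<Omega> (\<eta> s - \<xi> s) (\<eta> s - \<xi> s))"
  proof (subst Bochner_Integration.integrable_cong[OF refl])
    fix s assume "s \<in> space half_line"
    then have v: "\<eta> s \<in> V \<Omega>" "\<xi> s \<in> V \<Omega>" by (auto intro: memory_V assms)
    show "\<mu> s * ip1 \<Omega> (\<eta> s - \<xi> s) (\<eta> s - \<xi> s) = \<mu> s * ip1 \<Omega> (\<eta> s) (\<eta> s)
       - \<mu> s * ip1 \<Omega> (\<eta> s) (\<xi> s) - (\<mu> s * ip1 \<Omega> (\<xi> s) (\<eta> s) - \<mu> s * ip1 \<Omega> (\<xi> s) (\<xi> s))"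
      unfolding ip1_diff[OF v V_diff[OF v]] ip1_diff_right[OF v v(1)] ip1_diff_right[OF v v(2)]
      by (simp add: algebra_simps)
  qed (intro Bochner_Integration.integrable_diff memory_integrable assms)
  then show ?thesis
    using sm by (simp add: memory_space_def norm1_power2 fun_diff_def[of \<eta> \<xi>])
qed

lemma ip_memory_diff:
  assumes "\<eta> \<in> memory_space \<Omega> \<mu>" "\<xi> \<in> memory_space \<Omega> \<mu>" "\<zeta> \<in> memory_space \<Omega> \<mu>"
  shows "ip_memory \<Omega> \<mu> (\<eta> - \<xi>) \<zeta> = ip_memory \<Omega> \<mu> \<eta> \<zeta> - ip_memory \<Omega> \<mu> \<xi> \<zeta>"
proof -
  have "ip_memory \<Omega> \<mu> (\<eta> - \<xi>) \<zeta> = (\<integral>s. \<mu> s * ip1 \<Omega> (\<eta> s) (\<zeta> s) - \<mu> s * ip1 \<Omega> (\<xi> s) (\<zeta> s) \<partial>half_line)"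
    unfolding ip_memory_def
  proof (rule Bochner_Integration.integral_cong[OF refl])
    fix s assume "s \<in> space half_line"
    then have "\<eta> s \<in> V \<Omega>" "\<xi> s \<in> V \<Omega>" "\<zeta> s \<in> V \<Omega>" by (auto intro: memory_V assms)
    then show "\<mu> s * ip1 \<Omega> ((\<eta> - \<xi>) s) (\<zeta> s) = \<mu> s * ip1 \<Omega> (\<eta> s) (\<zeta> s) - \<mu> s * ip1 \<Omega> (\<xi> s) (\<zeta> s)"
      by (simp add: fun_diff_def[of \<eta> \<xi>] ip1_diff right_diff_distrib)
  qed
  then show ?thesis
    using memory_integrable[OF assms(1,3)] memory_integrable[OF assms(2,3)] by (simp add: ip_memory_def)
qed

lemma norm_memory_le_add:
  assumes "\<eta> \<in> memory_space \<Omega> \<mu>" "\<xi> \<in> memory_space \<Omega> \<mu>"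
  shows "norm_memory \<Omega> \<mu> \<eta> \<le> norm_memory \<Omega> \<mu> (\<eta> - \<xi>) + norm_memory \<Omega> \<mu> \<xi>"
proof (cases "norm_memory \<Omega> \<mu> \<eta> = 0")
  case True
  then show ?thesis using norm_memory_nonneg[of "\<eta> - \<xi>"] norm_memory_nonneg[of \<xi>] by simp
next
  case False
  have 1: "norm_memory \<Omega> \<mu> \<eta> * norm_memory \<Omega> \<mu> \<eta> = ip_memory \<Omega> \<mu> (\<eta> - \<xi>) \<eta> + ip_memory \<Omega> \<mu> \<xi> \<eta>"
    using ip_memory_diff[OF assms assms(1)] norm_memory_power2[of \<eta>] unfolding power2_eq_square by linarith
  have 2: "ip_memory \<Omega> \<mu> (\<eta> - \<xi>) \<eta> \<le> norm_memory \<Omega> \<mu> (\<eta> - \<xi>) * norm_memory \<Omega> \<mu> \<eta>"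
    by (rule order_trans[OF abs_ge_self ip_memory_Cauchy_Schwarz[OF memory_diff[OF assms] assms(1)]])
  have 3: "ip_memory \<Omega> \<mu> \<xi> \<eta> \<le> norm_memory \<Omega> \<mu> \<xi> * norm_memory \<Omega> \<mu> \<eta>"
    by (rule order_trans[OF abs_ge_self ip_memory_Cauchy_Schwarz[OF assms(2,1)]])
  have "norm_memory \<Omega> \<mu> \<eta> * norm_memory \<Omega> \<mu> \<eta>
      \<le> (norm_memory \<Omega> \<mu> (\<eta> - \<xi>) + norm_memory \<Omega> \<mu> \<xi>) * norm_memory \<Omega> \<mu> \<eta>"
    unfolding distrib_right 1 by (rule add_mono[OF 2 3])
  then show ?thesis
    by (rule mult_right_le_imp_le) (use False norm_memory_nonneg[of \<eta>] in linarith)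
qed

lemma norm_memory_diff_commute:
  assumes "\<eta> \<in> memory_space \<Omega> \<mu>" "\<xi> \<in> memory_space \<Omega> \<mu>"
  shows "norm_memory \<Omega> \<mu> (\<eta> - \<xi>) = norm_memory \<Omega> \<mu> (\<xi> - \<eta>)"
proof -
  have "ip_memory \<Omega> \<mu> (\<eta> - \<xi>) (\<eta> - \<xi>) = ip_memory \<Omega> \<mu> (\<xi> - \<eta>) (\<xi> - \<eta>)"
    unfolding ip_memory_def
  proof (rule Bochner_Integration.integral_cong[OF refl])
    fix s assume "s \<in> space half_line"
    then have "norm1 \<Omega> (\<eta> s - \<xi> s) = norm1 \<Omega> (\<xi> s - \<eta> s)"
      by (intro norm1_diff_commute memory_V assms) simp_all
    then show "\<mu> s * ip1 \<Omega> ((\<eta> - \<xi>) s) ((\<eta> - \<xi>) s) = \<mu> s * ip1 \<Omega> ((\<xi> - \<eta>) s) ((\<xi> - \<eta>) s)"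
      by (simp add: norm1_power2[symmetric] fun_diff_def[of \<eta> \<xi>] fun_diff_def[of \<xi> \<eta>])
  qed
  then show ?thesis by (simp add: norm_memory_def)
qed

lemma norm_memory_diff_le:
  assumes "\<eta> \<in> memory_space \<Omega> \<mu>" "\<xi> \<in> memory_space \<Omega> \<mu>"
  shows "\<bar>norm_memory \<Omega> \<mu> \<eta> - norm_memory \<Omega> \<mu> \<xi>\<bar> \<le> norm_memory \<Omega> \<mu> (\<eta> - \<xi>)"
  unfolding abs_le_iff
  using norm_memory_le_add[OF assms] norm_memory_le_add[OF assms(2,1)] norm_memory_diff_commute[OF assms] by simp

text \<open>Summability of \<open>\<mu>\<close> admits constant histories. The memory term of the
  equation is the inner product with the constant history v.\<close>

lemma memory_const: "v \<in> V \<Omega> \<Longrightarrow> (\<lambda>s. v) \<in> memory_space \<Omega> \<mu>"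
  by (simp add: memory_space_def strongly_measurable_const mu_integrable)

lemma norm_memory_const: "norm_memory \<Omega> \<mu> (\<lambda>s. v) = sqrt kappa * norm1 \<Omega> v"
  by (simp add: norm_memory_def ip_memory_def kappa_def norm1_def real_sqrt_mult)

end

section \<open>Pointwise form of the momentum equation and regularity in time of the
  velocity\<close>

section \<open>Weak solutions\<close>

lemma continuous_on_half_line_comparison:
  fixes F :: "real \<Rightarrow> real"
  assumes "\<And>t. 0 \<le> t \<Longrightarrow> (b t \<longlongrightarrow> 0) (at t within {0..})"
    and "\<And>r t. 0 \<le> r \<Longrightarrow> 0 \<le> t \<Longrightarrow> \<bar>F r - F t\<bar> \<le> b t r"
  shows "continuous_on {0..} F"
  unfolding continuous_on_def
proof
  fix t :: real assume t: "t \<in> {0..}"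
  have "((\<lambda>r. F r - F t) \<longlongrightarrow> 0) (at t within {0..})"
    by (rule Lim_null_comparison[OF _ assms(1)])
      (use t assms(2) in \<open>auto simp: eventually_at_filter intro!: always_eventually\<close>)
  then show "(F \<longlongrightarrow> F t) (at t within {0..})" by (simp add: LIM_zero_iff)
qed

locale voigt_solution = voigt \<Omega> \<mu> \<delta> m s1 \<alpha>
  for \<Omega> :: "(real^3) set" and \<mu> :: "real \<Rightarrow> real" and \<delta> m s1 \<alpha> :: real +
  fixes U0 :: state and U :: "real \<Rightarrow> state"
  assumes U0: "U0 \<in> phase_space \<Omega> \<mu>" and sol: "weak_solution \<Omega> \<alpha> \<mu> U0 U"
begin

text \<open>The values of \<open>U\<close> at negative times are arbitrary, so they are replaced by \<open>U 0\<close>.\<close>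

definition vel :: "real \<Rightarrow> vfield" where "vel t = fst (U (max 0 t))"
definition hist :: "real \<Rightarrow> real \<Rightarrow> vfield" where "hist t = snd (U (max 0 t))"

lemma vel_eq: "0 \<le> t \<Longrightarrow> fst (U t) = vel t" and hist_eq: "0 \<le> t \<Longrightarrow> snd (U t) = hist t"
  by (simp_all add: vel_def hist_def)

lemma U_phase: "0 \<le> t \<Longrightarrow> U t \<in> phase_space \<Omega> \<mu>"
  using sol by (simp add: weak_solution_def Let_def)

lemma vel_V: "vel t \<in> V \<Omega>" and hist_memory: "hist t \<in> memory_space \<Omega> \<mu>"
  using U_phase[of "max 0 t"] by (auto simp: vel_def hist_def phase_space_def mem_Times_iff)

lemma hist_V: "0 < s \<Longrightarrow> hist t s \<in> V \<Omega>"
  by (rule memory_V[OF hist_memory])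

lemma phase_continuous:
  "0 \<le> t \<Longrightarrow> ((\<lambda>r. norm_phase \<Omega> \<alpha> \<mu> (U r - U t)) \<longlongrightarrow> 0) (at t within {0..})"
  using sol by (simp add: weak_solution_def Let_def)

lemma norm_phase_ge:
  shows "sqrt \<alpha> * norm1 \<Omega> (fst Z) \<le> norm_phase \<Omega> \<alpha> \<mu> Z"
    and "norm_memory \<Omega> \<mu> (snd Z) \<le> norm_phase \<Omega> \<alpha> \<mu> Z"
proof -
  have "sqrt (\<alpha> * (norm1 \<Omega> (fst Z))\<^sup>2) \<le> norm_phase \<Omega> \<alpha> \<mu> Z"
    unfolding norm_phase_def by (intro real_sqrt_le_mono) simp
  then show "sqrt \<alpha> * norm1 \<Omega> (fst Z) \<le> norm_phase \<Omega> \<alpha> \<mu> Z"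
    using norm1_nonneg[of "fst Z"] by (simp add: real_sqrt_mult)
  have "sqrt ((norm_memory \<Omega> \<mu> (snd Z))\<^sup>2) \<le> norm_phase \<Omega> \<alpha> \<mu> Z"
    unfolding norm_phase_def using alpha_pos by (intro real_sqrt_le_mono) simp
  then show "norm_memory \<Omega> \<mu> (snd Z) \<le> norm_phase \<Omega> \<alpha> \<mu> Z"
    using norm_memory_nonneg[of "snd Z"] by simp
qed

lemma vel_tendsto:
  assumes "0 \<le> t" shows "((\<lambda>r. norm1 \<Omega> (vel r - vel t)) \<longlongrightarrow> 0) (at t within {0..})"
proof (rule Lim_null_comparison)
  have "norm (norm1 \<Omega> (vel r - vel t)) \<le> norm_phase \<Omega> \<alpha> \<mu> (U r - U t) / sqrt \<alpha>" if "0 \<le> r" for r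
    using norm_phase_ge(1)[of "U r - U t"] alpha_pos norm1_nonneg[of "vel r - vel t"]
    by (simp add: vel_eq assms that pos_le_divide_eq mult.commute)
  then show "\<forall>\<^sub>F r in at t within {0..}. norm (norm1 \<Omega> (vel r - vel t)) \<le> norm_phase \<Omega> \<alpha> \<mu> (U r - U t) / sqrt \<alpha>"
    by (auto simp: eventually_at_filter intro!: always_eventually)
  show "((\<lambda>r. norm_phase \<Omega> \<alpha> \<mu> (U r - U t) / sqrt \<alpha>) \<longlongrightarrow> 0) (at t within {0..})"
    using tendsto_divide[OF phase_continuous[OF assms] tendsto_const[of "sqrt \<alpha>"]] alpha_pos by simp
qed

lemma hist_tendsto:
  assumes "0 \<le> t" shows "((\<lambda>r. norm_memory \<Omega> \<mu> (hist r - hist t)) \<longlongrightarrow> 0) (at t within {0..})"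
proof (rule Lim_null_comparison[OF _ phase_continuous[OF assms]])
  have "norm (norm_memory \<Omega> \<mu> (hist r - hist t)) \<le> norm_phase \<Omega> \<alpha> \<mu> (U r - U t)" if "0 \<le> r" for r
    using norm_phase_ge(2)[of "U r - U t"] norm_memory_nonneg[of "hist r - hist t"]
    by (simp add: hist_eq assms that)
  then show "\<forall>\<^sub>F r in at t within {0..}. norm (norm_memory \<Omega> \<mu> (hist r - hist t)) \<le> norm_phase \<Omega> \<alpha> \<mu> (U r - U t)"
    by (auto simp: eventually_at_filter intro!: always_eventually)
qed

abbreviation "nv t \<equiv> norm1 \<Omega> (vel t)"
abbreviation "nm t \<equiv> norm_memory \<Omega> \<mu> (hist t)"

lemma nv_continuous: "continuous_on {0..} nv"
  by (rule continuous_on_half_line_comparison[OF vel_tendsto norm1_diff_le[OF vel_V vel_V]])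

lemma nm_continuous: "continuous_on {0..} nm"
  by (rule continuous_on_half_line_comparison[OF hist_tendsto norm_memory_diff_le[OF hist_memory hist_memory]])

text \<open>The inner product under the time derivative in the equation; on the diagonal it is twice
  the kinetic part of the energy.\<close>

definition bform :: "vfield \<Rightarrow> vfield \<Rightarrow> real" where
  "bform v w = ip \<Omega> v w + \<alpha> * ip1 \<Omega> v w"

text \<open>All terms of the equation without a time derivative, so that the equation reads d/dt
  \<open>bform (vel t) v\<close> = - \<open>force t v\<close>.\<close>

definition force :: "real \<Rightarrow> vfield \<Rightarrow> real" where
  "force t v = ip_memory \<Omega> \<mu> (hist t) (\<lambda>s. v) + trilinear \<Omega> (vel t) (vel t) v"

lemma bform_functional: "v \<in> V \<Omega> \<Longrightarrow> V_functional (\<lambda>w. bform w v)"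
  unfolding bform_def using V_functional_lincomb[OF V_functional_ip V_functional_ip1, of v v 1 \<alpha>] by simp

lemma vel_functional_continuous:
  assumes "V_functional l" shows "continuous_on {0..} (\<lambda>t. l (vel t))"
proof -
  obtain K where K: "\<And>u. u \<in> V \<Omega> \<Longrightarrow> \<bar>l u\<bar> \<le> K * norm1 \<Omega> u"
    using assms unfolding V_functional_def by blast
  show ?thesis
  proof (rule continuous_on_half_line_comparison)
    show "((\<lambda>r. K * norm1 \<Omega> (vel r - vel t)) \<longlongrightarrow> 0) (at t within {0..})" if "0 \<le> t" for t
      using tendsto_mult[OF tendsto_const[of K] vel_tendsto[OF that]] by simp
    show "\<bar>l (vel r) - l (vel t)\<bar> \<le> K * norm1 \<Omega> (vel r - vel t)" for r t
      using K[OF V_diff[OF vel_V vel_V]] unfolding V_functional_diff[OF assms vel_V vel_V] .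
  qed
qed

lemma bform_diff:
  "u \<in> V \<Omega> \<Longrightarrow> w \<in> V \<Omega> \<Longrightarrow> v \<in> V \<Omega> \<Longrightarrow> bform (u - w) v = bform u v - bform w v"
  by (rule V_functional_diff[OF bform_functional])

lemma bform_commute: "bform u v = bform v u"
  by (simp add: bform_def ip_commute[of u] ip1_commute[of u])

lemma bform_ge: "\<alpha> * (norm1 \<Omega> u)\<^sup>2 \<le> bform u u"
  by (simp add: bform_def norm1_power2 ip_nonneg)

lemma bform_le: "u \<in> V \<Omega> \<Longrightarrow> bform u u \<le> (sobolev_constant + \<alpha>) * (norm1 \<Omega> u)\<^sup>2"
  using poincare[of u] by (simp add: bform_def norm1_power2 distrib_right)

lemma bform_nonneg: "0 \<le> bform u u"
  using bform_ge[of u] alpha_pos by (meson mult_nonneg_nonneg order_trans less_imp_le zero_le_power2)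

lemma force_continuous:
  assumes v: "v \<in> V \<Omega>" shows "continuous_on {0..} (\<lambda>t. force t v)"
  unfolding force_def
proof (rule continuous_on_add)
  show "continuous_on {0..} (\<lambda>t. ip_memory \<Omega> \<mu> (hist t) (\<lambda>s. v))"
  proof (rule continuous_on_half_line_comparison)
    show "((\<lambda>r. norm_memory \<Omega> \<mu> (hist r - hist t) * norm_memory \<Omega> \<mu> (\<lambda>s. v)) \<longlongrightarrow> 0) (at t within {0..})"
      if "0 \<le> t" for t
      using tendsto_mult[OF hist_tendsto[OF that] tendsto_const[of "norm_memory \<Omega> \<mu> (\<lambda>s. v)"]] by simp
    show "\<bar>ip_memory \<Omega> \<mu> (hist r) (\<lambda>s. v) - ip_memory \<Omega> \<mu> (hist t) (\<lambda>s. v)\<bar>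
        \<le> norm_memory \<Omega> \<mu> (hist r - hist t) * norm_memory \<Omega> \<mu> (\<lambda>s. v)" for r t
      using ip_memory_Cauchy_Schwarz[OF memory_diff[OF hist_memory hist_memory] memory_const[OF v]]
      unfolding ip_memory_diff[OF hist_memory hist_memory memory_const[OF v]] .
  qed
  let ?b = "\<lambda>t r. trilinear_constant * norm1 \<Omega> (vel r - vel t) * nv r * norm1 \<Omega> v
    + trilinear_constant * nv t * norm1 \<Omega> (vel r - vel t) * norm1 \<Omega> v"
  show "continuous_on {0..} (\<lambda>t. trilinear \<Omega> (vel t) (vel t) v)"
  proof (rule continuous_on_half_line_comparison)
    fix t :: real assume t: "0 \<le> t"
    have "(nv \<longlongrightarrow> nv t) (at t within {0..})" using nv_continuous t by (simp add: continuous_on_def)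
    then have "(?b t \<longlongrightarrow> trilinear_constant * 0 * nv t * norm1 \<Omega> v + trilinear_constant * nv t * 0 * norm1 \<Omega> v) (at t within {0..})"
      by (intro tendsto_intros vel_tendsto t)
    then show "(?b t \<longlongrightarrow> 0) (at t within {0..})" by simp
  next
    fix r t :: real
    have 1: "\<bar>trilinear \<Omega> (vel r - vel t) (vel r) v\<bar> \<le> trilinear_constant * norm1 \<Omega> (vel r - vel t) * nv r * norm1 \<Omega> v"
      by (rule trilinear_bound[OF V_diff[OF vel_V vel_V] vel_V v])
    have 2: "\<bar>trilinear \<Omega> (vel t) (vel r - vel t) v\<bar> \<le> trilinear_constant * nv t * norm1 \<Omega> (vel r - vel t) * norm1 \<Omega> v"
      by (rule trilinear_bound[OF vel_V V_diff[OF vel_V vel_V] v])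
    have "trilinear \<Omega> (vel r) (vel r) v - trilinear \<Omega> (vel t) (vel t) v
        = trilinear \<Omega> (vel r - vel t) (vel r) v + trilinear \<Omega> (vel t) (vel r - vel t) v"
      unfolding trilinear_diff_left[OF vel_V vel_V vel_V v] trilinear_diff_middle[OF vel_V vel_V vel_V v] by simp
    then show "\<bar>trilinear \<Omega> (vel r) (vel r) v - trilinear \<Omega> (vel t) (vel t) v\<bar> \<le> ?b t r"
      using order_trans[OF abs_triangle_ineq add_mono[OF 1 2]] by simp
  qed
qed

text \<open>Pairing the V-valued weak derivative with v leaves a scalar weak derivative, and the
  equation identifies it with -\<open>force t v\<close>. As both functions are continuous on [0,
  \<infinity>), the integrated identity holds for all times, including a = 0.\<close>

lemma momentum_balance:
  assumes v: "v \<in> V \<Omega>" and ab: "0 \<le> a" "a \<le> b"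
  shows "bform (vel b) v - bform (vel a) v = - integral {a..b} (\<lambda>t. force t v)"
proof (rule weak_derivative_imp_integral[OF vel_functional_continuous[OF bform_functional[OF v]] force_continuous[OF v] _ ab])
  let ?l = "\<lambda>w. bform w v"
  note l = bform_functional[OF v]
  obtain u' where wd: "has_weak_time_derivative \<Omega> (\<lambda>t. fst (U t)) u'"
    and u': "\<And>\<tau>. \<tau> > 0 \<Longrightarrow> u' \<in> L2_V \<Omega> (lebesgue_on {0<..<\<tau>})"
    and eq: "AE t in half_line. ip \<Omega> (u' t) v + \<alpha> * ip1 \<Omega> (u' t) v
      + (\<integral>s. \<mu> s * ip1 \<Omega> (snd (U t) s) v \<partial>half_line) + trilinear \<Omega> (fst (U t)) (fst (U t)) v = 0"
    using sol v by (auto simp: weak_solution_def Let_def)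
  fix \<psi> :: "real \<Rightarrow> real" assume \<psi>: "test_fun {0<..} \<psi>"
  \<comment> \<open>The same w represents both V-valued integrals, so the two scalar integrals agree
    with \<open>bform w v\<close> and hence with each other.\<close>
  obtain w where w: "has_V_integral \<Omega> half_line (\<lambda>t x. deriv \<psi> t *\<^sub>R fst (U t) x) w"
    "has_V_integral \<Omega> half_line (\<lambda>t x. - (\<psi> t *\<^sub>R u' t x)) w"
    using wd \<psi> unfolding has_weak_time_derivative_def by blast
  have hl: "{0::real<..} \<in> sets lebesgue" by auto
  have u'V: "u' t \<in> V \<Omega>" if "0 < t" for t
    using u'[of "t + 1"] that by (auto simp: L2_V_def strongly_measurable_def)
  have 1: "(\<integral>t. deriv \<psi> t * bform (vel t) v \<partial>half_line) = bform w v"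
  proof -
    have "(\<integral>t. deriv \<psi> t * bform (vel t) v \<partial>half_line) = (\<integral>t. bform (\<lambda>x. deriv \<psi> t *\<^sub>R fst (U t) x) v \<partial>half_line)"
    proof (rule Bochner_Integration.integral_cong[OF refl])
      fix t assume "t \<in> space half_line"
      then have "fst (U t) = vel t" by (simp add: vel_eq)
      then show "deriv \<psi> t * bform (vel t) v = bform (\<lambda>x. deriv \<psi> t *\<^sub>R fst (U t) x) v"
        using V_functional_scale[OF l vel_V, of "deriv \<psi> t" t] by simp
    qed
    also have "\<dots> = bform w v"
      using V_integral_functional[OF hl w(1) l] by (rule has_bochner_integral_integral_eq)
    finally show ?thesis .
  qed
  have 2: "(\<integral>t. \<psi> t * force t v \<partial>half_line) = bform w v"
  proof -
    note I2 = V_integral_functional[OF hl w(2) l]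
    have "(\<integral>t. \<psi> t * force t v \<partial>half_line) = (\<integral>t. bform (\<lambda>x. - (\<psi> t *\<^sub>R u' t x)) v \<partial>half_line)"
    proof (rule integral_cong_AE)
      have "continuous_on {0<..} (\<lambda>t. \<psi> t * force t v)"
        by (intro continuous_on_mult continuous_on_subset[OF test_fun_continuous[OF \<psi>]]
            continuous_on_subset[OF force_continuous[OF v]]) auto
      then show "(\<lambda>t. \<psi> t * force t v) \<in> borel_measurable half_line"
        by (rule continuous_imp_measurable_on_sets_lebesgue) auto
      show "(\<lambda>t. bform (\<lambda>x. - (\<psi> t *\<^sub>R u' t x)) v) \<in> borel_measurable half_line"
        using I2 by (auto simp: has_bochner_integral_iff)
      show "AE t in half_line. \<psi> t * force t v = bform (\<lambda>x. - (\<psi> t *\<^sub>R u' t x)) v"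
        using eq AE_space
      proof eventually_elim
        case (elim t)
        then have t: "0 < t" by simp
        have "bform (u' t) v + force t v = 0"
          using elim(1) t by (simp add: bform_def force_def ip_memory_def vel_eq hist_eq)
        then have f: "force t v = - bform (u' t) v" by simp
        have "bform (\<lambda>x. - (\<psi> t *\<^sub>R u' t x)) v = - \<psi> t * bform (u' t) v"
          using V_functional_scale[OF l u'V[OF t], of "- \<psi> t"] by simp
        then show ?case by (simp add: f)
      qed
    qed
    also have "\<dots> = bform w v"
      using I2 by (rule has_bochner_integral_integral_eq)
    finally show ?thesis .
  qed
  show "(\<integral>t. deriv \<psi> t * bform (vel t) v \<partial>half_line) = (\<integral>t. \<psi> t * force t v \<partial>half_line)"
    unfolding 1 2 ..
qed

text \<open>A bound for the norm of \<open>force t\<close> as a functional on V: the memory enters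
  linearly, the convection quadratically.\<close>

definition drag :: "real \<Rightarrow> real" where
  "drag t = sqrt kappa * nm t + trilinear_constant * (nv t)\<^sup>2"

lemma drag_nonneg: "0 \<le> drag t"
  unfolding drag_def using kappa_nonneg norm_memory_nonneg trilinear_constant_pos
  by (intro add_nonneg_nonneg mult_nonneg_nonneg) auto

lemma drag_continuous: "continuous_on {0..} drag"
  unfolding drag_def[abs_def] by (intro continuous_intros nm_continuous nv_continuous)

lemma force_bound:
  assumes "v \<in> V \<Omega>" shows "\<bar>force t v\<bar> \<le> drag t * norm1 \<Omega> v"
proof -
  have 1: "\<bar>ip_memory \<Omega> \<mu> (hist t) (\<lambda>s. v)\<bar> \<le> nm t * (sqrt kappa * norm1 \<Omega> v)"
    using ip_memory_Cauchy_Schwarz[OF hist_memory memory_const[OF assms]] by (simp add: norm_memory_const)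
  have 2: "\<bar>trilinear \<Omega> (vel t) (vel t) v\<bar> \<le> trilinear_constant * nv t * nv t * norm1 \<Omega> v"
    by (rule trilinear_bound[OF vel_V vel_V assms])
  have "\<bar>force t v\<bar> \<le> nm t * (sqrt kappa * norm1 \<Omega> v) + trilinear_constant * nv t * nv t * norm1 \<Omega> v"
    unfolding force_def by (rule order_trans[OF abs_triangle_ineq add_mono[OF 1 2]])
  then show ?thesis by (simp add: drag_def power2_eq_square algebra_simps)
qed

text \<open>The momentum balance is tested with the increment itself: coercivity of
  \<open>bform\<close>, where \<alpha> > 0 enters, gives the square of its norm on the left, and one
  factor is cancelled.\<close>

lemma vel_increment:
  assumes "0 \<le> a" "a \<le> b"
  shows "\<alpha> * norm1 \<Omega> (vel b - vel a) \<le> integral {a..b} drag"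
proof -
  let ?d = "vel b - vel a"
  have d: "?d \<in> V \<Omega>" by (rule V_diff[OF vel_V vel_V])
  have sub: "{a..b} \<subseteq> {0..}" using assms by auto
  have id: "drag integrable_on {a..b}"
    by (intro integrable_continuous_real continuous_on_subset[OF drag_continuous sub])
  have if': "(\<lambda>t. force t ?d) integrable_on {a..b}"
    by (intro integrable_continuous_real continuous_on_subset[OF force_continuous[OF d] sub])
  have I: "0 \<le> integral {a..b} drag" by (intro integral_nonneg id drag_nonneg)
  have "\<alpha> * (norm1 \<Omega> ?d)\<^sup>2 \<le> bform ?d ?d" by (rule bform_ge)
  also have "\<dots> = integral {a..b} (\<lambda>t. - force t ?d)"
    using momentum_balance[OF d assms] bform_diff[OF vel_V vel_V d] by simp
  also have "\<dots> \<le> integral {a..b} (\<lambda>t. drag t * norm1 \<Omega> ?d)"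
  proof (rule integral_le)
    show "(\<lambda>t. - force t ?d) integrable_on {a..b}" using if' by (rule integrable_neg)
    show "(\<lambda>t. drag t * norm1 \<Omega> ?d) integrable_on {a..b}" using id by (rule integrable_on_mult_left)
    show "- force t ?d \<le> drag t * norm1 \<Omega> ?d" for t
      by (rule order_trans[OF abs_ge_minus_self force_bound[OF d]])
  qed
  also have "\<dots> = integral {a..b} drag * norm1 \<Omega> ?d" by simp
  finally have "(\<alpha> * norm1 \<Omega> ?d) * norm1 \<Omega> ?d \<le> integral {a..b} drag * norm1 \<Omega> ?d"
    by (simp add: power2_eq_square mult.assoc)
  then show ?thesis
    using I norm1_nonneg[of ?d] by (cases "norm1 \<Omega> ?d = 0") auto
qed

text \<open>L and K may depend on t and on the solution: they enter only the terms of higher order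
  in h of the Dini estimates and never the final constants.\<close>

lemma local_bounds:
  assumes t: "0 \<le> t"
  obtains L K where "0 \<le> L" "0 \<le> K" "\<And>r. r \<in> {t..t + 1} \<Longrightarrow> nv r \<le> L"
    "\<And>h r. r \<in> {t..t + h} \<Longrightarrow> h \<le> 1 \<Longrightarrow> norm1 \<Omega> (vel r - vel t) \<le> K * h"
proof -
  have sub: "{t..t + 1} \<subseteq> {0..}" using t by auto
  have "bounded (nv ` {t..t + 1})"
    by (intro compact_imp_bounded compact_continuous_image continuous_on_subset[OF nv_continuous sub]) simp
  then obtain L where L: "L > 0" "\<And>r. r \<in> {t..t + 1} \<Longrightarrow> \<bar>nv r\<bar> \<le> L"
    by (auto simp: bounded_pos)
  have "bounded (drag ` {t..t + 1})"
    by (intro compact_imp_bounded compact_continuous_image continuous_on_subset[OF drag_continuous sub]) simp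
  then obtain D where D: "D > 0" "\<And>r. r \<in> {t..t + 1} \<Longrightarrow> \<bar>drag r\<bar> \<le> D"
    by (auto simp: bounded_pos)
  have "norm1 \<Omega> (vel r - vel t) \<le> D / \<alpha> * h" if r: "r \<in> {t..t + h}" and h: "h \<le> 1" for h r
  proof -
    have rt: "t \<le> r" "r \<le> t + h" using r by auto
    have "\<alpha> * norm1 \<Omega> (vel r - vel t) \<le> integral {t..r} drag"
      by (rule vel_increment[OF t rt(1)])
    also have "\<dots> \<le> norm (integral {t..r} drag)" by simp
    also have "\<dots> \<le> D * (r - t)"
      by (rule integral_bound[OF rt(1) continuous_on_subset[OF drag_continuous]])
        (use t rt h D(2) in auto)
    also have "\<dots> \<le> D * h" using D(1) rt by (intro mult_left_mono) auto
    finally show ?thesis using alpha_pos by (simp add: field_simps)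
  qed
  then show ?thesis
    using that[of L "D / \<alpha>"] L D(1) alpha_pos by (metis abs_ge_self order_trans divide_nonneg_pos less_imp_le)
qed

section \<open>Weak form of the transport of the history\<close>

subsection \<open>The history variable\<close>

lemma V_integral_vel:
  assumes "has_V_integral \<Omega> (lebesgue_on {0..c}) (\<lambda>\<sigma>. fst (U (t - \<sigma>))) w" "c \<le> t" "v \<in> V \<Omega>"
  shows "ip1 \<Omega> w v = integral {0..c} (\<lambda>\<sigma>. ip1 \<Omega> (vel (t - \<sigma>)) v)"
proof -
  have S: "{0..c} \<in> sets lebesgue" by auto
  have hb: "has_bochner_integral (lebesgue_on {0..c}) (\<lambda>\<sigma>. ip1 \<Omega> (fst (U (t - \<sigma>))) v) (ip1 \<Omega> w v)"
    by (rule V_integral_functional[OF S assms(1) V_functional_ip1[OF assms(3)]])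
  have "ip1 \<Omega> w v = integral {0..c} (\<lambda>\<sigma>. ip1 \<Omega> (fst (U (t - \<sigma>))) v)"
    using hb lebesgue_integral_eq_integral[OF _ S] by (metis has_bochner_integral_iff)
  also have "\<dots> = integral {0..c} (\<lambda>\<sigma>. ip1 \<Omega> (vel (t - \<sigma>)) v)"
    by (rule Henstock_Kurzweil_Integration.integral_cong) (use assms(2) in \<open>auto simp: vel_eq\<close>)
  finally show ?thesis .
qed

text \<open>The null set of exceptional s is independent of v, because the V-valued identity holds
  first and is paired with v afterwards. Hence v may later be chosen depending on s, for instance as
  the history at s.\<close>

lemma history:
  assumes "0 \<le> t"
  shows "AE s in half_line. \<mu> s > 0 \<longrightarrow>
    (s \<le> t \<longrightarrow> (\<forall>v\<in>V \<Omega>. ip1 \<Omega> (hist t s) v = integral {0..s} (\<lambda>\<sigma>. ip1 \<Omega> (vel (t - \<sigma>)) v))) \<and>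
    (t < s \<longrightarrow> (\<forall>v\<in>V \<Omega>. ip1 \<Omega> (hist t s - snd U0 (s - t)) v = integral {0..t} (\<lambda>\<sigma>. ip1 \<Omega> (vel (t - \<sigma>)) v)))"
proof -
  have "history_formula \<Omega> \<mu> (snd U0) (\<lambda>t. fst (U t)) t (snd (U t))"
    using sol assms by (simp add: weak_solution_def Let_def)
  then have "AE s in half_line. \<mu> s > 0 \<longrightarrow>
        (if s \<le> t
         then has_V_integral \<Omega> (lebesgue_on {0..s}) (\<lambda>\<sigma>. fst (U (t - \<sigma>))) (hist t s)
         else has_V_integral \<Omega> (lebesgue_on {0..t}) (\<lambda>\<sigma>. fst (U (t - \<sigma>))) (hist t s - snd U0 (s - t)))"
    unfolding history_formula_def hist_eq[OF assms] .
  then show ?thesis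
  proof eventually_elim
    case (elim s)
    then show ?case using V_integral_vel[of s t "hist t s"] V_integral_vel[of t t "hist t s - snd U0 (s - t)"]
      by (cases "s \<le> t") auto
  qed
qed

lemma vel_ip1_continuous:
  assumes "v \<in> V \<Omega>" shows "continuous_on {0..t} (\<lambda>\<sigma>. ip1 \<Omega> (vel (t - \<sigma>)) v)"
  by (rule continuous_on_compose2[OF vel_functional_continuous[OF V_functional_ip1[OF assms]], of _ "\<lambda>\<sigma>. t - \<sigma>"])
    (auto intro!: continuous_intros)

text \<open>Advancing t and s together by h leaves s - t fixed, so the initial history cancels and
  only the velocity on [t, t + h] remains. Positivity of \<mu>(s + h) implies that of \<mu>(s) by
  monotonicity, so both representation formulas are available.\<close>

lemma history_step:
  assumes t: "0 \<le> t" and h: "0 < h"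
  shows "AE s in half_line. \<mu> (s + h) > 0 \<longrightarrow>
    (\<forall>v\<in>V \<Omega>. ip1 \<Omega> (hist (t + h) (s + h) - hist t s) v = integral {0..h} (\<lambda>\<sigma>. ip1 \<Omega> (vel (t + h - \<sigma>)) v))"
proof -
  have th: "0 \<le> t + h" using t h by simp
  show ?thesis
    using AE_half_line_shift[OF history[OF th] less_imp_le[OF h]] history[OF t] AE_space
  proof eventually_elim
    case (elim s)
    then have s: "0 < s" by simp
    show ?case
    proof (intro impI ballI)
      fix v assume mu: "\<mu> (s + h) > 0" and v: "v \<in> V \<Omega>"
      have mu': "\<mu> s > 0" using mu mu_antimono[of s "s + h"] s h by simp
      let ?f = "\<lambda>\<sigma>. ip1 \<Omega> (vel (t + h - \<sigma>)) v"
      \<comment> \<open>The substitution by h expresses the older integral through the newer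
        integrand; the missing piece over [0, h] is the asserted increment.\<close>
      have shift: "integral {0..c} (\<lambda>\<sigma>. ip1 \<Omega> (vel (t - \<sigma>)) v) = integral {0..c + h} ?f - integral {0..h} ?f"
        if c: "0 \<le> c" "c \<le> t" for c
      proof -
        have cont: "continuous_on {0 + h..c + h} ?f"
          by (rule continuous_on_subset[OF vel_ip1_continuous[OF v]]) (use c h in auto)
        have "integral {0..c} (?f \<circ> (\<lambda>x. x + h)) = integral {0 + h..c + h} ?f"
          by (rule integral_shift[OF cont])
        then have e: "integral {0..c} (\<lambda>\<sigma>. ip1 \<Omega> (vel (t - \<sigma>)) v) = integral {h..c + h} ?f"
          by (simp add: o_def)
        have "?f integrable_on {0..c + h}"
          by (intro integrable_continuous_real continuous_on_subset[OF vel_ip1_continuous[OF v, of "t + h"]]) (use c in auto)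
        then have "integral {0..h} ?f + integral {h..c + h} ?f = integral {0..c + h} ?f"
          by (intro Henstock_Kurzweil_Integration.integral_combine) (use c h in auto)
        then show ?thesis using e by simp
      qed
      show "ip1 \<Omega> (hist (t + h) (s + h) - hist t s) v = integral {0..h} ?f"
      proof (cases "s \<le> t")
        case True
        have "ip1 \<Omega> (hist (t + h) (s + h)) v = integral {0..s + h} ?f"
          using elim(1) mu True v by simp
        moreover have "ip1 \<Omega> (hist t s) v = integral {0..s} (\<lambda>\<sigma>. ip1 \<Omega> (vel (t - \<sigma>)) v)"
          using elim(2) mu' True v by simp
        moreover have "ip1 \<Omega> (hist (t + h) (s + h) - hist t s) v = ip1 \<Omega> (hist (t + h) (s + h)) v - ip1 \<Omega> (hist t s) v"
          by (rule ip1_diff[OF hist_V hist_V v]) (use s h in auto)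
        ultimately show ?thesis using shift[of s] s True by simp
      next
        case False
        have V0: "snd U0 (s - t) \<in> V \<Omega>"
          using U0 False by (auto simp: phase_space_def mem_Times_iff intro: memory_V)
        have V1: "hist (t + h) (s + h) \<in> V \<Omega>" "hist t s \<in> V \<Omega>" using s h by (auto intro: hist_V)
        have "ip1 \<Omega> (hist (t + h) (s + h) - snd U0 (s - t)) v = integral {0..t + h} ?f"
          using elim(1) mu False v by simp
        moreover have "ip1 \<Omega> (hist t s - snd U0 (s - t)) v = integral {0..t} (\<lambda>\<sigma>. ip1 \<Omega> (vel (t - \<sigma>)) v)"
          using elim(2) mu' False v by simp
        ultimately show ?thesis
          using shift[OF t order_refl] unfolding ip1_diff[OF V1(1) V0 v] ip1_diff[OF V1(2) V0 v] ip1_diff[OF V1 v] by simp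
      qed
    qed
  qed
qed

end

context voigt
begin

lemma mu_shift_le:
  assumes "0 < s" "0 \<le> h" shows "\<mu> (s + h) \<le> \<mu> s" "0 \<le> \<mu> (s + h)"
  using assms by (auto intro: mu_antimono mu_nonneg)

lemma mu_shift_integrable: "0 \<le> h \<Longrightarrow> integrable half_line (\<lambda>s. \<mu> (s + h))"
  by (rule half_line_integral_shift(1)[OF mu_integrable])

lemma shifted_integrable:
  assumes i: "integrable half_line (\<lambda>s. \<mu> s * k s)" and k: "k \<in> borel_measurable half_line" and h: "0 \<le> h"
  shows "integrable half_line (\<lambda>s. \<mu> (s + h) * k s)"
proof (rule Bochner_Integration.integrable_bound[OF i])
  show "(\<lambda>s. \<mu> (s + h) * k s) \<in> borel_measurable half_line"
    using mu_shift_integrable[OF h] k by auto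
  show "AE s in half_line. norm (\<mu> (s + h) * k s) \<le> norm (\<mu> s * k s)"
  proof (intro AE_I2)
    fix s assume "s \<in> space half_line"
    then have s: "0 < s" by simp
    show "norm (\<mu> (s + h) * k s) \<le> norm (\<mu> s * k s)"
      unfolding norm_mult using mu_shift_le[OF s h] mu_nonneg[OF s] by (intro mult_right_mono) auto
  qed
qed

end

context voigt_solution
begin

section \<open>Dini estimates for memory and kinetic energy, and dissipation\<close>

subsection \<open>The energy inequality\<close>

lemma hist_norm_integrable: "integrable half_line (\<lambda>s. \<mu> s * (norm1 \<Omega> (hist t s))\<^sup>2)"
  using hist_memory[of t] by (simp add: memory_space_def)

lemma nm_power2: "(nm t)\<^sup>2 = (\<integral>s. \<mu> s * (norm1 \<Omega> (hist t s))\<^sup>2 \<partial>half_line)"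
  by (simp add: norm_memory_power2 ip_memory_def norm1_power2)

text \<open>For s \<le> h the new history integrates only velocities from the last h units of time;
  pairing it with itself yields s L. This part therefore adds only O(h^2) to the squared memory
  norm.\<close>

lemma recent_history_bound:
  assumes t: "0 \<le> t" and h: "0 < h" and L: "\<And>r. r \<in> {t..t + h} \<Longrightarrow> nv r \<le> L"
  shows "AE s in half_line. \<mu> s > 0 \<longrightarrow> s \<le> h \<longrightarrow> norm1 \<Omega> (hist (t + h) s) \<le> h * L"
proof -
  have L0: "0 \<le> L" using order_trans[OF norm1_nonneg L[of t]] h by simp
  have th: "0 \<le> t + h" using t h by simp
  show ?thesis
    using history[OF th] AE_space
  proof eventually_elim
    case (elim s)
    then have s: "0 < s" by simp
    let ?v = "hist (t + h) s"
    have v: "?v \<in> V \<Omega>" by (rule hist_V[OF s])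
    show ?case
    proof (intro impI)
      assume mu: "\<mu> s > 0" and sh: "s \<le> h"
      have "(norm1 \<Omega> ?v)\<^sup>2 = integral {0..s} (\<lambda>\<sigma>. ip1 \<Omega> (vel (t + h - \<sigma>)) ?v)"
        using elim(1) mu sh t v by (simp add: norm1_power2)
      also have "\<dots> \<le> norm (integral {0..s} (\<lambda>\<sigma>. ip1 \<Omega> (vel (t + h - \<sigma>)) ?v))" by simp
      also have "\<dots> \<le> (L * norm1 \<Omega> ?v) * (s - 0)"
      proof (rule integral_bound)
        show "continuous_on {0..s} (\<lambda>\<sigma>. ip1 \<Omega> (vel (t + h - \<sigma>)) ?v)"
          by (rule continuous_on_subset[OF vel_ip1_continuous[OF v]]) (use sh t in auto)
        fix \<sigma> assume "\<sigma> \<in> {0..s}"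
        then have "nv (t + h - \<sigma>) \<le> L" using sh by (intro L) auto
        then have "nv (t + h - \<sigma>) * norm1 \<Omega> ?v \<le> L * norm1 \<Omega> ?v"
          by (rule mult_right_mono[OF _ norm1_nonneg])
        then show "norm (ip1 \<Omega> (vel (t + h - \<sigma>)) ?v) \<le> L * norm1 \<Omega> ?v"
          unfolding real_norm_def by (rule order_trans[OF ip1_Cauchy_Schwarz[OF vel_V v]])
      qed (use s in simp)
      finally have "norm1 \<Omega> ?v * norm1 \<Omega> ?v \<le> (s * L) * norm1 \<Omega> ?v"
        by (simp add: power2_eq_square mult_ac)
      then have "norm1 \<Omega> ?v \<le> s * L"
        using norm1_nonneg[of ?v] L0 s by (cases "norm1 \<Omega> ?v = 0") auto
      also have "\<dots> \<le> h * L" using sh L0 by (rule mult_right_mono)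
      finally show "norm1 \<Omega> ?v \<le> h * L" .
    qed
  qed
qed

text \<open>Write the new history as the old one plus an increment d. Pairing with d shows that d
  has norm at most h L, and pairing with the old history shows that d acts like h u(t) up to h w.
  Expanding the square then gives the claim.\<close>

lemma history_growth:
  assumes t: "0 \<le> t" and h: "0 < h" and L: "\<And>r. r \<in> {t..t + h} \<Longrightarrow> nv r \<le> L"
    and w: "\<And>r. r \<in> {t..t + h} \<Longrightarrow> norm1 \<Omega> (vel r - vel t) \<le> w"
  shows "AE s in half_line. \<mu> (s + h) > 0 \<longrightarrow> (norm1 \<Omega> (hist (t + h) (s + h)))\<^sup>2
    \<le> (1 + h * w) * (norm1 \<Omega> (hist t s))\<^sup>2 + 2 * h * ip1 \<Omega> (hist t s) (vel t) + (h * w + h\<^sup>2 * L\<^sup>2)"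
proof -
  have L0: "0 \<le> L" using order_trans[OF norm1_nonneg L[of t]] h by simp
  have w0: "0 \<le> w" using order_trans[OF norm1_nonneg w[of t]] h by simp
  show ?thesis
    using history_step[OF t h] AE_space
  proof eventually_elim
    case (elim s)
    then have s: "0 < s" by simp
    let ?x = "hist (t + h) (s + h)" and ?e = "hist t s"
    let ?d = "?x - ?e"
    have x: "?x \<in> V \<Omega>" and e: "?e \<in> V \<Omega>" using s h by (auto intro: hist_V)
    have d: "?d \<in> V \<Omega>" by (rule V_diff[OF x e])
    show ?case
    proof
      assume mu: "\<mu> (s + h) > 0"
      have rep: "ip1 \<Omega> ?d v = integral {0..h} (\<lambda>\<sigma>. ip1 \<Omega> (vel (t + h - \<sigma>)) v)" if "v \<in> V \<Omega>" for v
        using elim(1) mu that by blast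
      have cont: "continuous_on {0..h} (\<lambda>\<sigma>. ip1 \<Omega> (vel (t + h - \<sigma>)) v)" if "v \<in> V \<Omega>" for v
        by (rule continuous_on_subset[OF vel_ip1_continuous[OF that]]) (use t in auto)
      have "(norm1 \<Omega> ?d)\<^sup>2 \<le> norm (integral {0..h} (\<lambda>\<sigma>. ip1 \<Omega> (vel (t + h - \<sigma>)) ?d))"
        using rep[OF d] by (simp add: norm1_power2)
      also have "\<dots> \<le> (L * norm1 \<Omega> ?d) * (h - 0)"
      proof (rule integral_bound[OF _ cont[OF d]])
        fix \<sigma> assume "\<sigma> \<in> {0..h}"
        then have "nv (t + h - \<sigma>) \<le> L" by (intro L) auto
        then have "nv (t + h - \<sigma>) * norm1 \<Omega> ?d \<le> L * norm1 \<Omega> ?d"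
          by (rule mult_right_mono[OF _ norm1_nonneg])
        then show "norm (ip1 \<Omega> (vel (t + h - \<sigma>)) ?d) \<le> L * norm1 \<Omega> ?d"
          unfolding real_norm_def by (rule order_trans[OF ip1_Cauchy_Schwarz[OF vel_V d]])
      qed (use h in simp)
      finally have "norm1 \<Omega> ?d * norm1 \<Omega> ?d \<le> (h * L) * norm1 \<Omega> ?d"
        by (simp add: power2_eq_square mult_ac)
      then have nd: "norm1 \<Omega> ?d \<le> h * L"
        using norm1_nonneg[of ?d] L0 h by (cases "norm1 \<Omega> ?d = 0") auto
      have nd2: "(norm1 \<Omega> ?d)\<^sup>2 \<le> h\<^sup>2 * L\<^sup>2"
        using power_mono[OF nd norm1_nonneg, of 2] by (simp add: power_mult_distrib)
      have "ip1 \<Omega> ?d ?e - h * ip1 \<Omega> (vel t) ?e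
          = integral {0..h} (\<lambda>\<sigma>. ip1 \<Omega> (vel (t + h - \<sigma>)) ?e) - integral {0..h} (\<lambda>\<sigma>. ip1 \<Omega> (vel t) ?e)"
        using rep[OF e] h by simp
      also have "\<dots> = integral {0..h} (\<lambda>\<sigma>. ip1 \<Omega> (vel (t + h - \<sigma>)) ?e - ip1 \<Omega> (vel t) ?e)"
        by (intro Henstock_Kurzweil_Integration.integral_diff[symmetric] integrable_continuous_real cont e continuous_intros)
      also have "\<dots> \<le> norm (integral {0..h} (\<lambda>\<sigma>. ip1 \<Omega> (vel (t + h - \<sigma>)) ?e - ip1 \<Omega> (vel t) ?e))" by simp
      also have "\<dots> \<le> (w * norm1 \<Omega> ?e) * (h - 0)"
      proof (rule integral_bound)
        show "continuous_on {0..h} (\<lambda>\<sigma>. ip1 \<Omega> (vel (t + h - \<sigma>)) ?e - ip1 \<Omega> (vel t) ?e)"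
          by (intro continuous_on_diff cont e continuous_on_const)
        fix \<sigma> assume "\<sigma> \<in> {0..h}"
        then have "norm1 \<Omega> (vel (t + h - \<sigma>) - vel t) \<le> w" by (intro w) auto
        then have "norm1 \<Omega> (vel (t + h - \<sigma>) - vel t) * norm1 \<Omega> ?e \<le> w * norm1 \<Omega> ?e"
          by (rule mult_right_mono[OF _ norm1_nonneg])
        then show "norm (ip1 \<Omega> (vel (t + h - \<sigma>)) ?e - ip1 \<Omega> (vel t) ?e) \<le> w * norm1 \<Omega> ?e"
          unfolding real_norm_def ip1_diff[OF vel_V vel_V e, symmetric]
          by (rule order_trans[OF ip1_Cauchy_Schwarz[OF V_diff[OF vel_V vel_V] e]])
      qed (use h in simp)
      finally have de: "ip1 \<Omega> ?d ?e \<le> h * ip1 \<Omega> ?e (vel t) + h * w * norm1 \<Omega> ?e"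
        by (simp add: ip1_commute[of "vel t"] mult_ac)
      \<comment> \<open>This replaces the error term linear in the old history by a quadratic and a
        constant one, both integrable against \<open>\<mu>\<close>.\<close>
      have "2 * norm1 \<Omega> ?e \<le> 1 + (norm1 \<Omega> ?e)\<^sup>2"
        using sum_squares_bound[of 1 "norm1 \<Omega> ?e"] by simp
      then have "(h * w) * (2 * norm1 \<Omega> ?e) \<le> (h * w) * (1 + (norm1 \<Omega> ?e)\<^sup>2)"
        using h w0 by (intro mult_left_mono) auto
      then have amgm: "2 * (h * w * norm1 \<Omega> ?e) \<le> h * w + h * w * (norm1 \<Omega> ?e)\<^sup>2"
        by (simp add: algebra_simps)
      have "(norm1 \<Omega> ?x)\<^sup>2 = (norm1 \<Omega> ?d)\<^sup>2 + 2 * ip1 \<Omega> ?d ?e + (norm1 \<Omega> ?e)\<^sup>2"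
        unfolding norm1_power2 ip1_diff[OF x e d] ip1_diff[OF x e e] ip1_diff_right[OF x e x] ip1_diff_right[OF x e e]
        using ip1_commute[of ?x ?e] by simp
      also have "\<dots> \<le> h\<^sup>2 * L\<^sup>2 + (2 * (h * ip1 \<Omega> ?e (vel t)) + (h * w + h * w * (norm1 \<Omega> ?e)\<^sup>2)) + (norm1 \<Omega> ?e)\<^sup>2"
        using nd2 de amgm by simp
      finally show "(norm1 \<Omega> ?x)\<^sup>2 \<le> (1 + h * w) * (norm1 \<Omega> ?e)\<^sup>2 + 2 * h * ip1 \<Omega> ?e (vel t) + (h * w + h\<^sup>2 * L\<^sup>2)"
        by (simp add: algebra_simps)
    qed
  qed
qed

text \<open>The exchange term between memory and velocity, with the kernel shifted as it appears at
  finite h. Its limit is cancelled by the corresponding kinetic term.\<close>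

definition coupling :: "real \<Rightarrow> real \<Rightarrow> real" where
  "coupling t h = (\<integral>s. \<mu> (s + h) * ip1 \<Omega> (hist t s) (vel t) \<partial>half_line)"

lemma coupling_measurable: "(\<lambda>s. ip1 \<Omega> (hist t s) (vel t)) \<in> borel_measurable half_line"
  by (rule memory_ip1_measurable[OF hist_memory memory_const[OF vel_V]])

lemma coupling_integrable: "integrable half_line (\<lambda>s. \<mu> s * ip1 \<Omega> (hist t s) (vel t))"
  by (rule memory_integrable[OF hist_memory memory_const[OF vel_V]])

text \<open>Continuity of the kernel gives pointwise convergence, and its monotonicity gives a
  majorant independent of h even if the kernel is unbounded near 0.\<close>

lemma coupling_tendsto:
  "((\<lambda>h. coupling t h) \<longlongrightarrow> ip_memory \<Omega> \<mu> (hist t) (\<lambda>s. vel t)) (at_right 0)"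
  unfolding tendsto_at_iff_sequentially
proof (intro allI impI)
  fix X :: "nat \<Rightarrow> real" assume X: "\<forall>i. X i \<in> {0<..} - {0}" "X \<longlonglongrightarrow> 0"
  have Xn: "0 < X i" for i using X(1) by auto
  show "((\<lambda>h. coupling t h) \<circ> X) \<longlonglongrightarrow> ip_memory \<Omega> \<mu> (hist t) (\<lambda>s. vel t)"
    unfolding coupling_def o_def ip_memory_def
  proof (rule integral_dominated_convergence[where w="\<lambda>s. \<bar>\<mu> s * ip1 \<Omega> (hist t s) (vel t)\<bar>"])
    show "AE s in half_line. (\<lambda>i. \<mu> (s + X i) * ip1 \<Omega> (hist t s) (vel t)) \<longlonglongrightarrow> \<mu> s * ip1 \<Omega> (hist t s) (vel t)"
    proof (intro AE_I2 tendsto_mult_right)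
      fix s assume "s \<in> space half_line"
      then have s: "0 < s" by simp
      have "isCont \<mu> s" using mu_continuous s by (simp add: continuous_on_eq_continuous_at)
      moreover have "(\<lambda>i. s + X i) \<longlonglongrightarrow> s" using tendsto_add[OF tendsto_const[of s] X(2)] by simp
      ultimately show "(\<lambda>i. \<mu> (s + X i)) \<longlonglongrightarrow> \<mu> s" by (rule isCont_tendsto_compose)
    qed
    show "AE s in half_line. norm (\<mu> (s + X i) * ip1 \<Omega> (hist t s) (vel t)) \<le> \<bar>\<mu> s * ip1 \<Omega> (hist t s) (vel t)\<bar>" for i
    proof (intro AE_I2)
      fix s assume "s \<in> space half_line"
      then have s: "0 < s" by simp
      show "norm (\<mu> (s + X i) * ip1 \<Omega> (hist t s) (vel t)) \<le> \<bar>\<mu> s * ip1 \<Omega> (hist t s) (vel t)\<bar>"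
        unfolding real_norm_def abs_mult
        using mu_shift_le[OF s less_imp_le[OF Xn[of i]]] mu_nonneg[OF s] by (intro mult_right_mono) auto
    qed
    show "(\<lambda>s. \<mu> (s + X i) * ip1 \<Omega> (hist t s) (vel t)) \<in> borel_measurable half_line" for i
      using shifted_integrable[OF coupling_integrable coupling_measurable less_imp_le[OF Xn]] by auto
    show "integrable half_line (\<lambda>s. \<bar>\<mu> s * ip1 \<Omega> (hist t s) (vel t)\<bar>)"
      using coupling_integrable by (rule integrable_abs)
    show "(\<lambda>s. \<mu> s * ip1 \<Omega> (hist t s) (vel t)) \<in> borel_measurable half_line"
      using coupling_integrable by auto
  qed
qed

text \<open>The new history is split at s = h. The recent part is O(h^2); in the rest s is replaced
  by s + h and \<open>history_growth\<close> applies under the weight \<mu>(s + h). The exponential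
  decay is used for the quadratic term, plain monotonicity for the constant one. Each part
  contributes one h^2 L^2, whence the factor 2.\<close>

lemma memory_growth:
  assumes t: "0 \<le> t" and h: "0 < h" and L: "\<And>r. r \<in> {t..t + h} \<Longrightarrow> nv r \<le> L"
    and w: "\<And>r. r \<in> {t..t + h} \<Longrightarrow> norm1 \<Omega> (vel r - vel t) \<le> w"
  shows "(nm (t + h))\<^sup>2 \<le> (1 + h * w) * exp (- \<delta> * h) * (nm t)\<^sup>2 + 2 * h * coupling t h + (h * w + 2 * h\<^sup>2 * L\<^sup>2) * kappa"
proof -
  have h0: "0 \<le> h" using h by simp
  have w0: "0 \<le> w" using order_trans[OF norm1_nonneg w[of t]] h by simp
  have rb: "AE s in half_line. \<mu> s > 0 \<longrightarrow> s \<le> h \<longrightarrow> norm1 \<Omega> (hist (t + h) s) \<le> h * L"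
    by (rule recent_history_bound[OF t h], rule L)
  have hg: "AE s in half_line. \<mu> (s + h) > 0 \<longrightarrow> (norm1 \<Omega> (hist (t + h) (s + h)))\<^sup>2
    \<le> (1 + h * w) * (norm1 \<Omega> (hist t s))\<^sup>2 + 2 * h * ip1 \<Omega> (hist t s) (vel t) + (h * w + h\<^sup>2 * L\<^sup>2)"
    by (rule history_growth[OF t h], rule L, assumption, rule w)
  define f where "f s = \<mu> s * (norm1 \<Omega> (hist (t + h) s))\<^sup>2" for s
  have f: "integrable half_line f" unfolding f_def by (rule hist_norm_integrable)
  have fi: "integrable half_line (\<lambda>s. indicator {h<..} s * f s)" "integrable half_line (\<lambda>s. indicator {..h} s * f s)"
  proof -
    have i: "integrable half_line (\<lambda>s. indicator A s * f s)" if A: "A \<in> sets lebesgue" for A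
    proof (rule iffD2[OF Bochner_Integration.integrable_cong[OF refl]])
      have "A \<inter> {0<..} \<in> sets half_line" using A by (auto simp: sets_restrict_space)
      then show "integrable half_line (\<lambda>s. indicator (A \<inter> {0<..}) s *\<^sub>R f s)"
        by (rule integrable_mult_indicator[OF _ f])
      show "indicator A s * f s = indicator (A \<inter> {0<..}) s *\<^sub>R f s" if "s \<in> space half_line" for s
        using that by (simp add: indicator_def)
    qed
    show "integrable half_line (\<lambda>s. indicator {h<..} s * f s)" "integrable half_line (\<lambda>s. indicator {..h} s * f s)"
      by (intro i; simp)+
  qed
  have split: "(nm (t + h))\<^sup>2 = (\<integral>s. indicator {..h} s * f s \<partial>half_line) + (\<integral>s. indicator {h<..} s * f s \<partial>half_line)"
  proof -
    have "(nm (t + h))\<^sup>2 = (\<integral>s. indicator {..h} s * f s + indicator {h<..} s * f s \<partial>half_line)"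
      unfolding nm_power2 f_def by (intro Bochner_Integration.integral_cong refl) (auto simp: indicator_def)
    then show ?thesis using fi by simp
  qed
  have part1: "(\<integral>s. indicator {..h} s * f s \<partial>half_line) \<le> h\<^sup>2 * L\<^sup>2 * kappa"
  proof -
    have "(\<integral>s. indicator {..h} s * f s \<partial>half_line) \<le> (\<integral>s. h\<^sup>2 * L\<^sup>2 * \<mu> s \<partial>half_line)"
    proof (rule integral_mono_AE[OF fi(2)])
      show "integrable half_line (\<lambda>s. h\<^sup>2 * L\<^sup>2 * \<mu> s)" using mu_integrable by simp
      show "AE s in half_line. indicator {..h} s * f s \<le> h\<^sup>2 * L\<^sup>2 * \<mu> s"
        using rb AE_space
      proof eventually_elim
        case (elim s)
        then have s: "0 < s" by simp
        show ?case
        proof (cases "s \<le> h \<and> \<mu> s > 0")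
          case True
          then have "norm1 \<Omega> (hist (t + h) s) \<le> h * L" using elim(1) by simp
          then have "(norm1 \<Omega> (hist (t + h) s))\<^sup>2 \<le> (h * L)\<^sup>2" by (rule power_mono[OF _ norm1_nonneg])
          then have "\<mu> s * (norm1 \<Omega> (hist (t + h) s))\<^sup>2 \<le> \<mu> s * (h * L)\<^sup>2"
            by (rule mult_left_mono[OF _ mu_nonneg[OF s]])
          then show ?thesis using True by (simp add: f_def power_mult_distrib mult_ac)
        next
          case False
          then have z: "indicator {..h} s * f s = 0"
            using mu_nonneg[OF s] by (auto simp: indicator_def f_def)
          show ?thesis unfolding z using mu_nonneg[OF s] by simp
        qed
      qed
    qed
    then show ?thesis by (simp add: kappa_def)
  qed
  let ?g1 = "\<lambda>s. \<mu> (s + h) * (norm1 \<Omega> (hist t s))\<^sup>2" and ?g2 = "\<lambda>s. \<mu> (s + h) * ip1 \<Omega> (hist t s) (vel t)"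
  have m1: "(\<lambda>s. (norm1 \<Omega> (hist t s))\<^sup>2) \<in> borel_measurable half_line"
    by (intro borel_measurable_power strongly_measurable_norm1 memory_strongly_measurable hist_memory) auto
  have i1: "integrable half_line ?g1" by (rule shifted_integrable[OF hist_norm_integrable m1 h0])
  have i2: "integrable half_line ?g2" by (rule shifted_integrable[OF coupling_integrable coupling_measurable h0])
  have i3: "integrable half_line (\<lambda>s. \<mu> (s + h))" by (rule mu_shift_integrable[OF h0])
  have b1: "(\<integral>s. ?g1 s \<partial>half_line) \<le> exp (- \<delta> * h) * (nm t)\<^sup>2"
  proof -
    have "(\<integral>s. ?g1 s \<partial>half_line) \<le> (\<integral>s. exp (- \<delta> * h) * (\<mu> s * (norm1 \<Omega> (hist t s))\<^sup>2) \<partial>half_line)"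
    proof (rule integral_mono[OF i1])
      show "integrable half_line (\<lambda>s. exp (- \<delta> * h) * (\<mu> s * (norm1 \<Omega> (hist t s))\<^sup>2))"
        using hist_norm_integrable by simp
      fix s assume "s \<in> space half_line"
      then have s: "0 < s" by simp
      show "?g1 s \<le> exp (- \<delta> * h) * (\<mu> s * (norm1 \<Omega> (hist t s))\<^sup>2)"
        using mult_right_mono[OF mu_decay[OF s h0], of "(norm1 \<Omega> (hist t s))\<^sup>2"] by (simp add: mult.assoc)
    qed
    then show ?thesis by (simp add: nm_power2)
  qed
  have b3: "(\<integral>s. \<mu> (s + h) \<partial>half_line) \<le> kappa"
    unfolding kappa_def by (rule integral_mono[OF i3 mu_integrable]) (use mu_shift_le(1) h0 in auto)
  have part2: "(\<integral>s. indicator {h<..} s * f s \<partial>half_line)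
      \<le> (1 + h * w) * (exp (- \<delta> * h) * (nm t)\<^sup>2) + 2 * h * coupling t h + (h * w + h\<^sup>2 * L\<^sup>2) * kappa"
  proof -
    have "(\<integral>s. indicator {h<..} s * f s \<partial>half_line) = (\<integral>s. f (s + h) \<partial>half_line)"
      by (rule half_line_integral_shift(2)[OF f h0, symmetric])
    also have "\<dots> \<le> (\<integral>s. (1 + h * w) * ?g1 s + 2 * h * ?g2 s + (h * w + h\<^sup>2 * L\<^sup>2) * \<mu> (s + h) \<partial>half_line)"
    proof (rule integral_mono_AE)
      show "integrable half_line (\<lambda>s. f (s + h))" by (rule half_line_integral_shift(1)[OF f h0])
      show "integrable half_line (\<lambda>s. (1 + h * w) * ?g1 s + 2 * h * ?g2 s + (h * w + h\<^sup>2 * L\<^sup>2) * \<mu> (s + h))"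
        by (intro Bochner_Integration.integrable_add integrable_mult_right i1 i2 i3)
      show "AE s in half_line. f (s + h) \<le> (1 + h * w) * ?g1 s + 2 * h * ?g2 s + (h * w + h\<^sup>2 * L\<^sup>2) * \<mu> (s + h)"
        using hg AE_space
      proof eventually_elim
        case (elim s)
        then have s: "0 < s" by simp
        show ?case
        proof (cases "\<mu> (s + h) > 0")
          case True
          then have "\<mu> (s + h) * (norm1 \<Omega> (hist (t + h) (s + h)))\<^sup>2 \<le> \<mu> (s + h) *
            ((1 + h * w) * (norm1 \<Omega> (hist t s))\<^sup>2 + 2 * h * ip1 \<Omega> (hist t s) (vel t) + (h * w + h\<^sup>2 * L\<^sup>2))"
            using elim(1) by (intro mult_left_mono) auto
          then show ?thesis unfolding f_def by (simp add: algebra_simps)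
        next
          case False
          then have "\<mu> (s + h) = 0" using mu_shift_le(2)[OF s h0] by simp
          then show ?thesis by (simp add: f_def)
        qed
      qed
    qed
    also have "\<dots> = (1 + h * w) * (\<integral>s. ?g1 s \<partial>half_line) + 2 * h * coupling t h + (h * w + h\<^sup>2 * L\<^sup>2) * (\<integral>s. \<mu> (s + h) \<partial>half_line)"
      using i1 i2 i3 by (simp add: coupling_def)
    also have "\<dots> \<le> (1 + h * w) * (exp (- \<delta> * h) * (nm t)\<^sup>2) + 2 * h * coupling t h + (h * w + h\<^sup>2 * L\<^sup>2) * kappa"
      using h w0 by (intro add_mono mult_left_mono b1 b3) auto
    finally show ?thesis .
  qed
  show ?thesis using part1 part2 unfolding split by (simp add: algebra_simps)
qed

text \<open>This is \<open>memory_growth\<close> with w = K h, so that all errors are of second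
  order and disappear after division by h.\<close>

lemma memory_dini:
  assumes t: "0 \<le> t" and "0 < \<epsilon>"
  shows "\<exists>d>0. \<forall>h. 0 < h \<and> h < d \<longrightarrow>
    (nm (t + h))\<^sup>2 - (nm t)\<^sup>2 \<le> h * (- \<delta> * (nm t)\<^sup>2 + 2 * ip_memory \<Omega> \<mu> (hist t) (\<lambda>s. vel t) + \<epsilon>)"
proof -
  obtain L K where LK: "0 \<le> L" "0 \<le> K" "\<And>r. r \<in> {t..t + 1} \<Longrightarrow> nv r \<le> L"
    "\<And>h r. r \<in> {t..t + h} \<Longrightarrow> h \<le> 1 \<Longrightarrow> norm1 \<Omega> (vel r - vel t) \<le> K * h"
    by (rule local_bounds[OF t]) blast
  let ?P = "ip_memory \<Omega> \<mu> (hist t) (\<lambda>s. vel t)"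
  \<comment> \<open>The whole coefficient of the old memory norm; the factor with K h^2 does not
    affect its derivative at 0, which is -\<delta>.\<close>
  define F where "F h = (1 + K * h\<^sup>2) * exp (- \<delta> * h)" for h
  have "(F has_real_derivative - \<delta>) (at 0)"
    unfolding F_def[abs_def] by (auto intro!: derivative_eq_intros)
  then have "((\<lambda>h. (F h - 1) / h) \<longlongrightarrow> - \<delta>) (at 0)"
    by (simp add: DERIV_def F_def)
  then have F: "((\<lambda>h. (F h - 1) / h) \<longlongrightarrow> - \<delta>) (at_right 0)"
    by (rule filterlim_mono[OF _ order_refl at_le]) simp
  have "((\<lambda>h. (F h - 1) / h * (nm t)\<^sup>2 + 2 * coupling t h + (K * h + 2 * h * L\<^sup>2) * kappa)
      \<longlongrightarrow> - \<delta> * (nm t)\<^sup>2 + 2 * ?P + (K * 0 + 2 * 0 * L\<^sup>2) * kappa) (at_right 0)"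
    by (intro tendsto_intros F coupling_tendsto)
  then have "\<forall>\<^sub>F h in at_right 0. (F h - 1) / h * (nm t)\<^sup>2 + 2 * coupling t h + (K * h + 2 * h * L\<^sup>2) * kappa
      < - \<delta> * (nm t)\<^sup>2 + 2 * ?P + \<epsilon>"
    by (rule order_tendstoD) (use \<open>0 < \<epsilon>\<close> in simp)
  then obtain d where d: "d > 0" "\<And>h. 0 < h \<Longrightarrow> h < d \<Longrightarrow>
      (F h - 1) / h * (nm t)\<^sup>2 + 2 * coupling t h + (K * h + 2 * h * L\<^sup>2) * kappa < - \<delta> * (nm t)\<^sup>2 + 2 * ?P + \<epsilon>"
    unfolding eventually_at_right_field by blast
  show ?thesis
  proof (intro exI[of _ "min d 1"] conjI allI impI)
    show "0 < min d 1" using d(1) by simp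
    fix h assume "0 < h \<and> h < min d 1"
    then have h: "0 < h" "h < d" "h \<le> 1" by auto
    have "(nm (t + h))\<^sup>2 \<le> (1 + h * (K * h)) * exp (- \<delta> * h) * (nm t)\<^sup>2 + 2 * h * coupling t h
        + (h * (K * h) + 2 * h\<^sup>2 * L\<^sup>2) * kappa"
      by (rule memory_growth[OF t h(1)]) (use LK h in auto)
    also have "\<dots> = (nm t)\<^sup>2 + h * ((F h - 1) / h * (nm t)\<^sup>2 + 2 * coupling t h + (K * h + 2 * h * L\<^sup>2) * kappa)"
      using h(1) by (simp add: F_def field_simps power2_eq_square)
    also have "\<dots> \<le> (nm t)\<^sup>2 + h * (- \<delta> * (nm t)\<^sup>2 + 2 * ?P + \<epsilon>)"
      using d(2)[OF h(1,2)] h(1) by (intro add_left_mono mult_left_mono) auto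
    finally show "(nm (t + h))\<^sup>2 - (nm t)\<^sup>2 \<le> h * (- \<delta> * (nm t)\<^sup>2 + 2 * ?P + \<epsilon>)" by simp
  qed
qed

lemma force_self: "force t (vel t) = ip_memory \<Omega> \<mu> (hist t) (\<lambda>s. vel t)"
  by (simp add: force_def trilinear_self[OF vel_V])

lemma kinetic_dini:
  assumes t: "0 \<le> t" and "0 < \<epsilon>"
  shows "\<exists>d>0. \<forall>h. 0 < h \<and> h < d \<longrightarrow>
    bform (vel (t + h)) (vel (t + h)) - bform (vel t) (vel t)
      \<le> h * (- 2 * ip_memory \<Omega> \<mu> (hist t) (\<lambda>s. vel t) + \<epsilon>)"
proof -
  obtain L K where LK: "0 \<le> L" "0 \<le> K" "\<And>r. r \<in> {t..t + 1} \<Longrightarrow> nv r \<le> L"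
    "\<And>h r. r \<in> {t..t + h} \<Longrightarrow> h \<le> 1 \<Longrightarrow> norm1 \<Omega> (vel r - vel t) \<le> K * h"
    by (rule local_bounds[OF t]) blast
  let ?P = "ip_memory \<Omega> \<mu> (hist t) (\<lambda>s. vel t)" and ?v = "vel t"
  define C where "C = (sobolev_constant + \<alpha>) * K\<^sup>2"
  have C: "0 \<le> C" using sobolev_constant_pos alpha_pos by (simp add: C_def)
  note fc = force_continuous[OF vel_V[of t]]
  have "\<forall>e>0. \<exists>d>0. \<forall>r\<in>{0..}. dist r t < d \<longrightarrow> dist (force r ?v) (force t ?v) < e"
    using fc t by (simp add: continuous_on_iff)
  then obtain d1 where d1: "d1 > 0" "\<And>r. 0 \<le> r \<Longrightarrow> dist r t < d1 \<Longrightarrow> dist (force r ?v) (force t ?v) < \<epsilon> / 4"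
    using \<open>0 < \<epsilon>\<close> by (metis atLeast_iff divide_pos_pos zero_less_numeral)
  \<comment> \<open>The last bound makes the quadratic remainder C h at most \<epsilon> / 2; the
    summand 1 covers C = 0.\<close>
  define d where "d = min d1 (min 1 (\<epsilon> / (2 * (C + 1))))"
  have "d > 0" using d1(1) \<open>0 < \<epsilon>\<close> C by (simp add: d_def)
  moreover have "bform (vel (t + h)) (vel (t + h)) - bform ?v ?v \<le> h * (- 2 * ?P + \<epsilon>)" if "0 < h" "h < d" for h
  proof -
    have h: "0 < h" "h < d1" "h \<le> 1" "h \<le> \<epsilon> / (2 * (C + 1))" using that by (auto simp: d_def)
    let ?x = "vel (t + h)"
    let ?d = "?x - ?v"
    have dV: "?d \<in> V \<Omega>" by (rule V_diff[OF vel_V vel_V])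
    have "bform ?d ?d \<le> (sobolev_constant + \<alpha>) * (norm1 \<Omega> ?d)\<^sup>2" by (rule bform_le[OF dV])
    also have "\<dots> \<le> (sobolev_constant + \<alpha>) * (K * h)\<^sup>2"
      using sobolev_constant_pos alpha_pos LK(4)[of "t + h" h] h
      by (intro mult_left_mono power_mono norm1_nonneg) auto
    also have "\<dots> = h * (C * h)" by (simp add: C_def power2_eq_square)
    also have "\<dots> \<le> h * (\<epsilon> / 2)"
    proof (rule mult_left_mono)
      have "C * h \<le> C * (\<epsilon> / (2 * (C + 1)))" using h(4) C by (rule mult_left_mono)
      also have "\<dots> \<le> \<epsilon> / 2" using C \<open>0 < \<epsilon>\<close> by (simp add: field_simps)
      finally show "C * h \<le> \<epsilon> / 2" .
    qed (use h in simp)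
    finally have 1: "bform ?d ?d \<le> h * (\<epsilon> / 2)" .
    have fi: "(\<lambda>r. force r ?v) integrable_on {t..t + h}"
      by (intro integrable_continuous_real continuous_on_subset[OF fc]) (use t in auto)
    have "integral {t..t + h} (\<lambda>r. ?P - \<epsilon> / 4) \<le> integral {t..t + h} (\<lambda>r. force r ?v)"
    proof (rule integral_le)
      fix r assume r: "r \<in> {t..t + h}"
      have "dist (force r ?v) (force t ?v) < \<epsilon> / 4"
        by (rule d1(2)) (use r t h in \<open>auto simp: dist_real_def\<close>)
      then show "?P - \<epsilon> / 4 \<le> force r ?v"
        unfolding force_self[symmetric] dist_real_def abs_less_iff by simp
    qed (use fi in auto)
    then have 2: "h * (?P - \<epsilon> / 4) \<le> integral {t..t + h} (\<lambda>r. force r ?v)" using h by simp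
    have 3: "bform ?d ?v = - integral {t..t + h} (\<lambda>r. force r ?v)"
      using momentum_balance[OF vel_V[of t] t, of "t + h"] h bform_diff[OF vel_V vel_V vel_V, of "t + h" t t] by simp
    have "bform ?x ?x - bform ?v ?v = 2 * bform ?d ?v + bform ?d ?d"
      using bform_diff[OF vel_V vel_V dV, of "t + h" t] bform_diff[OF vel_V vel_V vel_V, of "t + h" t t]
        bform_diff[OF vel_V vel_V vel_V, of "t + h" t "t + h"]
        bform_commute[of ?x ?d] bform_commute[of ?v ?d] bform_commute[of ?x ?v] by simp
    also have "\<dots> \<le> - 2 * (h * (?P - \<epsilon> / 4)) + h * (\<epsilon> / 2)" using 1 2 3 by simp
    also have "\<dots> = h * (- 2 * ?P + \<epsilon>)" by (simp add: algebra_simps)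
    finally show ?thesis .
  qed
  ultimately show ?thesis by blast
qed

definition en :: "real \<Rightarrow> real" where
  "en t = (bform (vel t) (vel t) + (nm t)\<^sup>2) / 2"

lemma energy_eq: "0 \<le> t \<Longrightarrow> energy \<Omega> \<alpha> \<mu> (U t) = en t"
  using alpha_pos
  by (simp add: energy_def norm_phase_def en_def bform_def vel_eq hist_eq norm0_power2 norm1_power2 ip_nonneg ip1_nonneg)

lemma en_nonneg: "0 \<le> en t"
  by (simp add: en_def bform_nonneg)

lemma nv_le_en: "\<alpha> * (nv t)\<^sup>2 \<le> 2 * en t"
  using bform_ge[of "vel t"] by (simp add: en_def add_increasing2)

lemma en_le: "2 * en t \<le> (sobolev_constant + \<alpha>) * (nv t)\<^sup>2 + (nm t)\<^sup>2"
  using bform_le[OF vel_V] by (simp add: en_def)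

lemma bform_bound:
  assumes "u \<in> V \<Omega>" "v \<in> V \<Omega>" shows "\<bar>bform u v\<bar> \<le> (sobolev_constant + \<alpha>) * norm1 \<Omega> u * norm1 \<Omega> v"
proof -
  have "\<bar>ip \<Omega> u v\<bar> \<le> norm0 \<Omega> u * norm0 \<Omega> v" by (rule ip_Cauchy_Schwarz[OF assms])
  also have "\<dots> \<le> (sqrt sobolev_constant * norm1 \<Omega> u) * (sqrt sobolev_constant * norm1 \<Omega> v)"
    using sobolev_constant_pos
    by (intro mult_mono norm0_le assms norm0_nonneg mult_nonneg_nonneg norm1_nonneg) auto
  also have "\<dots> = (sqrt sobolev_constant * sqrt sobolev_constant) * (norm1 \<Omega> u * norm1 \<Omega> v)"
    by (simp only: mult_ac)
  also have "\<dots> = sobolev_constant * (norm1 \<Omega> u * norm1 \<Omega> v)" using sobolev_constant_pos by simp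
  finally have 1: "\<bar>ip \<Omega> u v\<bar> \<le> sobolev_constant * (norm1 \<Omega> u * norm1 \<Omega> v)" .
  have 2: "\<bar>\<alpha> * ip1 \<Omega> u v\<bar> \<le> \<alpha> * (norm1 \<Omega> u * norm1 \<Omega> v)"
    using alpha_pos ip1_Cauchy_Schwarz[OF assms] by (simp add: abs_mult)
  show ?thesis
    unfolding bform_def using order_trans[OF abs_triangle_ineq add_mono[OF 1 2]] by (simp add: distrib_right mult.assoc)
qed

lemma en_continuous: "continuous_on {0..} en"
proof -
  let ?C = "sobolev_constant + \<alpha>"
  have "continuous_on {0..} (\<lambda>t. bform (vel t) (vel t))"
  proof (rule continuous_on_half_line_comparison)
    fix t :: real assume t: "0 \<le> t"
    have "(nv \<longlongrightarrow> nv t) (at t within {0..})" using nv_continuous t by (simp add: continuous_on_def)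
    then have "((\<lambda>r. ?C * norm1 \<Omega> (vel r - vel t) * nv r + ?C * norm1 \<Omega> (vel r - vel t) * nv t)
        \<longlongrightarrow> ?C * 0 * nv t + ?C * 0 * nv t) (at t within {0..})"
      by (intro tendsto_intros vel_tendsto t)
    then show "((\<lambda>r. ?C * norm1 \<Omega> (vel r - vel t) * nv r + ?C * norm1 \<Omega> (vel r - vel t) * nv t)
        \<longlongrightarrow> 0) (at t within {0..})" by simp
  next
    fix r t :: real
    have dV: "vel r - vel t \<in> V \<Omega>" by (rule V_diff[OF vel_V vel_V])
    have "bform (vel r) (vel r) - bform (vel t) (vel t) = bform (vel r - vel t) (vel r) + bform (vel r - vel t) (vel t)"
      using bform_commute[of "vel r" "vel t"] by (simp add: bform_diff vel_V)
    then show "\<bar>bform (vel r) (vel r) - bform (vel t) (vel t)\<bar>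
        \<le> ?C * norm1 \<Omega> (vel r - vel t) * nv r + ?C * norm1 \<Omega> (vel r - vel t) * nv t"
      using order_trans[OF abs_triangle_ineq add_mono[OF bform_bound[OF dV vel_V[of r]] bform_bound[OF dV vel_V[of t]]]]
      by simp
  qed
  then show ?thesis unfolding en_def[abs_def] by (intro continuous_intros nm_continuous) auto
qed

text \<open>In the sum of the two Dini bounds the exchange terms cancel, and -\<delta> times the
  squared memory norm remains. Adding its time integral to the energy yields a function to which
  \<open>dini_nonincreasing\<close> applies.\<close>

lemma dissipation:
  assumes ab: "0 \<le> a" "a \<le> b"
  shows "en b + \<delta> / 2 * integral {a..b} (\<lambda>r. (nm r)\<^sup>2) \<le> en a"
proof -
  define f where "f t = en t + \<delta> / 2 * integral {a..t} (\<lambda>r. (nm r)\<^sup>2)" for t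
  have nmc: "continuous_on {0..} (\<lambda>r. (nm r)\<^sup>2)" by (intro continuous_intros nm_continuous)
  have nmi: "(\<lambda>r. (nm r)\<^sup>2) integrable_on {x..y}" if "0 \<le> x" for x y
    by (intro integrable_continuous_real continuous_on_subset[OF nmc]) (use that in auto)
  have "f b \<le> f a"
  proof (rule dini_nonincreasing[OF _ ab(2)])
    show "continuous_on {a..b} f"
      unfolding f_def using ab(1)
      by (intro continuous_intros continuous_on_subset[OF en_continuous] indefinite_integral_continuous_1 nmi) auto
    fix t \<epsilon> :: real assume "a \<le> t" "t < b" "0 < \<epsilon>"
    then have t: "0 \<le> t" using ab by simp
    let ?P = "ip_memory \<Omega> \<mu> (hist t) (\<lambda>s. vel t)"
    \<comment> \<open>The Dini errors contribute h \<epsilon> / 2 after halving, and the tolerance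
      \<epsilon> / \<delta> in the integral contributes h \<epsilon> / 2 after multiplication by
      \<delta> / 2.\<close>
    have e: "0 < \<epsilon> / 2" "0 < \<epsilon> / \<delta>" using \<open>0 < \<epsilon>\<close> delta_pos by auto
    obtain d1 where d1: "d1 > 0" "\<And>h. 0 < h \<and> h < d1 \<Longrightarrow>
      (nm (t + h))\<^sup>2 - (nm t)\<^sup>2 \<le> h * (- \<delta> * (nm t)\<^sup>2 + 2 * ?P + \<epsilon> / 2)"
      using memory_dini[OF t e(1)] by blast
    obtain d2 where d2: "d2 > 0" "\<And>h. 0 < h \<and> h < d2 \<Longrightarrow>
      bform (vel (t + h)) (vel (t + h)) - bform (vel t) (vel t) \<le> h * (- 2 * ?P + \<epsilon> / 2)"
      using kinetic_dini[OF t e(1)] by blast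
    have "\<forall>e>0. \<exists>d>0. \<forall>r\<in>{0..}. dist r t < d \<longrightarrow> dist ((nm r)\<^sup>2) ((nm t)\<^sup>2) < e"
      using nmc t by (simp add: continuous_on_iff)
    then obtain d3 where d3: "d3 > 0" "\<And>r. 0 \<le> r \<Longrightarrow> dist r t < d3 \<Longrightarrow> dist ((nm r)\<^sup>2) ((nm t)\<^sup>2) < \<epsilon> / \<delta>"
      using e(2) by (metis atLeast_iff)
    have "f (t + h) - f t \<le> \<epsilon> * h" if h: "0 < h" "h < min d1 (min d2 d3)" for h
    proof -
      have s: "integral {a..t} (\<lambda>r. (nm r)\<^sup>2) + integral {t..t + h} (\<lambda>r. (nm r)\<^sup>2) = integral {a..t + h} (\<lambda>r. (nm r)\<^sup>2)"
        using h \<open>a \<le> t\<close> ab by (intro Henstock_Kurzweil_Integration.integral_combine nmi) auto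
      have eq: "f (t + h) - f t = en (t + h) - en t + \<delta> / 2 * integral {t..t + h} (\<lambda>r. (nm r)\<^sup>2)"
        unfolding f_def s[symmetric] distrib_left by simp
      have "integral {t..t + h} (\<lambda>r. (nm r)\<^sup>2) \<le> integral {t..t + h} (\<lambda>r. (nm t)\<^sup>2 + \<epsilon> / \<delta>)"
      proof (rule integral_le[OF nmi[OF t]])
        fix r assume r: "r \<in> {t..t + h}"
        have "dist ((nm r)\<^sup>2) ((nm t)\<^sup>2) < \<epsilon> / \<delta>"
          by (rule d3(2)) (use r t h in \<open>auto simp: dist_real_def\<close>)
        then show "(nm r)\<^sup>2 \<le> (nm t)\<^sup>2 + \<epsilon> / \<delta>" unfolding dist_real_def abs_less_iff by simp
      qed auto
      then have "integral {t..t + h} (\<lambda>r. (nm r)\<^sup>2) \<le> h * ((nm t)\<^sup>2 + \<epsilon> / \<delta>)" using h by simp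
      then have 3: "\<delta> / 2 * integral {t..t + h} (\<lambda>r. (nm r)\<^sup>2) \<le> \<delta> / 2 * (h * ((nm t)\<^sup>2 + \<epsilon> / \<delta>))"
        using delta_pos by (intro mult_left_mono) auto
      have 1: "(nm (t + h))\<^sup>2 - (nm t)\<^sup>2 \<le> h * (- \<delta> * (nm t)\<^sup>2 + 2 * ?P + \<epsilon> / 2)"
        using d1(2) h by simp
      have 2: "bform (vel (t + h)) (vel (t + h)) - bform (vel t) (vel t) \<le> h * (- 2 * ?P + \<epsilon> / 2)"
        using d2(2) h by simp
      have "en (t + h) - en t = ((bform (vel (t + h)) (vel (t + h)) - bform (vel t) (vel t)) + ((nm (t + h))\<^sup>2 - (nm t)\<^sup>2)) / 2"
        by (simp add: en_def field_simps)
      also have "\<dots> \<le> (h * (- 2 * ?P + \<epsilon> / 2) + h * (- \<delta> * (nm t)\<^sup>2 + 2 * ?P + \<epsilon> / 2)) / 2"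
        by (intro divide_right_mono add_mono 1 2) simp
      finally have "f (t + h) - f t \<le> (h * (- 2 * ?P + \<epsilon> / 2) + h * (- \<delta> * (nm t)\<^sup>2 + 2 * ?P + \<epsilon> / 2)) / 2
          + \<delta> / 2 * (h * ((nm t)\<^sup>2 + \<epsilon> / \<delta>))"
        unfolding eq using 3 by (rule add_mono)
      also have "\<dots> = \<epsilon> * h" using delta_pos by (simp add: field_simps)
      finally show ?thesis .
    qed
    then show "\<exists>d>0. \<forall>h. 0 < h \<and> h < d \<longrightarrow> f (t + h) - f t \<le> \<epsilon> * h"
      using d1(1) d2(1) d3(1) by (intro exI[of _ "min d1 (min d2 d3)"]) auto
  qed
  then show ?thesis by (simp add: f_def)
qed

lemma en_antimono:
  assumes "0 \<le> a" "a \<le> b" shows "en b \<le> en a"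
proof -
  have "0 \<le> \<delta> / 2 * integral {a..b} (\<lambda>r. (nm r)\<^sup>2)"
    using delta_pos assms(1)
    by (intro mult_nonneg_nonneg integral_nonneg integrable_continuous_real continuous_intros
        continuous_on_subset[OF nm_continuous]) auto
  then show ?thesis using dissipation[OF assms] by linarith
qed

end

section \<open>Recovering the velocity from the memory, and the decay rate\<close>

section \<open>Exponential decay\<close>

lemma integral_Cauchy_Schwarz:
  fixes f :: "real \<Rightarrow> real"
  assumes "a \<le> b" and f: "continuous_on {a..b} f"
  shows "(integral {a..b} f)\<^sup>2 \<le> integral {a..b} (\<lambda>r. (f r)\<^sup>2) * (b - a)"
proof (rule quadratic_form_nonneg_imp)
  fix l :: real
  have i: "f integrable_on {a..b}" "(\<lambda>r. (f r)\<^sup>2) integrable_on {a..b}"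
    by (intro integrable_continuous_real continuous_intros f)+
  have "0 \<le> integral {a..b} (\<lambda>r. (f r - l)\<^sup>2)"
    by (intro integral_nonneg integrable_continuous_real continuous_intros f) auto
  also have "(\<lambda>r. (f r - l)\<^sup>2) = (\<lambda>r. (f r)\<^sup>2 - 2 * l * f r + l\<^sup>2)"
    by (intro ext) (simp add: power2_diff)
  also have "integral {a..b} (\<lambda>r. (f r)\<^sup>2 - 2 * l * f r + l\<^sup>2)
      = integral {a..b} (\<lambda>r. (f r)\<^sup>2 - 2 * l * f r) + integral {a..b} (\<lambda>r. l\<^sup>2)"
    by (intro Henstock_Kurzweil_Integration.integral_add integrable_diff i integrable_on_mult_right integrable_const_ivl)
  also have "integral {a..b} (\<lambda>r. (f r)\<^sup>2 - 2 * l * f r) = integral {a..b} (\<lambda>r. (f r)\<^sup>2) - integral {a..b} (\<lambda>r. 2 * l * f r)"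
    by (intro Henstock_Kurzweil_Integration.integral_diff i integrable_on_mult_right)
  also have "integral {a..b} (\<lambda>r. 2 * l * f r) = 2 * l * integral {a..b} f" by simp
  also have "integral {a..b} (\<lambda>r. l\<^sup>2) = l\<^sup>2 * (b - a)" using assms(1) by simp
  finally show "0 \<le> integral {a..b} (\<lambda>r. (f r)\<^sup>2) - 2 * l * integral {a..b} f + l\<^sup>2 * (b - a)" .
qed (use assms in simp)

context voigt
begin

text \<open>The delay \<open>window R\<close> is so short that the convective term changes the velocity by at most a
  small multiple of the energy as long as the energy does not exceed \<open>R\<close>.\<close>

definition window :: "real \<Rightarrow> real" where
  "window R = min (min s1 1) (\<alpha>\<^sup>2 / sqrt (32 * (sobolev_constant + \<alpha>) * trilinear_constant\<^sup>2 * R))"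

text \<open>The factor in 2 E(t0 + 2) \<le> \<open>observability R\<close> * D + E(t0) / 2, where D
  is the time integral of the squared memory norm over [t0, t0 + 2]. The first term comes from
  reading the velocity off the history, the 1 from the memory part of the energy, the last from the
  memory part of the drag.\<close>

definition observability :: "real \<Rightarrow> real" where
  "observability R = 16 * (sobolev_constant + \<alpha>) / (m * (window R) ^ 3) + 1
    + 4 * (sobolev_constant + \<alpha>) * kappa / \<alpha>\<^sup>2"

text \<open>Dissipation gives D \<le> (2 / \<delta>)(E(t0) - E(t0 + 2)). With K = 2
  \<open>observability R\<close> / \<delta> the observability estimate becomes (K + 2) E(t0 + 2)
  \<le> (K + 1/2) E(t0), whose quotient this is.\<close>

definition contraction :: "real \<Rightarrow> real" where
  "contraction R = (2 * observability R / \<delta> + 1 / 2) / (2 * observability R / \<delta> + 2)"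

text \<open>The bound by s1 keeps the delay where the kernel is at least m, the bound by 1 keeps it
  inside a step of length two. The last claim absorbs the convective term into half of the energy,
  which is why 32, twice 16, stands under the root.\<close>

lemma window:
  assumes "0 < R"
  shows "0 < window R" "window R \<le> s1" "window R \<le> 1"
    and "(sobolev_constant + \<alpha>) * (16 * trilinear_constant\<^sup>2 * (window R)\<^sup>2 * R / \<alpha> ^ 4) \<le> 1 / 2"
proof -
  let ?k = "32 * (sobolev_constant + \<alpha>) * trilinear_constant\<^sup>2 * R"
  have k: "0 < ?k" using assms sobolev_constant_pos alpha_pos trilinear_constant_pos by simp
  show w0: "0 < window R" using s1_pos alpha_pos k by (simp add: window_def)
  show "window R \<le> s1" "window R \<le> 1" by (auto simp: window_def)
  have "window R \<le> \<alpha>\<^sup>2 / sqrt ?k" by (simp add: window_def)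
  then have "(window R)\<^sup>2 \<le> (\<alpha>\<^sup>2 / sqrt ?k)\<^sup>2" using w0 by (intro power_mono) auto
  also have "\<dots> = \<alpha> ^ 4 / ?k" using k by (simp add: power_divide power_mult[symmetric])
  finally have "?k * (window R)\<^sup>2 \<le> \<alpha> ^ 4" using k by (simp add: pos_le_divide_eq mult.commute)
  then have "?k * (window R)\<^sup>2 / \<alpha> ^ 4 \<le> 1" using alpha_pos by (simp add: divide_le_eq)
  moreover have "c * (16 * x * y * R / z) = 32 * c * x * R * y / z / 2" for c x y z :: real by simp
  ultimately show "(sobolev_constant + \<alpha>) * (16 * trilinear_constant\<^sup>2 * (window R)\<^sup>2 * R / \<alpha> ^ 4) \<le> 1 / 2"
    by (metis divide_right_mono zero_le_numeral)
qed

lemma observability_nonneg: "0 < R \<Longrightarrow> 0 \<le> observability R"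
  unfolding observability_def
  using window(1)[of R] m_pos sobolev_constant_pos alpha_pos kappa_nonneg
  by (intro add_nonneg_nonneg divide_nonneg_nonneg mult_nonneg_nonneg) auto

lemma contraction: "0 < R \<Longrightarrow> 0 < contraction R" "0 < R \<Longrightarrow> contraction R < 1"
proof -
  assume "0 < R"
  then have "0 \<le> 2 * observability R / \<delta>" using observability_nonneg[of R] delta_pos by simp
  then show "0 < contraction R" "contraction R < 1" unfolding contraction_def by simp_all
qed

end

context voigt_solution
begin

text \<open>For s between s0/2 and s0 the history is an integral of s velocities that all lie within
  Z of u(t), so its norm is at least s(|u(t)| - Z). Squaring, and integrating over this range with
  \<mu> \<ge> m, bounds the velocity by the memory norm.\<close>

lemma velocity_observed:
  assumes s0: "0 < s0" "s0 \<le> s1" "s0 \<le> t"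
    and Z: "\<And>\<sigma>. \<sigma> \<in> {0..s0} \<Longrightarrow> norm1 \<Omega> (vel t - vel (t - \<sigma>)) \<le> Z"
  shows "(nv t)\<^sup>2 \<le> 16 / (m * s0 ^ 3) * (nm t)\<^sup>2 + 2 * Z\<^sup>2"
proof -
  have t: "0 \<le> t" using s0 by simp
  have Z0: "0 \<le> Z" using order_trans[OF norm1_nonneg Z[of 0]] s0 by simp
  let ?v = "vel t"
  define c where "c = (nv t)\<^sup>2 - 2 * Z\<^sup>2"
  define I where "I = {s0 / 2<..<s0}"
  \<comment> \<open>The factor 1/8 combines s^2 \<ge> s0^2 / 4 with the factor 2 from squaring a
    sum; the interval length s0 / 2 then gives the final 16. For negative c the bound is
    trivial.\<close>
  have ae: "AE s in half_line. indicator I s * (m * c * s0\<^sup>2 / 8) \<le> \<mu> s * (norm1 \<Omega> (hist t s))\<^sup>2"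
    using history[OF t] AE_space
  proof eventually_elim
    case (elim s)
    then have s: "0 < s" by simp
    show ?case
    proof (cases "s \<in> I")
      case False
      then show ?thesis using mu_nonneg[OF s] by simp
    next
      case True
      then have sI: "s0 / 2 < s" "s < s0" "s \<le> t" using s0 by (auto simp: I_def)
      have mu: "m \<le> \<mu> s" using s sI s0 by (intro mu_ge) auto
      let ?e = "hist t s"
      have eV: "?e \<in> V \<Omega>" by (rule hist_V[OF s])
      have cont: "continuous_on {0..s} (\<lambda>\<sigma>. ip1 \<Omega> (vel (t - \<sigma>)) ?v)"
        by (rule continuous_on_subset[OF vel_ip1_continuous[OF vel_V, of t]]) (use sI in auto)
      have rep: "ip1 \<Omega> ?e ?v = integral {0..s} (\<lambda>\<sigma>. ip1 \<Omega> (vel (t - \<sigma>)) ?v)"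
        using elim(1) mu m_pos sI vel_V by auto
      have "s * (nv t)\<^sup>2 - ip1 \<Omega> ?e ?v = integral {0..s} (\<lambda>\<sigma>. ip1 \<Omega> ?v ?v) - integral {0..s} (\<lambda>\<sigma>. ip1 \<Omega> (vel (t - \<sigma>)) ?v)"
        unfolding rep using s by (simp add: norm1_power2)
      also have "\<dots> = integral {0..s} (\<lambda>\<sigma>. ip1 \<Omega> ?v ?v - ip1 \<Omega> (vel (t - \<sigma>)) ?v)"
        by (intro Henstock_Kurzweil_Integration.integral_diff[symmetric] integrable_continuous_real cont continuous_on_const)
      also have "\<dots> \<le> norm (integral {0..s} (\<lambda>\<sigma>. ip1 \<Omega> ?v ?v - ip1 \<Omega> (vel (t - \<sigma>)) ?v))" by simp
      also have "\<dots> \<le> (Z * nv t) * (s - 0)"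
      proof (rule integral_bound)
        show "continuous_on {0..s} (\<lambda>\<sigma>. ip1 \<Omega> ?v ?v - ip1 \<Omega> (vel (t - \<sigma>)) ?v)"
          by (intro continuous_on_diff cont continuous_on_const)
        fix \<sigma> assume "\<sigma> \<in> {0..s}"
        then have "norm1 \<Omega> (?v - vel (t - \<sigma>)) \<le> Z" using sI by (intro Z) auto
        then have "norm1 \<Omega> (?v - vel (t - \<sigma>)) * nv t \<le> Z * nv t" by (rule mult_right_mono[OF _ norm1_nonneg])
        then show "norm (ip1 \<Omega> ?v ?v - ip1 \<Omega> (vel (t - \<sigma>)) ?v) \<le> Z * nv t"
          unfolding real_norm_def ip1_diff[OF vel_V vel_V vel_V, symmetric]
          by (rule order_trans[OF ip1_Cauchy_Schwarz[OF V_diff[OF vel_V vel_V] vel_V]])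
      qed (use s in simp)
      finally have "s * (nv t)\<^sup>2 \<le> ip1 \<Omega> ?e ?v + s * Z * nv t" by (simp add: mult_ac)
      also have "ip1 \<Omega> ?e ?v \<le> norm1 \<Omega> ?e * nv t"
        by (rule order_trans[OF abs_ge_self ip1_Cauchy_Schwarz[OF eV vel_V]])
      finally have "(s * nv t) * nv t \<le> (norm1 \<Omega> ?e + s * Z) * nv t"
        by (simp add: power2_eq_square distrib_right mult.assoc)
      then have "s * nv t \<le> norm1 \<Omega> ?e + s * Z"
        using norm1_nonneg[of ?v] norm1_nonneg[of ?e] Z0 s by (cases "nv t = 0") auto
      then have "(s * nv t)\<^sup>2 \<le> (norm1 \<Omega> ?e + s * Z)\<^sup>2"
        using s norm1_nonneg by (intro power_mono mult_nonneg_nonneg) auto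
      also have "\<dots> \<le> 2 * (norm1 \<Omega> ?e)\<^sup>2 + 2 * (s * Z)\<^sup>2"
        using sum_squares_bound[of "norm1 \<Omega> ?e" "s * Z"] by (simp add: power2_sum)
      finally have sc: "s\<^sup>2 * c \<le> 2 * (norm1 \<Omega> ?e)\<^sup>2"
        by (simp add: c_def power_mult_distrib right_diff_distrib mult_ac)
      have "m * c * s0\<^sup>2 / 8 \<le> \<mu> s * (norm1 \<Omega> ?e)\<^sup>2"
      proof (cases "0 \<le> c")
        case True
        have "(s0 / 2)\<^sup>2 \<le> s\<^sup>2" using sI s0 by (intro power_mono) auto
        then have "(s0 / 2)\<^sup>2 * c \<le> s\<^sup>2 * c" using True by (rule mult_right_mono)
        then have "c * s0\<^sup>2 / 8 \<le> (norm1 \<Omega> ?e)\<^sup>2"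
          using sc by (simp add: power_divide field_simps)
        then have "m * (c * s0\<^sup>2 / 8) \<le> \<mu> s * (norm1 \<Omega> ?e)\<^sup>2"
          using mu m_pos True by (intro mult_mono) auto
        then show ?thesis by (simp add: mult.assoc)
      next
        case False
        then have "m * c * s0\<^sup>2 / 8 \<le> 0"
          using m_pos by (simp add: mult_nonneg_nonpos mult_nonpos_nonneg)
        also have "0 \<le> \<mu> s * (norm1 \<Omega> ?e)\<^sup>2" using mu_nonneg[OF s] by simp
        finally show ?thesis .
      qed
      then show ?thesis using True by simp
    qed
  qed
  have I0: "I \<subseteq> {0<..}" using s0 by (auto simp: I_def)
  have hb: "has_bochner_integral half_line (indicat_real I) (s0 / 2)"
  proof -
    have "I \<in> sets lebesgue" by (auto simp: I_def)
    then have Is: "I \<in> sets half_line" using I0 by (auto simp: sets_restrict_space)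
    have "emeasure half_line I = emeasure lebesgue I"
      using I0 by (intro emeasure_restrict_space) auto
    also have "\<dots> = ennreal (s0 / 2)" using s0 by (simp add: I_def)
    finally have em: "emeasure half_line I = ennreal (s0 / 2)" .
    then have me: "measure half_line I = s0 / 2" using s0 by (simp add: measure_def)
    show ?thesis
      using has_bochner_integral_real_indicator[OF Is] em unfolding me by simp
  qed
  have i: "integrable half_line (\<lambda>s. indicator I s * (m * c * s0\<^sup>2 / 8))"
    "(\<integral>s. indicator I s * (m * c * s0\<^sup>2 / 8) \<partial>half_line) = s0 / 2 * (m * c * s0\<^sup>2 / 8)"
    using has_bochner_integral_mult_left[OF hb, of "m * c * s0\<^sup>2 / 8"] by (auto simp: has_bochner_integral_iff)
  have "s0 / 2 * (m * c * s0\<^sup>2 / 8) \<le> (nm t)\<^sup>2"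
    using integral_mono_AE[OF i(1) hist_norm_integrable ae] unfolding i(2) nm_power2 .
  then have "c * (m * s0 ^ 3) \<le> 16 * (nm t)\<^sup>2" by (simp add: power2_eq_square power3_eq_cube mult_ac)
  then have "c \<le> 16 * (nm t)\<^sup>2 / (m * s0 ^ 3)"
    using m_pos s0 by (subst pos_le_divide_eq) auto
  then show ?thesis by (simp add: c_def)
qed

text \<open>At each time of the second unit interval the velocity is read off the history with a
  delay of at most 1, so every quantity involved is controlled by the dissipation D on the whole
  step, up to half of the initial energy. Dissipation then converts D into an energy drop.\<close>

lemma energy_contraction:
  assumes t0: "0 \<le> t0" and R: "0 < R" "en t0 \<le> R"
  shows "en (t0 + 2) \<le> contraction R * en t0"
proof -
  define s0 where "s0 = window R"
  note w = window[OF R(1), folded s0_def]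
  let ?C = "sobolev_constant + \<alpha>"
  have C: "0 < ?C" using sobolev_constant_pos alpha_pos by simp
  let ?E = "en t0"
  define D where "D = integral {t0..t0 + 2} (\<lambda>r. (nm r)\<^sup>2)"
  have nm2c: "continuous_on {0..} (\<lambda>r. (nm r)\<^sup>2)" by (intro continuous_intros nm_continuous)
  have nm2i: "(\<lambda>r. (nm r)\<^sup>2) integrable_on {x..y}" if "0 \<le> x" for x y
    by (intro integrable_continuous_real continuous_on_subset[OF nm2c]) (use that in auto)
  have D_sub: "integral {x..y} (\<lambda>r. (nm r)\<^sup>2) \<le> D" if "t0 \<le> x" "y \<le> t0 + 2" for x y
    unfolding D_def by (rule integral_subset_le[OF _ nm2i nm2i]) (use that t0 in auto)
  have D0: "0 \<le> D" unfolding D_def by (intro integral_nonneg nm2i t0) auto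
  have diss: "en (t0 + 2) + \<delta> / 2 * D \<le> ?E"
    unfolding D_def by (rule dissipation[OF t0]) simp
  have pt: "2 * en t \<le> (16 * ?C / (m * s0 ^ 3) + 1) * (nm t)\<^sup>2 + (4 * ?C * kappa / \<alpha>\<^sup>2 * D + ?E / 2)"
    if t: "t \<in> {t0 + 1..t0 + 2}" for t
  proof -
    \<comment> \<open>The drag over a time at most s0: the memory part by Cauchy-Schwarz in time,
      with length at most 1, and the convective part from the bound 2 E / \<alpha> for the squared
      velocity.\<close>
    define Z where "Z = (sqrt kappa * sqrt D + trilinear_constant * s0 * (2 * ?E / \<alpha>)) / \<alpha>"
    have ts: "t0 \<le> t - s0" "t \<le> t0 + 2" using t w by auto
    have Zb: "norm1 \<Omega> (vel t - vel (t - \<sigma>)) \<le> Z" if \<sigma>: "\<sigma> \<in> {0..s0}" for \<sigma>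
    proof -
      have r: "t0 \<le> t - \<sigma>" "t - \<sigma> \<le> t" "0 \<le> t - \<sigma>" "\<sigma> \<le> s0" using \<sigma> ts t0 by auto
      have sub: "{t - \<sigma>..t} \<subseteq> {0..}" using r by auto
      have ni: "nm integrable_on {t - \<sigma>..t}"
        by (intro integrable_continuous_real continuous_on_subset[OF nm_continuous sub])
      have "integral {t - \<sigma>..t} drag \<le> integral {t - \<sigma>..t} (\<lambda>r. sqrt kappa * nm r + trilinear_constant * (2 * ?E / \<alpha>))"
      proof (rule integral_le)
        show "drag integrable_on {t - \<sigma>..t}"
          by (intro integrable_continuous_real continuous_on_subset[OF drag_continuous sub])
        show "(\<lambda>r. sqrt kappa * nm r + trilinear_constant * (2 * ?E / \<alpha>)) integrable_on {t - \<sigma>..t}"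
          by (intro integrable_add integrable_on_mult_right ni integrable_const_ivl)
        fix x assume x: "x \<in> {t - \<sigma>..t}"
        have "\<alpha> * (nv x)\<^sup>2 \<le> 2 * en x" by (rule nv_le_en)
        also have "\<dots> \<le> 2 * ?E" using en_antimono[OF t0, of x] x r by simp
        finally have "(nv x)\<^sup>2 \<le> 2 * ?E / \<alpha>" using alpha_pos by (simp add: pos_le_divide_eq mult.commute)
        then show "drag x \<le> sqrt kappa * nm x + trilinear_constant * (2 * ?E / \<alpha>)"
          unfolding drag_def using trilinear_constant_pos by (intro add_left_mono mult_left_mono) auto
      qed
      also have "\<dots> = integral {t - \<sigma>..t} (\<lambda>r. sqrt kappa * nm r) + integral {t - \<sigma>..t} (\<lambda>r. trilinear_constant * (2 * ?E / \<alpha>))"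
        by (intro Henstock_Kurzweil_Integration.integral_add integrable_on_mult_right ni integrable_const_ivl)
      also have "integral {t - \<sigma>..t} (\<lambda>r. sqrt kappa * nm r) = sqrt kappa * integral {t - \<sigma>..t} nm" by simp
      also have "integral {t - \<sigma>..t} (\<lambda>r. trilinear_constant * (2 * ?E / \<alpha>)) = trilinear_constant * \<sigma> * (2 * ?E / \<alpha>)"
        using r by simp
      also have "sqrt kappa * integral {t - \<sigma>..t} nm + trilinear_constant * \<sigma> * (2 * ?E / \<alpha>)
          \<le> sqrt kappa * sqrt D + trilinear_constant * s0 * (2 * ?E / \<alpha>)"
      proof (intro add_mono mult_left_mono mult_right_mono)
        have "(integral {t - \<sigma>..t} nm)\<^sup>2 \<le> integral {t - \<sigma>..t} (\<lambda>r. (nm r)\<^sup>2) * (t - (t - \<sigma>))"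
          by (rule integral_Cauchy_Schwarz[OF r(2) continuous_on_subset[OF nm_continuous sub]])
        also have "\<dots> \<le> D * 1"
          using \<sigma> w r ts D0 by (intro mult_mono D_sub) auto
        finally show "integral {t - \<sigma>..t} nm \<le> sqrt D" by (simp add: real_le_rsqrt)
      qed (use kappa_nonneg r trilinear_constant_pos alpha_pos en_nonneg in auto)
      finally have "\<alpha> * norm1 \<Omega> (vel t - vel (t - \<sigma>)) \<le> sqrt kappa * sqrt D + trilinear_constant * s0 * (2 * ?E / \<alpha>)"
        using vel_increment[OF r(3,2)] by simp
      then show ?thesis unfolding Z_def using alpha_pos by (simp add: pos_le_divide_eq mult.commute)
    qed
    have "(nv t)\<^sup>2 \<le> 16 / (m * s0 ^ 3) * (nm t)\<^sup>2 + 2 * Z\<^sup>2"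
      by (rule velocity_observed[OF w(1,2) _ Zb]) (use ts t0 in auto)
    moreover have "2 * Z\<^sup>2 \<le> 4 * kappa / \<alpha>\<^sup>2 * D + 16 * trilinear_constant\<^sup>2 * s0\<^sup>2 * R / \<alpha> ^ 4 * ?E"
    proof -
      let ?a = "sqrt kappa * sqrt D" and ?b = "trilinear_constant * s0 * (2 * ?E / \<alpha>)"
      have "2 * Z\<^sup>2 = 2 * (?a + ?b)\<^sup>2 / \<alpha>\<^sup>2" by (simp add: Z_def power_divide)
      also have "\<dots> \<le> 2 * (2 * ?a\<^sup>2 + 2 * ?b\<^sup>2) / \<alpha>\<^sup>2"
        using sum_squares_bound[of ?a ?b] by (intro divide_right_mono mult_left_mono) (auto simp: power2_sum)
      also have "?a\<^sup>2 = kappa * D" using kappa_nonneg D0 by (simp add: power_mult_distrib)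
      also have "?b\<^sup>2 = 4 * trilinear_constant\<^sup>2 * s0\<^sup>2 * (?E * ?E) / \<alpha>\<^sup>2"
        by (simp add: power_mult_distrib power_divide power2_eq_square)
      also have "2 * (2 * (kappa * D) + 2 * (4 * trilinear_constant\<^sup>2 * s0\<^sup>2 * (?E * ?E) / \<alpha>\<^sup>2)) / \<alpha>\<^sup>2
          = 4 * kappa / \<alpha>\<^sup>2 * D + 16 * trilinear_constant\<^sup>2 * s0\<^sup>2 / \<alpha> ^ 4 * (?E * ?E)"
        using alpha_pos by (simp add: field_simps power2_eq_square power4_eq_xxxx)
      \<comment> \<open>The square of the energy is linearised by E \<le> R; this is where the
        constants become dependent on R.\<close>
      also have "\<dots> \<le> 4 * kappa / \<alpha>\<^sup>2 * D + 16 * trilinear_constant\<^sup>2 * s0\<^sup>2 / \<alpha> ^ 4 * (R * ?E)"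
        using R en_nonneg[of t0] alpha_pos by (intro add_left_mono mult_left_mono mult_right_mono) auto
      finally show ?thesis by (simp add: mult_ac)
    qed
    ultimately have nvb: "(nv t)\<^sup>2 \<le> 16 / (m * s0 ^ 3) * (nm t)\<^sup>2 + (4 * kappa / \<alpha>\<^sup>2 * D
        + 16 * trilinear_constant\<^sup>2 * s0\<^sup>2 * R / \<alpha> ^ 4 * ?E)" by linarith
    have "2 * en t \<le> ?C * (nv t)\<^sup>2 + (nm t)\<^sup>2" by (rule en_le)
    also have "\<dots> \<le> ?C * (16 / (m * s0 ^ 3) * (nm t)\<^sup>2 + (4 * kappa / \<alpha>\<^sup>2 * D
        + 16 * trilinear_constant\<^sup>2 * s0\<^sup>2 * R / \<alpha> ^ 4 * ?E)) + (nm t)\<^sup>2"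
      using C nvb by (intro add_right_mono mult_left_mono) auto
    also have "\<dots> = (16 * ?C / (m * s0 ^ 3) + 1) * (nm t)\<^sup>2 + (4 * ?C * kappa / \<alpha>\<^sup>2 * D
        + ?C * (16 * trilinear_constant\<^sup>2 * s0\<^sup>2 * R / \<alpha> ^ 4) * ?E)"
      by (simp add: distrib_left distrib_right mult_ac)
    also have "\<dots> \<le> (16 * ?C / (m * s0 ^ 3) + 1) * (nm t)\<^sup>2 + (4 * ?C * kappa / \<alpha>\<^sup>2 * D + 1 / 2 * ?E)"
      by (intro add_left_mono mult_right_mono w(4) en_nonneg)
    finally show ?thesis by simp
  qed
  let ?A = "16 * ?C / (m * s0 ^ 3) + 1"
  have A: "0 \<le> ?A" using C m_pos w(1) by simp
  \<comment> \<open>The memory norm at a single time is not controlled by D, so the pointwise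
    estimate is averaged over a unit interval; monotonicity of the energy keeps its final value on
    the left.\<close>
  have "integral {t0 + 1..t0 + 2} (\<lambda>t. 2 * en (t0 + 2))
      \<le> integral {t0 + 1..t0 + 2} (\<lambda>t. ?A * (nm t)\<^sup>2 + (4 * ?C * kappa / \<alpha>\<^sup>2 * D + ?E / 2))"
  proof (rule integral_le)
    show "(\<lambda>t. ?A * (nm t)\<^sup>2 + (4 * ?C * kappa / \<alpha>\<^sup>2 * D + ?E / 2)) integrable_on {t0 + 1..t0 + 2}"
      using t0 by (intro integrable_add integrable_on_mult_right nm2i integrable_const_ivl) simp
    fix t assume t: "t \<in> {t0 + 1..t0 + 2}"
    have "en (t0 + 2) \<le> en t" by (rule en_antimono) (use t t0 in auto)
    then show "2 * en (t0 + 2) \<le> ?A * (nm t)\<^sup>2 + (4 * ?C * kappa / \<alpha>\<^sup>2 * D + ?E / 2)"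
      using pt[OF t] by linarith
  qed auto
  also have "\<dots> = integral {t0 + 1..t0 + 2} (\<lambda>t. ?A * (nm t)\<^sup>2)
      + integral {t0 + 1..t0 + 2} (\<lambda>t. 4 * ?C * kappa / \<alpha>\<^sup>2 * D + ?E / 2)"
    using t0 by (intro Henstock_Kurzweil_Integration.integral_add integrable_on_mult_right nm2i integrable_const_ivl) simp
  also have "\<dots> = ?A * integral {t0 + 1..t0 + 2} (\<lambda>t. (nm t)\<^sup>2) + (4 * ?C * kappa / \<alpha>\<^sup>2 * D + ?E / 2)" by simp
  also have "\<dots> \<le> ?A * D + (4 * ?C * kappa / \<alpha>\<^sup>2 * D + ?E / 2)"
    by (intro add_right_mono mult_left_mono D_sub A) auto
  also have "\<dots> = observability R * D + ?E / 2"
    by (simp add: observability_def s0_def distrib_right)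
  finally have main: "2 * en (t0 + 2) \<le> observability R * D + ?E / 2" by simp
  let ?K = "2 * observability R / \<delta>"
  have K0: "0 \<le> ?K" using observability_nonneg[OF R(1)] delta_pos by simp
  have "D \<le> 2 / \<delta> * (?E - en (t0 + 2))"
    using diss delta_pos by (simp add: field_simps)
  then have "observability R * D \<le> observability R * (2 / \<delta> * (?E - en (t0 + 2)))"
    by (rule mult_left_mono[OF _ observability_nonneg[OF R(1)]])
  also have "\<dots> = ?K * (?E - en (t0 + 2))" by simp
  finally have "2 * en (t0 + 2) \<le> ?K * (?E - en (t0 + 2)) + ?E / 2" using main by linarith
  then have "(?K + 2) * en (t0 + 2) \<le> (?K + 1 / 2) * ?E" by (simp only: distrib_right right_diff_distrib)
  then have "en (t0 + 2) \<le> (?K + 1 / 2) * ?E / (?K + 2)"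
    using K0 by (subst pos_le_divide_eq) (auto simp: mult.commute)
  then show ?thesis by (simp add: contraction_def)
qed

text \<open>The energy never increases, so R stays an admissible bound at each step and the factor
  is the same throughout.\<close>

lemma energy_contraction_power:
  assumes t0: "0 \<le> t0" and R: "0 < R" "en t0 \<le> R"
  shows "en (t0 + 2 * real n) \<le> contraction R ^ n * en t0"
proof (induction n)
  case (Suc n)
  let ?t = "t0 + 2 * real n"
  have "en (?t + 2) \<le> contraction R * en ?t"
    by (rule energy_contraction[OF _ R(1)]) (use t0 en_antimono[OF t0, of ?t] R in auto)
  also have "\<dots> \<le> contraction R * (contraction R ^ n * en t0)"
    using contraction(1)[OF R(1)] Suc by (intro mult_left_mono) auto
  finally show ?case by (simp add: algebra_simps)
qed simp

end

context voigt
begin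

text \<open>One step lasts two units of time, hence half of the logarithm. The level R = 1 is fixed,
  so the rate is independent of the initial energy.\<close>

definition decay_rate :: real where "decay_rate = - ln (contraction 1) / 2"

lemma decay_rate_pos: "0 < decay_rate"
  using contraction[of 1] by (simp add: decay_rate_def ln_less_zero)

text \<open>Once the energy has dropped below 1, the rate no longer depends on the solution.\<close>

lemma bounded_energy_decay:
  assumes R: "0 < R"
  obtains C where "0 \<le> C"
    "\<And>U0 U t. U0 \<in> phase_space \<Omega> \<mu> \<Longrightarrow> weak_solution \<Omega> \<alpha> \<mu> U0 U \<Longrightarrow> energy \<Omega> \<alpha> \<mu> (U 0) \<le> R \<Longrightarrow> 0 \<le> t \<Longrightarrow>
      energy \<Omega> \<alpha> \<mu> (U t) \<le> C * exp (- decay_rate * t)"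
proof -
  note q = contraction[OF R] and q1 = contraction[of 1]
  \<comment> \<open>The number of steps until the energy is at most 1 depends on the bound R alone,
    so the waiting time T is uniform over all solutions considered.\<close>
  obtain N where N: "contraction R ^ N < 1 / R"
    using real_arch_pow_inv[of "1 / R" "contraction R"] R q by auto
  define T where "T = 2 * real N"
  \<comment> \<open>R + 1 dominates both the energy before T and the value 1 afterwards. The
    exponential compensates the waiting time T and the last incomplete step of length below
    two.\<close>
  define C where "C = (R + 1) * exp (decay_rate * (T + 2))"
  have T0: "0 \<le> T" by (simp add: T_def)
  have "energy \<Omega> \<alpha> \<mu> (U t) \<le> C * exp (- decay_rate * t)"
    if U: "U0 \<in> phase_space \<Omega> \<mu>" "weak_solution \<Omega> \<alpha> \<mu> U0 U" "energy \<Omega> \<alpha> \<mu> (U 0) \<le> R" and t: "0 \<le> t" for U0 U t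
  proof -
    interpret voigt_solution \<Omega> \<mu> \<delta> m s1 \<alpha> U0 U
      by unfold_locales (use U in auto)
    have e0: "en 0 \<le> R" using U(3) energy_eq[of 0] by simp
    have C_split: "C * exp (- decay_rate * t) = (R + 1) * exp (decay_rate * (T + 2 - t))"
      by (simp add: C_def mult.assoc exp_add[symmetric] algebra_simps)
    have "en t \<le> C * exp (- decay_rate * t)"
    proof (cases "t \<le> T")
      case True
      have "en t \<le> (R + 1) * 1" using en_antimono[OF order_refl t] e0 by simp
      also have "\<dots> \<le> (R + 1) * exp (decay_rate * (T + 2 - t))"
        using R True decay_rate_pos by (intro mult_left_mono) auto
      finally show ?thesis unfolding C_split .
    next
      case False
      have "en T \<le> contraction R ^ N * en 0"
        using energy_contraction_power[OF order_refl R e0, of N] by (simp add: T_def)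
      also have "\<dots> \<le> (1 / R) * R"
        using N q e0 R en_nonneg by (intro mult_mono) auto
      finally have eT: "en T \<le> 1" using R by simp
      \<comment> \<open>The number of complete steps of length two between T and t.\<close>
      define n where "n = nat \<lfloor>(t - T) / 2\<rfloor>"
      have rn: "real n = of_int \<lfloor>(t - T) / 2\<rfloor>" using False by (simp add: n_def)
      have n: "real n \<le> (t - T) / 2" "(t - T) / 2 < real n + 1"
        unfolding rn by linarith+
      have "en t \<le> en (T + 2 * real n)" by (rule en_antimono) (use n T0 in auto)
      also have "\<dots> \<le> contraction 1 ^ n * en T"
        by (rule energy_contraction_power[OF T0 _ eT]) simp
      also have "\<dots> \<le> contraction 1 ^ n * 1"
        using q1 eT by (intro mult_left_mono) auto
      also have "\<dots> = exp (real n * ln (contraction 1))"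
        using q1 by (simp add: exp_of_nat_mult)
      also have "\<dots> = exp (decay_rate * (- 2 * real n))" by (simp add: decay_rate_def)
      also have "\<dots> \<le> exp (decay_rate * (T + 2 - t))"
        using n decay_rate_pos by (intro exp_le_cancel_iff[THEN iffD2] mult_left_mono) auto
      also have "\<dots> \<le> (R + 1) * exp (decay_rate * (T + 2 - t))"
        using R by (simp add: distrib_right)
      finally show ?thesis unfolding C_split .
    qed
    then show ?thesis using energy_eq[OF t] by simp
  qed
  moreover have "0 \<le> C" using R by (simp add: C_def)
  ultimately show ?thesis by (rule that[rotated])
qed

end

theorem theorem5p2:
  fixes \<Omega> :: "(real^3) set" and \<alpha> :: real and g \<mu> :: "real \<Rightarrow> real"
  assumes "smooth_bounded_domain \<Omega>"
    and "\<alpha> > 0"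
    and "memory_kernel g \<mu>"
  shows "\<exists>\<omega>>0. \<exists>Q :: real \<Rightarrow> real.
    strict_mono_on {0..} Q \<and> (\<forall>x\<ge>0. Q x > 0) \<and>
    (\<forall>U\<^sub>0\<in>phase_space \<Omega> \<mu>. \<forall>U. weak_solution \<Omega> \<alpha> \<mu> U\<^sub>0 U \<longrightarrow>
      (\<forall>t\<ge>0. energy \<Omega> \<alpha> \<mu> (U t) \<le> Q (energy \<Omega> \<alpha> \<mu> (U 0)) * exp (- \<omega> * t)))"
proof -
  obtain \<delta> m s1 where "decaying_kernel \<mu> \<delta> m s1"
    using memory_kernel_decaying[OF assms(3)] by blast
  then interpret decaying_kernel \<mu> \<delta> m s1 .
  interpret voigt \<Omega> \<mu> \<delta> m s1 \<alpha>
    by unfold_locales (use assms in \<open>auto simp: smooth_bounded_domain_def\<close>)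
  \<comment> \<open>One constant for each integer energy level, chosen before the solution; this is
    what allows a single function Q for all initial data.\<close>
  have "\<exists>C\<ge>0. \<forall>U0\<in>phase_space \<Omega> \<mu>. \<forall>U. weak_solution \<Omega> \<alpha> \<mu> U0 U \<longrightarrow>
      energy \<Omega> \<alpha> \<mu> (U 0) \<le> real (Suc k) \<longrightarrow>
      (\<forall>t\<ge>0. energy \<Omega> \<alpha> \<mu> (U t) \<le> C * exp (- decay_rate * t))" for k
    by (rule bounded_energy_decay[of "real (Suc k)"]) (simp, blast)
  then obtain C where C: "\<And>k. 0 \<le> C k"
    "\<And>k U0 U t. U0 \<in> phase_space \<Omega> \<mu> \<Longrightarrow> weak_solution \<Omega> \<alpha> \<mu> U0 U \<Longrightarrow>
      energy \<Omega> \<alpha> \<mu> (U 0) \<le> real (Suc k) \<Longrightarrow> 0 \<le> t \<Longrightarrow> energy \<Omega> \<alpha> \<mu> (U t) \<le> C k * exp (- decay_rate * t)"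
    by metis
  \<comment> \<open>Summing the constants up to the rounded-up energy makes Q nondecreasing and at
    least as large as the one constant required; the summands 1 + x make it positive and strictly
    increasing.\<close>
  define Q where "Q x = 1 + x + (\<Sum>k\<le>nat \<lceil>x\<rceil>. C k)" for x :: real
  have mono: "strict_mono_on {0..} Q"
  proof (rule strict_mono_onI)
    fix x y :: real assume xy: "x \<in> {0..}" "y \<in> {0..}" "x < y"
    have "nat \<lceil>x\<rceil> \<le> nat \<lceil>y\<rceil>"
      by (intro nat_mono ceiling_mono) (use xy in simp)
    then have "(\<Sum>k\<le>nat \<lceil>x\<rceil>. C k) \<le> (\<Sum>k\<le>nat \<lceil>y\<rceil>. C k)"
      using C(1) by (intro sum_mono2) auto
    then show "Q x < Q y" using xy by (simp add: Q_def)
  qed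
  have pos: "Q x > 0" if "x \<ge> 0" for x
    using that sum_nonneg[of "{..nat \<lceil>x\<rceil>}" C] C(1) by (simp add: Q_def add_pos_nonneg)
  have bound: "energy \<Omega> \<alpha> \<mu> (U t) \<le> Q (energy \<Omega> \<alpha> \<mu> (U 0)) * exp (- decay_rate * t)"
    if U: "U0 \<in> phase_space \<Omega> \<mu>" "weak_solution \<Omega> \<alpha> \<mu> U0 U" and t: "0 \<le> t" for U0 U t
  proof -
    let ?e = "energy \<Omega> \<alpha> \<mu> (U 0)"
    have e: "0 \<le> ?e" by (simp add: energy_def)
    have "?e \<le> real (Suc (nat \<lceil>?e\<rceil>))" by linarith
    from C(2)[OF U this t]
    have "energy \<Omega> \<alpha> \<mu> (U t) \<le> C (nat \<lceil>?e\<rceil>) * exp (- decay_rate * t)" .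
    also have "\<dots> \<le> Q ?e * exp (- decay_rate * t)"
    proof (rule mult_right_mono)
      have "C (nat \<lceil>?e\<rceil>) \<le> (\<Sum>k\<le>nat \<lceil>?e\<rceil>. C k)"
        using C(1) by (intro member_le_sum) auto
      then show "C (nat \<lceil>?e\<rceil>) \<le> Q ?e" using e by (simp add: Q_def)
    qed simp
    finally show ?thesis .
  qed
  show ?thesis
    using decay_rate_pos mono pos bound by (intro exI[of _ decay_rate] conjI exI[of _ Q]) blast+
qed

end
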